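(* The $\mathrm{LTLf}^+$ synthesis problem is 2EXPTIME-complete, and the $\mathrm{PPLTL}^+$ synthesis problem is EXPTIME-complete.
   Context: $AP$ is a fixed finite nonempty set of atoms partitioned as $X\cup Y$ (agent-controlled $X$, environment-controlled $Y$); $\Sigma=2^{AP}$. LTLf (future operators $X,U$ over finite traces, evaluated at the first position) and PPLTL (past operators $Y,S$ over finite traces, evaluated at the last position) are the standard temporal logics on finite traces; $[\Phi]$ is the set of nonempty finite traces satisfying $\Phi$. For a set $Z$ of finite traces: $\forall Z$ / $\exists Z$ / $\exists^\infty Z$ / $\forall^\infty Z$ is the set of infinite traces all / some / infinitely many / all but finitely many of whose nonempty finite prefixes lie in $Z$. $\mathrm{LTLf}^+$ (resp. $\mathrm{PPLTL}^+$) formulas: $\Psi::=\forall\Phi\mid\exists\Phi\mid\exists^\infty\Phi\mid\forall^\infty\Phi\mid\Psi\vee\Psi\mid\Psi\wedge\Psi\mid\neg\Psi$ with $\Phi$ in LTLf (resp. PPLTL), $[\mathbb{Q}\Phi]=\mathbb{Q}[\Phi]$, Boolean connectives set-theoretic on infinite traces. A strategy is a function $\sigma:(2^Y)^*\to2^X$; an outcome of $\sigma$ is an infinite trace $\tau$ over $2^{AP}$ with $\tau_0\cap X=\sigma(\varepsilon)$ and $\tau_i\cap X=\sigma((\tau_0\cap Y)\cdots(\tau_{i-1}\cap Y))$ for $i>0$. The synthesis problem asks, given $\Psi$, whether there is a strategy all of whose outcomes lie in $[\Psi]$, and if so to return a finite representation of one; complexity is measured in the size of $\Psi$. *)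

theory Defs
  imports Complex_Main "HOL-Computational_Algebra.Polynomial"
begin

section \<open>LTLf and PPLTL\<close>

text \<open>A trace over a set \<open>AP\<close> of atoms has subsets of \<open>AP\<close> as letters. Positions are counted from 0.\<close>

datatype (atoms_ltlf: 'a) ltlf =
    LAtom 'a
  | LNot "'a ltlf"
  | LOr "'a ltlf" "'a ltlf"
  | LAnd "'a ltlf" "'a ltlf"
  | LNext "'a ltlf"
  | LUntil "'a ltlf" "'a ltlf"

primrec ltlf_sat :: "'a set list \<Rightarrow> nat \<Rightarrow> 'a ltlf \<Rightarrow> bool" where
  "ltlf_sat t i (LAtom p) \<longleftrightarrow> p \<in> t ! i"
| "ltlf_sat t i (LNot \<phi>) \<longleftrightarrow> \<not> ltlf_sat t i \<phi>"
| "ltlf_sat t i (LOr \<phi> \<psi>) \<longleftrightarrow> ltlf_sat t i \<phi> \<or> ltlf_sat t i \<psi>"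
| "ltlf_sat t i (LAnd \<phi> \<psi>) \<longleftrightarrow> ltlf_sat t i \<phi> \<and> ltlf_sat t i \<psi>"
| "ltlf_sat t i (LNext \<phi>) \<longleftrightarrow> Suc i < length t \<and> ltlf_sat t (Suc i) \<phi>"
| "ltlf_sat t i (LUntil \<phi> \<psi>) \<longleftrightarrow>
     (\<exists>j. i \<le> j \<and> j < length t \<and> ltlf_sat t j \<psi> \<and> (\<forall>k. i \<le> k \<and> k < j \<longrightarrow> ltlf_sat t k \<phi>))"

datatype (atoms_ppltl: 'a) ppltl =
    PAtom 'a
  | PNot "'a ppltl"
  | POr "'a ppltl" "'a ppltl"
  | PAnd "'a ppltl" "'a ppltl"
  | PYesterday "'a ppltl"
  | PSince "'a ppltl" "'a ppltl"

primrec ppltl_sat :: "'a set list \<Rightarrow> nat \<Rightarrow> 'a ppltl \<Rightarrow> bool" where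
  "ppltl_sat t i (PAtom p) \<longleftrightarrow> p \<in> t ! i"
| "ppltl_sat t i (PNot \<phi>) \<longleftrightarrow> \<not> ppltl_sat t i \<phi>"
| "ppltl_sat t i (POr \<phi> \<psi>) \<longleftrightarrow> ppltl_sat t i \<phi> \<or> ppltl_sat t i \<psi>"
| "ppltl_sat t i (PAnd \<phi> \<psi>) \<longleftrightarrow> ppltl_sat t i \<phi> \<and> ppltl_sat t i \<psi>"
| "ppltl_sat t i (PYesterday \<phi>) \<longleftrightarrow> 0 < i \<and> ppltl_sat t (i - 1) \<phi>"
| "ppltl_sat t i (PSince \<phi> \<psi>) \<longleftrightarrow>
     (\<exists>j. j \<le> i \<and> ppltl_sat t j \<psi> \<and> (\<forall>k. j < k \<and> k \<le> i \<longrightarrow> ppltl_sat t k \<phi>))"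

definition ltlf_lang :: "'a set \<Rightarrow> 'a ltlf \<Rightarrow> 'a set list set" where
  "ltlf_lang AP \<phi> = {t \<in> lists (Pow AP). t \<noteq> [] \<and> ltlf_sat t 0 \<phi>}"

definition ppltl_lang :: "'a set \<Rightarrow> 'a ppltl \<Rightarrow> 'a set list set" where
  "ppltl_lang AP \<phi> = {t \<in> lists (Pow AP). t \<noteq> [] \<and> ppltl_sat t (length t - 1) \<phi>}"

section \<open>The logics of infinite traces\<close>

text \<open>The type parameter \<open>'f\<close> is the type of formulas on finite traces.\<close>

datatype (base: 'f) plus =
    QAll 'f
  | QEx 'f
  | QInfinitelyMany 'f
  | QAlmostAll 'f
  | QOr "'f plus" "'f plus"
  | QAnd "'f plus" "'f plus"
  | QNot "'f plus"

definition inf_traces :: "'a set \<Rightarrow> (nat \<Rightarrow> 'a set) set" where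
  "inf_traces AP = {\<tau>. \<forall>i. \<tau> i \<subseteq> AP}"

text \<open>\<open>trace_prefix \<tau> n\<close> is the prefix of length \<open>n + 1\<close>, so that \<open>n\<close> ranges exactly over the nonempty
  finite prefixes.\<close>

definition trace_prefix :: "(nat \<Rightarrow> 'a) \<Rightarrow> nat \<Rightarrow> 'a list" where
  "trace_prefix \<tau> n = map \<tau> [0..<Suc n]"

primrec plus_lang :: "('a set \<Rightarrow> 'f \<Rightarrow> 'a set list set) \<Rightarrow> 'a set \<Rightarrow> 'f plus \<Rightarrow> (nat \<Rightarrow> 'a set) set" where
  "plus_lang L AP (QAll \<phi>) = {\<tau> \<in> inf_traces AP. \<forall>n. trace_prefix \<tau> n \<in> L AP \<phi>}"
| "plus_lang L AP (QEx \<phi>) = {\<tau> \<in> inf_traces AP. \<exists>n. trace_prefix \<tau> n \<in> L AP \<phi>}"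
| "plus_lang L AP (QInfinitelyMany \<phi>) = {\<tau> \<in> inf_traces AP. \<exists>\<^sub>\<infinity>n. trace_prefix \<tau> n \<in> L AP \<phi>}"
| "plus_lang L AP (QAlmostAll \<phi>) = {\<tau> \<in> inf_traces AP. \<forall>\<^sub>\<infinity>n. trace_prefix \<tau> n \<in> L AP \<phi>}"
| "plus_lang L AP (QOr \<Psi> \<Psi>') = plus_lang L AP \<Psi> \<union> plus_lang L AP \<Psi>'"
| "plus_lang L AP (QAnd \<Psi> \<Psi>') = plus_lang L AP \<Psi> \<inter> plus_lang L AP \<Psi>'"
| "plus_lang L AP (QNot \<Psi>) = inf_traces AP - plus_lang L AP \<Psi>"

section \<open>Strategies\<close>

definition is_strategy :: "'a set \<Rightarrow> 'a set \<Rightarrow> ('a set list \<Rightarrow> 'a set) \<Rightarrow> bool" where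
  "is_strategy X Y \<sigma> \<longleftrightarrow> (\<forall>h \<in> lists (Pow Y). \<sigma> h \<subseteq> X)"

definition outcomes :: "'a set \<Rightarrow> 'a set \<Rightarrow> ('a set list \<Rightarrow> 'a set) \<Rightarrow> (nat \<Rightarrow> 'a set) set" where
  "outcomes X Y \<sigma> =
     {\<tau> \<in> inf_traces (X \<union> Y). \<forall>i. \<tau> i \<inter> X = \<sigma> (map (\<lambda>j. \<tau> j \<inter> Y) [0..<i])}"

definition wins :: "'a set \<Rightarrow> 'a set \<Rightarrow> ('a set list \<Rightarrow> 'a set) \<Rightarrow> (nat \<Rightarrow> 'a set) set \<Rightarrow> bool" where
  "wins X Y \<sigma> W \<longleftrightarrow> is_strategy X Y \<sigma> \<and> outcomes X Y \<sigma> \<subseteq> W"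

text \<open>
  Strategies are represented by explicit Moore machines. The states are the positions of the list
  and position 0 is initial. An entry consists of the output of the state, a subset of \<open>X\<close>, and of
  its transition table, which has exactly one entry for every subset of \<open>Y\<close>. Lists of atoms stand for
  their sets of elements.
\<close>

type_synonym moore = "(nat list \<times> (nat list \<times> nat) list) list"

definition moore_wf :: "nat set \<Rightarrow> nat set \<Rightarrow> moore \<Rightarrow> bool" where
  "moore_wf X Y T \<longleftrightarrow> T \<noteq> [] \<and>
     (\<forall>(out, trans) \<in> set T. set out \<subseteq> X \<and>
        (\<forall>(ys, q) \<in> set trans. set ys \<subseteq> Y \<and> q < length T) \<and>
        (\<forall>y. y \<subseteq> Y \<longrightarrow> (\<exists>!r. r \<in> set trans \<and> set (fst r) = y)))"

definition moore_next :: "moore \<Rightarrow> nat \<Rightarrow> nat set \<Rightarrow> nat" where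
  "moore_next T q y = snd (THE r. r \<in> set (snd (T ! q)) \<and> set (fst r) = y)"

definition moore_strategy :: "moore \<Rightarrow> nat set list \<Rightarrow> nat set" where
  "moore_strategy T h = set (fst (T ! foldl (moore_next T) 0 h))"

section \<open>Encodings as binary words\<close>

text \<open>All encodings are prefix-free codes; natural numbers are written in binary, each digit being
  preceded by \<open>True\<close>, the least significant digit first.\<close>

fun enc_nat :: "nat \<Rightarrow> bool list" where
  "enc_nat n = (if n = 0 then [False] else True # odd n # enc_nat (n div 2))"

declare enc_nat.simps [simp del]

definition enc_list :: "('b \<Rightarrow> bool list) \<Rightarrow> 'b list \<Rightarrow> bool list" where
  "enc_list e xs = concat (map (\<lambda>x. True # e x) xs) @ [False]"

definition enc_pair :: "('b \<Rightarrow> bool list) \<Rightarrow> ('c \<Rightarrow> bool list) \<Rightarrow> 'b \<times> 'c \<Rightarrow> bool list" where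
  "enc_pair e e' = (\<lambda>(x, y). e x @ e' y)"

primrec enc_ltlf :: "nat ltlf \<Rightarrow> bool list" where
  "enc_ltlf (LAtom p) = [False, False, False] @ enc_nat p"
| "enc_ltlf (LNot \<phi>) = [False, False, True] @ enc_ltlf \<phi>"
| "enc_ltlf (LOr \<phi> \<psi>) = [False, True, False] @ enc_ltlf \<phi> @ enc_ltlf \<psi>"
| "enc_ltlf (LAnd \<phi> \<psi>) = [False, True, True] @ enc_ltlf \<phi> @ enc_ltlf \<psi>"
| "enc_ltlf (LNext \<phi>) = [True, False, False] @ enc_ltlf \<phi>"
| "enc_ltlf (LUntil \<phi> \<psi>) = [True, False, True] @ enc_ltlf \<phi> @ enc_ltlf \<psi>"

primrec enc_ppltl :: "nat ppltl \<Rightarrow> bool list" where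
  "enc_ppltl (PAtom p) = [False, False, False] @ enc_nat p"
| "enc_ppltl (PNot \<phi>) = [False, False, True] @ enc_ppltl \<phi>"
| "enc_ppltl (POr \<phi> \<psi>) = [False, True, False] @ enc_ppltl \<phi> @ enc_ppltl \<psi>"
| "enc_ppltl (PAnd \<phi> \<psi>) = [False, True, True] @ enc_ppltl \<phi> @ enc_ppltl \<psi>"
| "enc_ppltl (PYesterday \<phi>) = [True, False, False] @ enc_ppltl \<phi>"
| "enc_ppltl (PSince \<phi> \<psi>) = [True, False, True] @ enc_ppltl \<phi> @ enc_ppltl \<psi>"

primrec enc_plus :: "('f \<Rightarrow> bool list) \<Rightarrow> 'f plus \<Rightarrow> bool list" where
  "enc_plus e (QAll \<phi>) = [False, False, False] @ e \<phi>"
| "enc_plus e (QEx \<phi>) = [False, False, True] @ e \<phi>"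
| "enc_plus e (QInfinitelyMany \<phi>) = [False, True, False] @ e \<phi>"
| "enc_plus e (QAlmostAll \<phi>) = [False, True, True] @ e \<phi>"
| "enc_plus e (QOr \<Psi> \<Psi>') = [True, False, False] @ enc_plus e \<Psi> @ enc_plus e \<Psi>'"
| "enc_plus e (QAnd \<Psi> \<Psi>') = [True, False, True] @ enc_plus e \<Psi> @ enc_plus e \<Psi>'"
| "enc_plus e (QNot \<Psi>) = [True, True, False] @ enc_plus e \<Psi>"

definition enc_moore :: "moore \<Rightarrow> bool list" where
  "enc_moore = enc_list (enc_pair (enc_list enc_nat) (enc_list (enc_pair (enc_list enc_nat) enc_nat)))"

text \<open>An instance consists of the agent's atoms, the environment's atoms and a formula.\<close>

type_synonym 'f inst = "nat list \<times> nat list \<times> 'f plus"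

definition enc_inst :: "('f \<Rightarrow> bool list) \<Rightarrow> 'f inst \<Rightarrow> bool list" where
  "enc_inst e = enc_pair (enc_list enc_nat) (enc_pair (enc_list enc_nat) (enc_plus e))"

definition prefix_code :: "('b \<Rightarrow> bool list) \<Rightarrow> bool" where
  "prefix_code e \<longleftrightarrow> (\<forall>x y u v. e x @ u = e y @ v \<longrightarrow> x = y \<and> u = v)"

lemma prefix_codeD: "prefix_code e \<Longrightarrow> e x @ u = e y @ v \<longleftrightarrow> x = y \<and> u = v"
  by (auto simp: prefix_code_def)

lemma prefix_code_inj: "prefix_code e \<Longrightarrow> inj e"
  unfolding prefix_code_def inj_def by (metis append_Nil2)

lemma prefix_code_enc_nat: "prefix_code enc_nat"
proof -
  have "x = y \<and> u = v" if "enc_nat x @ u = enc_nat y @ v" for x y u v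
    using that
  proof (induction x arbitrary: y rule: less_induct)
    case (less x)
    show ?case
    proof (cases "x = 0 \<or> y = 0")
      case True
      then show ?thesis using less.prems
        by (auto simp: enc_nat.simps[of x] enc_nat.simps[of y] split: if_splits)
    next
      case False
      then have eq: "odd x = odd y" "enc_nat (x div 2) @ u = enc_nat (y div 2) @ v"
        using less.prems by (auto simp: enc_nat.simps[of x] enc_nat.simps[of y])
      have "x div 2 = y div 2 \<and> u = v"
        using less.IH[OF _ eq(2)] False by simp
      then show ?thesis using eq(1) by (metis odd_two_times_div_two_succ even_two_times_div_two)
    qed
  qed
  then show ?thesis unfolding prefix_code_def by blast
qed

lemma prefix_code_enc_list:
  assumes e: "prefix_code e" shows "prefix_code (enc_list e)"
proof -
  have "xs = ys \<and> u = v" if "enc_list e xs @ u = enc_list e ys @ v" for xs ys u v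
    using that
  proof (induction xs arbitrary: ys)
    case Nil
    then show ?case by (cases ys) (auto simp: enc_list_def)
  next
    case (Cons x xs)
    then show ?case by (cases ys) (auto simp: enc_list_def prefix_codeD[OF e])
  qed
  then show ?thesis unfolding prefix_code_def by blast
qed

lemma prefix_code_enc_pair:
  assumes e: "prefix_code e" and e': "prefix_code e'"
  shows "prefix_code (enc_pair e e')"
  unfolding prefix_code_def enc_pair_def
  by (simp add: prefix_codeD[OF e] prefix_codeD[OF e'] split: prod.split)

lemma prefix_code_enc_ltlf: "prefix_code enc_ltlf"
proof -
  have "enc_ltlf \<phi> @ u = enc_ltlf \<psi> @ v \<longleftrightarrow> \<phi> = \<psi> \<and> u = v" for \<phi> \<psi> u v
    by (induction \<phi> arbitrary: \<psi> u v; case_tac \<psi>)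
      (simp_all add: prefix_codeD[OF prefix_code_enc_nat])
  then show ?thesis by (simp add: prefix_code_def)
qed

lemma prefix_code_enc_ppltl: "prefix_code enc_ppltl"
proof -
  have "enc_ppltl \<phi> @ u = enc_ppltl \<psi> @ v \<longleftrightarrow> \<phi> = \<psi> \<and> u = v" for \<phi> \<psi> u v
    by (induction \<phi> arbitrary: \<psi> u v; case_tac \<psi>)
      (simp_all add: prefix_codeD[OF prefix_code_enc_nat])
  then show ?thesis by (simp add: prefix_code_def)
qed

lemma prefix_code_enc_plus:
  assumes e: "prefix_code e" shows "prefix_code (enc_plus e)"
proof -
  have "enc_plus e \<phi> @ u = enc_plus e \<psi> @ v \<longleftrightarrow> \<phi> = \<psi> \<and> u = v" for \<phi> \<psi> u v
    by (induction \<phi> arbitrary: \<psi> u v; case_tac \<psi>) (simp_all add: prefix_codeD[OF e])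
  then show ?thesis by (simp add: prefix_code_def)
qed

lemma inj_enc_inst: "prefix_code e \<Longrightarrow> inj (enc_inst e)"
  unfolding enc_inst_def
  by (intro prefix_code_inj prefix_code_enc_pair prefix_code_enc_list prefix_code_enc_nat
      prefix_code_enc_plus)

lemma inj_enc_moore: "inj enc_moore"
  unfolding enc_moore_def
  by (intro prefix_code_inj prefix_code_enc_pair prefix_code_enc_list prefix_code_enc_nat)

section \<open>The synthesis problem\<close>

definition valid_inst :: "('f \<Rightarrow> nat set) \<Rightarrow> 'f inst \<Rightarrow> bool" where
  "valid_inst ats = (\<lambda>(X, Y, \<Psi>). set X \<inter> set Y = {} \<and> set X \<union> set Y \<noteq> {} \<and>
     (\<forall>\<phi> \<in> base \<Psi>. ats \<phi> \<subseteq> set X \<union> set Y))"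

text \<open>For a fixed partition of the atoms, the length of the input is linear in the size of the formula,
  the number of its symbols.\<close>

primrec size_ltlf_formula :: "'a ltlf \<Rightarrow> nat" where
  "size_ltlf_formula (LAtom p) = 1"
| "size_ltlf_formula (LNot \<phi>) = 1 + size_ltlf_formula \<phi>"
| "size_ltlf_formula (LOr \<phi> \<psi>) = 1 + size_ltlf_formula \<phi> + size_ltlf_formula \<psi>"
| "size_ltlf_formula (LAnd \<phi> \<psi>) = 1 + size_ltlf_formula \<phi> + size_ltlf_formula \<psi>"
| "size_ltlf_formula (LNext \<phi>) = 1 + size_ltlf_formula \<phi>"
| "size_ltlf_formula (LUntil \<phi> \<psi>) = 1 + size_ltlf_formula \<phi> + size_ltlf_formula \<psi>"

primrec size_ppltl_formula :: "'a ppltl \<Rightarrow> nat" where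
  "size_ppltl_formula (PAtom p) = 1"
| "size_ppltl_formula (PNot \<phi>) = 1 + size_ppltl_formula \<phi>"
| "size_ppltl_formula (POr \<phi> \<psi>) = 1 + size_ppltl_formula \<phi> + size_ppltl_formula \<psi>"
| "size_ppltl_formula (PAnd \<phi> \<psi>) = 1 + size_ppltl_formula \<phi> + size_ppltl_formula \<psi>"
| "size_ppltl_formula (PYesterday \<phi>) = 1 + size_ppltl_formula \<phi>"
| "size_ppltl_formula (PSince \<phi> \<psi>) = 1 + size_ppltl_formula \<phi> + size_ppltl_formula \<psi>"

primrec size_plus_formula :: "('f \<Rightarrow> nat) \<Rightarrow> 'f plus \<Rightarrow> nat" where
  "size_plus_formula s (QAll \<phi>) = 1 + s \<phi>"
| "size_plus_formula s (QEx \<phi>) = 1 + s \<phi>"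
| "size_plus_formula s (QInfinitelyMany \<phi>) = 1 + s \<phi>"
| "size_plus_formula s (QAlmostAll \<phi>) = 1 + s \<phi>"
| "size_plus_formula s (QOr \<Psi> \<Psi>') = 1 + size_plus_formula s \<Psi> + size_plus_formula s \<Psi>'"
| "size_plus_formula s (QAnd \<Psi> \<Psi>') = 1 + size_plus_formula s \<Psi> + size_plus_formula s \<Psi>'"
| "size_plus_formula s (QNot \<Psi>) = 1 + size_plus_formula s \<Psi>"

lemma size_enc_ltlf:
  assumes "\<forall>p \<in> atoms_ltlf \<phi>. length (enc_nat p) \<le> m"
  shows "size_ltlf_formula \<phi> \<le> length (enc_ltlf \<phi>) \<and> length (enc_ltlf \<phi>) \<le> (m + 3) * size_ltlf_formula \<phi>"
  using assms by (induction \<phi>) (simp_all add: ball_Un algebra_simps Suc_leI)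

lemma size_enc_ppltl:
  assumes "\<forall>p \<in> atoms_ppltl \<phi>. length (enc_nat p) \<le> m"
  shows "size_ppltl_formula \<phi> \<le> length (enc_ppltl \<phi>) \<and> length (enc_ppltl \<phi>) \<le> (m + 3) * size_ppltl_formula \<phi>"
  using assms by (induction \<phi>) (simp_all add: ball_Un algebra_simps Suc_leI)

lemma size_enc_plus:
  assumes "\<forall>\<phi> \<in> base \<Psi>. s \<phi> \<le> length (e \<phi>) \<and> length (e \<phi>) \<le> (m + 3) * s \<phi>"
  shows "size_plus_formula s \<Psi> \<le> length (enc_plus e \<Psi>) \<and>
         length (enc_plus e \<Psi>) \<le> (m + 3) * size_plus_formula s \<Psi>"
  using assms by (induction \<Psi>) (simp_all add: ball_Un algebra_simps)

lemma size_enc_inst_aux: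
  fixes ats :: "'f \<Rightarrow> nat set"
  assumes "\<And>\<phi> m. \<forall>p \<in> ats \<phi>. length (enc_nat p) \<le> m \<Longrightarrow>
             s \<phi> \<le> length (e \<phi>) \<and> length (e \<phi>) \<le> (m + 3) * s \<phi>"
  shows "\<exists>c. \<forall>\<Psi>. valid_inst ats (X, Y, \<Psi>) \<longrightarrow>
           size_plus_formula s \<Psi> \<le> length (enc_inst e (X, Y, \<Psi>)) \<and>
           length (enc_inst e (X, Y, \<Psi>)) \<le> c * size_plus_formula s \<Psi>"
proof -
  define m where "m = (\<Sum>p \<in> set X \<union> set Y. length (enc_nat p))"
  define k where "k = length (enc_list enc_nat X) + length (enc_list enc_nat Y)"
  have m: "length (enc_nat p) \<le> m" if "p \<in> set X \<union> set Y" for p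
    unfolding m_def using that by (intro member_le_sum) auto
  have "size_plus_formula s \<Psi> \<le> length (enc_inst e (X, Y, \<Psi>)) \<and>
        length (enc_inst e (X, Y, \<Psi>)) \<le> (k + m + 3) * size_plus_formula s \<Psi>"
    if "valid_inst ats (X, Y, \<Psi>)" for \<Psi>
  proof -
    have "\<forall>\<phi> \<in> base \<Psi>. s \<phi> \<le> length (e \<phi>) \<and> length (e \<phi>) \<le> (m + 3) * s \<phi>"
    proof
      fix \<phi> assume "\<phi> \<in> base \<Psi>"
      with that have "ats \<phi> \<subseteq> set X \<union> set Y" by (simp add: valid_inst_def)
      with m show "s \<phi> \<le> length (e \<phi>) \<and> length (e \<phi>) \<le> (m + 3) * s \<phi>"
        by (intro assms) blast
    qed
    note b = size_enc_plus[of \<Psi> s e m, OF this]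
    have "1 \<le> size_plus_formula s \<Psi>" by (cases \<Psi>) auto
    then have "k \<le> k * size_plus_formula s \<Psi>" by simp
    with b show ?thesis
      by (simp add: enc_inst_def enc_pair_def k_def algebra_simps)
  qed
  then show ?thesis by blast
qed

lemma size_enc_inst_ltlf:
  "\<exists>c. \<forall>\<Psi>. valid_inst atoms_ltlf (X, Y, \<Psi>) \<longrightarrow>
     size_plus_formula size_ltlf_formula \<Psi> \<le> length (enc_inst enc_ltlf (X, Y, \<Psi>)) \<and>
     length (enc_inst enc_ltlf (X, Y, \<Psi>)) \<le> c * size_plus_formula size_ltlf_formula \<Psi>"
  by (rule size_enc_inst_aux) (rule size_enc_ltlf)

lemma size_enc_inst_ppltl:
  "\<exists>c. \<forall>\<Psi>. valid_inst atoms_ppltl (X, Y, \<Psi>) \<longrightarrow>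
     size_plus_formula size_ppltl_formula \<Psi> \<le> length (enc_inst enc_ppltl (X, Y, \<Psi>)) \<and>
     length (enc_inst enc_ppltl (X, Y, \<Psi>)) \<le> c * size_plus_formula size_ppltl_formula \<Psi>"
  by (rule size_enc_inst_aux) (rule size_enc_ppltl)

definition inst_wins ::
  "(nat set \<Rightarrow> 'f \<Rightarrow> nat set list set) \<Rightarrow> 'f inst \<Rightarrow> (nat set list \<Rightarrow> nat set) \<Rightarrow> bool" where
  "inst_wins L = (\<lambda>(X, Y, \<Psi>) \<sigma>. wins (set X) (set Y) \<sigma> (plus_lang L (set X \<union> set Y) \<Psi>))"

definition realizable_words ::
  "('f \<Rightarrow> nat set) \<Rightarrow> (nat set \<Rightarrow> 'f \<Rightarrow> nat set list set) \<Rightarrow> ('f \<Rightarrow> bool list) \<Rightarrow> bool list set" where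
  "realizable_words ats L e = {enc_inst e I | I. valid_inst ats I \<and> (\<exists>\<sigma>. inst_wins L I \<sigma>)}"

text \<open>The admissible answers: \<open>[False]\<close> if there is no winning strategy (or the input does not encode
  an instance), otherwise \<open>True\<close> followed by a Moore machine for a winning strategy.\<close>

definition synthesis_answer ::
  "('f \<Rightarrow> nat set) \<Rightarrow> (nat set \<Rightarrow> 'f \<Rightarrow> nat set list set) \<Rightarrow> ('f \<Rightarrow> bool list) \<Rightarrow>
     bool list \<Rightarrow> bool list \<Rightarrow> bool" where
  "synthesis_answer ats L e w v \<longleftrightarrow>
     (if w \<in> realizable_words ats L e
      then \<exists>X Y \<Psi> T. valid_inst ats (X, Y, \<Psi>) \<and> w = enc_inst e (X, Y, \<Psi>) \<and>
             moore_wf (set X) (set Y) T \<and> inst_wins L (X, Y, \<Psi>) (moore_strategy T) \<and>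
             v = True # enc_moore T
      else v = [False])"

definition LTLf_plus_realizability :: "bool list set" where
  "LTLf_plus_realizability = realizable_words atoms_ltlf ltlf_lang enc_ltlf"

definition PPLTL_plus_realizability :: "bool list set" where
  "PPLTL_plus_realizability = realizable_words atoms_ppltl ppltl_lang enc_ppltl"

definition LTLf_plus_synthesis :: "bool list \<Rightarrow> bool list \<Rightarrow> bool" where
  "LTLf_plus_synthesis = synthesis_answer atoms_ltlf ltlf_lang enc_ltlf"

definition PPLTL_plus_synthesis :: "bool list \<Rightarrow> bool list \<Rightarrow> bool" where
  "PPLTL_plus_synthesis = synthesis_answer atoms_ppltl ppltl_lang enc_ppltl"

section \<open>Deterministic multitape Turing machines\<close>

datatype move = MLeft | MStay | MRight

text \<open>
  States and symbols are initial segments of the natural numbers. State 0 is initial, symbol 0 is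
  the blank, symbols 1 and 2 are the input letters \<open>False\<close> and \<open>True\<close>. The machine halts where the
  transition function is undefined. Tapes are infinite in both directions.
\<close>

record tm =
  num_tapes :: nat
  num_states :: nat
  num_symbols :: nat
  delta :: "nat \<Rightarrow> nat list \<Rightarrow> (nat \<times> (nat \<times> move) list) option"

type_synonym tape = "(int \<Rightarrow> nat) \<times> int"
type_synonym config = "nat \<times> tape list"

definition tm_wf :: "tm \<Rightarrow> bool" where
  "tm_wf M \<longleftrightarrow> 1 \<le> num_tapes M \<and> 1 \<le> num_states M \<and> 3 \<le> num_symbols M \<and>
     (\<forall>q rs q' as. q < num_states M \<and> length rs = num_tapes M \<and> (\<forall>s \<in> set rs. s < num_symbols M) \<and>
        delta M q rs = Some (q', as) \<longrightarrow>
          q' < num_states M \<and> length as = num_tapes M \<and> (\<forall>(s, m) \<in> set as. s < num_symbols M))"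

definition head_symbol :: "tape \<Rightarrow> nat" where
  "head_symbol = (\<lambda>(c, p). c p)"

definition head_pos :: "move \<Rightarrow> int \<Rightarrow> int" where
  "head_pos m p = (case m of MLeft \<Rightarrow> p - 1 | MStay \<Rightarrow> p | MRight \<Rightarrow> p + 1)"

definition tape_act :: "nat \<times> move \<Rightarrow> tape \<Rightarrow> tape" where
  "tape_act = (\<lambda>(s, m) (c, p). (c(p := s), head_pos m p))"

text \<open>Halting configurations are fixed points of \<open>tm_step\<close>.\<close>

definition tm_step :: "tm \<Rightarrow> config \<Rightarrow> config" where
  "tm_step M = (\<lambda>(q, ts). case delta M q (map head_symbol ts) of
       None \<Rightarrow> (q, ts)
     | Some (q', as) \<Rightarrow> (q', map2 tape_act as ts))"

definition halted :: "tm \<Rightarrow> config \<Rightarrow> bool" where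
  "halted M = (\<lambda>(q, ts). delta M q (map head_symbol ts) = None)"

definition word_cells :: "bool list \<Rightarrow> int \<Rightarrow> nat" where
  "word_cells w i = (if 0 \<le> i \<and> i < int (length w) then (if w ! nat i then 2 else 1) else 0)"

definition tm_init :: "tm \<Rightarrow> bool list \<Rightarrow> config" where
  "tm_init M w = (0, (word_cells w, 0) # replicate (num_tapes M - 1) (word_cells [], 0))"

text \<open>The output is the word that starts in cell 0 of the last tape and extends up to the first blank.\<close>

definition has_output :: "config \<Rightarrow> bool list \<Rightarrow> bool" where
  "has_output C v \<longleftrightarrow> (\<forall>i \<in> {0..int (length v)}. fst (last (snd C)) i = word_cells v i)"

definition tm_computes :: "tm \<Rightarrow> nat \<Rightarrow> bool list \<Rightarrow> bool list \<Rightarrow> bool" where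
  "tm_computes M t w v \<longleftrightarrow>
     (let C = (tm_step M ^^ t) (tm_init M w) in halted M C \<and> has_output C v)"

section \<open>Complexity classes\<close>

text \<open>A search problem relates each input to its admissible outputs.\<close>

definition solvable_in_time :: "(nat \<Rightarrow> nat) \<Rightarrow> (bool list \<Rightarrow> bool list \<Rightarrow> bool) \<Rightarrow> bool" where
  "solvable_in_time f R \<longleftrightarrow>
     (\<exists>M. tm_wf M \<and> (\<forall>w. \<exists>v. tm_computes M (f (length w)) w v \<and> R w v))"

definition decidable_in_time :: "(nat \<Rightarrow> nat) \<Rightarrow> bool list set \<Rightarrow> bool" where
  "decidable_in_time f A \<longleftrightarrow> solvable_in_time f (\<lambda>w v. v = [w \<in> A])"

definition poly_time_computable :: "(bool list \<Rightarrow> bool list) \<Rightarrow> bool" where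
  "poly_time_computable g \<longleftrightarrow> (\<exists>p :: nat poly. solvable_in_time (poly p) (\<lambda>w v. v = g w))"

definition EXPTIME :: "bool list set set" where
  "EXPTIME = {A. \<exists>p :: nat poly. decidable_in_time (\<lambda>n. 2 ^ poly p n) A}"

definition TWO_EXPTIME :: "bool list set set" where
  "TWO_EXPTIME = {A. \<exists>p :: nat poly. decidable_in_time (\<lambda>n. 2 ^ 2 ^ poly p n) A}"

definition search_EXPTIME :: "(bool list \<Rightarrow> bool list \<Rightarrow> bool) set" where
  "search_EXPTIME = {R. \<exists>p :: nat poly. solvable_in_time (\<lambda>n. 2 ^ poly p n) R}"

definition search_TWO_EXPTIME :: "(bool list \<Rightarrow> bool list \<Rightarrow> bool) set" where
  "search_TWO_EXPTIME = {R. \<exists>p :: nat poly. solvable_in_time (\<lambda>n. 2 ^ 2 ^ poly p n) R}"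

definition poly_reducible :: "bool list set \<Rightarrow> bool list set \<Rightarrow> bool" where
  "poly_reducible A B \<longleftrightarrow> (\<exists>g. poly_time_computable g \<and> (\<forall>w. w \<in> A \<longleftrightarrow> g w \<in> B))"

definition complete_for :: "bool list set set \<Rightarrow> bool list set \<Rightarrow> bool" where
  "complete_for \<C> B \<longleftrightarrow> B \<in> \<C> \<and> (\<forall>A \<in> \<C>. poly_reducible A B)"

end

theory Submission
  imports Defs "HOL-Library.Infinite_Set"
begin

text \<open>
  Membership: the truth values of all subformulas on a finite prefix are updated letter by letter (PPLTL), or
  the update functions are composed (LTLf), so the prefixes are tracked by exponentially, respectively doubly
  exponentially many states. Latest appearance records turn the Boolean combination of conditions on prefixes
  into a parity condition, and counters of the odd priorities turn the parity game into a safety game, which is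
  solved by iterating a predecessor operator. All this is polynomial in unary bounds on the number of states.
  PPLTL is mirrored into the syntax of LTLf, which has the same codes.

  Hardness: given a machine and an input, the agent claims backwards in time the state, the symbols under
  the heads and the symbol of one cell, and the environment chooses which cell to follow; the agent can defend its
  claims iff they are true. Times and distances are binary numbers, written as rows of \<open>W\<close> letters and
  checked by local rules. A formula of the form \<open>QAll\<close> enforces the rules; it compares letters at distance \<open>W\<close>,
  where \<open>W\<close> is polynomial for PPLTL (iterated yesterday) and exponential for LTLf (a binary counter).
\<close>

subsection \<open>A stack language on Turing machines\<close>

text \<open>Programs are measured by \<open>fpon\<close>: time and output size are bounded by a
  power of a freely chosen measure \<open>r\<close> of the input, and numbers are coded in unary. A
  (doubly) exponential \<open>r\<close> therefore needs no second calculus: only the bounds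
  \<open>P\<close> and \<open>B\<close> are computed by repeated doubling, and the synthesis
  procedure is polynomial in them. The delicate direction of the passage to safety games is that a
  winning strategy with unlimited memory can be replaced by one that bounds the counters. Memoryless
  determinacy is not invoked: an environment able to force an overflow could close cycles with odd
  maximum again and again against the given strategy. For hardness the obstacle is that
  configurations may be exponentially longer than the distance \<open>W\<close> at which a formula
  can compare letters. A play therefore follows a single cell backwards in time. A strategy commits
  to the claims of a row before the environment chooses the next cell, so all choices test the same
  claims, and induction on time shows these to be true.\<close>

text \<open>Tapes 0 to 4 hold stacks, the head being on the topmost symbol; tape 5 is the output tape.
  \<open>PUT\<close> is the second half of a \<open>PUSH\<close> and occurs only in machine states.\<close>

datatype com =
    SKIP | PUSH nat bool | PUT nat bool | OUT bool | SEQ com com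
  | POP nat com com com | LOOP nat com com

type_synonym store = "(nat => bool list) \<times> bool list"

inductive bs :: "com => store => nat => store => bool" where
  bs_SKIP: "bs SKIP s 1 s"
| bs_PUSH: "i < 5 ==> bs (PUSH i b) (S, out) 2 (S(i := b # S i), out)"
| bs_OUT: "bs (OUT b) (S, out) 1 (S, out @ [b])"
| bs_SEQ: "bs a s t s' ==> bs b s' t' s'' ==> bs (SEQ a b) s (t + t' + 1) s''"
| bs_POP_Nil: "i < 5 ==> S i = [] ==> bs e (S, out) t s' ==> bs (POP i e a b) (S, out) (t + 1) s'"
| bs_POP_Cons: "i < 5 ==> S i = v # vs ==> bs (if v then b else a) (S(i := vs), out) t s' ==>
    bs (POP i e a b) (S, out) (t + 1) s'"
| bs_LOOP_Nil: "i < 5 ==> S i = [] ==> bs (LOOP i a b) (S, out) 1 (S, out)"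
| bs_LOOP_Cons: "i < 5 ==> S i = v # vs ==> bs (if v then b else a) (S(i := vs), out) t s' ==>
    bs (LOOP i a b) s' t' s'' ==> bs (LOOP i a b) (S, out) (t + t' + 1) s''"

definition sym :: "bool => nat" where "sym b = (if b then 2 else 1)"

definition act :: "nat => nat => move => nat list => (nat \<times> move) list" where
  "act i s m rs = map (%l. if l = i then (s, m) else (rs ! l, MStay)) [0..<6]"

text \<open>Small steps by continuations: a control state is the list of commands still to be
  executed. A step without effect must still act on some tape, so it rewrites the scanned symbol of
  tape 0.\<close>

fun dlt :: "com list => nat list => (com list \<times> (nat \<times> move) list) option" where
  "dlt [] rs = None"
| "dlt (SKIP # K) rs = Some (K, act 0 (rs ! 0) MStay rs)"
| "dlt (PUSH i b # K) rs = Some (PUT i b # K, act i (rs ! i) MLeft rs)"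
| "dlt (PUT i b # K) rs = Some (K, act i (sym b) MStay rs)"
| "dlt (OUT b # K) rs = Some (K, act 5 (sym b) MRight rs)"
| "dlt (SEQ a b # K) rs = Some (a # b # K, act 0 (rs ! 0) MStay rs)"
| "dlt (POP i e a b # K) rs =
     (if rs ! i = 0 then Some (e # K, act i 0 MStay rs)
      else Some ((if rs ! i = 2 then b else a) # K, act i 0 MRight rs))"
| "dlt (LOOP i a b # K) rs =
     (if rs ! i = 0 then Some (K, act i 0 MStay rs)
      else Some ((if rs ! i = 2 then b else a) # LOOP i a b # K, act i 0 MRight rs))"

definition cstep :: "com list \<times> tape list => com list \<times> tape list" where
  "cstep = (%(K, ts). case dlt K (map head_symbol ts) of None => (K, ts)
     | Some (K', as) => (K', map2 tape_act as ts))"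

text \<open>The cells to the left of a stack head are left open, since the next push overwrites
  whatever stands there. On the output tape all cells from 0 on are fixed, so the final blank
  demanded by \<open>has_output\<close> is part of the invariant.\<close>

definition rep :: "store => tape list => bool" where
  "rep s ts \<longleftrightarrow> length ts = 6 \<and>
     (\<forall>i<5. \<forall>j\<ge>0. fst (ts ! i) (snd (ts ! i) + j) = word_cells (fst s i) j) \<and>
     snd (ts ! 5) = int (length (snd s)) \<and> (\<forall>j\<ge>0. fst (ts ! 5) j = word_cells (snd s) j)"

lemma map2_act:
  assumes "length ts = 6" "i < 6"
  shows "map2 tape_act (act i s m (map head_symbol ts)) ts = ts[i := tape_act (s, m) (ts ! i)]"
proof (rule nth_equalityI)
  fix l assume "l < length (map2 tape_act (act i s m (map head_symbol ts)) ts)"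
  then have l: "l < 6" by (simp add: act_def assms)
  show "map2 tape_act (act i s m (map head_symbol ts)) ts ! l = ts[i := tape_act (s, m) (ts ! i)] ! l"
    using l assms
    by (auto simp: act_def nth_list_update tape_act_def head_symbol_def head_pos_def split: prod.splits)
qed (simp add: act_def assms)

lemma word_cells_0: "word_cells xs 0 = (case xs of [] => 0 | x # _ => sym x)"
  by (auto simp: word_cells_def sym_def split: list.split)

lemma word_cells_Cons: "j \<ge> 0 ==> word_cells (x # xs) (1 + j) = word_cells xs j"
  by (auto simp: word_cells_def nat_add_distrib)

lemma word_cells_Cons': "j \<ge> 0 ==> word_cells (x # xs) j = (if j = 0 then sym x else word_cells xs (j - 1))"
  using word_cells_Cons[of "j - 1" x xs] by (auto simp: word_cells_0)

lemma word_cells_snoc: "j \<ge> 0 ==> word_cells (xs @ [x]) j = (if j = int (length xs) then sym x else word_cells xs j)"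
  by (auto simp: word_cells_def nth_append sym_def nat_less_iff)

lemma rep_head: "rep (S, out) ts ==> i < 5 ==> head_symbol (ts ! i) = (case S i of [] => 0 | x # _ => sym x)"
proof -
  assume "rep (S, out) ts" "i < 5"
  then have "fst (ts ! i) (snd (ts ! i) + 0) = word_cells (S i) 0" unfolding rep_def by fastforce
  then show ?thesis by (cases "ts ! i") (simp add: head_symbol_def word_cells_0)
qed

lemma rep_push:
  assumes "rep (S, out) ts" "i < 5"
  shows "rep (S(i := b # S i), out) (ts[i := tape_act (sym b, MStay) (tape_act (head_symbol (ts ! i), MLeft) (ts ! i))])"
proof -
  obtain c p where cp: "ts ! i = (c, p)" by fastforce
  have *: "c (p + j) = word_cells (S i) j" if "j \<ge> 0" for j using assms that cp unfolding rep_def by fastforce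
  have "c (p - 1 + j) = word_cells (S i) (j - 1)" if "j > 0" for j
    using *[of "j - 1"] that by (simp add: algebra_simps)
  then show ?thesis using assms cp
    unfolding rep_def by (auto simp: nth_list_update tape_act_def head_pos_def head_symbol_def word_cells_Cons')
qed

lemma rep_pop:
  assumes "rep (S, out) ts" "i < 5" "S i = v # vs"
  shows "rep (S(i := vs), out) (ts[i := tape_act (0, MRight) (ts ! i)])"
proof -
  obtain c p where cp: "ts ! i = (c, p)" by fastforce
  have *: "c (p + j) = word_cells (S i) j" if "j \<ge> 0" for j using assms that cp unfolding rep_def by fastforce
  have "c (p + 1 + j) = word_cells vs j" if "j \<ge> 0" for j
    using *[of "1 + j"] that word_cells_Cons[of j v vs] assms(3) by (simp add: algebra_simps)
  then show ?thesis using assms cp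
    unfolding rep_def by (auto simp: nth_list_update tape_act_def head_pos_def head_symbol_def)
qed

lemma rep_out:
  assumes "rep (S, out) ts"
  shows "rep (S, out @ [b]) (ts[5 := tape_act (sym b, MRight) (ts ! 5)])"
  using assms unfolding rep_def
  by (cases "ts ! 5") (auto simp: nth_list_update tape_act_def head_pos_def word_cells_snoc)

lemma tape_act_same: "tape_act (head_symbol x, MStay) x = x"
  by (auto simp: tape_act_def head_symbol_def head_pos_def split: prod.split)

lemma cstep_simp: "length ts = 6 ==> dlt K (map head_symbol ts) = Some (K', act i s m (map head_symbol ts)) ==> i < 6 ==>
   cstep (K, ts) = (K', ts[i := tape_act (s, m) (ts ! i)])"
  by (simp add: cstep_def map2_act)

lemma funpow_add_app: "(f ^^ (m + n)) x = (f ^^ n) ((f ^^ m) x)"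
  by (metis add.commute comp_apply funpow_add)

lemma rep_len: "rep s ts ==> length ts = 6" by (simp add: rep_def)

text \<open>A simulation with exact step counts. The continuation \<open>K\<close> has to be
  arbitrary because \<open>SEQ\<close> and \<open>LOOP\<close> run their parts on longer
  continuations.\<close>

lemma bs_cstep:
  "bs c s t s' ==> rep s ts ==> \<exists>ts'. (cstep ^^ t) (c # K, ts) = (K, ts') \<and> rep s' ts'"
proof (induction arbitrary: ts K rule: bs.induct)
  case (bs_SKIP s)
  note l = rep_len[OF bs_SKIP]
  have "cstep (SKIP # K, ts) = (K, ts)"
    using l by (subst cstep_simp[where i = 0]) (auto simp: tape_act_same)
  then show ?case using bs_SKIP by auto
next
  case (bs_PUSH i b S out)
  note l = rep_len[OF bs_PUSH(2)]
  have 1: "cstep (PUSH i b # K, ts) = (PUT i b # K, ts[i := tape_act (head_symbol (ts ! i), MLeft) (ts ! i)])" (is "_ = (_, ?ts)")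
    using l bs_PUSH by (intro cstep_simp) auto
  have 2: "cstep (PUT i b # K, ?ts) = (K, ?ts[i := tape_act (sym b, MStay) (?ts ! i)])"
    using l bs_PUSH by (intro cstep_simp) auto
  have 3: "?ts ! i = tape_act (head_symbol (ts ! i), MLeft) (ts ! i)" using l bs_PUSH by simp
  have "(cstep ^^ 2) (PUSH i b # K, ts) = (K, ts[i := tape_act (sym b, MStay) (tape_act (head_symbol (ts ! i), MLeft) (ts ! i))])"
    unfolding numeral_2_eq_2 funpow.simps o_apply id_apply 1 2 3 by simp
  then show ?case using rep_push[OF bs_PUSH(2,1)] by blast
next
  case (bs_OUT b S out)
  have "cstep (OUT b # K, ts) = (K, ts[5 := tape_act (sym b, MRight) (ts ! 5)])"
    using rep_len[OF bs_OUT] by (intro cstep_simp) auto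
  then show ?case using rep_out[OF bs_OUT, of b] by auto
next
  case (bs_SEQ a s t s' b t' s'')
  have 1: "cstep (SEQ a b # K, ts) = (a # b # K, ts)"
    using rep_len[OF bs_SEQ.prems] by (subst cstep_simp[where i = 0]) (auto simp: tape_act_same)
  obtain ts1 where 2: "(cstep ^^ t) (a # b # K, ts) = (b # K, ts1)" "rep s' ts1" using bs_SEQ by blast
  obtain ts2 where 3: "(cstep ^^ t') (b # K, ts1) = (K, ts2)" "rep s'' ts2" using bs_SEQ 2 by blast
  have "(cstep ^^ (t + t' + 1)) (SEQ a b # K, ts) = (K, ts2)"
    using 1 2 3 by (simp add: funpow_add_app funpow_swap1)
  then show ?case using 3 by blast
next
  case (bs_POP_Nil i S e out t s' a b)
  have h: "head_symbol (ts ! i) = 0" using rep_head[OF bs_POP_Nil.prems] bs_POP_Nil by simp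
  have 1: "cstep (POP i e a b # K, ts) = (e # K, ts)"
    using rep_len[OF bs_POP_Nil.prems] h bs_POP_Nil(1) tape_act_same[of "ts ! i"]
    by (subst cstep_simp[where i = i and s = 0 and m = MStay]) auto
  obtain ts1 where 2: "(cstep ^^ t) (e # K, ts) = (K, ts1)" "rep s' ts1" using bs_POP_Nil by blast
  have "(cstep ^^ (t + 1)) (POP i e a b # K, ts) = (K, ts1)" using 1 2 by (simp add: funpow_swap1)
  then show ?case using 2 by blast
next
  case (bs_POP_Cons i S v vs b a out t s' e)
  have h: "head_symbol (ts ! i) = sym v" using rep_head[OF bs_POP_Cons.prems] bs_POP_Cons by simp
  have 1: "cstep (POP i e a b # K, ts) = ((if v then b else a) # K, ts[i := tape_act (0, MRight) (ts ! i)])"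
    using rep_len[OF bs_POP_Cons.prems] h bs_POP_Cons(1)
    by (subst cstep_simp[where i = i and s = 0 and m = MRight]) (auto simp: sym_def)
  obtain ts1 where 2: "(cstep ^^ t) ((if v then b else a) # K, ts[i := tape_act (0, MRight) (ts ! i)]) = (K, ts1)" "rep s' ts1"
    using bs_POP_Cons.IH[OF rep_pop[OF bs_POP_Cons.prems bs_POP_Cons(1,2)]] by blast
  have "(cstep ^^ (t + 1)) (POP i e a b # K, ts) = (K, ts1)" using 1 2 by (simp add: funpow_swap1)
  then show ?case using 2 by blast
next
  case (bs_LOOP_Nil i S a b out)
  have h: "head_symbol (ts ! i) = 0" using rep_head[OF bs_LOOP_Nil(3)] bs_LOOP_Nil by simp
  have 1: "cstep (LOOP i a b # K, ts) = (K, ts)"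
    using rep_len[OF bs_LOOP_Nil(3)] h bs_LOOP_Nil(1) tape_act_same[of "ts ! i"]
    by (subst cstep_simp[where i = i and s = 0 and m = MStay]) auto
  then show ?case using bs_LOOP_Nil by auto
next
  case (bs_LOOP_Cons i S v vs b a out t s' t' s'')
  have h: "head_symbol (ts ! i) = sym v" using rep_head[OF bs_LOOP_Cons.prems] bs_LOOP_Cons by simp
  have 1: "cstep (LOOP i a b # K, ts) = ((if v then b else a) # LOOP i a b # K, ts[i := tape_act (0, MRight) (ts ! i)])"
    using rep_len[OF bs_LOOP_Cons.prems] h bs_LOOP_Cons(1)
    by (subst cstep_simp[where i = i and s = 0 and m = MRight]) (auto simp: sym_def)
  obtain ts1 where 2: "(cstep ^^ t) ((if v then b else a) # LOOP i a b # K, ts[i := tape_act (0, MRight) (ts ! i)]) = (LOOP i a b # K, ts1)" "rep s' ts1"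
    using bs_LOOP_Cons.IH(1)[OF rep_pop[OF bs_LOOP_Cons.prems bs_LOOP_Cons(1,2)]] by blast
  obtain ts2 where 3: "(cstep ^^ t') (LOOP i a b # K, ts1) = (K, ts2)" "rep s'' ts2" using bs_LOOP_Cons.IH(2) 2 by blast
  have "(cstep ^^ (t + t' + 1)) (LOOP i a b # K, ts) = (K, ts2)"
    using 1 2 3 by (simp add: funpow_add_app funpow_swap1)
  then show ?case using 3 by blast
qed

text \<open>The continuations that can occur before control returns to \<open>K\<close>. There are
  finitely many although \<open>LOOP\<close> reinserts itself: its body ends in the continuation
  \<open>LOOP i a b # K\<close>, which is already in the set.\<close>

fun residuals :: "com => com list => com list set" where
  "residuals (PUSH i b) K = {PUSH i b # K, PUT i b # K}"
| "residuals (SEQ a b) K = {SEQ a b # K} \<union> residuals a (b # K) \<union> residuals b K"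
| "residuals (POP i e a b) K = {POP i e a b # K} \<union> residuals e K \<union> residuals a K \<union> residuals b K"
| "residuals (LOOP i a b) K = {LOOP i a b # K} \<union> residuals a (LOOP i a b # K) \<union> residuals b (LOOP i a b # K)"
| "residuals c K = {c # K}"

lemma finite_residuals: "finite (residuals c K)"
  by (induction c K rule: residuals.induct) auto

lemma residuals_self: "c # K \<in> residuals c K"
  by (cases c) auto

lemma residuals_dlt:
  "K' \<in> residuals c K ==> dlt K' rs = Some (K'', as) ==> K'' \<in> residuals c K \<or> K'' = K"
proof (induction c K rule: residuals.induct)
  case (2 a b K)
  then show ?case using residuals_self[of a "b # K"] residuals_self[of b K] by auto
next
  case (3 i e a b K)
  then show ?case using residuals_self[of a K] residuals_self[of b K] residuals_self[of e K]
    by (auto split: if_splits)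
next
  case (4 i a b K)
  then show ?case using residuals_self[of a "LOOP i a b # K"] residuals_self[of b "LOOP i a b # K"]
    by (auto split: if_splits)
qed auto

lemma dlt_actions:
  assumes "dlt K rs = Some (K', as)" "length rs = 6" "\<forall>s\<in>set rs. s < 3"
  shows "length as = 6 \<and> (\<forall>(s, m)\<in>set as. s < 3)"
proof -
  have l: "length (act i s m rs) = 6" for i s m by (simp add: act_def)
  have 1: "s' < 3" if "(s', m') \<in> set (act i s m rs)" "s < 3" for i s m s' m'
    using assms(2,3) that by (auto simp: act_def)
  have 2: "s' < 3" if "(s', m') \<in> set (act i (rs ! i) m rs)" for i m s' m'
    using assms(2,3) that by (auto simp: act_def)
  have 3: "sym b < 3" for b by (simp add: sym_def)
  show ?thesis using assms(1)
    by (cases "(K, rs)" rule: dlt.cases)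
      (auto simp: l split: if_splits dest: 2 1[of _ _ _ 0, simplified] 1[OF _ 3])
qed

text \<open>States of the machine are positions in an enumeration of the residual programs.\<close>

lemma com_tm:
  obtains M where "tm_wf M" "\<And>w F t v S. bs c (%i. if i = 0 then w else [], []) t (S, v) ==> t \<le> F ==> tm_computes M F w v"
proof -
  define R where "R = insert [] (residuals c [])"
  have fin: "finite R" and cR: "[c] \<in> R" unfolding R_def using finite_residuals residuals_self by auto
  obtain xs where xs: "set xs = R - {[c]}" "distinct xs" using finite_distinct_list fin by (metis finite_Diff)
  \<comment> \<open>State 0 is initial, so the whole program \<open>[c]\<close> must come first in
    the enumeration.\<close>
  define Q where "Q = [c] # xs"
  have Q: "set Q = R" "distinct Q" using xs cR by (auto simp: Q_def)
  define idx where "idx K = (THE q. q < length Q \<and> Q ! q = K)" for K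
  have idx: "idx (Q ! q) = q" if "q < length Q" for q
    unfolding idx_def using that Q(2) by (auto simp: nth_eq_iff_index_eq intro!: the_equality)
  have idx': "idx K < length Q \<and> Q ! idx K = K" if "K \<in> R" for K
    using that idx Q(1) by (metis in_set_conv_nth)
  define M where "M = \<lparr>num_tapes = 6, num_states = length Q, num_symbols = 3,
     delta = (%q rs. map_option (%(K, as). (idx K, as)) (dlt (Q ! q) rs))\<rparr>"
  have cl: "K' \<in> R" if "K \<in> R" "dlt K rs = Some (K', as)" for K rs K' as
    using that residuals_dlt[of K c "[]"] by (auto simp: R_def)
  have wf: "tm_wf M"
    unfolding tm_wf_def
  proof (intro conjI allI impI)
    fix q rs q' as assume a: "q < num_states M \<and> length rs = num_tapes M \<and> (\<forall>s\<in>set rs. s < num_symbols M) \<and> delta M q rs = Some (q', as)"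
    then obtain K where K: "dlt (Q ! q) rs = Some (K, as)" "q' = idx K" by (auto simp: M_def)
    have "K \<in> R" using cl[OF _ K(1)] a Q(1) by (metis M_def nth_mem select_convs(2))
    then show "q' < num_states M" using idx' K by (simp add: M_def)
    show "length as = num_tapes M" "\<forall>(s, m)\<in>set as. s < num_symbols M"
      using dlt_actions[OF K(1)] a by (simp_all add: M_def)
  qed (auto simp: M_def Q_def)
  have step: "tm_step M (idx K, ts) = (idx K', ts') \<and> K' \<in> R" if "K \<in> R" "cstep (K, ts) = (K', ts')" for K ts K' ts'
    using that cl[of K] idx'[of K] by (auto simp: tm_step_def cstep_def M_def split: option.splits)
  have steps: "\<exists>K' ts'. (cstep ^^ t) (K, ts) = (K', ts') \<and> (tm_step M ^^ t) (idx K, ts) = (idx K', ts') \<and> K' \<in> R" if "K \<in> R" for K ts t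
  proof (induction t)
    case (Suc t)
    then obtain K' ts' where "(cstep ^^ t) (K, ts) = (K', ts')" "(tm_step M ^^ t) (idx K, ts) = (idx K', ts')" "K' \<in> R" by auto
    then show ?case using step[of K' ts'] by (cases "cstep (K', ts')") auto
  qed (use that in auto)
  show ?thesis
  proof (rule that[OF wf])
    fix w F t v S assume b: "bs c (%i. if i = 0 then w else [], []) t (S, v)" and t: "t \<le> F"
    define ts0 where "ts0 = (word_cells w, 0 :: int) # replicate 5 (word_cells [], 0)"
    have "rep (%i. if i = 0 then w else [], []) ts0"
      by (auto simp: rep_def ts0_def nth_Cons' less_Suc_eq numeral_eq_Suc)
    from bs_cstep[OF b this, of "[]"] obtain ts where ts: "(cstep ^^ t) ([c], ts0) = ([], ts)" "rep (S, v) ts" by auto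
    have ini: "tm_init M w = (idx [c], ts0)"
      using idx[of 0] by (simp add: tm_init_def M_def ts0_def Q_def)
    have fin: "(tm_step M ^^ t) (tm_init M w) = (idx [], ts)"
      using steps[OF cR, of t ts0] ts(1) ini by auto
    have "[] \<in> R" by (simp add: R_def)
    then have halt: "halted M (idx [], ts)" using idx' by (simp add: halted_def M_def)
    \<comment> \<open>The empty continuation has no transition, so the remaining
      \<open>F - t\<close> steps change nothing.\<close>
    then have "tm_step M (idx [], ts) = (idx [], ts)" by (simp add: halted_def tm_step_def)
    then have fp: "(tm_step M ^^ n) (idx [], ts) = (idx [], ts)" for n by (induction n) auto
    have "(tm_step M ^^ F) (tm_init M w) = (tm_step M ^^ (F - t)) ((tm_step M ^^ t) (tm_init M w))"
      using t by (metis funpow_add_app le_add_diff_inverse)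
    then have "(tm_step M ^^ F) (tm_init M w) = (idx [], ts)" using fin fp by simp
    moreover have "has_output (idx [], ts) v"
    proof -
      have "last ts = ts ! 5" using rep_len[OF ts(2)] by (subst last_conv_nth) auto
      then show ?thesis using ts(2) by (auto simp: has_output_def rep_def)
    qed
    ultimately show "tm_computes M F w v" using halt by (simp add: tm_computes_def)
  qed
qed

subsection \<open>Polynomial-time functions on trees\<close>

datatype tree = Leaf | Node tree tree

text \<open>A self-delimiting code: a tree can be cut off the top of a stack on which arbitrary
  further data follow.\<close>

primrec bits :: "tree => bool list" where
  "bits Leaf = [False]"
| "bits (Node l r) = True # bits l @ bits r"

lemma bits_ne: "bits t \<noteq> []" by (cases t) auto

lemma prefix_code_bits: "bits s @ u = bits t @ v ==> s = t \<and> u = v"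
proof (induction s arbitrary: t u v)
  case Leaf then show ?case by (cases t) auto
next
  case s: (Node s1 s2)
  show ?case
  proof (cases t)
    case (Node t1 t2)
    then have "bits s1 @ bits s2 @ u = bits t1 @ bits t2 @ v" using s.prems by simp
    then have "s1 = t1 \<and> bits s2 @ u = bits t2 @ v" by (rule s.IH(1))
    then show ?thesis using s.IH(2)[of u t2 v] Node by simp
  qed (use s.prems in simp)
qed

section \<open>Timed stack programs on trees\<close>

definition run :: "com => (nat => bool list) => nat => (nat => bool list) => bool" where
  "run c S n S' \<longleftrightarrow> (\<exists>t\<le>n. bs c (S, []) t (S', []))"

definition main :: "bool list => nat => bool list" where
  "main m = (%_. [])(0 := m)"

lemma run_mono: "run c S n S' ==> n \<le> m ==> run c S m S'"
  unfolding run_def by (meson le_trans)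

lemma run_SKIP: "n \<ge> 1 ==> S' = S ==> run SKIP S n S'"
  unfolding run_def using bs_SKIP by blast

lemma run_PUSH: "i < 5 ==> n \<ge> 2 ==> S' = S(i := b # S i) ==> run (PUSH i b) S n S'"
  unfolding run_def using bs_PUSH by blast

lemma run_SEQ: "run a S n S' ==> run b S' m S'' ==> n + m + 1 \<le> k ==> run (SEQ a b) S k S''"
  unfolding run_def by (meson add_le_mono bs_SEQ le_trans le_refl)

lemma run_POP: "i < 5 ==> S i = v # vs ==> run (if v then b else a) (S(i := vs)) n S' ==> n + 1 \<le> m ==> run (POP i e a b) S m S'"
  unfolding run_def by (meson bs_POP_Cons add_le_mono le_refl le_trans)

lemma run_POP_Nil: "i < 5 ==> S i = [] ==> run e S n S' ==> n + 1 \<le> m ==> run (POP i e a b) S m S'"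
  unfolding run_def by (meson bs_POP_Nil add_le_mono le_refl le_trans)

lemma run_LOOP_Nil: "i < 5 ==> S i = [] ==> n \<ge> 1 ==> S' = S ==> run (LOOP i a b) S n S'"
  unfolding run_def using bs_LOOP_Nil by blast

lemma run_LOOP_Cons: "i < 5 ==> S i = v # vs ==> run (if v then b else a) (S(i := vs)) n S' ==>
   run (LOOP i a b) S' m S'' ==> n + m + 1 \<le> k ==> run (LOOP i a b) S k S''"
  unfolding run_def by (meson add_le_mono bs_LOOP_Cons le_trans le_refl)

text \<open>Moves the topmost tree from stack 0 to stack \<open>d\<close>, reversing it; stack 2 counts the subtrees still to be read.\<close>

definition scan_loop :: "nat => com" where
  "scan_loop d = LOOP 2 SKIP (POP 0 SKIP (PUSH d False) (SEQ (PUSH d True) (SEQ (PUSH 2 True) (PUSH 2 True))))"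

definition scan :: "nat => com" where "scan d = SEQ (PUSH 2 True) (scan_loop d)"

text \<open>Continuation-passing form: the run of the loop after the tree has been read is a
  hypothesis, so that the induction hypotheses for the two subtrees can be chained. A round costs at
  most 10 steps per bit: 3 for a leaf or 9 for an inner node, and 1 for the loop test.\<close>

lemma run_scan_loop:
  assumes "d = 1 \<or> d = 3"
  shows "S 0 = bits t @ rest ==> S 2 = True # ms ==>
     run (scan_loop d) (S(0 := rest, 2 := ms, d := rev (bits t) @ S d)) n S' ==>
     run (scan_loop d) S (n + 10 * length (bits t)) S'"
proof (induction t arbitrary: S rest ms n)
  case Leaf
  show ?case unfolding scan_loop_def
  proof (rule run_LOOP_Cons[where v = True and vs = ms])
    show "run (if True then POP 0 SKIP (PUSH d False) (SEQ (PUSH d True) (SEQ (PUSH 2 True) (PUSH 2 True))) else SKIP) (S(2 := ms))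
       3 (S(0 := rest, 2 := ms, d := rev (bits Leaf) @ S d))"
      unfolding if_True using Leaf assms
      by (intro run_POP[where v = False and vs = rest and n = 2]) (auto intro!: run_PUSH simp: fun_eq_iff)
    show "run (LOOP 2 SKIP (POP 0 SKIP (PUSH d False) (SEQ (PUSH d True) (SEQ (PUSH 2 True) (PUSH 2 True)))))
       (S(0 := rest, 2 := ms, d := rev (bits Leaf) @ S d)) n S'"
      using Leaf(3) unfolding scan_loop_def .
  qed (use Leaf(2) in auto)
next
  case (Node l r)
  let ?S1 = "S(0 := bits l @ bits r @ rest, 2 := True # True # ms, d := True # S d)"
  let ?S2 = "S(0 := bits r @ rest, 2 := True # ms, d := rev (bits l) @ True # S d)"
  have e2: "?S2(0 := rest, 2 := ms, d := rev (bits r) @ ?S2 d) = S(0 := rest, 2 := ms, d := rev (bits (Node l r)) @ S d)"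
    by (auto simp: fun_eq_iff)
  have "run (scan_loop d) ?S2 (n + 10 * length (bits r)) S'"
  proof (rule Node.IH(2))
    show "run (scan_loop d) (?S2(0 := rest, 2 := ms, d := rev (bits r) @ ?S2 d)) n S'" unfolding e2 by fact
  qed (use assms in auto)
  moreover have e1: "?S1(0 := bits r @ rest, 2 := True # ms, d := rev (bits l) @ ?S1 d) = ?S2"
    by (auto simp: fun_eq_iff)
  ultimately have 1: "run (scan_loop d) ?S1 (n + 10 * length (bits r) + 10 * length (bits l)) S'"
    using assms by (intro Node.IH(1)[where rest = "bits r @ rest" and ms = "True # ms"]) (simp_all only: e1, auto)
  show ?case unfolding scan_loop_def
  proof (rule run_LOOP_Cons[where v = True and vs = ms])
    show "run (if True then POP 0 SKIP (PUSH d False) (SEQ (PUSH d True) (SEQ (PUSH 2 True) (PUSH 2 True))) else SKIP) (S(2 := ms))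
       9 ?S1"
    proof -
      let ?T = "S(2 := ms, 0 := bits l @ bits r @ rest)"
      have p1: "run (PUSH d True) ?T 2 (?T(d := True # S d))" using assms by (intro run_PUSH) auto
      have p2: "run (PUSH 2 True) (?T(d := True # S d)) 2 (?T(d := True # S d, 2 := True # ms))" using assms by (intro run_PUSH) auto
      have p3: "run (PUSH 2 True) (?T(d := True # S d, 2 := True # ms)) 2 ?S1" using assms by (intro run_PUSH) (auto simp: fun_eq_iff)
      have "run (SEQ (PUSH d True) (SEQ (PUSH 2 True) (PUSH 2 True))) ?T 8 ?S1"
        by (rule run_SEQ[OF p1 run_SEQ[OF p2 p3 order_refl]]) simp
      then show ?thesis using Node.prems assms
        unfolding if_True by (intro run_POP[where v = True and vs = "bits l @ bits r @ rest" and n = 8]) auto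
    qed
    show "run (LOOP 2 SKIP (POP 0 SKIP (PUSH d False) (SEQ (PUSH d True) (SEQ (PUSH 2 True) (PUSH 2 True)))))
       ?S1 (n + 10 * length (bits r) + 10 * length (bits l)) S'"
      using 1 unfolding scan_loop_def .
  qed (use Node.prems(2) in auto)
qed

lemma run_scan:
  assumes "d = 1 \<or> d = 3" "S 0 = bits t @ rest" "S 2 = []" "S' = S(0 := rest, d := rev (bits t) @ S d)"
    "n \<ge> 15 * length (bits t)"
  shows "run (scan d) S n S'"
  unfolding scan_def
proof (rule run_SEQ)
  show "run (PUSH 2 True) S 2 (S(2 := [True]))" using assms by (intro run_PUSH) auto
  have "run (scan_loop d) (S(2 := [True], 0 := rest, 2 := [], d := rev (bits t) @ S d)) 1 S'"
    unfolding scan_loop_def using assms by (intro run_LOOP_Nil) (auto simp: fun_eq_iff)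
  then show "run (scan_loop d) (S(2 := [True])) (1 + 10 * length (bits t)) S'"
    using assms by (intro run_scan_loop[where rest = rest and ms = "[]"]) auto
  have "length (bits t) \<ge> 1" using bits_ne[of t] by (cases "bits t") auto
  then show "2 + (1 + 10 * length (bits t)) + 1 \<le> n" using assms(5) by linarith
qed

definition shift :: "nat => nat => com" where "shift i j = LOOP i (PUSH j False) (PUSH j True)"

lemma run_shift:
  "i < 5 ==> j < 5 ==> i \<noteq> j ==> S' = S(i := [], j := rev (S i) @ S j) ==> n \<ge> 3 * length (S i) + 1 ==> run (shift i j) S n S'"
proof (induction "S i" arbitrary: S n)
  case Nil
  then show ?case unfolding shift_def by (intro run_LOOP_Nil) (auto simp: fun_eq_iff)
next
  case (Cons v vs)
  have "run (shift i j) (S(i := vs, j := v # S j)) (3 * length vs + 1) S'"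
    using Cons(3-) by (intro Cons(1)) (auto simp: Cons(2)[symmetric] fun_eq_iff)
  then show ?case using Cons(3-) unfolding shift_def
    by - (rule run_LOOP_Cons[where v = v and vs = vs and n = 2 and S' = "S(i := vs, j := v # S j)"], auto intro!: run_PUSH simp: Cons(2)[symmetric])
qed

definition wipe :: "nat => com" where "wipe i = LOOP i SKIP SKIP"

lemma run_wipe:
  "i < 5 ==> S' = S(i := []) ==> n \<ge> 2 * length (S i) + 1 ==> run (wipe i) S n S'"
proof (induction "S i" arbitrary: S n)
  case Nil
  then show ?case unfolding wipe_def by (intro run_LOOP_Nil) (auto simp: fun_eq_iff)
next
  case (Cons v vs)
  have "run (wipe i) (S(i := vs)) (2 * length vs + 1) S'"
    using Cons(3-) by (intro Cons(1)) (auto simp: Cons(2)[symmetric] fun_eq_iff)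
  then show ?case using Cons(3-) unfolding wipe_def
    by - (rule run_LOOP_Cons[where v = v and vs = vs and n = 1 and S' = "S(i := vs)"], auto intro!: run_SKIP simp: Cons(2)[symmetric])
qed

text \<open>Stack 1 receives the tree reversed. Emptying it onto stacks 0 and 2 restores the order
  on both, and stack 2 goes back to stack 0 through stack 1 so that the order survives two more
  reversals.\<close>

definition dup :: com where
  "dup = SEQ (scan 1) (SEQ (LOOP 1 (SEQ (PUSH 0 False) (PUSH 2 False)) (SEQ (PUSH 0 True) (PUSH 2 True)))
     (SEQ (shift 2 1) (shift 1 0)))"

lemma run_copy:
  "S' = S(1 := [], 0 := rev (S 1) @ S 0, 2 := rev (S 1) @ S 2) ==> n \<ge> 6 * length (S 1) + 1 ==>
   run (LOOP 1 (SEQ (PUSH 0 False) (PUSH 2 False)) (SEQ (PUSH 0 True) (PUSH 2 True))) S n S'"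
proof (induction "S 1" arbitrary: S n)
  case Nil
  then show ?case by (intro run_LOOP_Nil) (auto simp: fun_eq_iff)
next
  case (Cons v vs)
  have "run (LOOP 1 (SEQ (PUSH 0 False) (PUSH 2 False)) (SEQ (PUSH 0 True) (PUSH 2 True)))
      (S(1 := vs, 0 := v # S 0, 2 := v # S 2)) (6 * length vs + 1) S'"
    using Cons(3-) by (intro Cons(1)) (auto simp: Cons(2)[symmetric] fun_eq_iff simp del: One_nat_def)
  then show ?case using Cons(3-)
    by - (rule run_LOOP_Cons[where v = v and vs = vs and n = 5 and S' = "S(1 := vs, 0 := v # S 0, 2 := v # S 2)"], cases v, auto intro!: run_SEQ[where n = 2 and m = 2, OF run_PUSH[OF _ _ refl] run_PUSH] simp: Cons(2)[symmetric] simp del: One_nat_def)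
qed

lemma run_dup: "n \<ge> 40 * length (bits t) ==> run dup (main (bits t @ rest)) n (main (bits t @ bits t @ rest))"
proof -
  assume n: "n \<ge> 40 * length (bits t)"
  have l: "length (bits t) \<ge> 1" using bits_ne[of t] by (cases "bits t") auto
  let ?S1 = "(main rest)(1 := rev (bits t))"
  let ?S2 = "(main (bits t @ rest))(2 := bits t)"
  let ?S3 = "(main (bits t @ rest))(1 := rev (bits t))"
  have "run (scan 1) (main (bits t @ rest)) (15 * length (bits t)) ?S1"
    by (rule run_scan) (auto simp: main_def fun_eq_iff)
  moreover have "run (LOOP 1 (SEQ (PUSH 0 False) (PUSH 2 False)) (SEQ (PUSH 0 True) (PUSH 2 True))) ?S1 (6 * length (bits t) + 1) ?S2"
    by (rule run_copy) (auto simp: main_def fun_eq_iff)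
  moreover have "run (shift 2 1) ?S2 (3 * length (bits t) + 1) ?S3"
    by (rule run_shift) (auto simp: main_def fun_eq_iff)
  moreover have "run (shift 1 0) ?S3 (3 * length (bits t) + 1) (main (bits t @ bits t @ rest))"
    by (rule run_shift) (auto simp: main_def fun_eq_iff)
  ultimately show ?thesis unfolding dup_def
    by (rule run_SEQ[OF _ run_SEQ[OF _ run_SEQ[OF _ _ order_refl] order_refl]]) (use n l in auto)
qed

definition swap :: com where "swap = SEQ (scan 1) (SEQ (scan 3) (SEQ (shift 1 0) (shift 3 0)))"

lemma run_swap: "n \<ge> 40 * (length (bits s) + length (bits t)) ==> run swap (main (bits s @ bits t @ rest)) n (main (bits t @ bits s @ rest))"
proof -
  assume n: "n \<ge> 40 * (length (bits s) + length (bits t))"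
  have l: "length (bits s) \<ge> 1" using bits_ne[of s] by (cases "bits s") auto
  let ?S1 = "(main (bits t @ rest))(1 := rev (bits s))"
  let ?S2 = "(main rest)(1 := rev (bits s), 3 := rev (bits t))"
  let ?S3 = "(main (bits s @ rest))(3 := rev (bits t))"
  have "run (scan 1) (main (bits s @ bits t @ rest)) (15 * length (bits s)) ?S1"
    by (rule run_scan) (auto simp: main_def fun_eq_iff)
  moreover have "run (scan 3) ?S1 (15 * length (bits t)) ?S2"
    by (rule run_scan) (auto simp: main_def fun_eq_iff)
  moreover have "run (shift 1 0) ?S2 (3 * length (bits s) + 1) ?S3"
    by (rule run_shift) (auto simp: main_def fun_eq_iff)
  moreover have "run (shift 3 0) ?S3 (3 * length (bits t) + 1) (main (bits t @ bits s @ rest))"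
    by (rule run_shift) (auto simp: main_def fun_eq_iff)
  ultimately show ?thesis unfolding swap_def
    by (rule run_SEQ[OF _ run_SEQ[OF _ run_SEQ[OF _ _ order_refl] order_refl]]) (use n l in auto)
qed

definition drop_tree :: com where "drop_tree = SEQ (scan 1) (wipe 1)"

lemma run_drop: "n \<ge> 40 * length (bits t) ==> run drop_tree (main (bits t @ rest)) n (main rest)"
proof -
  assume n: "n \<ge> 40 * length (bits t)"
  have l: "length (bits t) \<ge> 1" using bits_ne[of t] by (cases "bits t") auto
  let ?S1 = "(main rest)(1 := rev (bits t))"
  have "run (scan 1) (main (bits t @ rest)) (15 * length (bits t)) ?S1"
    by (rule run_scan) (auto simp: main_def fun_eq_iff)
  moreover have "run (wipe 1) ?S1 (2 * length (bits t) + 1) (main rest)"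
    by (rule run_wipe) (auto simp: main_def fun_eq_iff)
  ultimately show ?thesis unfolding drop_tree_def by (rule run_SEQ) (use n l in auto)
qed

definition first :: com where "first = SEQ (POP 0 SKIP SKIP SKIP) (SEQ (scan 1) (SEQ (scan 3) (SEQ (wipe 3) (shift 1 0))))"

lemma run_first: "n \<ge> 40 * length (bits (Node s t)) ==> run first (main (bits (Node s t) @ rest)) n (main (bits s @ rest))"
proof -
  assume n: "n \<ge> 40 * length (bits (Node s t))"
  let ?S0 = "main (bits s @ bits t @ rest)"
  let ?S1 = "(main (bits t @ rest))(1 := rev (bits s))"
  let ?S2 = "(main rest)(1 := rev (bits s), 3 := rev (bits t))"
  let ?S3 = "(main rest)(1 := rev (bits s))"
  have "run (POP 0 SKIP SKIP SKIP) (main (bits (Node s t) @ rest)) 2 ?S0"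
    by (rule run_POP[where v = True and vs = "bits s @ bits t @ rest" and n = 1]) (auto intro!: run_SKIP simp: main_def)
  moreover have "run (scan 1) ?S0 (15 * length (bits s)) ?S1"
    by (rule run_scan) (auto simp: main_def fun_eq_iff)
  moreover have "run (scan 3) ?S1 (15 * length (bits t)) ?S2"
    by (rule run_scan) (auto simp: main_def fun_eq_iff)
  moreover have "run (wipe 3) ?S2 (2 * length (bits t) + 1) ?S3"
    by (rule run_wipe) (auto simp: main_def fun_eq_iff)
  moreover have "run (shift 1 0) ?S3 (3 * length (bits s) + 1) (main (bits s @ rest))"
    by (rule run_shift) (auto simp: main_def fun_eq_iff)
  ultimately show ?thesis unfolding first_def
    by (rule run_SEQ[OF _ run_SEQ[OF _ run_SEQ[OF _ run_SEQ[OF _ _ order_refl] order_refl] order_refl]]) (use n in auto)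
qed

definition second :: com where "second = SEQ (POP 0 SKIP SKIP SKIP) drop_tree"

lemma run_second: "n \<ge> 50 * length (bits (Node s t)) ==> run second (main (bits (Node s t) @ rest)) n (main (bits t @ rest))"
proof -
  assume n: "n \<ge> 50 * length (bits (Node s t))"
  let ?S0 = "main (bits s @ bits t @ rest)"
  have "run (POP 0 SKIP SKIP SKIP) (main (bits (Node s t) @ rest)) 2 ?S0"
    by (rule run_POP[where v = True and vs = "bits s @ bits t @ rest" and n = 1]) (auto intro!: run_SKIP simp: main_def)
  moreover have "run drop_tree ?S0 (40 * length (bits s)) (main (bits t @ rest))" by (rule run_drop) auto
  ultimately show ?thesis unfolding second_def by (rule run_SEQ) (use n in auto)
qed

primrec pushes :: "bool list => com" where
  "pushes [] = SKIP"
| "pushes (x # xs) = SEQ (pushes xs) (PUSH 0 x)"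

lemma run_pushes: "n \<ge> 3 * length xs + 1 ==> run (pushes xs) (main m) n (main (xs @ m))"
proof (induction xs arbitrary: n)
  case (Cons x xs)
  have "run (pushes xs) (main m) (3 * length xs + 1) (main (xs @ m))" using Cons by simp
  moreover have "run (PUSH 0 x) (main (xs @ m)) 2 (main ((x # xs) @ m))" by (rule run_PUSH) (auto simp: main_def)
  ultimately show ?case unfolding pushes.simps by (rule run_SEQ) (use Cons in auto)
qed (auto intro: run_SKIP)

text \<open>Tree encodings of booleans are recognised by their first bit.\<close>

definition branch :: "com => com => com" where
  "branch a b = POP 0 SKIP b (SEQ (POP 0 SKIP SKIP SKIP) (SEQ (POP 0 SKIP SKIP SKIP) a))"

abbreviation "bit_tree b \<equiv> (if b then Node Leaf Leaf else Leaf)"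

lemma run_branch: "run (if v then a else b) (main m) n S' ==> k \<ge> n + 7 ==> run (branch a b) (main (bits (bit_tree v) @ m)) k S'"
proof (cases v)
  case True
  assume a: "run (if v then a else b) (main m) n S'" "k \<ge> n + 7"
  have p: "run (POP 0 SKIP SKIP SKIP) (main (x # l)) 2 (main l)" for x l
    by (rule run_POP[where v = x and vs = l and n = 1]) (auto intro!: run_SKIP simp: main_def)
  show ?thesis unfolding branch_def
  proof (rule run_POP)
    show "run (if True then SEQ (POP 0 SKIP SKIP SKIP) (SEQ (POP 0 SKIP SKIP SKIP) a) else b) ((main (bits (bit_tree v) @ m))(0 := False # False # m)) (n + 6) S'"
      using run_SEQ[OF p[of False "False # m"] run_SEQ[OF p[of False m] _ order_refl], of a n S' "n + 6"] a True by (simp add: main_def)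
  qed (use a True in \<open>auto simp: main_def\<close>)
next
  case False
  assume a: "run (if v then a else b) (main m) n S'" "k \<ge> n + 7"
  then show ?thesis unfolding branch_def using False
    by (intro run_POP[where v = False and vs = m and n = n]) (auto simp: main_def)
qed

text \<open>Trees are compared via their reversed codes on stacks 1 and 3; stack 2 collects the mismatches.\<close>

definition cmp_loop :: com where
  "cmp_loop = LOOP 1 (POP 3 (PUSH 2 True) SKIP (PUSH 2 True)) (POP 3 (PUSH 2 True) (PUSH 2 True) SKIP)"

text \<open>Marks on stack 2 show a difference or that stack 3 was shorter; a rest on stack 3 shows
  that it was longer. The exact contents do not matter, only their emptiness and, for the time of
  the clean-up, their length.\<close>

lemma run_cmp_loop:
  "\<exists>ms zs. run cmp_loop S (6 * length (S 1) + 1) (S(1 := [], 3 := zs, 2 := ms)) \<and> length ms \<le> length (S 2) + length (S 1) \<and>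
     (ms = [] \<and> zs = [] \<longleftrightarrow> S 2 = [] \<and> S 1 = S 3) \<and> length zs \<le> length (S 3)"
proof (induction "S 1" arbitrary: S)
  case Nil
  then have "run cmp_loop S (6 * length (S 1) + 1) (S(1 := [], 3 := S 3, 2 := S 2))"
    unfolding cmp_loop_def by (intro run_LOOP_Nil) (auto simp: fun_eq_iff)
  then show ?case using Nil by - (rule exI[of _ "S 2"], rule exI[of _ "S 3"], auto simp del: One_nat_def fun_upd_apply)
next
  case (Cons v vs)
  define ms0 where "ms0 = (case S 3 of [] => True # S 2 | u # us => if u = v then S 2 else True # S 2)"
  define zs0 where "zs0 = tl (S 3)"
  let ?S = "S(1 := vs, 3 := zs0, 2 := ms0)"
  have b: "run (if v then POP 3 (PUSH 2 True) (PUSH 2 True) SKIP else POP 3 (PUSH 2 True) SKIP (PUSH 2 True)) (S(1 := vs)) 3 ?S"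
  proof (cases "S 3")
    case Nil
    have "run (PUSH 2 True) (S(1 := vs)) 2 ?S" using Nil by (intro run_PUSH) (auto simp: ms0_def zs0_def fun_eq_iff)
    then show ?thesis using Nil by (auto intro!: run_POP_Nil)
  next
    case (Cons u us)
    have 1: "run (PUSH 2 True) (S(1 := vs, 3 := us)) 2 ?S" if "u \<noteq> v" using Cons that by (intro run_PUSH) (auto simp: ms0_def zs0_def fun_eq_iff)
    have 2: "run SKIP (S(1 := vs, 3 := us)) 2 ?S" if "u = v" using Cons that by (intro run_SKIP) (auto simp: ms0_def zs0_def fun_eq_iff)
    show ?thesis using Cons 1 2 by (cases u; cases v) (auto intro!: run_POP[where v = u and vs = us and n = 2])
  qed
  obtain ms zs where ih: "run cmp_loop ?S (6 * length (?S 1) + 1) (?S(1 := [], 3 := zs, 2 := ms))" "length ms \<le> length (?S 2) + length (?S 1)"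
     "ms = [] \<and> zs = [] \<longleftrightarrow> ?S 2 = [] \<and> ?S 1 = ?S 3" "length zs \<le> length (?S 3)"
    using Cons(1)[of ?S] by auto
  have "run cmp_loop S (6 * length (S 1) + 1) (?S(1 := [], 3 := zs, 2 := ms))"
    using b ih(1) unfolding cmp_loop_def by - (rule run_LOOP_Cons[where v = v and vs = vs and n = 3], simp, simp only: Cons(2), assumption, assumption, simp add: Cons(2)[symmetric] del: One_nat_def)
  moreover have "?S(1 := [], 3 := zs, 2 := ms) = S(1 := [], 3 := zs, 2 := ms)" by (auto simp: fun_eq_iff)
  ultimately have "run cmp_loop S (6 * length (S 1) + 1) (S(1 := [], 3 := zs, 2 := ms))" by simp
  moreover have "ms = [] \<and> zs = [] \<longleftrightarrow> S 2 = [] \<and> S 1 = S 3"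
    using ih(3) Cons(2) by (auto simp: ms0_def zs0_def split: list.splits if_splits)
  moreover have "length ms \<le> length (S 2) + length (S 1)" "length zs \<le> length (S 3)"
    using ih(2,4) by (auto simp del: One_nat_def simp: ms0_def zs0_def Cons(2)[symmetric] split: list.splits if_splits)
  ultimately show ?case by blast
qed

definition equal_trees :: com where
  "equal_trees = SEQ (scan 1) (SEQ (scan 3) (SEQ cmp_loop (SEQ (shift 3 2)
     (POP 2 (pushes [True, False, False]) (SEQ (wipe 2) (pushes [False])) (SEQ (wipe 2) (pushes [False]))))))"

lemma run_equal_trees:
  assumes n: "n \<ge> 100 * (length (bits s) + length (bits t))"
  shows "run equal_trees (main (bits s @ bits t @ rest)) n (main (bits (bit_tree (s = t)) @ rest))"
proof -
  have l: "length (bits s) \<ge> 1" using bits_ne[of s] by (cases "bits s") auto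
  let ?l = "length (bits s) + length (bits t)"
  let ?S1 = "(main (bits t @ rest))(1 := rev (bits s))"
  let ?S2 = "(main rest)(1 := rev (bits s), 3 := rev (bits t))"
  obtain ms zs where m: "run cmp_loop ?S2 (6 * length (?S2 1) + 1) (?S2(1 := [], 3 := zs, 2 := ms))" "length ms \<le> length (?S2 2) + length (?S2 1)"
     "ms = [] \<and> zs = [] \<longleftrightarrow> ?S2 2 = [] \<and> ?S2 1 = ?S2 3" "length zs \<le> length (?S2 3)"
    using run_cmp_loop[of ?S2] by auto
  let ?S3 = "?S2(1 := [], 3 := zs, 2 := ms)"
  let ?S4 = "(main rest)(2 := rev zs @ ms)"
  have eq: "rev zs @ ms = [] \<longleftrightarrow> s = t"
    using m(3) prefix_code_bits[of s "[]" t "[]"] by (auto simp: main_def)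
  have ll: "length (rev zs @ ms) \<le> ?l" using m(2,4) by (simp add: main_def)
  have fin: "run (POP 2 (pushes [True, False, False]) (SEQ (wipe 2) (pushes [False])) (SEQ (wipe 2) (pushes [False]))) ?S4 (2 * ?l + 20)
      (main (bits (bit_tree (s = t)) @ rest))"
  proof (cases "rev zs @ ms")
    case Nil
    have "run (pushes [True, False, False]) (main rest) 10 (main ([True, False, False] @ rest))" by (rule run_pushes) simp
    moreover have "?S4 = main rest" using Nil by (auto simp: main_def fun_eq_iff)
    moreover have "bits (bit_tree (s = t)) = [True, False, False]" using Nil eq by simp
    ultimately show ?thesis by (simp only:) (rule run_POP_Nil[where n = 10], simp_all add: main_def)
  next
    case (Cons v vs)
    have "run (wipe 2) (?S4(2 := vs)) (2 * length vs + 1) (main rest)" by (intro run_wipe) (auto simp: main_def fun_eq_iff)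
    moreover have "run (pushes [False]) (main rest) 4 (main ([False] @ rest))" by (rule run_pushes) simp
    ultimately have "run (SEQ (wipe 2) (pushes [False])) (?S4(2 := vs)) (2 * length vs + 6) (main ([False] @ rest))" by (rule run_SEQ) simp
    moreover have "bits (bit_tree (s = t)) = [False]" using Cons eq by auto
    moreover have "?S4 2 = v # vs" "length vs < ?l" using Cons ll by simp_all
    ultimately show ?thesis
      by (simp only:) (rule run_POP[where v = v and vs = vs and n = "2 * length vs + 6"], simp_all)
  qed
  have "run (scan 1) (main (bits s @ bits t @ rest)) (15 * length (bits s)) ?S1"
    by (rule run_scan) (auto simp: main_def fun_eq_iff)
  moreover have "run (scan 3) ?S1 (15 * length (bits t)) ?S2"
    by (rule run_scan) (auto simp: main_def fun_eq_iff)
  moreover have "run (shift 3 2) ?S3 (3 * ?l + 1) ?S4"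
    using m(4) by (intro run_shift) (auto simp: main_def fun_eq_iff)
  ultimately show ?thesis unfolding equal_trees_def
    by (rule run_SEQ[OF _ run_SEQ[OF _ run_SEQ[OF m(1) run_SEQ[OF _ fin order_refl] order_refl] order_refl]], use n l in \<open>simp add: main_def\<close>)
qed

section \<open>Data types coded as trees\<close>

class data =
  fixes tr :: "'a => tree"
  assumes tr_inj: "tr x = tr y ==> x = y"

instantiation bool :: data begin
definition "tr b = bit_tree b"
instance by standard (auto simp: tr_bool_def split: if_splits)
end

text \<open>Unary coding: the size of a number is linear in its value, so bounds and counters enter
  running times by value. The codes of \<open>Suc n\<close>, of the pair \<open>(0, n)\<close> and
  of a list of \<open>Suc n\<close> zeros coincide on purpose, which makes conversions between them
  free.\<close>

instantiation nat :: data begin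
primrec tr_nat where "tr_nat 0 = Leaf" | "tr_nat (Suc n) = Node Leaf (tr_nat n)"
instance proof
  fix x y :: nat show "tr x = tr y ==> x = y"
    by (induction x arbitrary: y; case_tac y; auto)
qed
end

instantiation prod :: (data, data) data begin
definition "tr p = Node (tr (fst p)) (tr (snd p))"
instance by standard (auto simp: tr_prod_def prod_eq_iff dest: tr_inj)
end

instantiation list :: (data) data begin
primrec tr_list where "tr_list [] = Leaf" | "tr_list (x # xs) = Node (tr x) (tr_list xs)"
instance proof
  fix x y :: "'a list" show "tr x = tr y ==> x = y"
    by (induction x arbitrary: y; case_tac y; auto dest: tr_inj)
qed
end

lemma tr_eq_iff: "tr x = tr y \<longleftrightarrow> x = y" using tr_inj by blast

definition sz :: "'a::data => nat" where "sz x = length (bits (tr x))"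

lemma sz_simps [simp]: "sz (x, y) = Suc (sz x + sz y)" "sz ([] :: 'a::data list) = 1" "sz (x # xs) = Suc (sz x + sz xs)"
  "sz (0::nat) = 1" "sz (Suc n) = sz n + 2" "sz True = 3" "sz False = 1"
  by (simp_all add: sz_def tr_prod_def tr_bool_def)

lemma sz_nat [simp]: "sz (n :: nat) = 2 * n + 1" by (induction n) auto

lemma sz_pos: "sz x > 0" using bits_ne[of "tr x"] by (simp add: sz_def)

lemma sz_bool: "sz (b::bool) \<le> 3" by (cases b) auto

lemma sz_list_sum: "sz xs = (\<Sum>x\<leftarrow>xs. sz x + 1) + 1" by (induction xs) auto

lemma sz_append: "sz (xs @ ys) + 1 = sz xs + sz ys" by (simp add: sz_list_sum)

text \<open>The base \<open>r x + 2\<close> is at least 2, so its powers absorb constants, sums and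
  products.\<close>

definition pbd :: "'a set => ('a => nat) => ('a => nat) => bool" where
  "pbd D r g \<longleftrightarrow> (\<exists>k. \<forall>x\<in>D. g x \<le> (r x + 2) ^ k)"

lemma pbd_mono: "pbd D r g ==> (\<And>x. x \<in> D ==> h x \<le> g x) ==> pbd D r h"
  unfolding pbd_def by (meson le_trans)

lemma power_mono2: "k \<le> l ==> (n + 2 :: nat) ^ k \<le> (n + 2) ^ l"
  by (intro power_increasing) auto

lemma pbd_const: "pbd D r (%_. c)"
proof -
  have "c \<le> (r x + 2) ^ c" for x
  proof -
    have "c \<le> 2 ^ c" using less_exp[of c] by simp
    also have "\<dots> \<le> (r x + 2) ^ c" by (intro power_mono) auto
    finally show ?thesis .
  qed
  then show ?thesis unfolding pbd_def by blast
qed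

lemma pbd_self: "pbd D r r" unfolding pbd_def by (rule exI[of _ 1]) auto

lemma pbd_add: assumes "pbd D r f" "pbd D r g" shows "pbd D r (%x. f x + g x)"
proof -
  obtain k l where kl: "\<forall>x\<in>D. f x \<le> (r x + 2) ^ k" "\<forall>x\<in>D. g x \<le> (r x + 2) ^ l"
    using assms unfolding pbd_def by blast
  have "f x + g x \<le> (r x + 2) ^ Suc (k + l)" if "x \<in> D" for x
  proof -
    have "f x \<le> (r x + 2) ^ (k + l)" "g x \<le> (r x + 2) ^ (k + l)"
      using kl that power_mono2[of k "k + l" "r x"] power_mono2[of l "k + l" "r x"] by (meson le_trans le_add1 le_add2)+
    then have "f x + g x \<le> 2 * (r x + 2) ^ (k + l)" by simp
    also have "\<dots> \<le> (r x + 2) * (r x + 2) ^ (k + l)" by (intro mult_right_mono) auto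
    finally show ?thesis by simp
  qed
  then show ?thesis unfolding pbd_def by blast
qed

lemma pbd_mult: assumes "pbd D r f" "pbd D r g" shows "pbd D r (%x. f x * g x)"
proof -
  obtain k l where kl: "\<forall>x\<in>D. f x \<le> (r x + 2) ^ k" "\<forall>x\<in>D. g x \<le> (r x + 2) ^ l"
    using assms unfolding pbd_def by blast
  have "f x * g x \<le> (r x + 2) ^ (k + l)" if "x \<in> D" for x
    unfolding power_add using kl that by (intro mult_mono) auto
  then show ?thesis unfolding pbd_def by blast
qed

lemma pbd_power: "pbd D r f ==> pbd D r (%x. f x ^ k)"
  by (induction k) (auto intro: pbd_const pbd_mult simp: pbd_const)

lemma pbd_Suc: "pbd D r f ==> pbd D r (%x. Suc (f x))"
  using pbd_add[of D r f "%_. 1"] pbd_const[of D r 1] by simp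

lemma pbd_trans:
  assumes "pbd E r' T" "f ` D \<subseteq> E" "pbd D r (%x. r' (f x))"
  shows "pbd D r (%x. T (f x))"
proof -
  obtain k where k: "\<forall>y\<in>E. T y \<le> (r' y + 2) ^ k" using assms(1) unfolding pbd_def by blast
  have "pbd D r (%x. (r' (f x) + 2) ^ k)" using assms(3) by (intro pbd_power pbd_add pbd_const)
  then show ?thesis by (rule pbd_mono) (use k assms(2) in auto)
qed

text \<open>The program must work on top of arbitrary data \<open>rest\<close>; this is what allows
  intermediate results to be parked on the stack. The measure \<open>r\<close> may be much larger
  than the size of the argument.\<close>

definition fpon :: "'a::data set => ('a => nat) => ('a => 'b::data) => bool" where
  "fpon D r f \<longleftrightarrow> (\<exists>c T. pbd D r T \<and> pbd D r (%x. sz (f x)) \<and>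
     (\<forall>x\<in>D. \<forall>rest. run c (main (bits (tr x) @ rest)) (T x) (main (bits (tr (f x)) @ rest))))"

lemma fponI: "pbd D r T ==> pbd D r (%x. sz (f x)) ==>
   (\<And>x rest. x \<in> D ==> run c (main (bits (tr x) @ rest)) (T x) (main (bits (tr (f x)) @ rest))) ==> fpon D r f"
  unfolding fpon_def by blast

lemma fponE:
  assumes "fpon D r f"
  obtains c T where "pbd D r T" "pbd D r (%x. sz (f x))"
    "\<And>x rest. x \<in> D ==> run c (main (bits (tr x) @ rest)) (T x) (main (bits (tr (f x)) @ rest))"
  using assms unfolding fpon_def by blast

lemma fpon_size: "fpon D r f ==> pbd D r (%x. sz (f x))" by (auto elim: fponE)

lemma fpon_subset: "fpon D r f ==> E \<subseteq> D ==> fpon E r f"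
  unfolding fpon_def pbd_def by (meson subsetD)

lemma fpon_cong: "fpon D r f ==> (\<And>x. x \<in> D ==> f x = g x) ==> fpon D r g"
  unfolding fpon_def pbd_def by fastforce

text \<open>A function whose result has the same tree needs no program of its own. In this way
  \<open>Cons\<close>, \<open>Suc\<close>, the decomposition of lists and numbers, and lists of
  zeros are obtained from pairs and the identity.\<close>

lemma fpon_tr: "fpon D r f ==> (\<And>x. x \<in> D ==> tr (g x) = tr (f x)) ==> fpon D r g"
  unfolding fpon_def pbd_def sz_def by (elim exE conjE, intro exI conjI) auto

lemma fpon_id: "pbd D r sz ==> fpon D r (%x. x)"
  by (rule fponI[where c = SKIP and T = "%_. 1"]) (auto intro: pbd_const run_SKIP)

lemma fpon_comp:
  assumes f: "fpon D r f" and g: "fpon E r' g" and E: "f ` D \<subseteq> E" and r': "pbd D r (%x. r' (f x))"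
  shows "fpon D r (%x. g (f x))"
proof -
  from f obtain c T where 1: "pbd D r T" "\<And>x rest. x \<in> D ==> run c (main (bits (tr x) @ rest)) (T x) (main (bits (tr (f x)) @ rest))" unfolding fpon_def by blast
  from g obtain d U where 2: "pbd E r' U" "pbd E r' (%x. sz (g x))" "\<And>x rest. x \<in> E ==> run d (main (bits (tr x) @ rest)) (U x) (main (bits (tr (g x)) @ rest))" unfolding fpon_def by blast
  show ?thesis
  proof (rule fponI[where c = "SEQ c d" and T = "%x. T x + U (f x) + 1"])
    show "pbd D r (%x. T x + U (f x) + 1)"
      by (intro pbd_add 1 pbd_trans[OF 2(1) E r'] pbd_const)
    show "pbd D r (%x. sz (g (f x)))" by (rule pbd_trans[OF 2(2) E r'])
  qed (use 1(2) 2(3) E in \<open>blast intro: run_SEQ\<close>)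
qed

lemma fpon_pair:
  assumes f: "fpon D r f" and g: "fpon D r g" and s: "pbd D r sz"
  shows "fpon D r (%x. (f x, g x))"
proof -
  from f obtain c T where 1: "pbd D r T" "pbd D r (%x. sz (f x))" "\<And>x rest. x \<in> D ==> run c (main (bits (tr x) @ rest)) (T x) (main (bits (tr (f x)) @ rest))" unfolding fpon_def by blast
  from g obtain d U where 2: "pbd D r U" "pbd D r (%x. sz (g x))" "\<And>x rest. x \<in> D ==> run d (main (bits (tr x) @ rest)) (U x) (main (bits (tr (g x)) @ rest))" unfolding fpon_def by blast
  let ?c = "SEQ dup (SEQ c (SEQ swap (SEQ d (SEQ swap (PUSH 0 True)))))"
  show ?thesis
  proof (rule fponI[where c = ?c and T = "%x. 40 * sz x + T x + 40 * (sz (f x) + sz x) + U x + 40 * (sz (g x) + sz (f x)) + 7"])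
    fix x rest assume x: "x \<in> D"
    let ?x = "bits (tr x)" and ?f = "bits (tr (f x))" and ?g = "bits (tr (g x))"
    have a: "run dup (main (?x @ rest)) (40 * sz x) (main (?x @ ?x @ rest))" by (rule run_dup) (simp add: sz_def)
    have b: "run c (main (?x @ ?x @ rest)) (T x) (main (?f @ ?x @ rest))" by (rule 1) fact
    have c: "run swap (main (?f @ ?x @ rest)) (40 * (sz (f x) + sz x)) (main (?x @ ?f @ rest))" by (rule run_swap) (simp add: sz_def)
    have d: "run d (main (?x @ ?f @ rest)) (U x) (main (?g @ ?f @ rest))" by (rule 2) fact
    have e: "run swap (main (?g @ ?f @ rest)) (40 * (sz (g x) + sz (f x))) (main (?f @ ?g @ rest))" by (rule run_swap) (simp add: sz_def)
    have f: "run (PUSH 0 True) (main (?f @ ?g @ rest)) 2 (main (bits (tr (f x, g x)) @ rest))"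
      by (rule run_PUSH) (auto simp: main_def tr_prod_def)
    show "run ?c (main (?x @ rest)) (40 * sz x + T x + 40 * (sz (f x) + sz x) + U x + 40 * (sz (g x) + sz (f x)) + 7) (main (bits (tr (f x, g x)) @ rest))"
      by (rule run_SEQ[OF a run_SEQ[OF b run_SEQ[OF c run_SEQ[OF d run_SEQ[OF e f order_refl] order_refl] order_refl] order_refl]]) simp
  qed (auto intro!: pbd_add pbd_mult pbd_const 1 2 s pbd_Suc)
qed

lemma fpon_if:
  assumes p: "fpon D r p" and f: "fpon {x\<in>D. p x} r f" and g: "fpon {x\<in>D. \<not> p x} r g" and s: "pbd D r sz"
  shows "fpon D r (%x. if p x then f x else g x)"
proof -
  from p obtain e V where 0: "pbd D r V" "\<And>x rest. x \<in> D ==> run e (main (bits (tr x) @ rest)) (V x) (main (bits (tr (p x)) @ rest))" unfolding fpon_def by blast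
  from f obtain c T where 1: "pbd {x\<in>D. p x} r T" "pbd {x\<in>D. p x} r (%x. sz (f x))" "\<And>x rest. x \<in> {x\<in>D. p x} ==> run c (main (bits (tr x) @ rest)) (T x) (main (bits (tr (f x)) @ rest))" unfolding fpon_def by blast
  from g obtain d U where 2: "pbd {x\<in>D. \<not> p x} r U" "pbd {x\<in>D. \<not> p x} r (%x. sz (g x))" "\<And>x rest. x \<in> {x\<in>D. \<not> p x} ==> run d (main (bits (tr x) @ rest)) (U x) (main (bits (tr (g x)) @ rest))" unfolding fpon_def by blast
  let ?c = "SEQ dup (SEQ e (branch c d))"
  have pi: "pbd D r (%x. if p x then F x else G x)" if FG: "pbd {x\<in>D. p x} r F" "pbd {x\<in>D. \<not> p x} r G" for F G
  proof -
    obtain k l where kl: "\<forall>x\<in>{x\<in>D. p x}. F x \<le> (r x + 2) ^ k" "\<forall>x\<in>{x\<in>D. \<not> p x}. G x \<le> (r x + 2) ^ l"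
      using FG unfolding pbd_def by blast
    have "(if p x then F x else G x) \<le> (r x + 2) ^ (k + l)" if "x \<in> D" for x
      using kl that power_mono2[of k "k + l" "r x"] power_mono2[of l "k + l" "r x"] by (auto intro: le_trans)
    then show ?thesis unfolding pbd_def by blast
  qed
  have pi': "pbd D r (%x. sz (if p x then f x else g x))"
    using pi[OF 1(2) 2(2)] by (rule pbd_mono) auto
  show ?thesis
  proof (rule fponI[where c = ?c and T = "%x. 40 * sz x + V x + (if p x then T x else U x) + 9"])
    fix x rest assume x: "x \<in> D"
    let ?x = "bits (tr x)" and ?r = "if p x then f x else g x"
    have a: "run dup (main (?x @ rest)) (40 * sz x) (main (?x @ ?x @ rest))" by (rule run_dup) (simp add: sz_def)
    have b: "run e (main (?x @ ?x @ rest)) (V x) (main (bits (bit_tree (p x)) @ ?x @ rest))" using 0(2)[OF x] by (simp add: tr_bool_def)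
    have "run (if p x then c else d) (main (?x @ rest)) (if p x then T x else U x) (main (bits (tr ?r) @ rest))"
      using 1 2 x by auto
    then have c: "run (branch c d) (main (bits (bit_tree (p x)) @ ?x @ rest)) ((if p x then T x else U x) + 7) (main (bits (tr ?r) @ rest))"
      by (rule run_branch) simp
    show "run ?c (main (?x @ rest)) (40 * sz x + V x + (if p x then T x else U x) + 9) (main (bits (tr ?r) @ rest))"
      by (rule run_SEQ[OF a run_SEQ[OF b c order_refl]]) simp
  qed (auto intro!: pbd_add pbd_mult pbd_const 0 s pi 1 2 pbd_Suc pi')
qed

text \<open>The number of rounds and the size of all iterates are bounded in terms of the initial
  argument, for otherwise polynomial bodies could compose to exponential growth. Stack 4 holds the
  flag that keeps the loop going. The flag is popped before the body runs, so loops can be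
  nested.\<close>

lemma fpon_while:
  assumes p: "fpon E sz p" and f: "fpon {x\<in>E. p x} sz f" and G: "pbd D r G" and N: "pbd D r N"
    and it: "\<And>x i. x \<in> D ==> i \<le> N x ==> (f ^^ i) x \<in> E \<and> sz ((f ^^ i) x) \<le> G x \<and> (p ((f ^^ i) x) \<longleftrightarrow> i < N x)"
  shows "fpon D r (%x. (f ^^ N x) x)"
proof -
  from p obtain d V where 0: "pbd E sz V" "\<And>x rest. x \<in> E ==> run d (main (bits (tr x) @ rest)) (V x) (main (bits (tr (p x)) @ rest))" unfolding fpon_def by blast
  from f obtain c T where 1: "pbd {x\<in>E. p x} sz T" "\<And>x rest. x \<in> {x\<in>E. p x} ==> run c (main (bits (tr x) @ rest)) (T x) (main (bits (tr (f x)) @ rest))" unfolding fpon_def by blast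
  obtain k l where kl: "\<forall>x\<in>E. V x \<le> (sz x + 2) ^ k" "\<forall>x\<in>{x\<in>E. p x}. T x \<le> (sz x + 2) ^ l" using 0(1) 1(1) unfolding pbd_def by blast
  let ?b = "SEQ dup (SEQ d (branch (SEQ c (PUSH 4 True)) SKIP))"
  let ?L = "LOOP 4 SKIP ?b"
  \<comment> \<open>Cost of one round: copying the state, testing it and applying \<open>f\<close>,
    where all iterates have size at most \<open>G x\<close>.\<close>
  let ?H = "%x. 40 * G x + (G x + 2) ^ k + (G x + 2) ^ l + 20"
  show ?thesis
  proof (rule fponI[where c = "SEQ (PUSH 4 True) ?L" and T = "%x. (N x + 1) * ?H x + 10"])
    show "pbd D r (%x. (N x + 1) * ?H x + 10)"
      by (intro pbd_add pbd_mult pbd_const pbd_power G N)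
    have "sz ((f ^^ N x) x) \<le> G x" if "x \<in> D" for x using it[OF that] by blast
    then show "pbd D r (%x. sz ((f ^^ N x) x))" using G by (blast intro: pbd_mono)
    fix x rest assume x: "x \<in> D"
    let ?m = "%i. main (bits (tr ((f ^^ i) x)) @ rest)"
    have body: "run ?b (?m i) (?H x - 1) (if i < N x then (?m (Suc i))(4 := [True]) else ?m i)" if i: "i \<le> N x" for i
    proof -
      let ?x = "(f ^^ i) x"
      note j = it[OF x i]
      have a: "run dup (?m i) (40 * G x) (main (bits (tr ?x) @ bits (tr ?x) @ rest))" by (rule run_dup) (use j in \<open>simp add: sz_def\<close>)
      have "V ?x \<le> (G x + 2) ^ k" using kl(1) j by (meson add_le_mono1 le_trans power_mono zero_le)
      then have b: "run d (main (bits (tr ?x) @ bits (tr ?x) @ rest)) ((G x + 2) ^ k) (main (bits (bit_tree (p ?x)) @ bits (tr ?x) @ rest))"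
        using 0(2)[of ?x "bits (tr ?x) @ rest"] j by (auto simp: tr_bool_def elim: run_mono)
      have "run (if p ?x then SEQ c (PUSH 4 True) else SKIP) (?m i) ((G x + 2) ^ l + 5) (if i < N x then (?m (Suc i))(4 := [True]) else ?m i)"
      proof (cases "i < N x")
        case True
        then have px: "?x \<in> {x\<in>E. p x}" using j by simp
        have "T ?x \<le> (G x + 2) ^ l" using kl(2) px j by (meson add_le_mono1 le_trans power_mono zero_le)
        then have "run c (?m i) ((G x + 2) ^ l) (?m (Suc i))" using run_mono[OF 1(2)[OF px, of rest]] by simp
        moreover have "run (PUSH 4 True) (?m (Suc i)) 2 ((?m (Suc i))(4 := [True]))" by (rule run_PUSH) (auto simp: main_def)
        ultimately have "run (SEQ c (PUSH 4 True)) (?m i) ((G x + 2) ^ l + 5) ((?m (Suc i))(4 := [True]))" by (rule run_SEQ) simp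
        then show ?thesis using px True by simp
      qed (use j in \<open>auto intro: run_SKIP\<close>)
      then have c: "run (branch (SEQ c (PUSH 4 True)) SKIP) (main (bits (bit_tree (p ?x)) @ bits (tr ?x) @ rest)) ((G x + 2) ^ l + 12)
         (if i < N x then (?m (Suc i))(4 := [True]) else ?m i)" by (rule run_branch) simp
      show ?thesis by (rule run_SEQ[OF a run_SEQ[OF b c order_refl]]) simp
    qed
    have loop: "run ?L ((?m (N x - j))(4 := [True])) ((j + 1) * ?H x + 1) (?m (N x))" if "j \<le> N x" for j
      using that
    proof (induction j)
      case 0
      have L0: "run ?L (?m (N x)) 1 (?m (N x))" by (rule run_LOOP_Nil) (auto simp: main_def)
      have "(?m (N x))(4 := [True], 4 := []) = ?m (N x)" by (auto simp: main_def)
      then have "run (if True then ?b else SKIP) ((?m (N x))(4 := [True], 4 := [])) (?H x - 1) (?m (N x))" using body[of "N x"] by simp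
      from run_LOOP_Cons[of 4 "(?m (N x))(4 := [True])", OF _ _ this L0] show ?case
        unfolding diff_zero by (simp del: fun_upd_apply add: fun_upd_same)
    next
      case (Suc j)
      have e: "Suc (N x - Suc j) = N x - j" "N x - Suc j < N x" using Suc by auto
      have L1: "run ?L ((?m (N x - j))(4 := [True])) ((j + 1) * ?H x + 1) (?m (N x))" by (rule Suc.IH) (use Suc.prems in simp)
      have "(?m (N x - Suc j))(4 := [True], 4 := []) = ?m (N x - Suc j)" by (auto simp: main_def)
      then have B: "run (if True then ?b else SKIP) ((?m (N x - Suc j))(4 := [True], 4 := [])) (?H x - 1) ((?m (N x - j))(4 := [True]))"
        using body[of "N x - Suc j"] e by simp
      from run_LOOP_Cons[of 4 "(?m (N x - Suc j))(4 := [True])", OF _ _ B L1] show ?case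
        by (simp del: fun_upd_apply add: fun_upd_same algebra_simps)
    qed
    have "run (PUSH 4 True) (?m 0) 2 ((?m 0)(4 := [True]))" by (rule run_PUSH) (auto simp: main_def)
    then have "run (SEQ (PUSH 4 True) ?L) (?m 0) ((N x + 1) * ?H x + 10) (?m (N x))"
      using loop[of "N x"] by (intro run_SEQ) auto
    then show "run (SEQ (PUSH 4 True) ?L) (main (bits (tr x) @ rest)) ((N x + 1) * ?H x + 10) (main (bits (tr ((f ^^ N x) x)) @ rest))" by simp
  qed
qed

section \<open>Functions polynomial in the size of their argument, and their closure
  properties\<close>

definition fp :: "('a::data => 'b::data) => bool" where "fp f \<longleftrightarrow> fpon UNIV sz f"

abbreviation pb :: "('a::data => nat) => bool" where "pb \<equiv> pbd UNIV sz"

named_theorems fpi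

lemma fp_id [fpi]: "fp (%x. x)" unfolding fp_def by (intro fpon_id pbd_self)

lemma fp_const [fpi]: "fp (%x. c)" unfolding fp_def
proof (rule fponI[where c = "SEQ drop_tree (pushes (bits (tr c)))" and T = "%x. 40 * sz x + (3 * sz c + 1) + 1"])
  fix x :: 'a and rest
  have "run drop_tree (main (bits (tr x) @ rest)) (40 * sz x) (main rest)" by (rule run_drop) (simp add: sz_def)
  moreover have "run (pushes (bits (tr c))) (main rest) (3 * sz c + 1) (main (bits (tr c) @ rest))" by (rule run_pushes) (simp add: sz_def)
  ultimately show "run (SEQ drop_tree (pushes (bits (tr c)))) (main (bits (tr x) @ rest)) (40 * sz x + (3 * sz c + 1) + 1) (main (bits (tr c) @ rest))"
    by (rule run_SEQ) simp
qed (intro pbd_add pbd_mult pbd_const pbd_self)+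

lemma fp_comp: "fp g ==> fp f ==> fp (%x. g (f x))" unfolding fp_def
  by (rule fpon_comp) (auto intro: fpon_size)

lemma fp_pair [fpi]: "fp f ==> fp g ==> fp (%x. (f x, g x))" unfolding fp_def
  by (intro fpon_pair pbd_self)

lemma fp_fst [fpi]:
  fixes f :: "'a::data => 'b::data \<times> 'c::data"
  assumes "fp f" shows "fp (%x. fst (f x))"
proof -
  have "fp (fst :: 'b \<times> 'c => 'b)" unfolding fp_def
  proof (rule fponI[where c = first and T = "%x. 40 * sz x"])
    fix x :: "'b \<times> 'c" and rest
    show "run first (main (bits (tr x) @ rest)) (40 * sz x) (main (bits (tr (fst x)) @ rest))"
      unfolding tr_prod_def sz_def by (rule run_first) simp
  next
    show "pb (%x :: 'b \<times> 'c. sz (fst x))"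
      by (rule pbd_mono[OF pbd_self]) (simp add: sz_def tr_prod_def)
  qed (intro pbd_mult pbd_const pbd_self)
  from fp_comp[OF this assms] show ?thesis .
qed

lemma fp_snd [fpi]:
  fixes f :: "'a::data => 'b::data \<times> 'c::data"
  assumes "fp f" shows "fp (%x. snd (f x))"
proof -
  have "fp (snd :: 'b \<times> 'c => 'c)" unfolding fp_def
  proof (rule fponI[where c = second and T = "%x. 50 * sz x"])
    fix x :: "'b \<times> 'c" and rest
    show "run second (main (bits (tr x) @ rest)) (50 * sz x) (main (bits (tr (snd x)) @ rest))"
      unfolding tr_prod_def sz_def by (rule run_second) simp
  next
    show "pb (%x :: 'b \<times> 'c. sz (snd x))"
      by (rule pbd_mono[OF pbd_self]) (simp add: sz_def tr_prod_def)
  qed (intro pbd_mult pbd_const pbd_self)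
  from fp_comp[OF this assms] show ?thesis .
qed

lemma fp_if [fpi]: "fp p ==> fp f ==> fp g ==> fp (%x. if p x then f x else g x)"
  unfolding fp_def by (intro fpon_if pbd_self) (auto intro: fpon_subset)

lemma fp_eq [fpi]: "fp f ==> fp g ==> fp (%x. f x = g x)"
proof -
  assume "fp f" "fp g"
  have "fp (%p :: 'b \<times> 'b. fst p = snd p)" unfolding fp_def
  proof (rule fponI[where c = "SEQ (POP 0 SKIP SKIP SKIP) equal_trees" and T = "%x. 103 * sz x"])
    fix x :: "'b \<times> 'b" and rest
    let ?s = "tr (fst x)" and ?t = "tr (snd x)"
    have "run (POP 0 SKIP SKIP SKIP) (main (bits (tr x) @ rest)) 2 (main (bits ?s @ bits ?t @ rest))"
      by (rule run_POP[where v = True and vs = "bits ?s @ bits ?t @ rest" and n = 1]) (auto intro!: run_SKIP simp: main_def tr_prod_def)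
    moreover have "run equal_trees (main (bits ?s @ bits ?t @ rest)) (100 * (length (bits ?s) + length (bits ?t))) (main (bits (bit_tree (?s = ?t)) @ rest))"
      by (rule run_equal_trees) simp
    ultimately have "run (SEQ (POP 0 SKIP SKIP SKIP) equal_trees) (main (bits (tr x) @ rest)) (103 * sz x) (main (bits (bit_tree (?s = ?t)) @ rest))"
      by (rule run_SEQ) (simp add: sz_def tr_prod_def)
    then show "run (SEQ (POP 0 SKIP SKIP SKIP) equal_trees) (main (bits (tr x) @ rest)) (103 * sz x) (main (bits (tr (fst x = snd x)) @ rest))"
      by (simp add: tr_bool_def tr_eq_iff)
  next
    show "pb (%x :: 'b \<times> 'b. sz (fst x = snd x))"
      by (rule pbd_mono[OF pbd_const[of _ _ 3]]) (rule sz_bool)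
  qed (intro pbd_mult pbd_const pbd_self)
  from fp_comp[OF this fp_pair[OF \<open>fp f\<close> \<open>fp g\<close>]] show ?thesis by simp
qed

lemma fp_tr: "fp f ==> (\<And>x. tr (g x) = tr (f x)) ==> fp g"
  unfolding fp_def by (rule fpon_tr) auto

lemma fp_not [fpi]: "fp p ==> fp (%x. \<not> p x)"
  by (rule fp_tr[OF fp_if[OF _ fp_const[of False] fp_const[of True]]]) auto

lemma fp_conj [fpi]: "fp p ==> fp q ==> fp (%x. p x \<and> q x)"
  by (rule fp_tr[OF fp_if[of p q "%_. False", OF _ _ fp_const]]) auto

lemma fp_disj [fpi]: "fp p ==> fp q ==> fp (%x. p x \<or> q x)"
  by (rule fp_tr[OF fp_if[of p "%_. True" q, OF _ fp_const]]) auto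

lemma fp_imp [fpi]: "fp p ==> fp q ==> fp (%x. p x \<longrightarrow> q x)"
  by (rule fp_tr[OF fp_if[of p q "%_. True", OF _ _ fp_const]]) auto

lemma fp_Cons [fpi]: "fp f ==> fp g ==> fp (%x. f x # g x)"
  by (rule fp_tr[OF fp_pair]) (auto simp: tr_prod_def)

lemma fp_Suc [fpi]: "fp f ==> fp (%x. Suc (f x))"
  by (rule fp_tr[OF fp_pair[OF fp_const[of "0 :: nat"]]]) (auto simp: tr_prod_def)

lemma fp_case_list [fpi]:
  assumes xs: "fp xs" and g: "fp g" and h: "fp (%z. h (fst z) (fst (snd z)) (snd (snd z)))"
  shows "fp (%x. case xs x of [] => g x | y # ys => h x y ys)"
proof -
  let ?D = "{x. xs x \<noteq> []}"
  have "fpon ?D sz (%x. (x, xs x))"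
    using fp_pair[OF fp_id xs] unfolding fp_def by (rule fpon_subset) auto
  then have "fpon ?D sz (%x. (x, (hd (xs x), tl (xs x))))"
  proof (rule fpon_tr)
    fix x assume "x \<in> ?D" then show "tr (x, hd (xs x), tl (xs x)) = tr (x, xs x)"
      by (cases "xs x") (auto simp: tr_prod_def)
  qed
  from fpon_comp[OF this h[unfolded fp_def] _ fpon_size[OF this]]
  have "fpon ?D sz (%x. h x (hd (xs x)) (tl (xs x)))" by simp
  then have "fpon UNIV sz (%x. if xs x = [] then g x else h x (hd (xs x)) (tl (xs x)))"
    using fp_eq[OF xs fp_const] g unfolding fp_def
    by (intro fpon_if pbd_self) (auto elim: fpon_subset)
  then show ?thesis unfolding fp_def
    by (rule fpon_cong) (auto split: list.split)
qed

lemma fp_case_nat [fpi]: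
  assumes n: "fp n" and g: "fp g" and h: "fp (%z. h (fst z) (snd z))"
  shows "fp (%x. case n x of 0 => g x | Suc m => h x m)"
proof -
  have t: "tr (replicate k (0 :: nat)) = tr (k :: nat)" for k by (induction k) auto
  have l: "fp (%x. replicate (n x) (0 :: nat))" using n by (rule fp_tr) (simp add: t)
  have "fp (%z :: 'a \<times> nat \<times> nat list. h (fst z) (length (snd (snd z))))" if "fp (length :: nat list => nat)"
    using fp_comp[OF h fp_pair[OF fp_fst[OF fp_id] fp_comp[OF that fp_snd[OF fp_snd[OF fp_id]]]]] by simp
  let ?D = "{x. n x \<noteq> 0}"
  have "fpon ?D sz (%x. (x, n x))"
    using fp_pair[OF fp_id n] unfolding fp_def by (rule fpon_subset) auto
  then have "fpon ?D sz (%x. (x, ((0 :: nat), n x - 1)))"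
  proof (rule fpon_tr)
    fix x assume "x \<in> ?D" then show "tr (x, (0 :: nat), n x - 1) = tr (x, n x)"
      by (cases "n x") (auto simp: tr_prod_def)
  qed
  moreover have "fp (%z :: 'a \<times> nat \<times> nat. h (fst z) (snd (snd z)))"
    using fp_comp[OF h fp_pair[OF fp_fst[OF fp_id] fp_snd[OF fp_snd[OF fp_id]]]] by simp
  ultimately have "fpon ?D sz (%x. h x (n x - 1))"
    using fpon_comp[of ?D sz "%x. (x, ((0 :: nat), n x - 1))" UNIV sz "%z. h (fst z) (snd (snd z))"] fpon_size
    unfolding fp_def by fastforce
  then have "fpon UNIV sz (%x. if n x = 0 then g x else h x (n x - 1))"
    using fp_eq[OF n fp_const] g unfolding fp_def
    by (intro fpon_if pbd_self) (auto elim: fpon_subset)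
  then show ?thesis unfolding fp_def
    by (rule fpon_cong) (auto split: nat.split)
qed

section \<open>Bounded recursion on lists\<close>

lemma pb_sz: "fp f ==> pb (%x. sz (f x))" unfolding fp_def by (rule fpon_size)

text \<open>As in bounded recursion on notation, a fold of a polynomial step need not be polynomial:
  the accumulator might double in every round. Hypothesis \<open>b\<close> excludes this by bounding
  all intermediate accumulators.\<close>

lemma fp_foldl:
  assumes h: "fp (%z. h (fst z) (fst (snd z)) (snd (snd z)))" and i: "fp i" and xs: "fp xs"
    and g: "pb g" and b: "\<And>x k. k \<le> length (xs x) ==> sz (foldl (h x) (i x) (take k (xs x))) \<le> g x"
  shows "fp (%x. foldl (h x) (i x) (xs x))"
proof -
  let ?E = "UNIV :: ('a \<times> 'b \<times> 'c list) set"
  define p where "p s = (snd (snd s) \<noteq> [])" for s :: "'a \<times> 'b \<times> 'c list"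
  define f where "f s = (fst s, (h (fst s) (fst (snd s)) (hd (snd (snd s))), tl (snd (snd s))))" for s
  define s0 where "s0 x = (x, (i x, xs x))" for x
  have 1: "fpon ?E sz p" unfolding fp_def[symmetric] p_def by (intro fpi)
  have "fpon {s\<in>?E. p s} sz (%s. s)" by (intro fpon_id pbd_self)
  then have "fpon {s\<in>?E. p s} sz (%s. (fst s, (fst (snd s), (hd (snd (snd s)), tl (snd (snd s))))))"
  proof (rule fpon_tr)
    fix s assume "s \<in> {s\<in>?E. p s}" then show "tr (fst s, (fst (snd s), (hd (snd (snd s)), tl (snd (snd s))))) = tr s"
      by (cases "snd (snd s)") (auto simp: tr_prod_def p_def)
  qed
  moreover have "fp (%z :: 'a \<times> 'b \<times> 'c \<times> 'c list. (fst z, (h (fst z) (fst (snd z)) (fst (snd (snd z))), snd (snd (snd z)))))"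
  proof -
    have "fp (%z :: 'a \<times> 'b \<times> 'c \<times> 'c list. (fst z, (fst (snd z), fst (snd (snd z)))))" by (intro fpi)
    from fp_comp[OF h this] have "fp (%z :: 'a \<times> 'b \<times> 'c \<times> 'c list. h (fst z) (fst (snd z)) (fst (snd (snd z))))" by simp
    then show ?thesis by (intro fpi)
  qed
  ultimately have 2: "fpon {s\<in>?E. p s} sz f"
    using fpon_comp[of "{s\<in>?E. p s}" sz "%s. (fst s, (fst (snd s), (hd (snd (snd s)), tl (snd (snd s)))))" UNIV sz
       "%z. (fst z, (h (fst z) (fst (snd z)) (fst (snd (snd z))), snd (snd (snd z))))"] fpon_size
    unfolding fp_def f_def by fastforce
  have it: "(f ^^ k) (s0 x) = (x, (foldl (h x) (i x) (take k (xs x)), drop k (xs x)))" if "k \<le> length (xs x)" for k x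
    using that
    by (induction k) (auto simp: s0_def f_def take_Suc_conv_app_nth tl_drop drop_Suc hd_drop_conv_nth)
  have szd: "sz (drop k ys) \<le> sz ys" for k and ys :: "'c list"
  proof (induction ys arbitrary: k)
    case (Cons y ys) then show ?case by (cases k) (auto intro: le_SucI trans_le_add2)
  qed simp
  have sl: "length ys < sz ys" for ys :: "'c list" by (induction ys) auto
  \<comment> \<open>The size bound is available only for states reached from an initial one. They
    all retain \<open>x\<close> as first component, so the bound \<open>g (fst s)\<close> can be
    read off the state.\<close>
  let ?D = "range s0"
  have s0: "fp s0" unfolding s0_def by (intro fpi i xs)
  have "fpon ?D sz (%s. (f ^^ length (snd (snd s))) s)"
  proof (rule fpon_while[OF 1 2])
    show "pbd ?D sz (%s. sz s + g (fst s) + 2)"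
    proof (intro pbd_add pbd_self pbd_const)
      obtain k where k: "\<forall>x. g x \<le> (sz x + 2) ^ k" using g unfolding pbd_def by auto
      have "g (fst s) \<le> (sz s + 2) ^ k" if "s \<in> ?D" for s
        using k[rule_format, of "fst s"] by (rule le_trans) (intro power_mono, auto simp: s0_def sz_def tr_prod_def)
      then show "pbd ?D sz (%s. g (fst s))" unfolding pbd_def by blast
    qed
    show "pbd ?D sz (%s. length (snd (snd s)))"
    proof (rule pbd_mono[OF pbd_self])
      fix s :: "'a \<times> 'b \<times> 'c list"
      show "length (snd (snd s)) \<le> sz s" using sl[of "snd (snd s)"] by (cases s) auto
    qed
    fix s k assume "s \<in> ?D" "k \<le> length (snd (snd s))"
    then obtain x where x: "s = s0 x" "k \<le> length (xs x)" by (auto simp: s0_def)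
    show "(f ^^ k) s \<in> UNIV \<and> sz ((f ^^ k) s) \<le> sz s + g (fst s) + 2 \<and> (p ((f ^^ k) s) \<longleftrightarrow> k < length (snd (snd s)))"
      using b[OF x(2)] szd[of k "xs x"] unfolding x(1) it[OF x(2)] by (auto simp: s0_def p_def)
  qed
  from fpon_comp[OF s0[unfolded fp_def] this subset_refl pb_sz[OF s0]]
  have "fp (%x. (f ^^ length (xs x)) (s0 x))" unfolding fp_def by (simp add: s0_def)
  then have "fp (%x. fst (snd ((f ^^ length (xs x)) (s0 x))))" by (intro fpi)
  then show ?thesis by (simp add: it)
qed

lemma length_le_sz: "length xs < sz xs" for xs :: "'a::data list" by (induction xs) auto

lemma elem_le_sz: "y \<in> set xs ==> sz y < sz xs" for y :: "'a::data" by (induction xs) auto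

text \<open>Additive growth is harmless: after all rounds the accumulator has gained at most
  \<open>sz (xs x) * g x\<close>.\<close>

lemma fp_foldl_add:
  assumes h: "fp (%z. h (fst z) (fst (snd z)) (snd (snd z)))" and i: "fp i" and xs: "fp xs"
    and g: "pb g" and b: "\<And>x a y. y \<in> set (xs x) ==> sz (h x a y) \<le> sz a + g x"
  shows "fp (%x. foldl (h x) (i x) (xs x))"
proof (rule fp_foldl[OF h i xs])
  show "pb (%x. sz (i x) + sz (xs x) * g x)" by (intro pbd_add pbd_mult pb_sz i xs g)
  fix x k assume k: "k \<le> length (xs x)"
  have "sz (foldl (h x) (i x) (take k (xs x))) \<le> sz (i x) + k * g x" using k
  proof (induction k)
    case (Suc k)
    then show ?case using b[of "xs x ! k" x "foldl (h x) (i x) (take k (xs x))"]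
      by (simp add: take_Suc_conv_app_nth)
  qed simp
  also have "k * g x \<le> sz (xs x) * g x" using k length_le_sz[of "xs x"] by (intro mult_right_mono) auto
  finally show "sz (foldl (h x) (i x) (take k (xs x))) \<le> sz (i x) + sz (xs x) * g x" by simp
qed

text \<open>The variant with an invariant that bounds the accumulator, as for the repeated filtering
  in \<open>winset\<close>.\<close>

lemma fp_foldl_bdd:
  assumes h: "fp (%z. h (fst z) (fst (snd z)) (snd (snd z)))" and i: "fp i" and xs: "fp xs"
    and g: "pb g" and b: "\<And>x a y. y \<in> set (xs x) ==> P x a ==> P x (h x a y) " "\<And>x. P x (i x)" "\<And>x a. P x a ==> sz a \<le> g x"
  shows "fp (%x. foldl (h x) (i x) (xs x))"
proof (rule fp_foldl[OF h i xs g])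
  fix x k assume k: "k \<le> length (xs x)"
  then have "P x (foldl (h x) (i x) (take k (xs x)))"
    by (induction k) (auto intro!: b(1,2) simp: take_Suc_conv_app_nth)
  then show "sz (foldl (h x) (i x) (take k (xs x))) \<le> g x" by (rule b)
qed

lemma foldl_Cons_rev: "foldl (%a y. f y # a) b l = rev (map f l) @ b"
  by (induction l arbitrary: b) auto

lemma foldl_append_concat: "foldl (%a y. a @ y) b l = b @ concat l"
  by (induction l arbitrary: b) auto

lemma concat_if_filter: "concat (map (%y. if Q y then [y] else []) l) = filter Q l"
  by (induction l) auto

lemma fp_rev [fpi]: "fp xs ==> fp (%x. rev (xs x))"
proof -
  assume xs: "fp xs"
  have "fp (%x. foldl (%a y. y # a) [] (xs x))"
    by (rule fp_foldl_add[OF _ _ xs, where g = "%x. sz (xs x) + 1"])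
      (auto intro!: fpi pbd_Suc pbd_add pbd_const pb_sz xs dest: elem_le_sz)
  then show ?thesis by (simp add: foldl_Cons_rev[of "%y. y", simplified])
qed

lemma fp_append [fpi]: "fp xs ==> fp ys ==> fp (%x. xs x @ ys x)"
proof -
  assume xs: "fp xs" and ys: "fp ys"
  have "fp (%x. foldl (%a y. y # a) (ys x) (rev (xs x)))"
    by (rule fp_foldl_add[OF _ ys fp_rev[OF xs], where g = "%x. sz (xs x) + 1"])
      (auto intro!: fpi pbd_Suc pbd_add pbd_const pb_sz xs dest: elem_le_sz)
  then show ?thesis by (simp add: foldl_Cons_rev[of "%y. y", simplified])
qed

lemma pb_elem:
  assumes f: "fp (%z. f (fst z) (snd z))" and xs: "fp xs"
  obtains g where "pb g" "\<And>x y. y \<in> set (xs x) ==> sz (f x y) \<le> g x"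
proof -
  obtain k where k: "\<forall>z. sz (f (fst z) (snd z)) \<le> (sz z + 2) ^ k" using pb_sz[OF f] unfolding pbd_def by auto
  show ?thesis
  proof (rule that)
    show "pb (%x. (sz x + sz (xs x) + 3) ^ k)" by (intro pbd_power pbd_add pbd_self pbd_const pb_sz xs)
    fix x y assume "y \<in> set (xs x)"
    then have "sz (x, y) + 2 \<le> sz x + sz (xs x) + 3" using elem_le_sz by fastforce
    then have "(sz (x, y) + 2) ^ k \<le> (sz x + sz (xs x) + 3) ^ k" by (rule power_mono) simp
    then show "sz (f x y) \<le> (sz x + sz (xs x) + 3) ^ k" using k[rule_format, of "(x, y)"] by simp
  qed
qed

lemma fp_map [fpi]:
  assumes xs: "fp xs" and f: "fp (%z. f (fst z) (snd z))"
  shows "fp (%x. map (f x) (xs x))"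
proof -
  obtain g where g: "pb g" "\<And>x y. y \<in> set (xs x) ==> sz (f x y) \<le> g x" using pb_elem[OF f xs] by blast
  have "fp (%x. foldl (%a y. f x y # a) [] (xs x))"
  proof (rule fp_foldl_add[OF _ fp_const xs, where g = "%x. g x + 1"])
    show "fp (%z. f (fst z) (snd (snd z)) # fst (snd z))"
    proof -
      have "fp (%z :: 'a \<times> 'c list \<times> 'b. (fst z, snd (snd z)))" by (intro fpi)
      from fp_comp[OF f this] have "fp (%z :: 'a \<times> 'c list \<times> 'b. f (fst z) (snd (snd z)))" by simp
      then show ?thesis by (intro fpi)
    qed
  qed (use g in \<open>auto intro!: pbd_Suc pbd_add pbd_const\<close>)
  then have "fp (%x. rev (foldl (%a y. f x y # a) [] (xs x)))" by (rule fp_rev)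
  then show ?thesis by (simp add: foldl_Cons_rev)
qed

lemma sz_append_le: "sz (xs @ ys) \<le> sz xs + sz ys" using sz_append[of xs ys] by simp

lemma fp_concat [fpi]: "fp xs ==> fp (%x. concat (xs x))"
proof -
  assume xs: "fp xs"
  have "fp (%x. foldl (%a y. a @ y) [] (xs x))"
  proof (rule fp_foldl_add[OF _ _ xs pb_sz[OF xs]])
    fix x a y assume "y \<in> set (xs x)"
    then show "sz (a @ y) \<le> sz a + sz (xs x)" using sz_append_le[of a y] elem_le_sz[of y "xs x"] by linarith
  qed (intro fpi)+
  then show ?thesis by (simp add: foldl_append_concat)
qed

lemma fp_filter [fpi]:
  assumes xs: "fp xs" and P: "fp (%z. P (fst z) (snd z))"
  shows "fp (%x. filter (P x) (xs x))"
proof -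
  have "fp (%x. concat (map (%y. if P x y then [y] else []) (xs x)))" by (intro fpi xs P)
  then show ?thesis by (simp add: concat_if_filter)
qed

lemma fp_bex [fpi]: "fp xs ==> fp (%z. P (fst z) (snd z)) ==> fp (%x. \<exists>y\<in>set (xs x). P x y)"
proof -
  assume "fp xs" "fp (%z. P (fst z) (snd z))"
  then have "fp (%x. filter (P x) (xs x) \<noteq> [])" by (intro fpi)
  then show ?thesis by (simp add: filter_empty_conv)
qed

lemma fp_ball [fpi]: "fp xs ==> fp (%z. P (fst z) (snd z)) ==> fp (%x. \<forall>y\<in>set (xs x). P x y)"
proof -
  assume "fp xs" "fp (%z. P (fst z) (snd z))"
  then have "fp (%x. \<not> (\<exists>y\<in>set (xs x). \<not> P x y))" by (intro fpi)
  then show ?thesis by simp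
qed

lemma fp_member [fpi]: "fp f ==> fp xs ==> fp (%x. f x \<in> set (xs x))"
proof -
  assume f: "fp f" and xs: "fp xs"
  have "fp (%x. \<exists>y\<in>set (xs x). f x = y)" by (intro fpi xs fp_comp[OF f])
  then show ?thesis by simp
qed

lemma fp_length [fpi]:
  fixes xs :: "'a::data => 'b::data list"
  shows "fp xs ==> fp (%x. length (xs x))"
proof -
  assume xs: "fp xs"
  have "fp (%x. foldl (%a _. Suc a) 0 (xs x))"
    by (rule fp_foldl_add[OF _ _ xs, where g = "%_. 2"]) (auto intro!: fpi pbd_const)
  moreover have "foldl (%a _. Suc a) b l = b + length l" for b and l :: "'b list" by (induction l arbitrary: b) auto
  ultimately show ?thesis by simp
qed

section \<open>Unary arithmetic by iteration\<close>

lemma tr_replicate_0: "tr (replicate n (0 :: nat)) = tr n" by (induction n) auto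

lemma fp_replicate_0: "fp n ==> fp (%x. replicate (n x) (0 :: nat))"
  by (erule fp_tr) (rule tr_replicate_0)

lemma fp_replicate [fpi]: "fp n ==> fp f ==> fp (%x. replicate (n x) (f x))"
proof -
  assume n: "fp n" and f: "fp f"
  have "fp (%x. map (%_. f x) (replicate (n x) (0 :: nat)))" by (intro fpi fp_replicate_0 n fp_comp[OF f])
  then show ?thesis by simp
qed

lemma foldl_funpow: "foldl (%a _. f a) b (replicate n c) = (f ^^ n) b"
  by (induction n arbitrary: b) (auto simp: funpow_swap1)

lemma fp_funpow_add:
  fixes h :: "'a::data => 'b::data => 'b"
  assumes h: "fp (%z. h (fst z) (snd z))" and n: "fp n" and i: "fp i" and g: "pb g" and b: "\<And>x a. sz (h x a) \<le> sz a + g x"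
  shows "fp (%x. (h x ^^ n x) (i x))"
proof -
  have "fp (%x. foldl (%a _. h x a) (i x) (replicate (n x) (0 :: nat)))"
  proof (rule fp_foldl_add[OF _ i fp_replicate_0[OF n] g b])
    show "fp (%z :: 'a \<times> 'b \<times> nat. h (fst z) (fst (snd z)))"
      using fp_comp[OF h, of "%z :: 'a \<times> 'b \<times> nat. (fst z, fst (snd z))"] by (simp add: fpi)
  qed
  then show ?thesis by (simp add: foldl_funpow)
qed

lemma fp_plus [fpi]: "fp m ==> fp n ==> fp (%x. m x + n x :: nat)"
proof -
  assume m: "fp m" and n: "fp n"
  have "fp (%x. (Suc ^^ m x) (n x))"
    by (rule fp_funpow_add[OF _ m n, where g = "%_. 2"]) (auto intro!: fpi pbd_const)
  moreover have "(Suc ^^ k) l = k + l" for k l by (induction k) auto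
  ultimately show ?thesis by simp
qed

lemma fp_times [fpi]: "fp m ==> fp n ==> fp (%x. m x * n x :: nat)"
proof -
  assume m: "fp m" and n: "fp n"
  have "fp (%x. ((+) (m x) ^^ n x) 0)"
    by (rule fp_funpow_add[OF _ n, where g = "%x. sz (m x)"]) (auto intro!: fpi pbd_const pb_sz m fp_comp[OF m] simp del: sz_nat simp: sz_nat[of "_ + _"], simp)
  moreover have "((+) k ^^ l) 0 = k * l" for k l :: nat by (induction l) auto
  ultimately show ?thesis by simp
qed

lemma fp_power [fpi]: "fp m ==> fp (%x. m x ^ k :: nat)"
  by (induction k) (auto intro!: fpi)

lemma fp_pred [fpi]: "fp m ==> fp (%x. m x - 1 :: nat)"
proof -
  assume m: "fp m"
  have "fp (%x. case m x of 0 => 0 | Suc k => k)" by (intro fpi m)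
  then show ?thesis by (rule fp_tr) (auto split: nat.split)
qed

lemma fp_minus [fpi]: "fp m ==> fp n ==> fp (%x. m x - n x :: nat)"
proof -
  assume m: "fp m" and n: "fp n"
  have "fp (%x. ((%k. k - 1) ^^ n x) (m x))"
  proof (rule fp_funpow_add[OF _ n m, where g = "%_. 2"])
    show "fp (%z :: 'a \<times> nat. snd z - 1)" by (intro fpi)
  qed (auto intro: pbd_const)
  moreover have "((%k. k - 1) ^^ k) l = l - k" for k l :: nat by (induction k) auto
  ultimately show ?thesis by simp
qed

lemma fp_le [fpi]: "fp m ==> fp n ==> fp (%x. (m x :: nat) \<le> n x)"
proof -
  assume "fp m" "fp n"
  then have "fp (%x. m x - n x = 0)" by (intro fpi)
  then show ?thesis by simp
qed

lemma fp_less [fpi]: "fp m ==> fp n ==> fp (%x. (m x :: nat) < n x)"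
  using fp_le[OF fp_Suc, of m n] by (simp add: Suc_le_eq)

lemma sz_le_elems: "(\<And>y. y \<in> set xs ==> sz y \<le> b) ==> sz xs \<le> length xs * (b + 1) + 1" for xs :: "'a::data list"
  by (induction xs) (auto, fastforce)

lemma fp_upt [fpi]: "fp n ==> fp (%x. [0..<n x])"
proof -
  assume n: "fp n"
  have e: "((%l. l @ [length l]) ^^ k) [] = [0..<k]" for k by (induction k) auto
  have "fp (%x. foldl (%l _. l @ [length l]) [] (replicate (n x) (0 :: nat)))"
  proof (rule fp_foldl[OF _ _ fp_replicate_0[OF n]])
    show "pb (%x. sz (n x) * (sz (n x) + 1) + 1)" by (intro pbd_add pbd_mult pbd_const pb_sz n)
    fix x k assume "k \<le> length (replicate (n x) (0 :: nat))"
    then have k: "k \<le> n x" by simp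
    have "sz [0..<k] \<le> length [0..<k] * (sz (n x) + 1) + 1" using k by (intro sz_le_elems) auto
    also have "\<dots> \<le> sz (n x) * (sz (n x) + 1) + 1" using k by (intro add_right_mono mult_right_mono) auto
    finally show "sz (foldl (%l _. l @ [length l]) [] (take k (replicate (n x) (0 :: nat)))) \<le> sz (n x) * (sz (n x) + 1) + 1"
      using k by (simp only: take_replicate foldl_funpow e min_absorb1)
  qed (intro fpi)+
  then show ?thesis by (simp only: foldl_funpow e)
qed

lemma fp_tl [fpi]: "fp xs ==> fp (%x. tl (xs x))"
proof -
  assume m: "fp xs"
  have "fp (%x. case xs x of [] => [] | y # ys => ys)" by (intro fpi m)
  then show ?thesis by (rule fp_tr) (auto split: list.split)
qed

lemma fp_drop [fpi]:
  fixes xs :: "'a::data => 'b::data list"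
  shows "fp n ==> fp xs ==> fp (%x. drop (n x) (xs x))"
proof -
  assume n: "fp n" and xs: "fp xs"
  have "sz (tl a) \<le> sz a" for a :: "'b list" by (cases a) auto
  then have "fp (%x. (tl ^^ n x) (xs x))"
    by (intro fp_funpow_add[OF _ n xs, where g = "%_. 0"]) (auto intro!: fpi pbd_const)
  moreover have "(tl ^^ k) l = drop k l" for k and l :: "'b list" by (induction k) (auto simp: tl_drop drop_Suc)
  ultimately show ?thesis by simp
qed

lemma fp_take [fpi]:
  fixes xs :: "'a::data => 'b::data list"
  shows "fp n ==> fp xs ==> fp (%x. take (n x) (xs x))"
proof -
  assume "fp n" "fp xs"
  then have "fp (%x. rev (drop (length (xs x) - n x) (rev (xs x))))" by (intro fpi)
  moreover have "rev (drop (length l - k) (rev l)) = take k l" for k and l :: "'b list"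
    by (cases "k \<le> length l") (auto simp: rev_drop)
  ultimately show ?thesis by simp
qed

text \<open>Lookup with a default: the result of \<open>!\<close> beyond the end of a list is
  unspecified, which no program could reproduce.\<close>

definition nthd :: "'a => 'a list => nat => 'a" where
  "nthd d xs i = (case drop i xs of [] => d | y # _ => y)"

lemma nthd_nth [simp]: "i < length xs ==> nthd d xs i = xs ! i"
  by (auto simp: nthd_def Cons_nth_drop_Suc[symmetric])

lemma fp_nthd [fpi]: "fp d ==> fp xs ==> fp i ==> fp (%x. nthd (d x) (xs x) (i x))"
  unfolding nthd_def by (intro fpi)

definition first_of :: "'a => ('a => bool) => 'a list => 'a" where
  "first_of d P xs = (case filter P xs of [] => d | y # _ => y)"

lemma first_of: "\<exists>y\<in>set xs. P y ==> first_of d P xs \<in> set xs \<and> P (first_of d P xs)"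
proof -
  assume "\<exists>y\<in>set xs. P y"
  then obtain y ys where "filter P xs = y # ys" by (metis filter_empty_conv list.exhaust)
  then show ?thesis by (auto simp: first_of_def filter_eq_Cons_iff)
qed

lemma fp_first_of [fpi]: "fp d ==> fp (%z. P (fst z) (snd z)) ==> fp xs ==> fp (%x. first_of (d x) (P x) (xs x))"
  unfolding first_of_def by (intro fpi)

lemma fp_foldr_add:
  assumes h: "fp (%z. h (fst z) (snd (snd z)) (fst (snd z)))" and i: "fp i" and xs: "fp xs"
    and g: "pb g" and b: "\<And>x a y. y \<in> set (xs x) ==> sz (h x y a) \<le> sz a + g x"
  shows "fp (%x. foldr (h x) (xs x) (i x))"
proof -
  have "fp (%x. foldl (%a y. h x y a) (i x) (rev (xs x)))"
    by (rule fp_foldl_add[OF h i fp_rev[OF xs] g]) (use b in auto)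
  then show ?thesis by (simp add: foldr_conv_foldl)
qed

lemma fp_zip [fpi]:
  fixes xs :: "'a::data => 'b::data list" and ys :: "'a => 'c::data list"
  shows "fp xs ==> fp ys ==> fp (%x. zip (xs x) (ys x))"
proof -
  assume xs: "fp xs" and ys: "fp ys"
  let ?h = "%(a :: ('b \<times> 'c) list \<times> 'c list) (x :: 'b). case snd a of [] => (fst a, []) | y # t => (fst a @ [(x, y)], t)"
  have "fp (%x. foldl ?h ([], ys x) (xs x))"
  proof (rule fp_foldl_add[OF _ _ xs, where g = "%x. sz (xs x) + 5"])
    fix x y and a :: "('b \<times> 'c) list \<times> 'c list" assume y: "y \<in> set (xs x)"
    then have "sz y \<le> sz (xs x)" using elem_le_sz by fastforce
    moreover have "sz (fst a @ [(y, u)]) + 1 = sz (fst a) + sz [(y, u)]" for u using sz_append by blast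
    ultimately show "sz (?h a y) \<le> sz a + (sz (xs x) + 5)"
      by (cases a; cases "snd a") (auto simp: le_SucI)
  qed (intro fpi xs ys pbd_Suc pbd_add pbd_const pb_sz)+
  then have "fp (%x. fst (foldl ?h ([], ys x) (xs x)))" by (rule fp_fst)
  moreover have "fst (foldl ?h (b, m) l) = b @ zip l m" for b l m
    by (induction l arbitrary: b m) (auto split: list.split)
  ultimately show ?thesis by simp
qed

subsection \<open>Parity games as safety games\<close>

definition parity_ok :: "(nat => nat) => bool" where
  "parity_ok p \<longleftrightarrow> (\<exists>k. even k \<and> (\<exists>\<^sub>\<infinity>i. p i = k) \<and> (\<forall>\<^sub>\<infinity>i. p i \<le> k))"

text \<open>The entry of an odd priority counts its occurrences since the last larger priority; the
  entries of even priorities are never increased.\<close>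

definition upd :: "nat list => nat => nat list" where
  "upd c p = map (%j. if j < p then 0 else if j = p \<and> odd p then Suc (c ! j) else c ! j) [0..<length c]"

lemma length_upd [simp]: "length (upd c p) = length c" by (simp add: upd_def)

lemma upd_nth: "j < length c ==> upd c p ! j = (if j < p then 0 else if j = p \<and> odd p then Suc (c ! j) else c ! j)"
  by (simp add: upd_def)

lemma parity_ok_Suc: "parity_ok (%i. p (Suc i)) \<longleftrightarrow> parity_ok p"
proof -
  have 1: "(\<exists>\<^sub>\<infinity>i. P (Suc i)) \<longleftrightarrow> (\<exists>\<^sub>\<infinity>i. P i)" for P
  proof
    assume a: "\<exists>\<^sub>\<infinity>i. P (Suc i)"
    show "\<exists>\<^sub>\<infinity>i. P i" unfolding INFM_nat
    proof
      fix m obtain n where "n > m" "P (Suc n)" using a unfolding INFM_nat by blast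
      then show "\<exists>n>m. P n" by (intro exI[of _ "Suc n"]) auto
    qed
  next
    assume a: "\<exists>\<^sub>\<infinity>i. P i"
    show "\<exists>\<^sub>\<infinity>i. P (Suc i)" unfolding INFM_nat
    proof
      fix m obtain n where "n > Suc m" "P n" using a unfolding INFM_nat by blast
      then show "\<exists>n>m. P (Suc n)" by (intro exI[of _ "n - 1"]) auto
    qed
  qed
  have 2: "(\<forall>\<^sub>\<infinity>i. P (Suc i)) \<longleftrightarrow> (\<forall>\<^sub>\<infinity>i. P i)" for P
    by (rule MOST_Suc_iff)
  have "(\<exists>\<^sub>\<infinity>i. p (Suc i) = k) \<longleftrightarrow> (\<exists>\<^sub>\<infinity>i. p i = k)" "(\<forall>\<^sub>\<infinity>i. p (Suc i) \<le> k) \<longleftrightarrow> (\<forall>\<^sub>\<infinity>i. p i \<le> k)" for k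
    using 1[of "%i. p i = k"] 2[of "%i. p i \<le> k"] by auto
  then show ?thesis unfolding parity_ok_def by (simp only:)
qed

text \<open>If the largest priority occurring infinitely often were odd, its counter would
  eventually never be reset and would grow beyond \<open>N\<close>.\<close>

lemma bounded_counters_parity:
  assumes p: "\<And>i. p i < d" and C0: "length (C 0) = d" and C: "\<And>i. C (Suc i) = upd (C i) (p i)"
    and b: "\<And>i j. j < d ==> C i ! j \<le> N"
  shows "parity_ok p"
proof -
  have lC: "length (C i) = d" for i by (induction i) (auto simp: C0 C)
  define I where "I = {k. \<exists>\<^sub>\<infinity>i. p i = k}"
  have sub: "I \<subseteq> {..<d}" using p by (auto simp: I_def INFM_nat)
  then have finI: "finite I" using finite_subset by blast
  have ev: "\<forall>\<^sub>\<infinity>i. p i \<in> I"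
  proof -
    have "\<forall>\<^sub>\<infinity>i. \<forall>k\<in>{..<d} - I. p i \<noteq> k"
      by (subst eventually_ball_finite_distrib) (auto simp: I_def not_INFM)
    then show ?thesis using p by (auto elim!: MOST_mono)
  qed
  then have "I \<noteq> {}" by (auto simp: MOST_nat)
  define k where "k = Max I"
  have kI: "k \<in> I" using finI \<open>I \<noteq> {}\<close> by (simp add: k_def)
  have le: "\<forall>\<^sub>\<infinity>i. p i \<le> k" using ev finI by (auto elim!: MOST_mono simp: k_def)
  then obtain T where T: "\<And>i. i \<ge> T ==> p i \<le> k" by (auto simp: MOST_nat_le)
  have kd: "k < d" using kI sub by auto
  have "even k"
  proof (rule ccontr)
    assume odd: "odd k"
    have mono: "C i ! k \<le> C (Suc i) ! k" "p i = k ==> Suc (C i ! k) = C (Suc i) ! k" if "i \<ge> T" for i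
      using T[OF that] odd kd lC by (auto simp: C upd_nth)
    have mono': "C i ! k \<le> C (i + n) ! k" if "i \<ge> T" for i n
      using mono that by (induction n) (auto intro: le_trans)
    have "\<exists>i\<ge>T. n \<le> C i ! k" for n
    proof (induction n)
      case (Suc n)
      then obtain i where i: "i \<ge> T" "n \<le> C i ! k" by blast
      obtain j where j: "j > i" "p j = k" using kI by (auto simp: I_def INFM_nat)
      have "n \<le> C j ! k" using mono'[OF i(1), of "j - i"] i j by simp
      then have "Suc n \<le> C (Suc j) ! k" using mono(2)[of j] i j by simp
      then show ?case using i j by (intro exI[of _ "Suc j"]) auto
    qed auto
    then obtain i where "Suc N \<le> C i ! k" by blast
    then show False using b[OF kd, of i] by simp
  qed
  then show ?thesis unfolding parity_ok_def using kI le by (auto simp: I_def)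
qed

text \<open>As in synthesis, the agent moves first and sees only the past moves of the environment.
  The number \<open>N\<close> bounds both the number of positions and, in \<open>lose\<close>, the
  counters.\<close>

locale parity_game =
  fixes Q :: "'s set" and A :: "'a set" and E :: "'e set"
    and step :: "'s => 'a => 'e => 's" and pr :: "'s => nat" and s0 :: 's and d N :: nat
  assumes finQ: "finite Q" and s0: "s0 \<in> Q"
    and step: "s \<in> Q ==> a \<in> A ==> e \<in> E ==> step s a e \<in> Q"
    and prd: "s \<in> Q ==> pr s < d" and cardQ: "card Q \<le> N"
begin

text \<open>The history is rebuilt next to the state, because the strategy depends on the moves made
  so far and not on the state.\<close>

definition sth :: "('e list => 'a) => 'e list => 's" where
  "sth \<sigma> h = fst (foldl (%(s, g) e. (step s (\<sigma> g) e, g @ [e])) (s0, []) h)"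

lemma sth_Nil [simp]: "sth \<sigma> [] = s0" by (simp add: sth_def)

lemma sth_snoc [simp]: "sth \<sigma> (h @ [e]) = step (sth \<sigma> h) (\<sigma> h) e"
proof -
  have "snd (foldl (%(s, g) e. (step s (\<sigma> g) e, g @ [e])) (s0, []) h) = h"
    by (induction h rule: rev_induct) (auto split: prod.splits)
  then show ?thesis
    by (cases "foldl (%(s, g) e. (step s (\<sigma> g) e, g @ [e])) (s0, []) h") (simp add: sth_def)
qed

section \<open>From winning strategies to bounded counters\<close>

definition winning :: "('e list => 'a) => bool" where
  "winning \<sigma> \<longleftrightarrow> (\<forall>h\<in>lists E. \<sigma> h \<in> A) \<and>
     (\<forall>y. range y \<subseteq> E \<longrightarrow> parity_ok (%i. pr (sth \<sigma> (map y [0..<i]))))"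

lemma sth_Q: "\<forall>h\<in>lists E. \<sigma> h \<in> A ==> h \<in> lists E ==> sth \<sigma> h \<in> Q"
  by (induction h rule: rev_induct) (auto simp: s0 intro!: step)

text \<open>The positions from which the environment forces a counter above \<open>N\<close> in
  finitely many rounds. As a least fixed point it supplies the induction for
  \<open>lose_return\<close>, and outside of it the agent always has a move that stays
  outside.\<close>

inductive lose :: "'s => nat list => bool" where
  "(\<And>a. a \<in> A ==> \<exists>e\<in>E. (\<exists>j<d. N < upd c (pr (step s a e)) ! j) \<or>
      lose (step s a e) (upd c (pr (step s a e)))) ==> lose s c"

definition ctr :: "'s list => nat list" where
  "ctr \<pi> = foldl (%c s. upd c (pr s)) (replicate d 0) (tl \<pi>)"

lemma ctr_snoc: "\<pi> \<noteq> [] ==> ctr (\<pi> @ [s]) = upd (ctr \<pi>) (pr s)" by (simp add: ctr_def)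

lemma length_ctr: "length (ctr \<pi>) = d"
proof -
  have "length (foldl (%c s. upd c (pr s)) c zs) = length c" for c zs
    by (induction zs arbitrary: c) auto
  then show ?thesis by (simp add: ctr_def)
qed

text \<open>No two equal states of the path enclose an odd maximum. The starting state of such a
  cycle is left out of the maximum since it returns at the end.\<close>

definition nobad :: "'s list => bool" where
  "nobad \<pi> \<longleftrightarrow> (\<forall>i j. i < j \<longrightarrow> j < length \<pi> \<longrightarrow> \<pi> ! i = \<pi> ! j \<longrightarrow> even (Max ((%l. pr (\<pi> ! l)) ` {i<..j})))"

lemma ctr_occurrences:
  assumes "p < d" "\<pi> \<noteq> []"
  shows "\<exists>J\<subseteq>{..<length \<pi>}. card J = ctr \<pi> ! p \<and> (\<forall>l\<in>J. odd p \<and> pr (\<pi> ! l) = p \<and> (\<forall>m. l < m \<longrightarrow> m < length \<pi> \<longrightarrow> pr (\<pi> ! m) \<le> p))"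
  using assms(2)
proof (induction \<pi> rule: rev_nonempty_induct)
  case (single x)
  then show ?case using assms(1) by (intro exI[of _ "{}"]) (simp add: ctr_def)
next
  case (snoc x \<pi>)
  then obtain J where J: "J \<subseteq> {..<length \<pi>}" "card J = ctr \<pi> ! p"
    "\<forall>l\<in>J. odd p \<and> pr (\<pi> ! l) = p \<and> (\<forall>m. l < m \<longrightarrow> m < length \<pi> \<longrightarrow> pr (\<pi> ! m) \<le> p)" by blast
  have fJ: "finite J" using J(1) finite_subset by blast
  have c: "ctr (\<pi> @ [x]) ! p = (if p < pr x then 0 else if p = pr x \<and> odd (pr x) then Suc (ctr \<pi> ! p) else ctr \<pi> ! p)"
    using assms(1) snoc(1) by (simp add: ctr_snoc upd_nth length_ctr)
  consider "p < pr x" | "p = pr x" "odd (pr x)" | "pr x \<le> p" "\<not> (p = pr x \<and> odd (pr x))" by linarith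
  then show ?case
  proof cases
    case 1 then show ?thesis using c by (intro exI[of _ "{}"]) simp
  next
    case 2
    have "length \<pi> \<notin> J" using J(1) by auto
    then have "card (insert (length \<pi>) J) = ctr (\<pi> @ [x]) ! p" using fJ 2 c J(2) by simp
    moreover have "\<forall>l\<in>insert (length \<pi>) J. odd p \<and> pr ((\<pi> @ [x]) ! l) = p \<and> (\<forall>m. l < m \<longrightarrow> m < length (\<pi> @ [x]) \<longrightarrow> pr ((\<pi> @ [x]) ! m) \<le> p)"
      using J(1,3) 2 by (auto simp: nth_append less_Suc_eq)
    moreover have "insert (length \<pi>) J \<subseteq> {..<length (\<pi> @ [x])}" using J(1) by auto
    ultimately show ?thesis by blast
  next
    case 3
    have "\<forall>l\<in>J. odd p \<and> pr ((\<pi> @ [x]) ! l) = p \<and> (\<forall>m. l < m \<longrightarrow> m < length (\<pi> @ [x]) \<longrightarrow> pr ((\<pi> @ [x]) ! m) \<le> p)"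
      using J(1,3) 3 by (auto simp: nth_append less_Suc_eq)
    moreover have "J \<subseteq> {..<length (\<pi> @ [x])}" using J(1) by auto
    moreover have "card J = ctr (\<pi> @ [x]) ! p" using 3 c J(2) by auto
    ultimately show ?thesis by blast
  qed
qed

text \<open>Two of the positions counted for \<open>p\<close> with the same state would enclose a
  cycle whose maximum is \<open>p\<close>, which is odd. Hence these positions carry distinct states
  and there are at most \<open>card Q\<close> of them.\<close>

lemma ctr_bound:
  assumes "nobad \<pi>" "\<pi> \<noteq> []" "set \<pi> \<subseteq> Q" "p < d"
  shows "ctr \<pi> ! p \<le> N"
proof -
  obtain J where J: "J \<subseteq> {..<length \<pi>}" "card J = ctr \<pi> ! p"
    "\<forall>l\<in>J. odd p \<and> pr (\<pi> ! l) = p \<and> (\<forall>m. l < m \<longrightarrow> m < length \<pi> \<longrightarrow> pr (\<pi> ! m) \<le> p)"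
    using ctr_occurrences[OF assms(4,2)] by blast
  have *: "\<pi> ! l \<noteq> \<pi> ! l'" if l: "l \<in> J" "l' \<in> J" "l < l'" for l l'
  proof
    assume e: "\<pi> ! l = \<pi> ! l'"
    have l': "l' < length \<pi>" using l J(1) by auto
    have "Max ((%l. pr (\<pi> ! l)) ` {l<..l'}) = p"
    proof (rule Max_eqI)
      show "p \<in> (%l. pr (\<pi> ! l)) ` {l<..l'}" using l J(3) by force
    qed (use l l' J(3) in auto)
    moreover have "even (Max ((%l. pr (\<pi> ! l)) ` {l<..l'}))" using assms(1) l(3) l' e by (auto simp: nobad_def)
    ultimately show False using l(1) J(3) by auto
  qed
  have "inj_on ((!) \<pi>) J" by (rule inj_onI) (metis * linorder_neqE_nat)
  moreover have "(!) \<pi> ` J \<subseteq> Q" using J(1) assms(3) by force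
  ultimately have "card J \<le> card Q" using finQ by (metis card_inj_on_le)
  then show ?thesis using J(2) cardQ by simp
qed

text \<open>The state at \<open>h\<close> itself is excluded and the last one included, so that the
  segments of consecutive extensions cover a play without overlap.\<close>

definition seg :: "('e list => 'a) => 'e list => 'e list => 's set" where
  "seg \<sigma> h u = (%m. sth \<sigma> (h @ take m u)) ` {1..length u}"

lemma seg_single: "seg \<sigma> h [e] = {sth \<sigma> (h @ [e])}" by (auto simp: seg_def)

lemma seg_append: "seg \<sigma> h (u @ v) = seg \<sigma> h u \<union> seg \<sigma> (h @ u) v"
proof
  show "seg \<sigma> h (u @ v) \<subseteq> seg \<sigma> h u \<union> seg \<sigma> (h @ u) v"
  proof
    fix x assume "x \<in> seg \<sigma> h (u @ v)"
    then obtain m where m: "x = sth \<sigma> (h @ take m (u @ v))" "1 \<le> m" "m \<le> length u + length v" by (auto simp: seg_def)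
    show "x \<in> seg \<sigma> h u \<union> seg \<sigma> (h @ u) v"
    proof (cases "m \<le> length u")
      case False
      then have "x = sth \<sigma> ((h @ u) @ take (m - length u) v)" "m - length u \<in> {1..length v}" using m by auto
      then show ?thesis by (auto simp: seg_def)
    qed (use m in \<open>auto simp: seg_def\<close>)
  qed
  have "sth \<sigma> (h @ u @ take m v) \<in> seg \<sigma> h (u @ v)" if "1 \<le> m" "m \<le> length v" for m
    unfolding seg_def using that by (intro image_eqI[of _ _ "length u + m"]) auto
  moreover have "sth \<sigma> (h @ take m u) \<in> seg \<sigma> h (u @ v)" if "1 \<le> m" "m \<le> length u" for m
    unfolding seg_def using that by (intro image_eqI[of _ _ m]) auto
  ultimately show "seg \<sigma> h u \<union> seg \<sigma> (h @ u) v \<subseteq> seg \<sigma> h (u @ v)" by (auto simp: seg_def[of \<sigma> h u] seg_def[of \<sigma> "h @ u"])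
qed

lemma finite_seg: "finite (seg \<sigma> h u)" by (simp add: seg_def)
lemma seg_ne: "u \<noteq> [] ==> seg \<sigma> h u \<noteq> {}" by (cases u) (auto simp: seg_def)

text \<open>The extensions concatenate to an infinite play of \<open>\<sigma>\<close> made of
  segments with odd maximum. Its dominating priority \<open>k\<close> is even and occurs in a
  segment that starts after \<open>k\<close> has been exceeded for the last time; there
  \<open>k\<close> is the maximum.\<close>

lemma no_odd_repetition:
  assumes win: "winning \<sigma>" and ne: "h0 \<in> H" and HE: "H \<subseteq> lists E"
    and ext: "\<And>h. h \<in> H ==> \<exists>u. u \<noteq> [] \<and> h @ u \<in> H \<and> odd (Max (pr ` seg \<sigma> h u))"
  shows False
proof -
  have "\<exists>hs. \<forall>n. hs n \<in> H \<and> (\<exists>u. u \<noteq> [] \<and> hs (Suc n) = hs n @ u \<and> odd (Max (pr ` seg \<sigma> (hs n) u)))"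
    using ne ext by (intro dependent_nat_choice[of "%_ h. h \<in> H" "%_ h h'. \<exists>u. u \<noteq> [] \<and> h' = h @ u \<and> odd (Max (pr ` seg \<sigma> h u))"]) blast+
  then obtain hs where hs: "\<And>n. hs n \<in> H" "\<And>n. \<exists>u. u \<noteq> [] \<and> hs (Suc n) = hs n @ u \<and> odd (Max (pr ` seg \<sigma> (hs n) u))" by blast
  then obtain u where u: "\<And>n. u n \<noteq> []" "\<And>n. hs (Suc n) = hs n @ u n" "\<And>n. odd (Max (pr ` seg \<sigma> (hs n) (u n)))" by metis
  have len: "length (hs n) \<ge> n" for n
  proof (induction n)
    case (Suc n) then show ?case using u(1)[of n] by (cases "u n") (auto simp: u(2))
  qed simp
  have pre: "\<exists>v. hs (n + m) = hs n @ v" for n m by (induction m) (auto simp: u(2))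
  have pre': "hs a ! i = hs b ! i" if "i < length (hs a)" "i < length (hs b)" for a b i
    using that pre[of a "b - a"] pre[of b "a - b"] by (cases "a \<le> b") (auto simp: nth_append)
  define y where "y i = hs (Suc i) ! i" for i
  have hsy: "hs n = map y [0..<length (hs n)]" for n
    by (rule nth_equalityI) (auto simp: y_def intro!: pre' less_le_trans[OF lessI len])
  have "y i \<in> E" for i
  proof -
    have "hs (Suc i) \<in> lists E" "i < length (hs (Suc i))" using hs(1) HE len[of "Suc i"] by auto
    then show ?thesis unfolding y_def by (auto simp: in_lists_conv_set)
  qed
  then have "parity_ok (%i. pr (sth \<sigma> (map y [0..<i])))" using win by (auto simp: winning_def)
  then obtain k T where k: "even k" "\<exists>\<^sub>\<infinity>i. pr (sth \<sigma> (map y [0..<i])) = k" "\<And>i. i \<ge> T ==> pr (sth \<sigma> (map y [0..<i])) \<le> k"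
    unfolding parity_ok_def MOST_nat_le by blast
  obtain i where i: "i > length (hs T)" "pr (sth \<sigma> (map y [0..<i])) = k" using k(2) by (auto simp: INFM_nat)
  define m where "m = (LEAST m. i \<le> length (hs m))"
  have m: "i \<le> length (hs m)" unfolding m_def using len[of i] by (rule LeastI)
  have "m \<noteq> 0"
  proof
    assume "m = 0"
    then have "i \<le> length (hs 0)" using m by simp
    moreover have "length (hs 0) \<le> length (hs T)" using pre[of 0 T] by auto
    ultimately show False using i by simp
  qed
  then obtain n where n: "m = Suc n" by (cases m) auto
  have n1: "length (hs n) < i"
    using not_less_Least[of n "%m. i \<le> length (hs m)"] unfolding m_def[symmetric] n by simp
  have nT: "n \<ge> T"
  proof (rule ccontr)
    assume "\<not> n \<ge> T"
    then have "length (hs (Suc n)) \<le> length (hs T)" using pre[of "Suc n" "T - Suc n"] by auto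
    then show False using m n i by simp
  qed
  have tk: "hs n @ take l (u n) = map y [0..<length (hs n) + l]" if "l \<le> length (u n)" for l
  proof -
    have "hs n @ take l (u n) = take (length (hs n) + l) (hs (Suc n))" by (simp add: u(2))
    also have "\<dots> = take (length (hs n) + l) (map y [0..<length (hs (Suc n))])" using hsy[of "Suc n"] by simp
    also have "\<dots> = map y [0..<length (hs n) + l]" using that by (simp add: take_map u(2))
    finally show ?thesis .
  qed
  have "Max (pr ` seg \<sigma> (hs n) (u n)) = k"
  proof (rule Max_eqI)
    fix x assume "x \<in> pr ` seg \<sigma> (hs n) (u n)"
    then obtain l where "x = pr (sth \<sigma> (hs n @ take l (u n)))" "l \<le> length (u n)" by (auto simp: seg_def)
    then show "x \<le> k" using tk[of l] k(3)[of "length (hs n) + l"] len[of n] nT by auto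
  next
    have "i - length (hs n) \<in> {1..length (u n)}" using n1 m n u(2)[of n] by auto
    then show "k \<in> pr ` seg \<sigma> (hs n) (u n)"
      unfolding seg_def image_image using tk[of "i - length (hs n)"] i(2) n1
      by (intro image_eqI[of _ _ "i - length (hs n)"]) auto
  qed (simp add: finite_seg)
  then show False using u(3)[of n] k(1) by simp
qed

lemma odd_Max_Un: "finite S ==> finite T ==> S \<noteq> {} ==> T \<noteq> {} ==> odd (Max S) ==> odd (Max T) ==> odd (Max (S \<union> T :: nat set))"
  by (simp add: Max_Un max_def)

text \<open>The path \<open>\<pi>\<close> need not be part of the history \<open>h\<close>; they
  only agree in their last state. This freedom is what permits cycles to be cut out of the path
  while the play goes on.\<close>

definition returns :: "('e list => 'a) => 's => nat list => bool" where
  "returns \<sigma> s c \<longleftrightarrow> (\<forall>\<pi> h. \<pi> \<noteq> [] \<longrightarrow> set \<pi> \<subseteq> Q \<longrightarrow> last \<pi> = s \<longrightarrow> c = ctr \<pi> \<longrightarrow> nobad \<pi> \<longrightarrow> h \<in> lists E \<longrightarrow> sth \<sigma> h = s \<longrightarrow>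
     (\<exists>u i. u \<in> lists E \<and> u \<noteq> [] \<and> i < length \<pi> \<and> sth \<sigma> (h @ u) = \<pi> ! i \<and>
       odd (Max ((%l. pr (\<pi> ! l)) ` {i<..<length \<pi>} \<union> pr ` seg \<sigma> h u))))"

text \<open>The key to memoryless play: from a lost position the environment can force a return to an
  earlier position of the reduced path (in which all cycles with odd maximum have been cut out)
  such that the maximum on the way is odd.\<close>

lemma lose_return:
  assumes win: "winning \<sigma>"
  shows "lose s c ==> returns \<sigma> s c"
proof (induction rule: lose.induct)
  case (1 c s)
  have sA: "\<forall>h\<in>lists E. \<sigma> h \<in> A" using win by (simp add: winning_def)
  show ?case
    unfolding returns_def
  proof (intro allI impI)
  fix \<pi> h assume a: "\<pi> \<noteq> []" "set \<pi> \<subseteq> Q" "last \<pi> = s" "c = ctr \<pi>" "nobad \<pi>" "h \<in> lists E" "sth \<sigma> h = s"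
  define s' where "s' e = step s (\<sigma> h) e" for e
  obtain e where e: "e \<in> E" and eor: "(\<exists>j<d. N < upd c (pr (s' e)) ! j) \<or> returns \<sigma> (s' e) (upd c (pr (s' e)))"
    using 1[of "\<sigma> h"] sA a(6) unfolding s'_def by blast
  define t where "t = s' e"
  have st: "sth \<sigma> (h @ [e]) = t" using a(7) by (simp add: t_def s'_def)
  have tQ: "t \<in> Q" using sth_Q[OF sA, of "h @ [e]"] e a(6) st by simp
  show "\<exists>u i. u \<in> lists E \<and> u \<noteq> [] \<and> i < length \<pi> \<and> sth \<sigma> (h @ u) = \<pi> ! i \<and>
       odd (Max ((%l. pr (\<pi> ! l)) ` {i<..<length \<pi>} \<union> pr ` seg \<sigma> h u))" (is ?thesis)
  proof (cases "\<exists>i<length \<pi>. \<pi> ! i = t \<and> odd (Max ((%l. pr (\<pi> ! l)) ` {i<..<length \<pi>} \<union> {pr t}))")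
    case True
    then show ?thesis using e st by (intro exI[of _ "[e]"]) (auto simp: seg_single)
  next
    \<comment> \<open>Otherwise the extended path is still free of bad cycles. By
      \<open>ctr_bound\<close> the move causes no overflow, so the induction hypothesis applies to
      the extended path.\<close>
    case A: False
    let ?\<pi> = "\<pi> @ [t]"
    have nb: "nobad ?\<pi>"
      unfolding nobad_def
    proof (intro allI impI)
      fix i j assume ij: "i < j" "j < length ?\<pi>" "?\<pi> ! i = ?\<pi> ! j"
      show "even (Max ((%l. pr (?\<pi> ! l)) ` {i<..j}))"
      proof (cases "j < length \<pi>")
        case True
        then have "(%l. pr (?\<pi> ! l)) ` {i<..j} = (%l. pr (\<pi> ! l)) ` {i<..j}" by (auto simp: nth_append)
        then show ?thesis using a(5) ij True by (auto simp: nobad_def nth_append)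
      next
        case False
        then have j: "j = length \<pi>" using ij by simp
        have "{i<..j} = {i<..<length \<pi>} \<union> {length \<pi>}" using ij j by auto
        then have "(%l. pr (?\<pi> ! l)) ` {i<..j} = (%l. pr (\<pi> ! l)) ` {i<..<length \<pi>} \<union> {pr t}"
          by (auto simp: nth_append)
        then show ?thesis using A ij j by (auto simp: nth_append)
      qed
    qed
    have c': "upd c (pr t) = ctr ?\<pi>" using a(1,4) by (simp add: ctr_snoc)
    have "set ?\<pi> \<subseteq> Q" using a(2) tQ by simp
    then have "upd c (pr t) ! j \<le> N" if "j < d" for j using ctr_bound[OF nb _ _ that] c' by simp
    then have "\<not> (\<exists>j<d. N < upd c (pr t) ! j)" by (meson leD)
    then have IH: "\<exists>u i. u \<in> lists E \<and> u \<noteq> [] \<and> i < length ?\<pi> \<and> sth \<sigma> (h' @ u) = ?\<pi> ! i \<and>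
       odd (Max ((%l. pr (?\<pi> ! l)) ` {i<..<length ?\<pi>} \<union> pr ` seg \<sigma> h' u))" if "h' \<in> lists E" "sth \<sigma> h' = t" for h'
      using eor that nb c' \<open>set ?\<pi> \<subseteq> Q\<close> unfolding t_def[symmetric] returns_def by (metis last_snoc snoc_eq_iff_butlast)
    show "?thesis"
    proof (rule ccontr)
      assume neg: "\<not> ?thesis"
      let ?h = "h @ [e]"
      \<comment> \<open>Histories that have come back to \<open>t\<close> with odd maximum since
        \<open>?h\<close>. From each of them the environment returns either to a position of
        \<open>\<pi>\<close>, which proves the claim, or once more to \<open>t\<close>; if only the
        latter ever happened, \<open>no_odd_repetition\<close> would apply.\<close>
      define H where "H = (%u. ?h @ u) ` {u \<in> lists E. sth \<sigma> (?h @ u) = t \<and> (u = [] \<or> odd (Max (pr ` seg \<sigma> ?h u)))}"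
      have HE: "H \<subseteq> lists E" using a(6) e by (auto simp: H_def)
      have "?h \<in> H" using st by (force simp: H_def)
      moreover have "\<exists>u. u \<noteq> [] \<and> h' @ u \<in> H \<and> odd (Max (pr ` seg \<sigma> h' u))" if "h' \<in> H" for h'
      proof -
        obtain w where w: "h' = ?h @ w" "w \<in> lists E" "sth \<sigma> h' = t" "w = [] \<or> odd (Max (pr ` seg \<sigma> ?h w))"
        proof -
          from \<open>h' \<in> H\<close> obtain w where "h' = ?h @ w" "w \<in> {u \<in> lists E. sth \<sigma> (?h @ u) = t \<and> (u = [] \<or> odd (Max (pr ` seg \<sigma> ?h u)))}"
            unfolding H_def by (rule imageE)
          then show thesis by (auto intro!: that[of w])
        qed
        have "h' \<in> lists E" using HE \<open>h' \<in> H\<close> by (rule subsetD)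
        from IH[OF this w(3)] obtain u i where u0: "u \<in> lists E \<and> u \<noteq> [] \<and> i < length ?\<pi> \<and> sth \<sigma> (h' @ u) = ?\<pi> ! i \<and>
          odd (Max ((%l. pr (?\<pi> ! l)) ` {i<..<length ?\<pi>} \<union> pr ` seg \<sigma> h' u))" by (elim exE)
        note u = u0[THEN conjunct1] u0[THEN conjunct2, THEN conjunct1] u0[THEN conjunct2, THEN conjunct2, THEN conjunct1]
          u0[THEN conjunct2, THEN conjunct2, THEN conjunct2, THEN conjunct1] u0[THEN conjunct2, THEN conjunct2, THEN conjunct2, THEN conjunct2]
        show ?thesis
        proof (cases "i = length \<pi>")
          case True
          have em: "{i<..<length ?\<pi>} = {}" using True by auto
          have o: "odd (Max (pr ` seg \<sigma> h' u))" using u(5) unfolding em by simp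
          have "w @ u = [] \<or> odd (Max (pr ` seg \<sigma> ?h (w @ u)))"
          proof (cases "w = []")
            case False
            then have "odd (Max (pr ` seg \<sigma> ?h w \<union> pr ` seg \<sigma> h' u))"
              using o w(4) u(2) by (intro odd_Max_Un) (auto simp: finite_seg seg_ne)
            then show ?thesis by (simp add: seg_append w(1) image_Un)
          qed (use o w in auto)
          then have "h' @ u \<in> H" using u w True by (auto simp: H_def)
          then show ?thesis using u(2) o by blast
        next
          case False
          then have i: "i < length \<pi>" using u by simp
          have sg: "seg \<sigma> h ([e] @ w @ u) = {t} \<union> (seg \<sigma> ?h w \<union> seg \<sigma> h' u)"
            unfolding seg_append seg_single using st w(1) by simp
          let ?P = "(%l. pr (\<pi> ! l)) ` {i<..<length \<pi>}"
          have "{i<..<length ?\<pi>} = {i<..<length \<pi>} \<union> {length \<pi>}" using i by auto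
          then have P: "(%l. pr (?\<pi> ! l)) ` {i<..<length ?\<pi>} = ?P \<union> {pr t}" by (auto simp: nth_append)
          have o: "odd (Max (?P \<union> {pr t} \<union> pr ` seg \<sigma> h' u))" using u(5) unfolding P .
          have "odd (Max (?P \<union> pr ` seg \<sigma> h ([e] @ w @ u)))"
          proof (cases "w = []")
            case True
            then have "seg \<sigma> ?h w = {}" by (simp add: seg_def)
            then have "?P \<union> pr ` seg \<sigma> h ([e] @ w @ u) = ?P \<union> {pr t} \<union> pr ` seg \<sigma> h' u" unfolding sg by auto
            then show ?thesis using o by simp
          next
            case False
            have "odd (Max (pr ` seg \<sigma> ?h w \<union> (?P \<union> {pr t} \<union> pr ` seg \<sigma> h' u)))"
            proof (rule odd_Max_Un)
              show "odd (Max (?P \<union> {pr t} \<union> pr ` seg \<sigma> h' u))" by (rule o)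
            qed (use w(4) False in \<open>auto simp: finite_seg seg_ne\<close>)
            moreover have "pr ` seg \<sigma> ?h w \<union> (?P \<union> {pr t} \<union> pr ` seg \<sigma> h' u) = ?P \<union> pr ` seg \<sigma> h ([e] @ w @ u)" unfolding sg by auto
            ultimately show ?thesis by simp
          qed
          moreover have "[e] @ w @ u \<in> lists E" using e w u by simp
          moreover have "sth \<sigma> (h @ [e] @ w @ u) = \<pi> ! i" using u(4) w(1) i by (simp add: nth_append)
          ultimately show ?thesis using neg i by blast
        qed
      qed
      ultimately show False using no_odd_repetition[OF win _ HE] by blast
    qed
  qed
qed
qed

text \<open>On the path that consists of \<open>s0\<close> alone the only possible return is to
  \<open>s0\<close>, so a lost initial position would yield endless returns with odd
  maximum.\<close>

theorem winning_not_lose: "winning \<sigma> ==> \<not> lose s0 (replicate d 0)"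
proof
  assume win: "winning \<sigma>" and l: "lose s0 (replicate d 0)"
  define H where "H = {h \<in> lists E. sth \<sigma> h = s0}"
  show False
  proof (rule no_odd_repetition[OF win, of "[]" H])
    fix h assume "h \<in> H"
    have e1: "{0<..<Suc 0} = {}" by auto
    from \<open>h \<in> H\<close> have "\<exists>u i. u \<in> lists E \<and> u \<noteq> [] \<and> i < length [s0] \<and> sth \<sigma> (h @ u) = [s0] ! i \<and>
       odd (Max ((%l. pr ([s0] ! l)) ` {i<..<length [s0]} \<union> pr ` seg \<sigma> h u))"
      using s0 lose_return[OF win l, unfolded returns_def, rule_format, of "[s0]" h] by (auto simp: H_def ctr_def nobad_def)
    then obtain u where "u \<in> lists E" "u \<noteq> []" "sth \<sigma> (h @ u) = s0" "odd (Max (pr ` seg \<sigma> h u))"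
      using e1 by auto
    then show "\<exists>u. u \<noteq> [] \<and> h @ u \<in> H \<and> odd (Max (pr ` seg \<sigma> h u))"
      using \<open>h \<in> H\<close> by (intro exI[of _ u]) (simp add: H_def)
  qed (auto simp: H_def)
qed

end

subsection \<open>Latest appearance records\<close>

definition mtf :: "('c => bool) => 'c list => 'c list" where
  "mtf V l = filter V l @ filter (%x. \<not> V x) l"

text \<open>The length of the shortest prefix that contains all visited entries, and 0 if none is
  visited. Everything behind it stays in place under \<open>mtf\<close>.\<close>

definition hit :: "('c => bool) => 'c list => nat" where
  "hit V l = length (dropWhile (%x. \<not> V x) (rev l))"

text \<open>Larger hits dominate smaller ones, and the condition on the hit prefix decides the
  parity. A step may visit several colours at once or none at all.\<close>

definition lar_prio :: "('c set => bool) => ('c => bool) => 'c list => nat" where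
  "lar_prio \<alpha> V l = (if \<alpha> (set (take (hit V l) (mtf V l))) then 2 * hit V l + 2 else 2 * hit V l + 1)"

lemma length_mtf [simp]: "length (mtf V l) = length l"
  by (induction l) (auto simp: mtf_def)

lemma set_mtf [simp]: "set (mtf V l) = set l" by (auto simp: mtf_def)

lemma distinct_mtf: "distinct l ==> distinct (mtf V l)" by (auto simp: mtf_def)

lemma hit_le: "hit V l \<le> length l"
  using length_dropWhile_le[of "%x. \<not> V x" "rev l"] by (simp add: hit_def)

lemma drop_hit: "x \<in> set (drop (hit V l) l) ==> \<not> V x"
proof -
  have "rev l = takeWhile (%x. \<not> V x) (rev l) @ dropWhile (%x. \<not> V x) (rev l)" by simp
  then have "l = rev (dropWhile (%x. \<not> V x) (rev l)) @ rev (takeWhile (%x. \<not> V x) (rev l))"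
    by (metis rev_append rev_rev_ident)
  then have "drop (hit V l) l = rev (takeWhile (%x. \<not> V x) (rev l))" unfolding hit_def
    by (metis append_eq_conv_conj length_rev)
  then show "x \<in> set (drop (hit V l) l) ==> \<not> V x" by (auto dest: set_takeWhileD)
qed

lemma hit_le_prefix: "(\<And>x. x \<in> set ys ==> \<not> V x) ==> hit V (xs @ ys) \<le> length xs"
  using length_dropWhile_le[of "%x. \<not> V x" "rev xs"] by (simp add: hit_def dropWhile_append)

lemma mtf_drop: "hit V l \<le> n ==> drop n (mtf V l) = drop n l"
proof -
  assume n: "hit V l \<le> n"
  have nv: "\<not> V x" if "x \<in> set (drop n l)" for x
    using that n set_drop_subset_set_drop[of "hit V l" n l] drop_hit[of x V l] by auto
  have "filter V (drop n l) = []" "filter (%x. \<not> V x) (drop n l) = drop n l"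
    using nv by (simp_all add: filter_empty_conv filter_id_conv)
  moreover have "filter P l = filter P (take n l) @ filter P (drop n l)" for P
    by (metis append_take_drop_id filter_append)
  ultimately have "mtf V l = mtf V (take n l) @ drop n l" by (simp add: mtf_def)
  moreover have "length (mtf V (take n l)) = min n (length l)" by (simp add: min.commute)
  ultimately show ?thesis by (cases "n \<le> length l") auto
qed

text \<open>The colours visited infinitely often eventually fill the first \<open>card I\<close>
  entries. From then on hits never exceed \<open>card I\<close> and attain it infinitely often, and
  at those times the hit prefix is exactly \<open>I\<close>.\<close>

theorem lar_correct:
  fixes V :: "nat => 'c => bool"
  assumes l0: "distinct (l 0)" and l: "\<And>i. l (Suc i) = mtf (V i) (l i)" and V: "\<And>i x. V i x ==> x \<in> set (l 0)"
  shows "parity_ok (%i. lar_prio \<alpha> (V i) (l i)) \<longleftrightarrow> \<alpha> {x. \<exists>\<^sub>\<infinity>i. V i x}"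
proof -
  define I where "I = {x. \<exists>\<^sub>\<infinity>i. V i x}"
  have IS: "I \<subseteq> set (l 0)" using V by (auto simp: I_def INFM_nat)
  then have finI: "finite I" using finite_subset by blast
  have dl: "distinct (l i) \<and> set (l i) = set (l 0)" for i by (induction i) (auto simp: l0 l distinct_mtf)
  have "\<forall>\<^sub>\<infinity>i. \<forall>x\<in>set (l 0) - I. \<not> V i x"
    by (subst eventually_ball_finite_distrib) (auto simp: I_def not_INFM)
  then obtain T0 where T0: "\<And>i x. i \<ge> T0 ==> V i x ==> x \<in> I" unfolding MOST_nat_le using V by blast
  define U where "U i = {x. \<exists>j. T0 \<le> j \<and> j < i \<and> V j x}" for i
  \<comment> \<open>From \<open>T0\<close> on only colours of \<open>I\<close> are visited; those
    visited since then form a prefix of the record.\<close>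
  have pre: "\<exists>xs ys. l (T0 + n) = xs @ ys \<and> set xs = U (T0 + n)" for n
  proof (induction n)
    case 0 show ?case by - (rule exI[of _ "[]"], rule exI[of _ "l T0"], auto simp: U_def)
  next
    case (Suc n)
    then obtain xs ys where xy: "l (T0 + n) = xs @ ys" "set xs = U (T0 + n)" by blast
    let ?V = "V (T0 + n)"
    have "l (T0 + Suc n) = (filter ?V xs @ filter ?V ys @ filter (%x. \<not> ?V x) xs) @ filter (%x. \<not> ?V x) ys"
      by (simp add: l xy mtf_def)
    moreover have "set (filter ?V xs @ filter ?V ys @ filter (%x. \<not> ?V x) xs) = U (T0 + Suc n)"
    proof -
      have "U (T0 + Suc n) = U (T0 + n) \<union> {x. ?V x}"
        unfolding U_def add_Suc_right less_Suc_eq by (auto intro: le_add1)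
      moreover have "x \<in> set xs \<union> set ys" if "?V x" for x using V[OF that] dl[of "T0 + n"] xy(1) by auto
      ultimately show ?thesis unfolding set_append set_filter using xy(2) by blast
    qed
    ultimately show ?case by blast
  qed
  have "\<forall>x\<in>I. \<exists>j\<ge>T0. V j x" by (auto simp: I_def INFM_nat_le)
  then obtain j where j: "\<And>x. x \<in> I ==> j x \<ge> T0 \<and> V (j x) x" by metis
  define T1 where "T1 = Max (insert T0 (Suc ` j ` I))"
  have T1: "T1 \<ge> T0" "\<And>x. x \<in> I ==> j x < T1" using finI by (auto simp: T1_def Suc_le_eq[symmetric])
  have UI: "U i = I" if "i \<ge> T1" for i
    using that T0 j T1 by (fastforce simp: U_def)
  have split: "\<exists>xs ys. l i = xs @ ys \<and> set xs = I \<and> length xs = card I" if "i \<ge> T1" for i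
  proof -
    have e: "T0 + (i - T0) = i" using \<open>i \<ge> T1\<close> T1(1) by simp
    obtain xs ys where xy: "l i = xs @ ys" "set xs = U i" using pre[of "i - T0"] unfolding e by blast
    then have "distinct xs" by (metis dl distinct_append)
    then have "length xs = card I" using xy(2) UI[OF that] distinct_card[of xs] by simp
    then show ?thesis using xy UI[OF that] by blast
  qed
  define n where "n = card I"
  have hn: "hit (V i) (l i) \<le> n" if i: "i \<ge> T1" for i
  proof -
    obtain xs ys where xy: "l i = xs @ ys" "set xs = I" "length xs = card I" using split[OF i] by blast
    have "\<not> V i x" if "x \<in> set ys" for x using that xy dl[of i] T0[of i x] i T1 by auto
    then show ?thesis using hit_le_prefix[of ys "V i" xs] xy by (simp add: n_def)
  qed
  have tI: "set (take n (l i)) = I" if "i \<ge> T1" for i using split[OF that] by (auto simp: n_def)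
  \<comment> \<open>If all later hits were smaller than \<open>n\<close>, the entry at index
    \<open>n - 1\<close> would never move and never be visited again, although it belongs to
    \<open>I\<close>.\<close>
  have freq: "\<exists>\<^sub>\<infinity>i. hit (V i) (l i) = n"
  proof (rule ccontr)
    assume "\<not> ?thesis"
    then obtain T2 where T2: "\<And>i. i \<ge> T2 ==> hit (V i) (l i) \<noteq> n" by (auto simp: not_INFM MOST_nat_le)
    define T where "T = max T1 T2"
    have lt: "hit (V i) (l i) < n" if "i \<ge> T" for i using that T2[of i] hn[of i] by (auto simp: T_def)
    have n0: "n > 0" using lt[of T] by simp
    have ln: "n \<le> length (l i)" for i
    proof -
      have "n \<le> card (set (l i))" unfolding n_def using IS dl[of i] by (intro card_mono) simp_all
      then show ?thesis using card_length[of "l i"] by simp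
    qed
    define z where "z = l T ! (n - 1)"
    have "take n (l T) ! (n - 1) \<in> set (take n (l T))" using n0 ln[of T] by (intro nth_mem) simp
    then have zI: "z \<in> I" using tI[of T] n0 by (simp add: z_def T_def)
    have zc: "l (T + m) ! (n - 1) = z" for m
    proof (induction m)
      case (Suc m)
      have "drop (n - 1) (l (T + Suc m)) = drop (n - 1) (l (T + m))"
        using lt[of "T + m"] by (simp add: l mtf_drop)
      then have "hd (drop (n - 1) (l (T + Suc m))) = hd (drop (n - 1) (l (T + m)))" by simp
      then show ?case using Suc ln[of "T + m"] ln[of "T + Suc m"] n0 by (simp add: hd_drop_conv_nth)
    qed (simp add: z_def)
    have "\<not> V (T + m) z" for m
    proof -
      have "z \<in> set (drop (n - 1) (l (T + m)))" using zc[of m] ln[of "T + m"] n0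
        by (metis Cons_nth_drop_Suc diff_less less_le_trans list.set_intros(1) zero_less_one)
      moreover have "hit (V (T + m)) (l (T + m)) \<le> n - 1" using lt[of "T + m"] by simp
      ultimately have "z \<in> set (drop (hit (V (T + m)) (l (T + m))) (l (T + m)))"
        by (metis set_drop_subset_set_drop subsetD)
      then show ?thesis by (rule drop_hit)
    qed
    moreover obtain i where "i \<ge> T" "V i z" using zI unfolding I_def INFM_nat_le by blast
    ultimately show False by (metis le_add_diff_inverse)
  qed
  define k where "k = (if \<alpha> I then 2 * n + 2 else 2 * n + 1)"
  have eqk: "lar_prio \<alpha> (V i) (l i) = k" if "i \<ge> T1" "hit (V i) (l i) = n" for i
  proof -
    have "set (take n (mtf (V i) (l i))) = I" using tI[of "Suc i"] that by (simp add: l)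
    then show ?thesis using that by (simp add: lar_prio_def k_def)
  qed
  have lek: "lar_prio \<alpha> (V i) (l i) \<le> k" if "i \<ge> T1" for i
  proof (cases "hit (V i) (l i) = n")
    case False
    then have "hit (V i) (l i) < n" using hn[OF that] by simp
    then show ?thesis by (auto simp: lar_prio_def k_def)
  qed (use eqk that in simp)
  have fk: "\<exists>\<^sub>\<infinity>i. lar_prio \<alpha> (V i) (l i) = k"
    unfolding INFM_nat_le
  proof
    fix m
    obtain i where "i \<ge> max m T1" "hit (V i) (l i) = n" using freq unfolding INFM_nat_le by blast
    then show "\<exists>i\<ge>m. lar_prio \<alpha> (V i) (l i) = k" using eqk[of i] by auto
  qed
  have mk: "\<forall>\<^sub>\<infinity>i. lar_prio \<alpha> (V i) (l i) \<le> k" unfolding MOST_nat_le using lek by blast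
  have "parity_ok (%i. lar_prio \<alpha> (V i) (l i)) \<longleftrightarrow> even k"
  proof
    assume "parity_ok (%i. lar_prio \<alpha> (V i) (l i))"
    then obtain k' T' where k': "even k'" "\<exists>\<^sub>\<infinity>i. lar_prio \<alpha> (V i) (l i) = k'" "\<And>i. i \<ge> T' ==> lar_prio \<alpha> (V i) (l i) \<le> k'"
      unfolding parity_ok_def MOST_nat_le by blast
    obtain i where "i \<ge> T1" "lar_prio \<alpha> (V i) (l i) = k'" using k'(2) unfolding INFM_nat_le by blast
    moreover obtain i' where "i' \<ge> T'" "lar_prio \<alpha> (V i') (l i') = k" using fk unfolding INFM_nat_le by blast
    ultimately have "k = k'" using lek[of i] k'(3)[of i'] by simp
    then show "even k" using k' by simp
  qed (use fk mk in \<open>auto simp: parity_ok_def\<close>)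
  also have "even k \<longleftrightarrow> \<alpha> I" by (simp add: k_def)
  finally show ?thesis by (simp add: I_def)
qed

lemma lar_prio_bound: "lar_prio \<alpha> V l \<le> 2 * length l + 2"
  using hit_le[of V l] by (auto simp: lar_prio_def)

subsection \<open>Formulas as token lists\<close>

text \<open>A token consists of a label (2: quantifier or Boolean operator of the outer logic, 3: operator of the inner
  logic) and its code. Formulas are represented by their tokens in prefix order.\<close>

type_synonym token = "nat \<times> bool list"

primrec pre :: "nat ltlf => token list" where
  "pre (LAtom p) = [(3, [False, False, False] @ enc_nat p)]"
| "pre (LNot \<phi>) = (3, [False, False, True]) # pre \<phi>"
| "pre (LOr \<phi> \<psi>) = (3, [False, True, False]) # pre \<phi> @ pre \<psi>"
| "pre (LAnd \<phi> \<psi>) = (3, [False, True, True]) # pre \<phi> @ pre \<psi>"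
| "pre (LNext \<phi>) = (3, [True, False, False]) # pre \<phi>"
| "pre (LUntil \<phi> \<psi>) = (3, [True, False, True]) # pre \<phi> @ pre \<psi>"

primrec subs :: "'a ltlf => 'a ltlf list" where
  "subs (LAtom p) = [LAtom p]"
| "subs (LNot \<phi>) = LNot \<phi> # subs \<phi>"
| "subs (LOr \<phi> \<psi>) = LOr \<phi> \<psi> # subs \<phi> @ subs \<psi>"
| "subs (LAnd \<phi> \<psi>) = LAnd \<phi> \<psi> # subs \<phi> @ subs \<psi>"
| "subs (LNext \<phi>) = LNext \<phi> # subs \<phi>"
| "subs (LUntil \<phi> \<psi>) = LUntil \<phi> \<psi> # subs \<phi> @ subs \<psi>"

primrec prep :: "nat ltlf plus => token list" where
  "prep (QAll \<phi>) = (2, [False, False, False]) # pre \<phi>"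
| "prep (QEx \<phi>) = (2, [False, False, True]) # pre \<phi>"
| "prep (QInfinitelyMany \<phi>) = (2, [False, True, False]) # pre \<phi>"
| "prep (QAlmostAll \<phi>) = (2, [False, True, True]) # pre \<phi>"
| "prep (QOr \<Psi> \<Psi>') = (2, [True, False, False]) # prep \<Psi> @ prep \<Psi>'"
| "prep (QAnd \<Psi> \<Psi>') = (2, [True, False, True]) # prep \<Psi> @ prep \<Psi>'"
| "prep (QNot \<Psi>) = (2, [True, True, False]) # prep \<Psi>"

primrec subsp :: "'a ltlf plus => 'a ltlf option list" where
  "subsp (QAll \<phi>) = None # map Some (subs \<phi>)"
| "subsp (QEx \<phi>) = None # map Some (subs \<phi>)"
| "subsp (QInfinitelyMany \<phi>) = None # map Some (subs \<phi>)"
| "subsp (QAlmostAll \<phi>) = None # map Some (subs \<phi>)"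
| "subsp (QOr \<Psi> \<Psi>') = None # subsp \<Psi> @ subsp \<Psi>'"
| "subsp (QAnd \<Psi> \<Psi>') = None # subsp \<Psi> @ subsp \<Psi>'"
| "subsp (QNot \<Psi>) = None # subsp \<Psi>"

lemma length_pre: "length (pre \<phi>) = length (subs \<phi>)" by (induction \<phi>) auto
lemma length_prep: "length (prep \<Psi>) = length (subsp \<Psi>)" by (induction \<Psi>) (auto simp: length_pre)
lemma subs_Cons: "\<exists>l. subs \<phi> = \<phi> # l" by (cases \<phi>) auto

definition opt :: "('a => bool) => 'a option => bool" where
  "opt P o' = (case o' of None => False | Some \<phi> => P \<phi>)"

lemma opt_simps [simp]: "opt P None = False" "opt P (Some \<phi>) = P \<phi>" by (auto simp: opt_def)

text \<open>One step of the evaluation of all subformulas. The stack holds the current value of a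
  subformula and its value at the neighbouring position.\<close>

definition cur_val :: "bool list list => bool list => bool => bool \<times> bool => bool \<times> bool => bool" where
  "cur_val a t b x y =
     (if take 3 t = [False, False, False] then drop 3 t \<in> set a
      else if take 3 t = [False, False, True] then \<not> fst x
      else if take 3 t = [False, True, False] then fst x \<or> fst y
      else if take 3 t = [False, True, True] then fst x \<and> fst y
      else if take 3 t = [True, False, False] then snd x
      else fst y \<or> (fst x \<and> b))"

definition fstep :: "bool list list => token \<times> bool => (bool \<times> bool) list \<times> bool list => (bool \<times> bool) list \<times> bool list" where
  "fstep a tb so =
     (if fst (fst tb) = 3
      then (let c = cur_val a (snd (fst tb)) (snd tb) (nthd (False, False) (fst so) 0) (nthd (False, False) (fst so) 1) in
       ((c, snd tb) # (if take 3 (snd (fst tb)) = [False, False, False] then fst so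
          else if take 3 (snd (fst tb)) = [False, False, True] \<or> take 3 (snd (fst tb)) = [True, False, False] then tl (fst so)
          else tl (tl (fst so))), c # snd so))
      else (fst so, False # snd so))"

definition step_vec :: "token list => bool list list => bool list => bool list" where
  "step_vec ts a v = snd (foldr (fstep a) (zip ts v) ([], []))"

text \<open>\<open>P\<close> gives the truth values at a position and \<open>P'\<close> those at the
  neighbour: the next position for LTLf, the previous one for PPLTL. Outside the trace
  \<open>P'\<close> is false throughout, even on negations; this is sound because only
  \<open>LNext\<close> and \<open>LUntil\<close> consult it.\<close>

definition local_rec :: "bool list list => (nat ltlf => bool) => (nat ltlf => bool) => bool" where
  "local_rec a P P' \<longleftrightarrow> (\<forall>p. P (LAtom p) = (enc_nat p \<in> set a)) \<and> (\<forall>\<phi>. P (LNot \<phi>) = (\<not> P \<phi>)) \<and>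
     (\<forall>\<phi> \<psi>. P (LOr \<phi> \<psi>) = (P \<phi> \<or> P \<psi>)) \<and> (\<forall>\<phi> \<psi>. P (LAnd \<phi> \<psi>) = (P \<phi> \<and> P \<psi>)) \<and>
     (\<forall>\<phi>. P (LNext \<phi>) = P' \<phi>) \<and> (\<forall>\<phi> \<psi>. P (LUntil \<phi> \<psi>) = (P \<psi> \<or> (P \<phi> \<and> P' (LUntil \<phi> \<psi>))))"

lemma nthd_Cons: "nthd d (x # xs) 0 = x" "nthd d (x # xs) (Suc i) = nthd d xs i"
  by (simp_all add: nthd_def)

text \<open>Prefix notation is evaluated from the right, so the operands of a token are on the stack
  when it is reached. Values at the neighbour travel along because \<open>LNext\<close> needs that
  of its operand.\<close>

lemma foldr_fstep_pre:
  assumes "local_rec a P P'"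
  shows "foldr (fstep a) (zip (pre \<phi>) (map P' (subs \<phi>))) (stk, out) = ((P \<phi>, P' \<phi>) # stk, map P (subs \<phi>) @ out)"
proof (induction \<phi> arbitrary: stk out)
  case (LAtom p) then show ?case using assms by (simp add: fstep_def cur_val_def local_rec_def Let_def)
next
  case (LUntil \<phi> \<psi>) then show ?case using assms
    by (auto simp: fstep_def cur_val_def local_rec_def nthd_Cons length_pre Let_def)
qed (use assms in \<open>simp_all add: fstep_def cur_val_def local_rec_def nthd_Cons length_pre Let_def\<close>)

lemma fstep_plus: "fstep a ((2, x), b) so = (fst so, False # snd so)" by (simp add: fstep_def)

lemma foldr_fstep_prep:
  assumes "local_rec a P P'"
  shows "snd (foldr (fstep a) (zip (prep \<Psi>) (map (opt P') (subsp \<Psi>))) so) = map (opt P) (subsp \<Psi>) @ snd so"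
proof (induction \<Psi> arbitrary: so)
  case (QOr \<Psi>1 \<Psi>2) then show ?case by (simp add: fstep_plus length_prep)
next
  case (QAnd \<Psi>1 \<Psi>2) then show ?case by (simp add: fstep_plus length_prep)
next
  case (QNot \<Psi>) then show ?case by (simp add: fstep_plus)
next
  case (QAll \<phi>) show ?case by (cases so) (simp add: fstep_plus foldr_fstep_pre[OF assms] comp_def)
next
  case (QEx \<phi>) show ?case by (cases so) (simp add: fstep_plus foldr_fstep_pre[OF assms] comp_def)
next
  case (QInfinitelyMany \<phi>) show ?case by (cases so) (simp add: fstep_plus foldr_fstep_pre[OF assms] comp_def)
next
  case (QAlmostAll \<phi>) show ?case by (cases so) (simp add: fstep_plus foldr_fstep_pre[OF assms] comp_def)
qed

lemma step_vec:
  "local_rec a P P' ==> step_vec (prep \<Psi>) a (map (opt P') (subsp \<Psi>)) = map (opt P) (subsp \<Psi>)"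
  by (simp add: step_vec_def foldr_fstep_prep)

lemma length_step_vec: "length v = length ts ==> length (step_vec ts a v) = length ts"
proof -
  have "length (snd (foldr (fstep a) l so)) = length l + length (snd so)" for l so
    by (induction l) (auto simp: fstep_def Let_def)
  then show "length v = length ts ==> length (step_vec ts a v) = length ts" by (simp add: step_vec_def)
qed

definition zero_vec :: "token list => bool list" where "zero_vec ts = replicate (length ts) False"

lemma zero_vec: "zero_vec (prep \<Psi>) = map (opt (%_. False)) (subsp \<Psi>)"
  by (rule nth_equalityI) (auto simp: zero_vec_def length_prep opt_def split: option.split)

definition codes :: "nat set list => bool list list list => bool" where
  "codes t as \<longleftrightarrow> list_all2 (%s a. set a = enc_nat ` s) t as"

lemma enc_nat_inj: "inj enc_nat" by (rule prefix_code_inj[OF prefix_code_enc_nat])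

lemma ltlf_local_rec:
  assumes i: "i < length t" and a: "set a = enc_nat ` (t ! i)"
  shows "local_rec a (%\<phi>. i < length t \<and> ltlf_sat t i \<phi>) (%\<phi>. Suc i < length t \<and> ltlf_sat t (Suc i) \<phi>)"
proof -
  have "ltlf_sat t i (LUntil \<phi> \<psi>) \<longleftrightarrow> ltlf_sat t i \<psi> \<or> (ltlf_sat t i \<phi> \<and> Suc i < length t \<and> ltlf_sat t (Suc i) (LUntil \<phi> \<psi>))" (is "?l = ?r") for \<phi> \<psi>
  proof
    assume ?l
    then obtain j where j: "i \<le> j" "j < length t" "ltlf_sat t j \<psi>" "\<And>k. i \<le> k ==> k < j ==> ltlf_sat t k \<phi>" by auto
    show ?r
    proof (cases "i = j")
      case False
      then have "\<exists>j. Suc i \<le> j \<and> j < length t \<and> ltlf_sat t j \<psi> \<and> (\<forall>k. Suc i \<le> k \<and> k < j \<longrightarrow> ltlf_sat t k \<phi>)"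
        using j by (intro exI[of _ j]) auto
      then show ?thesis using False j by (auto simp: Suc_le_eq)
    qed (use j in simp)
  next
    assume ?r
    then show ?l
    proof
      assume "ltlf_sat t i \<psi>" then show ?l using i by auto
    next
      assume r: "ltlf_sat t i \<phi> \<and> Suc i < length t \<and> ltlf_sat t (Suc i) (LUntil \<phi> \<psi>)"
      then obtain j where j: "Suc i \<le> j" "j < length t" "ltlf_sat t j \<psi>" "\<And>k. Suc i \<le> k ==> k < j ==> ltlf_sat t k \<phi>" by auto
      then have "\<And>k. i \<le> k ==> k < j ==> ltlf_sat t k \<phi>" using r by (metis Suc_leI le_neq_implies_less)
      then show ?l using j i by (auto intro!: exI[of _ j])
    qed
  qed
  then show ?thesis using assms
    by (auto simp: local_rec_def inj_image_mem_iff[OF enc_nat_inj] simp del: ltlf_sat.simps(6))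
qed

primrec mir :: "'a ltlf => 'a ppltl" where
  "mir (LAtom p) = PAtom p"
| "mir (LNot \<phi>) = PNot (mir \<phi>)"
| "mir (LOr \<phi> \<psi>) = POr (mir \<phi>) (mir \<psi>)"
| "mir (LAnd \<phi> \<psi>) = PAnd (mir \<phi>) (mir \<psi>)"
| "mir (LNext \<phi>) = PYesterday (mir \<phi>)"
| "mir (LUntil \<phi> \<psi>) = PSince (mir \<phi>) (mir \<psi>)"

lemma ppltl_local_rec:
  assumes a: "set a = enc_nat ` (t ! i)"
  shows "local_rec a (%\<phi>. ppltl_sat t i (mir \<phi>)) (%\<phi>. 0 < i \<and> ppltl_sat t (i - 1) (mir \<phi>))"
proof -
  have "ppltl_sat t i (PSince \<phi> \<psi>) \<longleftrightarrow> ppltl_sat t i \<psi> \<or> (ppltl_sat t i \<phi> \<and> 0 < i \<and> ppltl_sat t (i - 1) (PSince \<phi> \<psi>))" (is "?l = ?r") for \<phi> \<psi>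
  proof
    assume ?l
    then obtain j where j: "j \<le> i" "ppltl_sat t j \<psi>" "\<And>k. j < k ==> k \<le> i ==> ppltl_sat t k \<phi>" by auto
    show ?r
    proof (cases "i = j")
      case False
      then have "\<exists>j. j \<le> i - 1 \<and> ppltl_sat t j \<psi> \<and> (\<forall>k. j < k \<and> k \<le> i - 1 \<longrightarrow> ppltl_sat t k \<phi>)"
        using j by (intro exI[of _ j]) auto
      then show ?thesis using False j by auto
    qed (use j in simp)
  next
    assume ?r
    then show ?l
    proof
      assume "ppltl_sat t i \<psi>" then show ?l by (auto intro!: exI[of _ i])
    next
      assume r: "ppltl_sat t i \<phi> \<and> 0 < i \<and> ppltl_sat t (i - 1) (PSince \<phi> \<psi>)"
      then obtain j where j: "j \<le> i - 1" "ppltl_sat t j \<psi>" "\<And>k. j < k ==> k \<le> i - 1 ==> ppltl_sat t k \<phi>" by auto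
      have "ppltl_sat t k \<phi>" if "j < k" "k \<le> i" for k using that j r by (cases "k = i") auto
      then show ?l using j r by (auto intro!: exI[of _ j])
    qed
  qed
  then show ?thesis using assms
    by (auto simp: local_rec_def inj_image_mem_iff[OF enc_nat_inj] simp del: ppltl_sat.simps(6))
qed

text \<open>Truth at the first position is computed from the last letter backwards, whereas
  \<open>ppltl_vec\<close> reads forwards. A device that reads an LTLf trace from the left must
  therefore store functions on vectors, and this causes the additional exponential.\<close>

lemma ltlf_vec:
  assumes c: "codes t as"
  shows "foldr (step_vec (prep \<Psi>)) as (zero_vec (prep \<Psi>)) = map (opt (%\<phi>. 0 < length t \<and> ltlf_sat t 0 \<phi>)) (subsp \<Psi>)"
proof -
  have len: "length as = length t" using c by (simp add: codes_def list_all2_lengthD)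
  have "foldr (step_vec (prep \<Psi>)) (drop (length t - n) as) (zero_vec (prep \<Psi>)) =
      map (opt (%\<phi>. length t - n < length t \<and> ltlf_sat t (length t - n) \<phi>)) (subsp \<Psi>)" if "n \<le> length t" for n
    using that
  proof (induction n)
    case 0
    then show ?case by (simp add: len zero_vec)
  next
    case (Suc n)
    let ?i = "length t - Suc n"
    have i: "Suc ?i = length t - n" "?i < length t" using Suc by auto
    have "set (as ! ?i) = enc_nat ` (t ! ?i)" using c i unfolding codes_def list_all2_conv_all_nth by blast
    from ltlf_local_rec[OF i(2) this] Suc i
    show ?case by (simp add: Cons_nth_drop_Suc[symmetric] len step_vec)
  qed
  from this[of "length t"] show ?thesis by simp
qed

lemma ppltl_vec:
  assumes c: "codes t as" "as \<noteq> []"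
  shows "foldl (%v a. step_vec (prep \<Psi>) a v) (zero_vec (prep \<Psi>)) as = map (opt (%\<phi>. ppltl_sat t (length t - 1) (mir \<phi>))) (subsp \<Psi>)"
proof -
  have len: "length as = length t" using c by (simp add: codes_def list_all2_lengthD)
  have "foldl (%v a. step_vec (prep \<Psi>) a v) (zero_vec (prep \<Psi>)) (take n as) =
      map (opt (%\<phi>. 0 < n \<and> ppltl_sat t (n - 1) (mir \<phi>))) (subsp \<Psi>)" if "n \<le> length t" for n
    using that
  proof (induction n)
    case 0
    then show ?case by (simp add: zero_vec)
  next
    case (Suc n)
    have "set (as ! n) = enc_nat ` (t ! n)" using c Suc unfolding codes_def list_all2_conv_all_nth by auto
    from ppltl_local_rec[OF this] Suc
    show ?case by (simp add: take_Suc_conv_app_nth len step_vec)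
  qed
  note * = this[of "length t"]
  have "0 < length t" using c len by (cases as) auto
  with * show ?thesis by (simp add: len)
qed

subsection \<open>The acceptance condition\<close>

text \<open>The colours are the positions of the tokens. Only quantifiers ever produce a colour; those of
  \<open>QAll\<close> and \<open>QEx\<close> are latched.\<close>

definition upc :: "token list => bool list => bool list => bool list" where
  "upc ts u v = map (%i. let t = nthd (0, []) ts i; b = nthd False v (Suc i); l = nthd False u i in
     if fst t = 2 then
       (if snd t = [False, False, False] then l \<or> \<not> b
        else if snd t = [False, False, True] then l \<or> b
        else if snd t = [False, True, False] then b
        else if snd t = [False, True, True] then \<not> b else False)
     else False) [0..<length ts]"

text \<open>The colours of \<open>QAll\<close> and \<open>QAlmostAll\<close> signal violations, so
  these quantifiers hold iff their colour does not recur. Tokens of the inner logic leave the stack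
  unchanged.\<close>

definition aev :: "token list => nat set => nat => bool list => bool list" where
  "aev ts I i stk = (let t = nthd (0, []) ts i; x = nthd False stk 0; y = nthd False stk 1 in
     if fst t = 2 then
       (if snd t = [False, False, False] \<or> snd t = [False, True, True] then (i \<notin> I) # stk
        else if snd t = [False, False, True] \<or> snd t = [False, True, False] then (i \<in> I) # stk
        else if snd t = [True, False, False] then (x \<or> y) # tl (tl stk)
        else if snd t = [True, False, True] then (x \<and> y) # tl (tl stk)
        else (\<not> x) # tl stk)
     else stk)"

definition alpha :: "token list => nat set => bool" where
  "alpha ts I = nthd False (foldr (aev ts I) [0..<length ts] []) 0"

lemma aev_pre:
  assumes "ts = xs @ pre \<phi> @ ys" "length xs = k"
  shows "foldr (aev ts I) [k..<k + length (pre \<phi>)] stk = stk"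
proof -
  have p: "\<forall>t\<in>set (pre \<phi>). fst t = 3" by (induction \<phi>) auto
  have "aev ts I i s = s" if "i \<in> {k..<k + length (pre \<phi>)}" for i s
  proof -
    have "i < length ts" "ts ! i = pre \<phi> ! (i - k)" "i - k < length (pre \<phi>)" using that assms by (auto simp: nth_append)
    then show ?thesis using p by (simp add: aev_def Let_def)
  qed
  then have "foldr (aev ts I) l stk = stk" if "set l \<subseteq> {k..<k + length (pre \<phi>)}" for l
    using that by (induction l) auto
  then show ?thesis by simp
qed

lemma upt_split: "[k..<k + Suc (a + b)] = k # [Suc k..<Suc k + a] @ [Suc k + a..<Suc k + a + b]"
proof -
  have "[Suc k..<Suc k + a + b] = [Suc k..<Suc k + a] @ [Suc k + a..<Suc k + a + b]"
    by (rule upt_add_eq_append) simp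
  moreover have "[k..<k + Suc (a + b)] = k # [Suc k..<Suc k + a + b]"
    using upt_conv_Cons[of k "k + Suc (a + b)"] by (simp add: add.assoc del: upt_Suc)
  ultimately show ?thesis by simp
qed

text \<open>Latching turns a property of a single prefix into a recurrence property, so all four
  quantifiers depend only on the set of recurring colours.\<close>

lemma inf_latch: "(\<And>n. U (Suc n) \<longleftrightarrow> U n \<or> b n) ==> \<not> U 0 ==> (\<exists>\<^sub>\<infinity>n. U (Suc n)) \<longleftrightarrow> (\<exists>n. b n)"
proof -
  assume U: "\<And>n. U (Suc n) \<longleftrightarrow> U n \<or> b n" "\<not> U 0"
  then have *: "U n \<longleftrightarrow> (\<exists>m<n. b m)" for n by (induction n) (auto simp: less_Suc_eq)
  show ?thesis unfolding * INFM_nat_le by (meson lessI less_Suc_eq_le less_le_trans max.cobounded1 max.cobounded2)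
qed

text \<open>In prefix order the root of the inner formula is the token directly after its
  quantifier; hence \<open>upc\<close> reads the truth value at index \<open>Suc i\<close>.\<close>

lemma aev_prep:
  assumes "ts = xs @ prep \<Psi> @ ys" "length xs = k"
    and us0: "\<And>i. nthd False (us 0) i = False" and us: "\<And>n. us (Suc n) = upc ts (us n) (v n)"
    and v: "\<And>n i. i < length (subsp \<Psi>) ==> nthd False (v n) (k + i) = opt (S n) (subsp \<Psi> ! i)"
    and I: "I = {i. \<exists>\<^sub>\<infinity>n. nthd False (us (Suc n)) i}" and \<tau>: "\<tau> \<in> inf_traces AP"
    and S: "\<And>n \<phi>. S n \<phi> \<longleftrightarrow> trace_prefix \<tau> n \<in> L AP \<phi>"
  shows "foldr (aev ts I) [k..<k + length (prep \<Psi>)] stk = (\<tau> \<in> plus_lang L AP \<Psi>) # stk"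
  using assms(1,2) v
proof (induction \<Psi> arbitrary: xs ys k stk)
  case (QOr \<Psi>1 \<Psi>2)
  let ?k1 = "Suc k" and ?k2 = "Suc k + length (prep \<Psi>1)"
  have 2: "foldr (aev ts I) [?k2..<?k2 + length (prep \<Psi>2)] s = (\<tau> \<in> plus_lang L AP \<Psi>2) # s" for s
  proof (rule QOr.IH(2)[where xs = "xs @ [(2, [True, False, False])] @ prep \<Psi>1" and ys = ys])
    fix n i assume "i < length (subsp \<Psi>2)"
    then show "nthd False (v n) (?k2 + i) = opt (S n) (subsp \<Psi>2 ! i)"
      using QOr.prems(3)[of "Suc (length (subsp \<Psi>1) + i)" n] by (simp add: nth_append length_prep add.assoc)
  qed (use QOr.prems in auto)
  have 1: "foldr (aev ts I) [?k1..<?k1 + length (prep \<Psi>1)] s = (\<tau> \<in> plus_lang L AP \<Psi>1) # s" for s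
  proof (rule QOr.IH(1)[where xs = "xs @ [(2, [True, False, False])]" and ys = "prep \<Psi>2 @ ys"])
    fix n i assume "i < length (subsp \<Psi>1)"
    then show "nthd False (v n) (?k1 + i) = opt (S n) (subsp \<Psi>1 ! i)"
      using QOr.prems(3)[of "Suc i" n] by (simp add: nth_append)
  qed (use QOr.prems in auto)
  have "length (prep (QOr \<Psi>1 \<Psi>2)) = Suc (length (prep \<Psi>1) + length (prep \<Psi>2))" by simp
  then have e: "[k..<k + length (prep (QOr \<Psi>1 \<Psi>2))] = k # [?k1..<?k2] @ [?k2..<?k2 + length (prep \<Psi>2)]"
    by (simp only: upt_split)
  have "nthd (0, []) ts k = (2, [True, False, False])" using QOr.prems by (simp add: nth_append)
  then show ?case unfolding e foldr_append foldr_Cons o_apply 2 1 by (simp add: aev_def nthd_Cons)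
next
  case (QAnd \<Psi>1 \<Psi>2)
  let ?k1 = "Suc k" and ?k2 = "Suc k + length (prep \<Psi>1)"
  have 2: "foldr (aev ts I) [?k2..<?k2 + length (prep \<Psi>2)] s = (\<tau> \<in> plus_lang L AP \<Psi>2) # s" for s
  proof (rule QAnd.IH(2)[where xs = "xs @ [(2, [True, False, True])] @ prep \<Psi>1" and ys = ys])
    fix n i assume "i < length (subsp \<Psi>2)"
    then show "nthd False (v n) (?k2 + i) = opt (S n) (subsp \<Psi>2 ! i)"
      using QAnd.prems(3)[of "Suc (length (subsp \<Psi>1) + i)" n] by (simp add: nth_append length_prep add.assoc)
  qed (use QAnd.prems in auto)
  have 1: "foldr (aev ts I) [?k1..<?k1 + length (prep \<Psi>1)] s = (\<tau> \<in> plus_lang L AP \<Psi>1) # s" for s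
  proof (rule QAnd.IH(1)[where xs = "xs @ [(2, [True, False, True])]" and ys = "prep \<Psi>2 @ ys"])
    fix n i assume "i < length (subsp \<Psi>1)"
    then show "nthd False (v n) (?k1 + i) = opt (S n) (subsp \<Psi>1 ! i)"
      using QAnd.prems(3)[of "Suc i" n] by (simp add: nth_append)
  qed (use QAnd.prems in auto)
  have "length (prep (QAnd \<Psi>1 \<Psi>2)) = Suc (length (prep \<Psi>1) + length (prep \<Psi>2))" by simp
  then have e: "[k..<k + length (prep (QAnd \<Psi>1 \<Psi>2))] = k # [?k1..<?k2] @ [?k2..<?k2 + length (prep \<Psi>2)]"
    by (simp only: upt_split)
  have "nthd (0, []) ts k = (2, [True, False, True])" using QAnd.prems by (simp add: nth_append)
  then show ?case unfolding e foldr_append foldr_Cons o_apply 2 1 by (simp add: aev_def nthd_Cons)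
next
  case (QNot \<Psi>)
  have 1: "foldr (aev ts I) [Suc k..<Suc k + length (prep \<Psi>)] s = (\<tau> \<in> plus_lang L AP \<Psi>) # s" for s
  proof (rule QNot.IH[where xs = "xs @ [(2, [True, True, False])]" and ys = ys])
    fix n i assume "i < length (subsp \<Psi>)"
    then show "nthd False (v n) (Suc k + i) = opt (S n) (subsp \<Psi> ! i)"
      using QNot.prems(3)[of "Suc i" n] by (simp add: nth_append)
  qed (use QNot.prems in auto)
  have e: "[k..<k + length (prep (QNot \<Psi>))] = k # [Suc k..<Suc k + length (prep \<Psi>)]"
    by (simp add: upt_conv_Cons del: upt_Suc)
  have "nthd (0, []) ts k = (2, [True, True, False])" using QNot.prems by (simp add: nth_append)
  then show ?case unfolding e foldr_append foldr_Cons o_apply 1 using \<tau> by (simp add: aev_def nthd_Cons)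
next
  case (QAll \<phi>)
  have t: "nthd (0, []) ts k = (2, [False, False, False])" "k < length ts" using QAll.prems by (simp_all add: nth_append)
  have b: "nthd False (v n) (Suc k) = S n \<phi>" for n using QAll.prems(3)[of 1 n] subs_Cons[of \<phi>] by auto
  have "nthd False (us (Suc n)) k \<longleftrightarrow> nthd False (us n) k \<or> \<not> S n \<phi>" for n using t by (simp add: us upc_def b)
  from inf_latch[of "%n. nthd False (us n) k", OF this] us0 have kI: "k \<in> I \<longleftrightarrow> (\<exists>n. \<not> S n \<phi>)" by (simp add: I)
  have e: "[k..<k + length (prep (QAll \<phi>))] = k # [Suc k..<Suc k + length (pre \<phi>)]" by (simp add: upt_conv_Cons del: upt_Suc)
  have f: "foldr (aev ts I) [Suc k..<Suc k + length (pre \<phi>)] stk = stk"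
    by (rule aev_pre[of _ "xs @ [(2, [False, False, False])]" _ ys]) (use QAll.prems in auto)
  show ?case unfolding e foldr_Cons o_apply f using kI \<tau> S t by (simp add: aev_def del: upt_Suc)
next
  case (QEx \<phi>)
  have t: "nthd (0, []) ts k = (2, [False, False, True])" "k < length ts" using QEx.prems by (simp_all add: nth_append)
  have b: "nthd False (v n) (Suc k) = S n \<phi>" for n using QEx.prems(3)[of 1 n] subs_Cons[of \<phi>] by auto
  have "nthd False (us (Suc n)) k \<longleftrightarrow> nthd False (us n) k \<or> S n \<phi>" for n using t by (simp add: us upc_def b)
  from inf_latch[of "%n. nthd False (us n) k", OF this] us0 have kI: "k \<in> I \<longleftrightarrow> (\<exists>n. S n \<phi>)" by (simp add: I)
  have e: "[k..<k + length (prep (QEx \<phi>))] = k # [Suc k..<Suc k + length (pre \<phi>)]" by (simp add: upt_conv_Cons del: upt_Suc)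
  have f: "foldr (aev ts I) [Suc k..<Suc k + length (pre \<phi>)] stk = stk"
    by (rule aev_pre[of _ "xs @ [(2, [False, False, True])]" _ ys]) (use QEx.prems in auto)
  show ?case unfolding e foldr_Cons o_apply f using kI \<tau> S t by (simp add: aev_def del: upt_Suc)
next
  case (QInfinitelyMany \<phi>)
  have t: "nthd (0, []) ts k = (2, [False, True, False])" "k < length ts" using QInfinitelyMany.prems by (simp_all add: nth_append)
  have b: "nthd False (v n) (Suc k) = S n \<phi>" for n using QInfinitelyMany.prems(3)[of 1 n] subs_Cons[of \<phi>] by auto
  have "nthd False (us (Suc n)) k \<longleftrightarrow> S n \<phi>" for n using t by (simp add: us upc_def b)
  then have kI: "k \<in> I \<longleftrightarrow> (\<exists>\<^sub>\<infinity>n. S n \<phi>)" by (simp add: I)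
  have e: "[k..<k + length (prep (QInfinitelyMany \<phi>))] = k # [Suc k..<Suc k + length (pre \<phi>)]" by (simp add: upt_conv_Cons del: upt_Suc)
  have f: "foldr (aev ts I) [Suc k..<Suc k + length (pre \<phi>)] stk = stk"
    by (rule aev_pre[of _ "xs @ [(2, [False, True, False])]" _ ys]) (use QInfinitelyMany.prems in auto)
  show ?case unfolding e foldr_Cons o_apply f using kI \<tau> S t by (simp add: aev_def del: upt_Suc)
next
  case (QAlmostAll \<phi>)
  have t: "nthd (0, []) ts k = (2, [False, True, True])" "k < length ts" using QAlmostAll.prems by (simp_all add: nth_append)
  have b: "nthd False (v n) (Suc k) = S n \<phi>" for n using QAlmostAll.prems(3)[of 1 n] subs_Cons[of \<phi>] by auto
  have "nthd False (us (Suc n)) k \<longleftrightarrow> \<not> S n \<phi>" for n using t by (simp add: us upc_def b)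
  then have "k \<in> I \<longleftrightarrow> (\<exists>\<^sub>\<infinity>n. \<not> S n \<phi>)" by (simp add: I)
  then have kI: "k \<notin> I \<longleftrightarrow> (\<forall>\<^sub>\<infinity>n. S n \<phi>)" by (simp only: not_INFM not_not)
  have e: "[k..<k + length (prep (QAlmostAll \<phi>))] = k # [Suc k..<Suc k + length (pre \<phi>)]" by (simp add: upt_conv_Cons del: upt_Suc)
  have f: "foldr (aev ts I) [Suc k..<Suc k + length (pre \<phi>)] stk = stk"
    by (rule aev_pre[of _ "xs @ [(2, [False, True, True])]" _ ys]) (use QAlmostAll.prems in auto)
  show ?case unfolding e foldr_Cons o_apply f using kI \<tau> S t by (simp add: aev_def del: upt_Suc)
qed

theorem alpha_correct:
  assumes us0: "us 0 = zero_vec (prep \<Psi>)" and us: "\<And>n. us (Suc n) = upc (prep \<Psi>) (us n) (v n)"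
    and v: "\<And>n. v n = map (opt (S n)) (subsp \<Psi>)" and \<tau>: "\<tau> \<in> inf_traces AP"
    and S: "\<And>n \<phi>. S n \<phi> \<longleftrightarrow> trace_prefix \<tau> n \<in> L AP \<phi>"
  shows "alpha (prep \<Psi>) {i. \<exists>\<^sub>\<infinity>n. nthd False (us (Suc n)) i} \<longleftrightarrow> \<tau> \<in> plus_lang L AP \<Psi>"
proof -
  have z: "nthd False (replicate n False) i = False" for n i
    by (cases "i < n") (simp, simp add: nthd_def)
  have "foldr (aev (prep \<Psi>) {i. \<exists>\<^sub>\<infinity>n. nthd False (us (Suc n)) i}) [0..<0 + length (prep \<Psi>)] [] = [\<tau> \<in> plus_lang L AP \<Psi>]"
    by (rule aev_prep[where xs = "[]" and ys = "[]" and us = us and v = v and S = S])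
      (use us v \<tau> S in \<open>auto simp: us0 zero_vec_def z\<close>)
  then show ?thesis by (simp add: alpha_def nthd_Cons)
qed

subsection \<open>Solving the game\<close>

text \<open>Enumerations are truncated to length \<open>P\<close>, which keeps them polynomial in their arguments.\<close>

definition tnl :: "nat => nat => 'a list => 'a list list" where
  "tnl P n xs = foldl (%acc _. take P (concat (map (%ys. map (%y. y # ys) xs) acc))) [[]] (replicate n (0 :: nat))"

lemma tnl: "length xs ^ n \<le> P ==> tnl P n xs = List.n_lists n xs"
proof -
  assume P: "length xs ^ n \<le> P"
  have "((%acc. take P (concat (map (%ys. map (%y. y # ys) xs) acc))) ^^ k) [[]] = List.n_lists k xs" if "k \<le> n" for k
    using that
  proof (induction k)
    case (Suc k)
    show ?case
    proof (cases "xs = []")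
      case False
      have "length (List.n_lists (Suc k) xs) \<le> length xs ^ n"
        unfolding length_n_lists using Suc False by (intro power_increasing) (auto simp: Suc_le_eq)
      then have "take P (List.n_lists (Suc k) xs) = List.n_lists (Suc k) xs" using P by simp
      then show ?thesis using Suc by simp
    qed (use Suc in simp)
  qed simp
  then show ?thesis by (simp add: tnl_def foldl_funpow)
qed

definition tsubs :: "nat => 'a list => 'a list list" where
  "tsubs P xs = foldr (%x acc. take P (map ((#) x) acc @ acc)) xs [[]]"

lemma tsubs: "2 ^ length xs \<le> P ==> tsubs P xs = subseqs xs"
proof (induction xs)
  case (Cons x xs)
  then have "tsubs P xs = subseqs xs" by simp
  moreover have "length (subseqs (x # xs)) \<le> P" using Cons.prems by (simp only: length_subseqs)
  ultimately show ?case by (simp add: tsubs_def Let_def)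
qed (auto simp: tsubs_def)

text \<open>The greatest fixed point of the controllable predecessor. Every effective round removes
  a position, so as many rounds as \<open>S\<close> has elements suffice; the list \<open>S\<close>
  itself serves as the round counter.\<close>

definition winset :: "('s => 'x => 'y => 's) => 'x list => 'y list => 's list => 's list" where
  "winset step Xs Ys S = foldl (%W _. filter (%s. \<exists>x\<in>set Xs. \<forall>y\<in>set Ys. step s x y \<in> set W) W) S S"

lemma winset_subset: "set (winset step Xs Ys S) \<subseteq> set S"
proof -
  have "set (foldl (%W _. filter (p W) W) W l) \<subseteq> set W" for p :: "'a list => 'a => bool" and W and l :: "'a list"
    by (induction l arbitrary: W) (simp, force)
  then show ?thesis by (simp add: winset_def)
qed

lemma winset_fixed:
  assumes "s \<in> set (winset step Xs Ys S)"
  shows "\<exists>x\<in>set Xs. \<forall>y\<in>set Ys. step s x y \<in> set (winset step Xs Ys S)"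
proof -
  define f where "f W = filter (%s. \<exists>x\<in>set Xs. \<forall>y\<in>set Ys. step s x y \<in> set W) W" for W
  have e: "foldl (%W _. f W) W l = (f ^^ length l) W" for W and l :: "'a list"
    by (induction l arbitrary: W) (auto simp: funpow_swap1)
  have "f ((f ^^ n) W) = (f ^^ n) W" if "length W \<le> n" for W n
    using that
  proof (induction n arbitrary: W)
    case 0 then show ?case by (simp add: f_def)
  next
    case (Suc n)
    show ?case
    proof (cases "f W = W")
      case True
      then have "(f ^^ k) W = W" for k by (induction k) auto
      then show ?thesis using True by simp
    next
      case False
      then obtain s where "s \<in> set W" "\<not> (\<exists>x\<in>set Xs. \<forall>y\<in>set Ys. step s x y \<in> set W)"
        unfolding f_def filter_id_conv by blast
      then have "length (f W) < length W" unfolding f_def by (rule length_filter_less)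
      then show ?thesis using Suc by (simp add: funpow_swap1)
    qed
  qed
  from this[of S "length S"] have "f (winset step Xs Ys S) = winset step Xs Ys S"
    using e[of S S] by (simp add: winset_def f_def)
  then show ?thesis using assms unfolding f_def filter_id_conv by (rule bspec)
qed

lemma winset_greatest:
  assumes "G \<subseteq> set S" "\<And>s. s \<in> G ==> \<exists>x\<in>set Xs. \<forall>y\<in>set Ys. step s x y \<in> G"
  shows "G \<subseteq> set (winset step Xs Ys S)"
proof -
  have "G \<subseteq> set (foldl (%W _. filter (%s. \<exists>x\<in>set Xs. \<forall>y\<in>set Ys. step s x y \<in> set W) W) W l)" if "G \<subseteq> set W" for W and l :: "'a list"
    using that
  proof (induction l arbitrary: W)
    case (Cons a l)
    have "G \<subseteq> set (filter (%s. \<exists>x\<in>set Xs. \<forall>y\<in>set Ys. step s x y \<in> set W) W)" using assms(2) Cons.prems by fastforce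
    then show ?case using Cons.IH by simp
  qed simp
  then show ?thesis using assms(1) by (simp add: winset_def)
qed

section \<open>Game positions, strategy tables and Moore machines\<close>

definition code_nat :: "bool list => nat" where "code_nat = inv enc_nat"

lemma code_nat [simp]: "code_nat (enc_nat n) = n" by (simp add: code_nat_def enc_nat_inj)

type_synonym env = "token list \<times> bool list list"

definition envof :: "nat ltlf plus => env" where
  "envof \<Psi> = (prep \<Psi>, List.n_lists (length (prep \<Psi>)) [False, True])"

type_synonym 'd qstate = "'d \<times> bool list \<times> nat list \<times> nat"

text \<open>The procedure handles atoms only through their codes. This decoding belongs to the
  correctness statements and is never executed.\<close>

definition machine :: "(bool list list \<times> (bool list list \<times> nat) list) list => moore" where
  "machine = map (%(x, ts). (map code_nat x, map (%(y, q). (map code_nat y, q)) ts))"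

text \<open>What a logic has to provide: an automaton whose state determines the truth values of all
  subformulas on the prefix read so far, and a list of at most \<open>nd m\<close> states closed
  under its steps. \<open>Ds\<close> receives \<open>P\<close> as the length at which enumerations
  are truncated.\<close>

locale vmachine =
  fixes S :: "nat set list => nat ltlf => bool"
    and d0 :: "env => 'd::data" and updd :: "env => bool list list => 'd => 'd"
    and vecof :: "env => 'd => bool list" and Ds :: "nat => env => 'd list" and nd :: "nat => nat"
  assumes vec: "codes t as ==> as \<noteq> [] ==>
      vecof (envof \<Psi>) (foldl (%d a. updd (envof \<Psi>) a d) (d0 (envof \<Psi>)) as) = map (opt (S t)) (subsp \<Psi>)"
    and Ds: "nd (length (prep \<Psi>)) \<le> P ==> d0 (envof \<Psi>) \<in> set (Ds P (envof \<Psi>))"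
      "nd (length (prep \<Psi>)) \<le> P ==> d \<in> set (Ds P (envof \<Psi>)) ==> updd (envof \<Psi>) a d \<in> set (Ds P (envof \<Psi>))"
      "nd (length (prep \<Psi>)) \<le> P ==> length (Ds P (envof \<Psi>)) \<le> nd (length (prep \<Psi>))"
begin

definition L :: "nat set => nat ltlf => nat set list set" where
  "L AP \<phi> = {t \<in> lists (Pow AP). t \<noteq> [] \<and> S t \<phi>}"

text \<open>The priority of the latest letter is stored in the state because
  \<open>parity_game\<close> attaches priorities to states.\<close>

definition qtrans :: "env => bool list list => 'd qstate => 'd qstate" where
  "qtrans env a q = (let d' = updd env a (fst q); u' = upc (fst env) (fst (snd q)) (vecof env d');
     l = fst (snd (snd q)) in
     (d', (u', (mtf (nthd False u') l, lar_prio (alpha (fst env)) (nthd False u') l))))"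

definition trans :: "env => bool list list => 'd qstate \<times> nat list => 'd qstate \<times> nat list" where
  "trans env a s = (qtrans env a (fst s), upd (snd s) (snd (snd (snd (qtrans env a (fst s))))))"

text \<open>The initial priority 0 is arbitrary, since a parity condition ignores finitely many
  positions. There are \<open>2 * m + 3\<close> counters because the priorities of a record of
  length \<open>m\<close> are at most \<open>2 * m + 2\<close>.\<close>

definition init :: "env => 'd qstate \<times> nat list" where
  "init env = ((d0 env, (zero_vec (fst env), ([0..<length (fst env)], 0))), replicate (2 * length (fst env) + 3) 0)"

definition allS :: "nat => nat => env => ('d qstate \<times> nat list) list" where
  "allS P B env = concat (map (%d. concat (map (%u. concat (map (%l. concat (map (%p. map (%c. ((d, (u, (l, p))), c))
     (tnl P (2 * length (fst env) + 3) [0..<B])) [0..<2 * length (fst env) + 3]))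
     (tnl P (length (fst env)) [0..<length (fst env)]))) (snd env))) (Ds P env))"

definition W :: "nat => nat => env => bool list list list => bool list list list => ('d qstate \<times> nat list) list" where
  "W P B env Xs Ys = winset (%s x y. trans env (x @ y) s) Xs Ys (allS P B env)"

text \<open>Position 0 of a Moore machine is initial, hence the initial game position is moved to
  the front.\<close>

definition WS :: "nat => nat => env => bool list list list => bool list list list => ('d qstate \<times> nat list) list" where
  "WS P B env Xs Ys = init env # filter (%s. s \<noteq> init env) (W P B env Xs Ys)"

definition choice :: "env => bool list list list => bool list list list => ('d qstate \<times> nat list) list => 'd qstate \<times> nat list => bool list list" where
  "choice env Xs Ys ws s = first_of [] (%x. \<forall>y\<in>set Ys. trans env (x @ y) s \<in> set ws) Xs"

definition index :: "env => ('d qstate \<times> nat list) list => 'd qstate \<times> nat list => nat" where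
  "index env ws s = first_of 0 (%i. nthd (init env) ws i = s) [0..<length ws]"

definition table :: "env => bool list list list => bool list list list => ('d qstate \<times> nat list) list =>
    (bool list list \<times> (bool list list \<times> nat) list) list" where
  "table env Xs Ys ws = map (%s. (choice env Xs Ys ws s,
     map (%y. (y, index env ws (trans env (choice env Xs Ys ws s @ y) s))) Ys)) ws"

text \<open>Joins \<open>alpha_correct\<close> and \<open>lar_correct\<close>: recurring colours
  decide the formula, and the priorities decide the condition on recurring colours.\<close>

lemma run_lemma:
  assumes a: "\<And>i. set (a i) = enc_nat ` \<tau> i" and \<tau>: "\<tau> \<in> inf_traces AP"
    and q0: "q 0 = fst (init (envof \<Psi>))" and q: "\<And>i. q (Suc i) = qtrans (envof \<Psi>) (a i) (q i)"
  shows "parity_ok (%i. snd (snd (snd (q i)))) \<longleftrightarrow> \<tau> \<in> plus_lang L AP \<Psi>"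
proof -
  define m where "m = length (prep \<Psi>)"
  have e1: "fst (envof \<Psi>) = prep \<Psi>" by (simp add: envof_def)
  have d: "fst (q n) = foldl (%d a. updd (envof \<Psi>) a d) (d0 (envof \<Psi>)) (map a [0..<n])" for n
    by (induction n) (auto simp: q0 init_def q qtrans_def Let_def)
  have cod: "codes (trace_prefix \<tau> n) (map a [0..<Suc n])" for n
    unfolding codes_def trace_prefix_def list_all2_conv_all_nth using a by (auto simp del: upt_Suc)
  define v where "v n = vecof (envof \<Psi>) (fst (q (Suc n)))" for n
  have v: "v n = map (opt (S (trace_prefix \<tau> n))) (subsp \<Psi>)" for n
    unfolding v_def d using vec[OF cod[of n]] by simp
  define us where "us n = fst (snd (q n))" for n
  have us: "us 0 = zero_vec (prep \<Psi>)" "us (Suc n) = upc (prep \<Psi>) (us n) (v n)" for n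
    by (simp_all add: us_def q0 init_def q qtrans_def Let_def v_def e1)
  define l where "l n = fst (snd (snd (q n)))" for n
  define V where "V n = nthd False (us (Suc n))" for n
  have l: "l 0 = [0..<m]" "l (Suc n) = mtf (V n) (l n)" for n
    by (simp_all add: l_def q0 init_def q qtrans_def Let_def V_def us_def e1 m_def)
  have p: "snd (snd (snd (q (Suc n)))) = lar_prio (alpha (prep \<Psi>)) (V n) (l n)" for n
    by (simp add: l_def q qtrans_def Let_def V_def us_def e1)
  have S: "S (trace_prefix \<tau> n) \<phi> \<longleftrightarrow> trace_prefix \<tau> n \<in> L AP \<phi>" for n \<phi>
  proof -
    have "trace_prefix \<tau> n \<in> lists (Pow AP)" "trace_prefix \<tau> n \<noteq> []"
      using \<tau> by (force simp: trace_prefix_def inf_traces_def in_lists_conv_set simp del: upt_Suc)+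
    then show ?thesis by (simp add: L_def)
  qed
  have lenu: "length (us (Suc n)) = m" for n by (simp add: us upc_def m_def)
  have "parity_ok (%i. snd (snd (snd (q i)))) \<longleftrightarrow> parity_ok (%i. lar_prio (alpha (prep \<Psi>)) (V i) (l i))"
    using parity_ok_Suc[of "%i. snd (snd (snd (q i)))"] p by simp
  also have "\<dots> \<longleftrightarrow> alpha (prep \<Psi>) {x. \<exists>\<^sub>\<infinity>i. V i x}"
  proof (rule lar_correct)
    fix i x assume "V i x"
    then have "x < m" using lenu[of i] by (cases "x < m") (auto simp: V_def nthd_def)
    then show "x \<in> set (l 0)" by (simp add: l)
  qed (auto simp: l)
  also have "\<dots> \<longleftrightarrow> \<tau> \<in> plus_lang L AP \<Psi>"
    unfolding V_def by (rule alpha_correct[where v = v and S = "%n. S (trace_prefix \<tau> n)"]) (use us v \<tau> S in auto)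
  finally show ?thesis .
qed

definition nq :: "nat => nat" where "nq m = nd m * (2 ^ m * (m ^ m * (2 * m + 3)))"

context
  fixes X Y :: "nat list" and \<Psi> :: "nat ltlf plus" and Xs Ys :: "bool list list list" and P B m :: nat and env :: env
  assumes m_def: "m = length (prep \<Psi>)" and env_def: "env = envof \<Psi>"
    and disj: "set X \<inter> set Y = {}"
    and Xs1: "\<And>x. x \<in> set Xs ==> set x \<subseteq> enc_nat ` set X" and Xs2: "\<And>s. s \<subseteq> set X ==> \<exists>x\<in>set Xs. set x = enc_nat ` s"
    and Ys1: "\<And>x. x \<in> set Ys ==> set x \<subseteq> enc_nat ` set Y" and Ys2: "\<And>s. s \<subseteq> set Y ==> \<exists>x\<in>set Ys. set x = enc_nat ` s"
    and Ys3: "\<And>y y'. y \<in> set Ys ==> y' \<in> set Ys ==> set y = set y' ==> y = y'"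
    and P1: "nd m \<le> P" and P2: "m ^ m \<le> P" and P3: "B ^ (2 * m + 3) \<le> P" and B: "nq m < B"
begin

definition Q :: "'d qstate set" where
  "Q = set (Ds P env) \<times> {u. length u = m} \<times> {l. length l = m \<and> set l \<subseteq> {..<m}} \<times> {..<2 * m + 3}"

lemma fst_env: "fst env = prep \<Psi>" and snd_env: "set (snd env) = {u. length u = m}"
  by (auto simp: env_def envof_def set_n_lists m_def)

lemma set_allS: "set (allS P B env) = Q \<times> {c. length c = 2 * m + 3 \<and> set c \<subseteq> {..<B}}"
proof -
  have 1: "tnl P m [0..<m] = List.n_lists m [0..<m]" using P2 by (intro tnl) simp
  have 2: "tnl P (2 * m + 3) [0..<B] = List.n_lists (2 * m + 3) [0..<B]" using P3 by (intro tnl) simp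
  have e: "length (fst env) = m" by (simp add: fst_env m_def)
  show ?thesis
    unfolding allS_def e 1 2 set_eq_iff by (auto simp: snd_env set_n_lists Q_def image_iff atLeast0LessThan)
qed

lemma finite_Q: "finite Q" and card_Q: "card Q \<le> nq m"
proof -
  have 1: "card {u :: bool list. length u = m} = 2 ^ m" "finite {u :: bool list. length u = m}"
    using card_lists_length_eq[of "UNIV :: bool set" m] finite_lists_length_eq[of "UNIV :: bool set" m] by simp_all
  have 2: "card {l. set l \<subseteq> {..<m} \<and> length l = m} = m ^ m" "finite {l. set l \<subseteq> {..<m} \<and> length l = m}"
    using card_lists_length_eq[of "{..<m}" m] finite_lists_length_eq[of "{..<m}" m] by simp_all
  have 3: "card (set (Ds P env)) \<le> nd m"
    using Ds(3)[of \<Psi> P] P1 card_length[of "Ds P env"] by (simp add: m_def env_def)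
  show "finite Q" using 1 2 by (auto simp: Q_def conj_commute)
  show "card Q \<le> nq m" using 1 2 3 by (simp add: Q_def nq_def card_cartesian_product conj_commute mult_le_mono1)
qed

lemma qtrans_Q: "q \<in> Q ==> qtrans env a q \<in> Q"
proof -
  assume q: "q \<in> Q"
  have 1: "d \<in> set (Ds P env) ==> updd env a d \<in> set (Ds P env)" for d
    using Ds(2)[of \<Psi> P] P1 by (simp add: m_def env_def)
  have 2: "length (upc (fst env) u v) = m" for u v by (simp add: upc_def fst_env m_def)
  have 3: "lar_prio \<alpha> V l < 2 * m + 3" if "length l = m" for \<alpha> :: "nat set => bool" and V l
    using lar_prio_bound[of \<alpha> V l] that by simp
  show ?thesis using q 1 2 3 by (cases q) (simp add: Q_def qtrans_def Let_def)
qed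

lemma init_Q: "fst (init env) \<in> Q"
  using Ds(1)[of \<Psi> P] P1 by (auto simp: Q_def init_def fst_env m_def[symmetric] env_def[symmetric] zero_vec_def)

interpretation parity_game Q "set Xs" "set Ys" "%q x y. qtrans env (x @ y) q" "%q. snd (snd (snd q))" "fst (init env)" "2 * m + 3" "B - 1"
  using finite_Q card_Q B init_Q qtrans_Q by unfold_locales (auto simp: Q_def)

lemma init_snd: "snd (init env) = replicate (2 * m + 3) 0"
  by (simp add: init_def fst_env m_def)

lemma dec_enc: "s \<subseteq> enc_nat ` U ==> enc_nat ` code_nat ` s = s \<and> code_nat ` s \<subseteq> U"
  by (auto simp: image_image) (metis (no_types, lifting) code_nat image_iff subsetD)

lemma wins_imp_init:
  assumes "wins (set X) (set Y) \<sigma> (plus_lang L (set X \<union> set Y) \<Psi>)"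
  shows "init env \<in> set (W P B env Xs Ys)"
proof -
  \<comment> \<open>The given strategy works with sets of atoms and the game with lists of codes;
    \<open>dh\<close> decodes a history, and \<open>\<sigma>'\<close> selects a code of the
    answer.\<close>
  define dh where "dh h = map (%y. code_nat ` set y) h" for h :: "bool list list list"
  define \<sigma>' where "\<sigma>' h = (SOME x. x \<in> set Xs \<and> set x = enc_nat ` \<sigma> (dh h))" for h
  have dhY: "dh h \<in> lists (Pow (set Y))" if "h \<in> lists (set Ys)" for h
  proof -
    have "code_nat ` set y \<subseteq> set Y" if "y \<in> set h" for y
      using dec_enc[OF Ys1, of y] \<open>h \<in> lists (set Ys)\<close> that by blast
    then show ?thesis unfolding dh_def in_lists_conv_set by (simp only: set_map, blast)
  qed
  have \<sigma>X: "\<forall>h\<in>lists (Pow (set Y)). \<sigma> h \<subseteq> set X"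
    using assms unfolding wins_def is_strategy_def by (rule conjunct1)
  have \<sigma>': "\<sigma>' h \<in> set Xs \<and> set (\<sigma>' h) = enc_nat ` \<sigma> (dh h)" if "h \<in> lists (set Ys)" for h
  proof -
    have "\<sigma> (dh h) \<subseteq> set X" using \<sigma>X dhY[OF that] by (rule bspec)
    from Xs2[OF this] obtain x where "x \<in> set Xs \<and> set x = enc_nat ` \<sigma> (dh h)" by (elim bexE) simp
    then show ?thesis unfolding \<sigma>'_def by (rule someI)
  qed
  have "winning \<sigma>'"
    unfolding winning_def
  proof (intro conjI ballI allI impI)
    fix h assume "h \<in> lists (set Ys)" then show "\<sigma>' h \<in> set Xs" using \<sigma>' by blast
  next
    fix y :: "nat => bool list list" assume y: "range y \<subseteq> set Ys"
    define h where "h i = map y [0..<i]" for i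
    have hY: "h i \<in> lists (set Ys)" for i using range_subsetD[OF y] by (auto simp: h_def)
    define \<tau> where "\<tau> i = \<sigma> (dh (h i)) \<union> code_nat ` set (y i)" for i
    have sX: "\<sigma> (dh (h i)) \<subseteq> set X" for i using \<sigma>X dhY[OF hY] by (rule bspec)
    have yY: "code_nat ` set (y i) \<subseteq> set Y" "enc_nat ` code_nat ` set (y i) = set (y i)" for i
      using dec_enc[OF Ys1, of "y i"] y by auto
    have tau: "\<tau> \<in> inf_traces (set X \<union> set Y)"
      unfolding inf_traces_def \<tau>_def mem_Collect_eq using Un_mono[OF sX yY(1)] by blast
    have tY: "\<tau> i \<inter> set Y = code_nat ` set (y i)" "\<tau> i \<inter> set X = \<sigma> (dh (h i))" for i using sX[of i] yY(1)[of i] disj by (auto simp: \<tau>_def)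
    have "\<tau> \<in> outcomes (set X) (set Y) \<sigma>"
      unfolding outcomes_def using tau tY by (auto simp: dh_def h_def comp_def)
    then have tl: "\<tau> \<in> plus_lang L (set X \<union> set Y) \<Psi>" using assms by (auto simp: wins_def)
    have "parity_ok (%i. snd (snd (snd (sth \<sigma>' (h i))))) \<longleftrightarrow> \<tau> \<in> plus_lang L (set X \<union> set Y) \<Psi>"
    proof (rule run_lemma[where a = "%i. \<sigma>' (h i) @ y i"])
      show "set (\<sigma>' (h i) @ y i) = enc_nat ` \<tau> i" for i using \<sigma>'[OF hY[of i]] yY(2)[of i] by (auto simp: \<tau>_def image_Un)
      show "sth \<sigma>' (h (Suc i)) = qtrans (envof \<Psi>) (\<sigma>' (h i) @ y i) (sth \<sigma>' (h i))" for i by (simp add: h_def env_def[symmetric])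
    qed (use tau in \<open>simp_all add: h_def env_def[symmetric]\<close>)
    then show "parity_ok (%i. snd (snd (snd (sth \<sigma>' (map y [0..<i])))))" using tl by (simp add: h_def)
  qed
  then have nl: "\<not> lose (fst (init env)) (snd (init env))" using winning_not_lose init_snd by simp
  \<comment> \<open>By the introduction rule of \<open>lose\<close>, a position that is not lost has
    a move after which no counter exceeds \<open>B - 1\<close> and the position is again not lost.
    So \<open>G\<close> survives every round of \<open>winset\<close>.\<close>
  define G where "G = {s. fst s \<in> Q \<and> length (snd s) = 2 * m + 3 \<and> set (snd s) \<subseteq> {..<B} \<and> \<not> lose (fst s) (snd s)}"
  have "G \<subseteq> set (W P B env Xs Ys)"
    unfolding W_def
  proof (rule winset_greatest)
    show "G \<subseteq> set (allS P B env)" unfolding set_allS by (auto simp: G_def)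
    fix s assume s: "s \<in> G"
    let ?c = "%x y. upd (snd s) (snd (snd (snd (qtrans env (x @ y) (fst s)))))"
    obtain x where x: "x \<in> set Xs" "\<And>y. y \<in> set Ys ==> \<not> (\<exists>j<2 * m + 3. B - 1 < ?c x y ! j) \<and> \<not> lose (qtrans env (x @ y) (fst s)) (?c x y)"
      using s lose.intros[where s = "fst s" and c = "snd s"] unfolding G_def by blast
    have "trans env (x @ y) s \<in> G" if y: "y \<in> set Ys" for y
    proof -
      have "set (?c x y) \<subseteq> {..<B}"
      proof
        fix v assume "v \<in> set (?c x y)"
        then obtain j where "j < 2 * m + 3" "v = ?c x y ! j" using s by (auto simp: in_set_conv_nth G_def)
        moreover from this have "\<not> B - 1 < ?c x y ! j" using x(2)[OF y] by blast
        ultimately show "v \<in> {..<B}" using B by simp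
      qed
      then show ?thesis using s x(2)[OF y] qtrans_Q by (auto simp: trans_def G_def)
    qed
    then show "\<exists>x\<in>set Xs. \<forall>y\<in>set Ys. trans env (x @ y) s \<in> G" using x(1) by blast
  qed
  moreover have "init env \<in> G" using nl init_Q init_snd B by (auto simp: G_def)
  ultimately show ?thesis by blast
qed

text \<open>The machine never leaves the winning set, in which all counters are below
  \<open>B\<close>, and bounded counters imply the parity condition.\<close>

lemma machine_correct:
  assumes i: "init env \<in> set (W P B env Xs Ys)"
  defines "T \<equiv> machine (table env Xs Ys (WS P B env Xs Ys))"
  shows "moore_wf (set X) (set Y) T \<and> wins (set X) (set Y) (moore_strategy T) (plus_lang L (set X \<union> set Y) \<Psi>)"
proof -
  define ws where "ws = WS P B env Xs Ys"
  have setws: "set ws = set (W P B env Xs Ys)" using i by (auto simp: ws_def WS_def)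
  have ws0: "ws ! 0 = init env" "ws \<noteq> []" by (simp_all add: ws_def WS_def)
  define ch where "ch s = choice env Xs Ys ws s" for s
  have ch: "ch s \<in> set Xs \<and> (\<forall>y\<in>set Ys. trans env (ch s @ y) s \<in> set ws)" if "s \<in> set ws" for s
    unfolding ch_def choice_def using winset_fixed[of s "%s x y. trans env (x @ y) s" Xs Ys "allS P B env"] that
    by (intro first_of[where P = "%x. \<forall>y\<in>set Ys. trans env (x @ y) s \<in> set ws"]) (simp add: setws W_def)
  have idx: "index env ws s < length ws \<and> ws ! index env ws s = s" if "s \<in> set ws" for s
  proof -
    have "\<exists>j\<in>set [0..<length ws]. nthd (init env) ws j = s" using that by (auto simp: in_set_conv_nth)
    from first_of[of _ "%j. nthd (init env) ws j = s", OF this, of 0]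
    have "index env ws s < length ws" "nthd (init env) ws (index env ws s) = s" by (simp_all add: index_def)
    then show ?thesis by simp
  qed
  have lenT: "length T = length ws" by (simp add: T_def machine_def table_def ws_def)
  have Tn: "T ! q = (map code_nat (ch (ws ! q)), map (%y. (map code_nat y, index env ws (trans env (ch (ws ! q) @ y) (ws ! q)))) Ys)" if "q < length ws" for q
    using that by (simp add: T_def machine_def table_def ws_def[symmetric] ch_def)
  have chX: "set (map code_nat (ch s)) \<subseteq> set X" "enc_nat ` set (map code_nat (ch s)) = set (ch s)" if "s \<in> set ws" for s
    using dec_enc[OF Xs1] ch[OF that] by auto
  have yY: "set (map code_nat y) \<subseteq> set Y" "enc_nat ` set (map code_nat y) = set y" if "y \<in> set Ys" for y
    using dec_enc[OF Ys1] that by auto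
  have uniq: "\<exists>!y. y \<in> set Ys \<and> set (map code_nat y) = s" if s: "s \<subseteq> set Y" for s
  proof -
    obtain y where y: "y \<in> set Ys" "set y = enc_nat ` s" using Ys2[OF s] by blast
    then have "set (map code_nat y) = s" by (simp add: image_image)
    moreover have "y' = y''" if "y' \<in> set Ys \<and> set (map code_nat y') = s" "y'' \<in> set Ys \<and> set (map code_nat y'') = s" for y' y''
      using that yY(2)[of y'] yY(2)[of y''] by (intro Ys3) auto
    ultimately show ?thesis using y(1) by blast
  qed
  have nx: "moore_next T q (set (map code_nat y)) = index env ws (trans env (ch (ws ! q) @ y) (ws ! q))" if q: "q < length ws" and y: "y \<in> set Ys" for q y
  proof -
    have "(THE r. r \<in> set (snd (T ! q)) \<and> set (fst r) = set (map code_nat y)) = (map code_nat y, index env ws (trans env (ch (ws ! q) @ y) (ws ! q)))"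
    proof (rule the_equality)
      fix r assume "r \<in> set (snd (T ! q)) \<and> set (fst r) = set (map code_nat y)"
      then obtain y' where y': "y' \<in> set Ys" "r = (map code_nat y', index env ws (trans env (ch (ws ! q) @ y') (ws ! q)))" "set (map code_nat y') = set (map code_nat y)"
        by (auto simp: Tn[OF q])
      then have "y' = y" using uniq[OF yY(1)[OF y]] y by blast
      then show "r = (map code_nat y, index env ws (trans env (ch (ws ! q) @ y) (ws ! q)))" using y' by simp
    qed (use y in \<open>auto simp: Tn[OF q]\<close>)
    then show ?thesis by (simp add: moore_next_def)
  qed
  have wf: "moore_wf (set X) (set Y) T"
    unfolding moore_wf_def
  proof (intro conjI ballI)
    show "T \<noteq> []" using lenT ws0 by auto
    fix r assume "r \<in> set T"
    then obtain q where q: "q < length ws" "r = T ! q" using lenT by (auto simp: in_set_conv_nth)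
    let ?s = "ws ! q"
    have s: "?s \<in> set ws" using q by simp
    have r: "r = (map code_nat (ch ?s), map (%y. (map code_nat y, index env ws (trans env (ch ?s @ y) ?s))) Ys)" using Tn q by simp
    have "\<exists>!r'. r' \<in> set (map (%y. (map code_nat y, index env ws (trans env (ch ?s @ y) ?s))) Ys) \<and> set (fst r') = y" if yY': "y \<subseteq> set Y" for y
    proof -
      from uniq[OF yY'] obtain yl where yl: "yl \<in> set Ys \<and> set (map code_nat yl) = y"
        "\<forall>y'. y' \<in> set Ys \<and> set (map code_nat y') = y \<longrightarrow> y' = yl" by (rule ex1E)
      let ?g = "%y. (map code_nat y, index env ws (trans env (ch ?s @ y) ?s))"
      show ?thesis
      proof (rule ex1I[of _ "?g yl"])
        show "?g yl \<in> set (map ?g Ys) \<and> set (fst (?g yl)) = y" using yl(1) by simp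
        fix r' assume "r' \<in> set (map ?g Ys) \<and> set (fst r') = y"
        then obtain y' where y': "y' \<in> set Ys" "r' = ?g y'" "set (fst r') = y" by (elim conjE) (unfold set_map, blast)
        then have "y' \<in> set Ys \<and> set (map code_nat y') = y" by simp
        then have "y' = yl" using yl(2) by blast
        then show "r' = ?g yl" using y'(2) by simp
      qed
    qed
    then show "case r of (out, step) => set out \<subseteq> set X \<and> (\<forall>(ys, q)\<in>set step. set ys \<subseteq> set Y \<and> q < length T) \<and>
        (\<forall>y. y \<subseteq> set Y \<longrightarrow> (\<exists>!r. r \<in> set step \<and> set (fst r) = y))"
      unfolding r using chX(1)[OF s] yY(1) ch[OF s] idx lenT by auto
  qed
  have st: "foldl (moore_next T) q h < length ws" if "h \<in> lists (Pow (set Y))" "q < length ws" for h q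
    using that
  proof (induction h arbitrary: q)
    case (Cons y h)
    then obtain yl where "yl \<in> set Ys" "set (map code_nat yl) = y" using uniq[of y] by auto
    then have "moore_next T q y < length ws" using nx[of q yl] Cons.prems ch[of "ws ! q"] idx by auto
    then show ?case using Cons by auto
  qed simp
  have strat: "is_strategy (set X) (set Y) (moore_strategy T)"
    unfolding is_strategy_def
  proof
    fix h assume h: "h \<in> lists (Pow (set Y))"
    from st[OF h, of 0] ws0 show "moore_strategy T h \<subseteq> set X"
      using chX(1)[of "ws ! foldl (moore_next T) 0 h"] by (simp add: moore_strategy_def Tn)
  qed
  have "\<tau> \<in> plus_lang L (set X \<union> set Y) \<Psi>" if "\<tau> \<in> outcomes (set X) (set Y) (moore_strategy T)" for \<tau>
  proof -
    have tau: "\<tau> \<in> inf_traces (set X \<union> set Y)" and out: "\<And>i. \<tau> i \<inter> set X = moore_strategy T (map (%j. \<tau> j \<inter> set Y) [0..<i])"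
      using that by (auto simp: outcomes_def)
    have "\<exists>yl. yl \<in> set Ys \<and> set (map code_nat yl) = \<tau> i \<inter> set Y" for i using uniq[of "\<tau> i \<inter> set Y"] by blast
    then obtain y where y: "\<And>i. y i \<in> set Ys" "\<And>i. set (map code_nat (y i)) = \<tau> i \<inter> set Y" by metis
    define k where "k i = foldl (moore_next T) 0 (map (%j. \<tau> j \<inter> set Y) [0..<i])" for i
    define s where "s i = ws ! k i" for i
    have kl: "k i < length ws" for i unfolding k_def using ws0 by (intro st) auto
    have sw: "s i \<in> set ws" for i using kl by (simp add: s_def)
    have kS: "k (Suc i) = index env ws (trans env (ch (s i) @ y i) (s i))" for i
      using nx[OF kl y(1), of i i, unfolded y(2)] by (simp add: k_def[of "Suc i"] k_def[symmetric] s_def)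
    have sS: "s (Suc i) = trans env (ch (s i) @ y i) (s i)" for i
      using idx[of "trans env (ch (s i) @ y i) (s i)"] ch[OF sw[of i]] y(1) by (simp add: s_def[of "Suc i"] kS)
    have s0: "s 0 = init env" using ws0 by (simp add: s_def k_def)
    have setA: "set (ch (s i) @ y i) = enc_nat ` \<tau> i" for i
    proof -
      have "\<tau> i \<inter> set X = set (map code_nat (ch (s i)))" using out[of i] kl[of i] by (simp add: moore_strategy_def k_def[symmetric] Tn s_def)
      moreover have "\<tau> i = (\<tau> i \<inter> set X) \<union> (\<tau> i \<inter> set Y)" using tau by (auto simp: inf_traces_def)
      ultimately have "enc_nat ` \<tau> i = enc_nat ` set (map code_nat (ch (s i))) \<union> enc_nat ` set (map code_nat (y i))" by (metis image_Un y(2))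
      then show ?thesis using chX(2)[OF sw[of i]] yY(2)[OF y(1)[of i]] by simp
    qed
    have "parity_ok (%i. snd (snd (snd (fst (s (Suc i))))))"
    proof (rule bounded_counters_parity[where C = "%i. snd (s i)" and N = B and d = "2 * m + 3"])
      have inS: "s i \<in> set (allS P B env)" for i
        using sw[of i] winset_subset[of "%s x y. trans env (x @ y) s" Xs Ys "allS P B env"] setws by (auto simp: W_def)
      show "snd (snd (snd (fst (s (Suc i))))) < 2 * m + 3" for i using inS[of "Suc i"] by (auto simp: set_allS Q_def)
      show "length (snd (s 0)) = 2 * m + 3" by (simp add: s0 init_snd)
      show "snd (s (Suc i)) = upd (snd (s i)) (snd (snd (snd (fst (s (Suc i))))))" for i by (simp add: sS trans_def)
      show "snd (s i) ! j \<le> B" if "j < 2 * m + 3" for i j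
      proof -
        have "length (snd (s i)) = 2 * m + 3" "set (snd (s i)) \<subseteq> {..<B}" using inS[of i] by (auto simp: set_allS)
        then have "snd (s i) ! j \<in> {..<B}" using that by (metis nth_mem subsetD)
        then show ?thesis by simp
      qed
    qed
    then have "parity_ok (%i. snd (snd (snd (fst (s i)))))" using parity_ok_Suc[of "%i. snd (snd (snd (fst (s i))))"] by simp
    moreover have "parity_ok (%i. snd (snd (snd (fst (s i))))) \<longleftrightarrow> \<tau> \<in> plus_lang L (set X \<union> set Y) \<Psi>"
      by (rule run_lemma[where a = "%i. ch (s i) @ y i", OF setA tau]) (simp_all add: s0 sS trans_def env_def)
    ultimately show ?thesis by simp
  qed
  then show ?thesis using wf strat by (auto simp: wins_def)
qed

end

end

subsection \<open>Input and output of tree programs\<close>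

lemma fpon_mono_r: "fpon D r f ==> (\<And>x. x \<in> D ==> r x \<le> r' x) ==> fpon D r' f"
proof -
  assume f: "fpon D r f" and r: "\<And>x. x \<in> D ==> r x \<le> r' x"
  have "pbd D r' g" if g: "pbd D r g" for g
  proof -
    obtain k where "\<forall>x\<in>D. g x \<le> (r x + 2) ^ k" using g unfolding pbd_def by blast
    moreover have "(r x + 2) ^ k \<le> (r' x + 2) ^ k" if "x \<in> D" for x using r[OF that] by (intro power_mono) auto
    ultimately show ?thesis unfolding pbd_def by (meson le_trans)
  qed
  then show ?thesis using f unfolding fpon_def by blast
qed

text \<open>The word is first reversed onto stack 1, so that the tree of the list of its letters can
  be built from the end.\<close>

definition read_input :: com where
  "read_input = SEQ (shift 0 1) (SEQ (PUSH 0 False) (LOOP 1 (SEQ (PUSH 0 False) (PUSH 0 True))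
     (SEQ (pushes [False, False]) (SEQ (PUSH 0 True) (PUSH 0 True)))))"

lemma run_pushes': "n \<ge> 3 * length xs + 1 ==> S' = S(0 := xs @ S 0) ==> run (pushes xs) S n S'"
proof (induction xs arbitrary: n S')
  case (Cons x xs)
  have "run (pushes xs) S (3 * length xs + 1) (S(0 := xs @ S 0))" by (rule Cons.IH) simp_all
  moreover have "run (PUSH 0 x) (S(0 := xs @ S 0)) 2 S'" by (rule run_PUSH) (auto simp: Cons)
  ultimately show ?case unfolding pushes.simps by (rule run_SEQ) (use Cons in auto)
qed (auto intro: run_SKIP)

lemma run_read_loop:
  "S 0 = bits (tr v) ==> S' = S(1 := [], 0 := bits (tr (rev (S 1) @ v))) ==> n \<ge> 20 * length (S 1) + 1 ==>
   run (LOOP 1 (SEQ (PUSH 0 False) (PUSH 0 True)) (SEQ (pushes [False, False]) (SEQ (PUSH 0 True) (PUSH 0 True)))) S n S'"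
  (is "_ ==> _ ==> _ ==> run ?L S n S'")
proof (induction "S 1" arbitrary: S n v)
  case Nil
  then show ?case by (intro run_LOOP_Nil) (auto simp: fun_eq_iff)
next
  case (Cons x xs)
  let ?S = "S(1 := xs, 0 := bits (tr (x # v)))"
  have 1: "run ?L ?S (20 * length xs + 1) S'"
    by (rule Cons(1)[where v = "x # v"]) (auto simp: Cons(4) Cons(2)[symmetric] fun_eq_iff simp del: One_nat_def)
  let ?T = "S(1 := xs)"
  have a: "run (SEQ (PUSH 0 False) (PUSH 0 True)) ?T 5 (?T(0 := [True, False] @ S 0))"
    by (rule run_SEQ[OF run_PUSH[OF _ _ refl] run_PUSH]) auto
  have b: "run (SEQ (pushes [False, False]) (SEQ (PUSH 0 True) (PUSH 0 True))) ?T 13 (?T(0 := [True, True, False, False] @ S 0))"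
    by (rule run_SEQ[OF run_pushes'[OF _ refl] run_SEQ[OF run_PUSH[OF _ _ refl] run_PUSH]]) auto
  have "run (if x then SEQ (pushes [False, False]) (SEQ (PUSH 0 True) (PUSH 0 True)) else SEQ (PUSH 0 False) (PUSH 0 True)) ?T 13 ?S"
    using run_mono[OF a, of 13] b Cons(3) by (cases x) (simp_all add: tr_bool_def)
  from run_LOOP_Cons[of 1 S x xs, OF _ _ this 1, of n] show ?case
    using Cons(2)[symmetric] Cons(5) by simp
qed

lemma run_read_input: "n \<ge> 30 * length w + 20 ==> run read_input (main w) n (main (bits (tr w)))"
proof -
  assume n: "n \<ge> 30 * length w + 20"
  have "run (shift 0 1) (main w) (3 * length w + 1) ((main [])(1 := rev w))"
    by (rule run_shift) (auto simp: main_def fun_eq_iff)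
  moreover have "run (PUSH 0 False) ((main [])(1 := rev w)) 2 ((main [False])(1 := rev w))"
    by (rule run_PUSH) (auto simp: main_def fun_eq_iff)
  moreover have "run (LOOP 1 (SEQ (PUSH 0 False) (PUSH 0 True)) (SEQ (pushes [False, False]) (SEQ (PUSH 0 True) (PUSH 0 True))))
     ((main [False])(1 := rev w)) (20 * length w + 1) (main (bits (tr w)))"
    by (rule run_read_loop[where v = "[]"]) (auto simp: main_def fun_eq_iff)
  ultimately show ?thesis unfolding read_input_def
    by (rule run_SEQ[OF _ run_SEQ[OF _ _ order_refl]]) (use n in auto)
qed

definition write_output :: com where
  "write_output = LOOP 0 SKIP (POP 0 SKIP (OUT False) (POP 0 SKIP (POP 0 SKIP (OUT True) SKIP) SKIP))"

lemma bs_write_output: "\<exists>t\<le>5 * length v + 3. bs write_output (main (bits (tr v)), out) t (main [], out @ v)"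
proof (induction v arbitrary: out)
  case Nil
  have "bs SKIP ((main [False])(0 := []), out) 1 ((main [False])(0 := []), out)" by (rule bs_SKIP)
  moreover have "(main [False])(0 := []) = main []" by (auto simp: main_def)
  ultimately have "bs SKIP ((main [False])(0 := []), out) 1 (main [], out)" by simp
  moreover have "bs write_output (main [], out) 1 (main [], out)" unfolding write_output_def
    by (rule bs_LOOP_Nil) (auto simp: main_def)
  ultimately have "bs write_output (main [False], out) 3 (main [], out)"
    unfolding write_output_def
    using bs_LOOP_Cons[of 0 "main [False]" False "[]" _ SKIP out 1 "(main [], out)" 1 "(main [], out)"] by (simp add: main_def numeral_3_eq_3)
  then show ?case by fastforce
next
  case (Cons x v)
  let ?r = "bits (tr v)"
  have m: "(main m)(0 := m') = main m'" "main m 0 = m" for m m' by (auto simp: main_def)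
  obtain t where t: "t \<le> 5 * length v + 3" "bs write_output (main ?r, out @ [x]) t (main [], (out @ [x]) @ v)" using Cons by blast
  have T: "bs (POP 0 SKIP (OUT False) (POP 0 SKIP (POP 0 SKIP (OUT True) SKIP) SKIP)) (main (True # False # False # ?r), out) (1 + 1 + 1 + 1) (main ?r, out @ [True])"
    by (rule bs_POP_Cons[where v = True and vs = "False # False # ?r"], simp, simp add: m,
      simp add: m del: One_nat_def add_2_eq_Suc' add_2_eq_Suc one_add_one,
      rule bs_POP_Cons[where v = False and vs = "False # ?r"], simp, simp add: m,
      simp add: m del: One_nat_def add_2_eq_Suc' add_2_eq_Suc one_add_one,
      rule bs_POP_Cons[where v = False and vs = "?r"], simp, simp add: m,
      simp add: m bs_OUT del: One_nat_def)
  have F: "bs (POP 0 SKIP (OUT False) (POP 0 SKIP (POP 0 SKIP (OUT True) SKIP) SKIP)) (main (False # ?r), out) (1 + 1) (main ?r, out @ [False])"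
    by (rule bs_POP_Cons[where v = False and vs = "?r"], simp, simp add: m, simp add: m bs_OUT del: One_nat_def)
  obtain t' where t': "t' \<le> 4" "bs (POP 0 SKIP (OUT False) (POP 0 SKIP (POP 0 SKIP (OUT True) SKIP) SKIP)) (main (bits (tr x) @ ?r), out) t' (main ?r, out @ [x])"
    using T F by (cases x) (auto simp: tr_bool_def intro: that[of "1 + 1 + 1 + 1"] that[of "1 + 1"])
  have "bs write_output (main (bits (tr (x # v))), out) (t' + t + 1) (main [], out @ x # v)"
    unfolding write_output_def
    by (rule bs_LOOP_Cons[where v = True and vs = "bits (tr x) @ ?r" and s' = "(main ?r, out @ [x])"])
      (use t t' in \<open>simp_all add: m write_output_def\<close>)
  then show ?case using t t' by (intro exI[of _ "t' + t + 1"]) simp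
qed

lemma sz_bools: "sz w \<le> 4 * length w + 1" for w :: "bool list"
proof (induction w)
  case (Cons a w) then show ?case using sz_bool[of a] by simp
qed simp

text \<open>The exponent is fixed before the time bound \<open>F\<close> and the relation
  \<open>R\<close>, so that a caller can choose the polynomial in \<open>F\<close> after having
  obtained the exponent.\<close>

lemma fpon_solvable:
  assumes f: "fpon UNIV r (f :: bool list => bool list)" and r: "\<And>w. sz w \<le> r w"
  shows "\<exists>k. \<forall>F R. (\<forall>w. (r w + 2) ^ k \<le> F (length w)) \<longrightarrow> (\<forall>w. R w (f w)) \<longrightarrow> solvable_in_time F R"
proof -
  from f obtain c T where 1: "pbd UNIV r T" "pbd UNIV r (%x. sz (f x))" "\<And>x rest. run c (main (bits (tr x) @ rest)) (T x) (main (bits (tr (f x)) @ rest))"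
    unfolding fpon_def by blast
  have ln: "length w \<le> sz w" for w :: "bool list" using length_le_sz[of w] by simp
  have "pbd UNIV r (%w. (30 * length w + 20) + T w + (5 * length (f w) + 3) + 2)"
  proof (intro pbd_add pbd_mult pbd_const 1)
    show "pbd UNIV r (%w. length w)" by (rule pbd_mono[OF pbd_self]) (use ln r in \<open>meson le_trans\<close>)
    show "pbd UNIV r (%w. length (f w))" by (rule pbd_mono[OF 1(2)]) (rule ln)
  qed
  then obtain k where k: "\<And>w. (30 * length w + 20) + T w + (5 * length (f w) + 3) + 2 \<le> (r w + 2) ^ k" unfolding pbd_def by auto
  let ?c = "SEQ read_input (SEQ c write_output)"
  obtain M where M: "tm_wf M" "\<And>w F t v S. bs ?c (%i. if i = 0 then w else [], []) t (S, v) ==> t \<le> F ==> tm_computes M F w v"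
    using com_tm[of ?c] by blast
  have "tm_computes M F w (f w)" if "(r w + 2) ^ k \<le> F" for w F
  proof -
    obtain t1 where t1: "t1 \<le> 30 * length w + 20" "bs read_input (main w, []) t1 (main (bits (tr w)), [])"
      using run_read_input[of w "30 * length w + 20"] unfolding run_def by blast
    obtain t2 where t2: "t2 \<le> T w" "bs c (main (bits (tr w)), []) t2 (main (bits (tr (f w))), [])"
      using 1(3)[of w "[]"] unfolding run_def by auto
    obtain t3 where t3: "t3 \<le> 5 * length (f w) + 3" "bs write_output (main (bits (tr (f w))), []) t3 (main [], [] @ f w)"
      using bs_write_output by blast
    have "bs ?c (main w, []) (t1 + (t2 + t3 + 1) + 1) (main [], f w)"
      using bs_SEQ[OF t1(2) bs_SEQ[OF t2(2) t3(2)]] by simp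
    moreover have "main w = (%i. if i = 0 then w else [])" by (auto simp: main_def)
    ultimately show ?thesis using M(2)[of w "t1 + (t2 + t3 + 1) + 1" "main []" "f w" F] k[of w] t1 t2 t3 that by simp
  qed
  then show ?thesis using M(1) unfolding solvable_in_time_def by blast
qed

lemma fpon_fp: "fpon UNIV r f ==> fp g ==> fpon UNIV r (%x. g (f x))"
  unfolding fp_def by (rule fpon_comp) (auto intro: fpon_size)

text \<open>In unary the result itself is exponentially large, hence the measure
  \<open>2 ^ n\<close>. Doubling \<open>n\<close> times, starting from 1, is polynomial in
  it.\<close>

lemma fpon_exp: "fpon UNIV (%n. 2 ^ n) (%n :: nat. 2 ^ n :: nat)"
proof -
  let ?D = "range (%n :: nat. (n, 1 :: nat))"
  define p where "p s \<longleftrightarrow> fst s \<noteq> 0" for s :: "nat \<times> nat"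
  define f where "f s = (fst s - 1, snd s + snd s)" for s :: "nat \<times> nat"
  have it: "(f ^^ i) (n, 1) = (n - i, 2 ^ i)" for i n by (induction i) (auto simp: f_def)
  have le: "n \<le> 2 ^ n" for n :: nat using less_exp[of n] by simp
  have "fpon ?D (%s. 2 ^ fst s) (%s. (f ^^ fst s) s)"
  proof (rule fpon_while[where E = UNIV and p = p and G = "%s. 2 * 2 ^ fst s + 2 * 2 ^ fst s + 3"])
    show "fpon UNIV sz p" unfolding fp_def[symmetric] p_def by (intro fpi)
    show "fpon {x \<in> UNIV. p x} sz f" by (rule fpon_subset[of UNIV]) (auto simp: fp_def[symmetric] f_def[abs_def] intro!: fpi fp_pred[unfolded One_nat_def])
    show "pbd ?D (%s. 2 ^ fst s) (%s. 2 * 2 ^ fst s + 2 * 2 ^ fst s + 3)" by (intro pbd_add pbd_mult pbd_const pbd_self)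
    show "pbd ?D (%s. 2 ^ fst s) fst" by (rule pbd_mono[OF pbd_self]) (rule le)
    fix s :: "nat \<times> nat" and i assume "s \<in> ?D" "i \<le> fst s"
    then obtain n where s: "s = (n, 1)" "i \<le> n" by auto
    have "2 ^ i \<le> (2 :: nat) ^ n" "n - i \<le> 2 ^ n" using s le_trans[OF diff_le_self le, of n i] by (auto intro: power_increasing)
    then have "2 * (n - i) + 2 * 2 ^ i \<le> 2 * 2 ^ n + 2 * (2 :: nat) ^ n" by (intro add_mono mult_left_mono) auto
    then show "(f ^^ i) s \<in> UNIV \<and> sz ((f ^^ i) s) \<le> 2 * 2 ^ fst s + 2 * 2 ^ fst s + 3 \<and> p ((f ^^ i) s) = (i < fst s)"
      unfolding s(1) it using s(2) by (auto simp: p_def)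
  qed
  from fpon_comp[OF _ this, of UNIV "%n. 2 ^ n" "%n. (n, 1)"]
  have "fpon UNIV (%n. 2 ^ n) (%n. (f ^^ n) (n, 1))"
  proof -
    have "fp (%n :: nat. (n, 1 :: nat))" by (intro fpi)
    then have "fpon UNIV (%n. 2 * 2 ^ n + 1) (%n :: nat. (n, 1 :: nat))" unfolding fp_def
      by (rule fpon_mono_r) (use le in auto)
    moreover have "pbd UNIV (%n. 2 ^ n) g" if "pbd UNIV (%n. 2 * 2 ^ n + 1) g" for g :: "nat => nat"
    proof -
      have "pbd UNIV (%n :: nat. 2 ^ n) (%n. 2 * 2 ^ n + 1)" by (intro pbd_add pbd_mult pbd_const pbd_self)
      then show ?thesis using pbd_trans[of UNIV "%n. 2 * 2 ^ n + 1" g "%n. n" UNIV "%n. 2 ^ n", OF that] by simp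
    qed
    ultimately have "fpon UNIV (%n. 2 ^ n) (%n :: nat. (n, 1 :: nat))" unfolding fpon_def by blast
    from fpon_comp[OF this \<open>fpon ?D _ _\<close>] show ?thesis by (auto intro: pbd_self)
  qed
  from fpon_fp[OF this fp_snd[OF fp_id]] show ?thesis by (simp add: it del: One_nat_def)
qed

lemma fpon_exp_comp: "fpon UNIV r f ==> (\<And>x. 2 ^ f x \<le> r x) ==> fpon UNIV r (%x. 2 ^ f x :: nat)"
  by (rule fpon_comp[OF _ fpon_exp]) (auto intro: pbd_mono[OF pbd_self])

subsection \<open>Parsing\<close>

text \<open>A predictive parser. The symbols 0 and 1 stand for the lists of atoms, 2 and 3 for formulas of the
  outer and the inner logic, 4, 5, 6 for (the rest of) a number, a digit, and a nonzero number; 9 is an error.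
  The second component of a symbol holds the part of a tag that has been read. The parser also
  cuts the word into segments labelled by the symbols 0 to 3.\<close>

definition expand :: "nat \<times> bool list => bool => (nat \<times> bool list) list" where
  "expand g b = (if fst g \<le> 1 then (if b then [(4, []), (fst g, [])] else [])
     else if fst g = 4 then (if b then [(5, [])] else [])
     else if fst g = 5 then (if b then [(4, [])] else [(6, [])])
     else if fst g = 6 then (if b then [(5, [])] else [(9, [])])
     else if fst g = 9 then [(9, [])]
     else if length (snd g) < 2 then [(fst g, snd g @ [b])]
     else if fst g = 2 then
       (if hd (snd g @ [b]) = False then [(3, [])]
        else if snd g @ [b] = [True, False, False] \<or> snd g @ [b] = [True, False, True] then [(2, []), (2, [])]
        else if snd g @ [b] = [True, True, False] then [(2, [])] else [(9, [])])
     else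
       (if snd g @ [b] = [False, False, False] then [(4, [])]
        else if snd g @ [b] = [False, False, True] \<or> snd g @ [b] = [True, False, False] then [(3, [])]
        else if snd g @ [b] = [False, True, False] \<or> snd g @ [b] = [False, True, True] \<or> snd g @ [b] = [True, False, True]
        then [(3, []), (3, [])] else [(9, [])]))"

text \<open>A letter read with an empty stack produces the error symbol, so trailing input is
  rejected.\<close>

definition pstep :: "(nat \<times> bool list) list \<times> token list => bool => (nat \<times> bool list) list \<times> token list" where
  "pstep st b = (case fst st of [] => ([(9, [])], snd st)
     | g # s => (expand g b @ s, if fst g \<le> 3 \<and> snd g = [] then (fst g, [b]) # snd st
         else (case snd st of [] => [] | h # t => (fst h, snd h @ [b]) # t)))"

lemma pstep_Cons: "pstep (g # s, sg) b = (expand g b @ s, if fst g \<le> 3 \<and> snd g = [] then (fst g, [b]) # sg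
    else (case sg of [] => [] | h # t => (fst h, snd h @ [b]) # t))"
  by (simp add: pstep_def)

definition parse :: "bool list => (nat \<times> bool list) list \<times> token list" where
  "parse w = foldl pstep ([(0, []), (1, []), (2, [])], []) w"

lemma parse_nat: "foldl pstep ((4, []) # s, (l, x) # sg) (enc_nat n) = (s, (l, x @ enc_nat n) # sg)"
proof (induction n arbitrary: x rule: less_induct)
  case (less n)
  show ?case
  proof (cases "n = 0")
    case True
    then show ?thesis by (simp add: enc_nat.simps[of 0] pstep_Cons expand_def)
  next
    case n: False
    show ?thesis
    proof (cases "odd n")
      case True
      then show ?thesis using less[of "n div 2"] n by (simp add: enc_nat.simps[of n] pstep_Cons expand_def)
    next
      case False
      \<comment> \<open>After a digit 0 the rest must be nonzero, which symbol 6 enforces in order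
        to rule out leading zeros. On the code of a nonzero number the symbols 6 and 4 behave
        alike.\<close>
      then have "n div 2 \<noteq> 0" using n by auto
      then have "foldl pstep ((6, []) # s, (l, x @ [True, False]) # sg) (enc_nat (n div 2)) = foldl pstep ((4, []) # s, (l, x @ [True, False]) # sg) (enc_nat (n div 2))"
        by (simp add: enc_nat.simps[of "n div 2"] pstep_Cons expand_def)
      then show ?thesis using less[of "n div 2"] n False by (simp add: enc_nat.simps[of n] pstep_Cons expand_def)
    qed
  qed
qed

lemma parse_ltlf: "foldl pstep ((3, []) # s, sg) (enc_ltlf \<phi>) = (s, rev (pre \<phi>) @ sg)"
  by (induction \<phi> arbitrary: s sg) (simp_all add: pstep_Cons expand_def parse_nat)

lemma parse_plus: "foldl pstep ((2, []) # s, sg) (enc_plus enc_ltlf \<Psi>) = (s, rev (prep \<Psi>) @ sg)"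
  by (induction \<Psi> arbitrary: s sg) (simp_all add: pstep_Cons expand_def parse_ltlf)

lemma parse_list: "l \<le> 1 ==> foldl pstep ((l, []) # s, sg) (enc_list enc_nat X) = (s, rev (map (%x. (l, True # enc_nat x)) X @ [(l, [False])]) @ sg)"
proof (induction X arbitrary: sg)
  case Nil then show ?case by (simp add: enc_list_def pstep_Cons expand_def)
next
  case (Cons x X)
  have "enc_list enc_nat (x # X) = True # enc_nat x @ enc_list enc_nat X" by (simp add: enc_list_def)
  moreover have "pstep ((l, []) # s, sg) True = ((4, []) # (l, []) # s, (l, [True]) # sg)" using Cons.prems by (simp add: pstep_Cons expand_def)
  ultimately show ?case using Cons by (simp add: parse_nat)
qed

definition segs_of :: "nat list => nat list => nat ltlf plus => token list" where
  "segs_of X Y \<Psi> = map (%x. (0, True # enc_nat x)) X @ [(0, [False])] @ map (%x. (1, True # enc_nat x)) Y @ [(1, [False])] @ prep \<Psi>"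

lemma parse_inst: "parse (enc_inst enc_ltlf (X, Y, \<Psi>)) = ([], rev (segs_of X Y \<Psi>))"
  by (simp add: parse_def enc_inst_def enc_pair_def parse_list parse_plus segs_of_def)

section \<open>Every accepted word is a code\<close>

definition acc :: "(nat \<times> bool list) list => bool list => bool" where
  "acc s w \<longleftrightarrow> fst (foldl pstep (s, []) w) = []"

lemma fst_pstep_indep: "fst st = fst st' ==> fst (foldl pstep st w) = fst (foldl pstep st' w)"
proof (induction w arbitrary: st st')
  case (Cons b w)
  have "fst (pstep st b) = fst (pstep st' b)" using Cons.prems by (simp add: pstep_def split: list.split)
  then have "fst (foldl pstep (pstep st b) w) = fst (foldl pstep (pstep st' b) w)" by (rule Cons.IH)
  then show ?case by simp
qed simp

lemma acc_Nil: "acc s [] \<longleftrightarrow> s = []" by (simp add: acc_def)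

lemma acc_Cons: "acc (g # s) (b # w) \<longleftrightarrow> acc (expand g b @ s) w"
  using fst_pstep_indep[of "pstep (g # s, []) b" "(expand g b @ s, [])" w]
  by (simp add: acc_def pstep_Cons)

lemma acc_error: "\<not> acc ((9, []) # s) w"
  by (induction w) (auto simp: acc_Nil acc_Cons expand_def)

lemma acc_empty: "acc [] (b # w) = False"
proof -
  have "acc [] (b # w) \<longleftrightarrow> acc [(9, [])] w" by (simp add: acc_def pstep_def)
  then show ?thesis using acc_error by simp
qed

text \<open>A predictive parser works off its stack from the top, so an accepted word splits at the
  moment when \<open>s1\<close> has been consumed.\<close>

lemma acc_split: "acc (s1 @ s2) w ==> \<exists>u v. w = u @ v \<and> acc s1 u \<and> acc s2 v"
proof (induction w arbitrary: s1)
  case Nil then show ?case by (auto simp: acc_Nil)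
next
  case (Cons b w)
  show ?case
  proof (cases s1)
    case Nil then show ?thesis using Cons.prems by (intro exI[of _ "[]"] exI[of _ "b # w"]) (auto simp: acc_Nil)
  next
    case (Cons g s)
    then have "acc ((expand g b @ s) @ s2) w" using \<open>acc (s1 @ s2) (b # w)\<close> by (simp add: acc_Cons)
    then obtain u v where "w = u @ v" "acc (expand g b @ s) u" "acc s2 v" using Cons.IH by blast
    then show ?thesis using Cons by (intro exI[of _ "b # u"] exI[of _ v]) (simp add: acc_Cons)
  qed
qed

text \<open>The symbols 4 and 6 reach each other through the digit symbol 5, which forces a joint
  induction.\<close>

lemma acc_nat: "(acc [(4, [])] u \<longrightarrow> (\<exists>n. u = enc_nat n)) \<and> (acc [(6, [])] u \<longrightarrow> (\<exists>n>0. u = enc_nat n))"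
proof (induction u rule: length_induct)
  case (1 u)
  have digit: "\<exists>n>0. True # v = enc_nat n" if v: "acc [(5, [])] v" "length v < length u" for v
  proof -
    obtain b v' where b: "v = b # v'" using v by (cases v) (auto simp: acc_Nil)
    have *: "enc_nat (2 * n + (if b then 1 else 0)) = True # b # enc_nat n" if "b \<or> n > 0" for n
      using that by (cases b) (simp_all add: enc_nat.simps[of "2 * n"] enc_nat.simps[of "Suc (2 * n)"])
    show ?thesis
    proof (cases b)
      case True
      then have "acc [(4, [])] v'" using v b by (simp add: acc_Cons expand_def)
      then obtain n where "v' = enc_nat n" using 1[rule_format, of v'] v b by auto
      then show ?thesis using *[of n] True b by (intro exI[of _ "2 * n + 1"]) simp
    next
      case False
      then have "acc [(6, [])] v'" using v b by (simp add: acc_Cons expand_def)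
      then obtain n where "v' = enc_nat n" "n > 0" using 1[rule_format, of v'] v b by auto
      then show ?thesis using *[of n] False b by (intro exI[of _ "2 * n"]) simp
    qed
  qed
  show ?case
  proof (cases u)
    case (Cons b v)
    show ?thesis
    proof (cases b)
      case True
      then show ?thesis using digit[of v] Cons by (auto simp: acc_Cons expand_def)
    next
      case False
      have "enc_nat 0 = [False]" by (simp add: enc_nat.simps[of 0])
      then show ?thesis using False Cons acc_error acc_empty
        by (cases v) (auto simp: acc_Cons expand_def acc_Nil intro!: exI[of _ 0])
    qed
  qed (simp add: acc_Nil)
qed

lemma acc_ltlf: "acc [(3, [])] u ==> \<exists>\<phi>. u = enc_ltlf \<phi>"
proof (induction u rule: length_induct)
  case (1 u)
  obtain a b c v where u: "u = a # b # c # v"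
    using 1(2) by (cases u; cases "tl u"; cases "tl (tl u)") (auto simp: acc_Nil acc_Cons expand_def)
  have bin: "\<exists>\<phi> \<psi>. v = enc_ltlf \<phi> @ enc_ltlf \<psi>" if v: "acc [(3, []), (3, [])] v"
  proof -
    obtain x y where "v = x @ y" "acc [(3, [])] x" "acc [(3, [])] y" using acc_split[of "[(3, [])]" "[(3, [])]" v] v by auto
    moreover from this have "\<exists>\<phi>. x = enc_ltlf \<phi>" "\<exists>\<phi>. y = enc_ltlf \<phi>" using 1(1) u by simp_all
    ultimately show ?thesis by blast
  qed
  have un: "\<exists>\<phi>. v = enc_ltlf \<phi>" if "acc [(3, [])] v" using that 1(1) u by simp
  have at: "\<exists>n. v = enc_nat n" if "acc [(4, [])] v" using that acc_nat by blast
  show ?case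
    using 1(2) acc_error unfolding u
    by (cases a; cases b; cases c)
      (auto simp: acc_Cons expand_def dest!: bin un at intro: exI[of _ "LAtom _"] exI[of _ "LNot _"] exI[of _ "LNext _"]
        exI[of _ "LOr _ _"] exI[of _ "LAnd _ _"] exI[of _ "LUntil _ _"])
qed

lemma acc_plus: "acc [(2, [])] u ==> \<exists>\<Psi>. u = enc_plus enc_ltlf \<Psi>"
proof (induction u rule: length_induct)
  case (1 u)
  obtain a b c v where u: "u = a # b # c # v"
    using 1(2) by (cases u; cases "tl u"; cases "tl (tl u)") (auto simp: acc_Nil acc_Cons expand_def)
  have bin: "\<exists>\<phi> \<psi>. v = enc_plus enc_ltlf \<phi> @ enc_plus enc_ltlf \<psi>" if v: "acc [(2, []), (2, [])] v"
  proof -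
    obtain x y where "v = x @ y" "acc [(2, [])] x" "acc [(2, [])] y" using acc_split[of "[(2, [])]" "[(2, [])]" v] v by auto
    moreover from this have "\<exists>\<phi>. x = enc_plus enc_ltlf \<phi>" "\<exists>\<phi>. y = enc_plus enc_ltlf \<phi>" using 1(1) u by simp_all
    ultimately show ?thesis by blast
  qed
  have un: "\<exists>\<phi>. v = enc_plus enc_ltlf \<phi>" if "acc [(2, [])] v" using that 1(1) u by simp
  have at: "\<exists>\<phi>. v = enc_ltlf \<phi>" if "acc [(3, [])] v" using that acc_ltlf by blast
  show ?case
    using 1(2) acc_error unfolding u
    by (cases a; cases b; cases c)
      (auto simp: acc_Cons expand_def dest!: bin un at intro: exI[of _ "QAll _"] exI[of _ "QEx _"] exI[of _ "QInfinitelyMany _"]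
        exI[of _ "QAlmostAll _"] exI[of _ "QOr _ _"] exI[of _ "QAnd _ _"] exI[of _ "QNot _"])
qed

lemma acc_list: "l \<le> 1 ==> acc [(l, [])] u ==> \<exists>X. u = enc_list enc_nat X"
proof (induction u rule: length_induct)
  case (1 u)
  obtain b v where u: "u = b # v" using 1(3) by (cases u) (auto simp: acc_Nil)
  show ?case
  proof (cases b)
    case True
    then have "acc ([(4, [])] @ [(l, [])]) v" using 1(2,3) u by (simp add: acc_Cons expand_def)
    then obtain x y where xy: "v = x @ y" "acc [(4, [])] x" "acc [(l, [])] y" using acc_split by blast
    then obtain n where "x = enc_nat n" using acc_nat by blast
    moreover obtain X where "y = enc_list enc_nat X" using 1(1,2) xy u by fastforce
    ultimately have "u = enc_list enc_nat (n # X)" using xy u True by (simp add: enc_list_def)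
    then show ?thesis by blast
  next
    case False
    then have "v = []" using 1(2,3) u acc_empty by (cases v) (auto simp: acc_Cons expand_def)
    then have "u = enc_list enc_nat []" using u False by (simp add: enc_list_def)
    then show ?thesis by blast
  qed
qed

text \<open>Words that encode no instance require the answer \<open>[False]\<close>, so it does not
  suffice that the parser works on codes; it must reject everything else.\<close>

lemma parse_complete: "fst (parse w) = [] ==> \<exists>X Y \<Psi>. w = enc_inst enc_ltlf (X, Y, \<Psi>)"
proof -
  assume "fst (parse w) = []"
  then have "acc ([(0, [])] @ [(1, [])] @ [(2, [])]) w" by (simp add: acc_def parse_def)
  then obtain x y z where w: "w = x @ y @ z" and x: "acc [(0, [])] x" and y: "acc [(1, [])] y" and z: "acc [(2, [])] z"
    using acc_split[of "[(0, [])]" "[(1, [])] @ [(2, [])]" w] acc_split[of "[(1, [])]" "[(2, [])]"] by blast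
  obtain X where "x = enc_list enc_nat X" using acc_list[OF _ x] by auto
  moreover obtain Y where "y = enc_list enc_nat Y" using acc_list[OF _ y] by auto
  moreover obtain \<Psi> where "z = enc_plus enc_ltlf \<Psi>" using acc_plus[OF z] by auto
  ultimately show ?thesis using w by (auto simp: enc_inst_def enc_pair_def)
qed

subsection \<open>The synthesis procedure is polynomial in its bounds\<close>

lemma sz_tl: "sz (tl xs) \<le> sz xs" by (cases xs) auto

lemma fp_cur_val [fpi]: "fp a ==> fp t ==> fp b ==> fp x ==> fp y ==> fp (%z. cur_val (a z) (t z) (b z) (x z) (y z))"
  unfolding cur_val_def by (intro fpi)

lemma fp_fstep [fpi]: "fp a ==> fp tb ==> fp so ==> fp (%z. fstep (a z) (tb z) (so z))"
  unfolding fstep_def Let_def by (intro fpi)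

lemma sz_pair: "sz p = Suc (sz (fst p) + sz (snd p))" by (cases p) simp

lemma sz_fstep: "sz (fstep a tb so) \<le> sz so + 20"
proof (cases so)
  case (Pair stk out)
  have R: "sz (if p then stk else if q then tl stk else tl (tl stk)) \<le> sz stk" for p q
    using sz_tl[of stk] sz_tl[of "tl stk"] by auto
  show ?thesis
  proof (cases "fst (fst tb) = 3")
    case True
    let ?c = "cur_val a (snd (fst tb)) (snd tb) (nthd (False, False) stk 0) (nthd (False, False) stk 1)"
    let ?A = "take 3 (snd (fst tb)) = [False, False, False]"
    let ?B = "take 3 (snd (fst tb)) = [False, False, True] \<or> take 3 (snd (fst tb)) = [True, False, False]"
    have "fstep a tb so = ((?c, snd tb) # (if ?A then stk else if ?B then tl stk else tl (tl stk)), ?c # out)"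
      using True Pair by (simp add: fstep_def Let_def)
    then show ?thesis using R[of ?A ?B] sz_bool[of ?c] sz_bool[of "snd tb"] Pair by (simp only: sz_simps)
  qed (simp add: fstep_def Pair)
qed

lemma fp_step_vec [fpi]: "fp ts ==> fp a ==> fp v ==> fp (%z. step_vec (ts z) (a z) (v z))"
proof -
  assume ts: "fp ts" and a: "fp a" and v: "fp v"
  have "fp (%z. foldr (fstep (a z)) (zip (ts z) (v z)) ([], []))"
    by (rule fp_foldr_add[where g = "%_. 20"]) (intro fpi fp_comp[OF a] ts v pbd_const sz_fstep)+
  then show ?thesis unfolding step_vec_def by (rule fp_snd)
qed

lemma fp_upc [fpi]: "fp ts ==> fp u ==> fp v ==> fp (%z. upc (ts z) (u z) (v z))"
  unfolding upc_def Let_def by (intro fpi; (erule fp_comp)?; intro fpi)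

lemma fp_aev [fpi]: "fp ts ==> fp I ==> fp i ==> fp stk ==> fp (%z. aev (ts z) (set (I z)) (i z) (stk z))"
  unfolding aev_def Let_def by (intro fpi)

lemma sz_aev: "sz (aev ts I i stk) \<le> sz stk + 4"
  using sz_tl[of stk] le_trans[OF sz_tl sz_tl, of stk]
  by (auto simp: aev_def Let_def intro!: add_mono sz_bool le_trans[OF sz_bool])

lemma fp_alpha [fpi]: "fp ts ==> fp I ==> fp (%z. alpha (ts z) (set (I z)))"
proof -
  assume ts: "fp ts" and I: "fp I"
  have "fp (%z. foldr (aev (ts z) (set (I z))) [0..<length (ts z)] [])"
    by (rule fp_foldr_add[where g = "%_. 4"]) (intro fpi fp_comp[OF ts] fp_comp[OF I] ts pbd_const sz_aev)+
  then show ?thesis unfolding alpha_def by (intro fpi)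
qed

lemma foldl_dropWhile: "foldl (%a x. if a = [] \<and> P x then [] else a @ [x]) [] xs = dropWhile P xs"
proof -
  have "foldl (%a x. if a = [] \<and> P x then [] else a @ [x]) b xs = b @ xs" if "b \<noteq> []" for b xs
    using that by (induction xs arbitrary: b) auto
  note * = this[of "[_]", simplified]
  show ?thesis by (induction xs) (auto simp: *)
qed

lemma fp_dropWhile [fpi]:
  fixes xs :: "'a::data => 'b::data list"
  assumes xs: "fp xs" and P: "fp (%z. P (fst z) (snd z))" shows "fp (%x. dropWhile (P x) (xs x))"
proof -
  have "fp (%x. foldl (%a y. if a = [] \<and> P x y then [] else a @ [y]) [] (xs x))"
  proof (rule fp_foldl_add[where g = "%x. sz (xs x) + 5"])
    have "fp (%z :: 'a \<times> 'b list \<times> 'b. P (fst z) (snd (snd z)))"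
      using fp_comp[OF P, of "%z :: 'a \<times> 'b list \<times> 'b. (fst z, snd (snd z))"] by (simp add: fpi)
    then show "fp (%z :: 'a \<times> 'b list \<times> 'b. if fst (snd z) = [] \<and> P (fst z) (snd (snd z)) then [] else fst (snd z) @ [snd (snd z)])"
      by (intro fpi)
    show "sz (if a = [] \<and> P x y then [] else a @ [y]) \<le> sz a + (sz (xs x) + 5)" if "y \<in> set (xs x)" for x a y
      using elem_le_sz[OF that] sz_append_le[of a "[y]"] sz_pos[of a] by auto
  qed (intro fpi xs pbd_add pbd_const pb_sz)+
  then show ?thesis by (simp add: foldl_dropWhile)
qed

lemma fp_mtf [fpi]: "fp u ==> fp l ==> fp (%z. mtf (nthd False (u z)) (l z))"
proof -
  assume u: "fp u" and l: "fp l"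
  show ?thesis unfolding mtf_def by (intro fpi l fp_comp[OF u])
qed

lemma fp_hit [fpi]: "fp u ==> fp l ==> fp (%z. hit (nthd False (u z)) (l z))"
proof -
  assume u: "fp u" and l: "fp l"
  show ?thesis unfolding hit_def by (intro fpi l fp_comp[OF u])
qed

lemma fp_lar_prio [fpi]: "fp ts ==> fp u ==> fp l ==> fp (%z. lar_prio (alpha (ts z)) (nthd False (u z)) (l z))"
  unfolding lar_prio_def by (intro fpi)

text \<open>Half and parity are maintained together while a unary number is counted up.\<close>

lemma fp_odd [fpi]: "fp n ==> fp (%z. odd (n z :: nat))" and fp_div2 [fpi]: "fp n ==> fp (%z. n z div 2 :: nat)"
proof -
  assume n: "fp n"
  define h where "h s = (if snd s then (Suc (fst s), False) else (fst s, True))" for s :: "nat \<times> bool"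
  have "(h ^^ k) (0, False) = (k div 2, odd k)" for k by (induction k) (auto simp: h_def)
  moreover have "fp (%z. (h ^^ n z) (0, False))"
  proof (rule fp_funpow_add[OF _ n fp_const pbd_const[of _ _ 10]])
    show "fp (%z. h (snd z))" unfolding h_def by (intro fpi)
    show "sz (h a) \<le> sz a + 10" for a by (cases a) (auto simp: h_def)
  qed
  ultimately have *: "fp (%z. (n z div 2, odd (n z)))" by simp
  from fp_snd[OF *] show "fp (%z. odd (n z))" by simp
  from fp_fst[OF *] show "fp (%z. n z div 2)" by simp
qed

lemma fp_upd [fpi]: "fp c ==> fp p ==> fp (%z. upd (c z) (p z))"
proof -
  assume c: "fp c" and p: "fp p"
  have "fp (%z. map (%j. if j < p z then 0 else if j = p z \<and> odd (p z) then Suc (nthd 0 (c z) j) else nthd 0 (c z) j) [0..<length (c z)])"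
    by (intro fpi c fp_comp[OF c] fp_comp[OF p])
  moreover have "upd c p = map (%j. if j < p then 0 else if j = p \<and> odd p then Suc (nthd 0 c j) else nthd 0 c j) [0..<length c]" for c p
    by (simp add: upd_def)
  ultimately show ?thesis by simp
qed

text \<open>A number \<open>n\<close> has at most \<open>n\<close> binary digits, so
  \<open>n\<close> rounds suffice; once the number has become 0 the iteration idles.\<close>

lemma fp_enc_nat [fpi]: "fp n ==> fp (%z. enc_nat (n z))"
proof -
  assume n: "fp n"
  define h where "h s = (if fst s = 0 then s else (fst s div 2, snd s @ [True, odd (fst s)]))" for s :: "nat \<times> bool list"
  have *: "snd ((h ^^ k) (n, x)) @ [False] = x @ enc_nat n" if "n \<le> k" for k n x
    using that
  proof (induction k arbitrary: n x)
    case 0 then show ?case by (simp add: enc_nat.simps[of 0])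
  next
    case (Suc k)
    show ?case
    proof (cases "n = 0")
      case True
      have "(h ^^ j) (0, x) = (0, x)" for j by (induction j) (auto simp: h_def)
      then show ?thesis using True by (simp add: enc_nat.simps[of 0] del: funpow.simps)
    next
      case False
      then have "n div 2 \<le> k" using Suc.prems by linarith
      from Suc.IH[OF this, of "x @ [True, odd n]"] False show ?thesis
        by (simp add: funpow_Suc_right h_def enc_nat.simps[of n] del: funpow.simps)
    qed
  qed
  have "fp (%z. (h ^^ n z) (n z, []))"
  proof (rule fp_funpow_add[OF _ n _ pbd_const[of _ _ 20]])
    show "fp (%z. h (snd z))" unfolding h_def by (intro fpi)
    show "sz (h a) \<le> sz a + 20" for a
      using sz_append_le[of "snd a" "[True, odd (fst a)]"] sz_bool[of "odd (fst a)"] by (auto simp: h_def sz_pair[of a])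
  qed (intro fpi n)
  then have "fp (%z. snd ((h ^^ n z) (n z, [])) @ [False])" by (intro fpi)
  then show ?thesis using *[OF order_refl, of _ "[]"] by simp
qed

lemma sz_lists:
  fixes xs :: "'a::data list"
  assumes "\<And>ys. ys \<in> set a ==> length ys \<le> n \<and> set ys \<subseteq> set xs" "length a \<le> M"
  shows "sz a \<le> M * (n * (sz xs + 1) + 2) + 1"
proof -
  have "sz ys \<le> n * (sz xs + 1) + 1" if "ys \<in> set a" for ys
  proof -
    have "sz ys \<le> length ys * (sz xs + 1) + 1"
    proof (rule sz_le_elems)
      fix y assume "y \<in> set ys"
      then have "y \<in> set xs" using assms(1)[OF that] by blast
      then show "sz y \<le> sz xs" using elem_le_sz by fastforce
    qed
    also have "\<dots> \<le> n * (sz xs + 1) + 1"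
      using assms(1)[OF that] by (intro add_right_mono mult_right_mono) auto
    finally show ?thesis .
  qed
  then have "sz a \<le> length a * (n * (sz xs + 1) + 1 + 1) + 1" by (rule sz_le_elems)
  also have "length a * (n * (sz xs + 1) + 1 + 1) + 1 \<le> M * (n * (sz xs + 1) + 1 + 1) + 1"
    using assms(2) by (intro add_right_mono mult_right_mono) auto
  also have "\<dots> = M * (n * (sz xs + 1) + 2) + 1" by simp
  finally show ?thesis .
qed

lemma nat_le_sz: "(n :: nat) \<le> sz n" by simp

lemma fp_tnl [fpi]:
  fixes xs :: "'a::data => 'b::data list"
  assumes P: "fp P" and n: "fp n" and xs: "fp xs"
  shows "fp (%z. tnl (P z) (n z) (xs z))"
  unfolding tnl_def
proof (rule fp_foldl)
  show "pb (%z. (sz (P z) + 1) * (sz (n z) * (sz (xs z) + 1) + 2) + 1)" by (intro pbd_add pbd_mult pbd_const pb_sz P n xs)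
  fix z k assume "k \<le> length (replicate (n z) (0 :: nat))"
  then have k: "k \<le> n z" by simp
  let ?f = "%acc. take (P z) (concat (map (%ys. map (%y. y # ys) (xs z)) acc))"
  have "length ((?f ^^ k) [[]]) \<le> P z + 1 \<and> (\<forall>ys\<in>set ((?f ^^ k) [[]]). length ys = k \<and> set ys \<subseteq> set (xs z))"
  proof (induction k)
    case (Suc k)
    have "length ys = Suc k \<and> set ys \<subseteq> set (xs z)" if ys: "ys \<in> set (?f ((?f ^^ k) [[]]))" for ys
    proof -
      obtain y v where "v \<in> set ((?f ^^ k) [[]])" "y \<in> set (xs z)" "ys = y # v" using in_set_takeD[OF ys] by auto
      moreover from this have "length v = k \<and> set v \<subseteq> set (xs z)" using Suc by blast
      ultimately show ?thesis by simp
    qed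
    then show ?case by simp
  qed simp
  moreover have "foldl (%acc _. ?f acc) [[]] (take k (replicate (n z) (0 :: nat))) = (?f ^^ k) [[]]"
    using k by (simp only: take_replicate foldl_funpow min_absorb1)
  ultimately have "sz (foldl (%acc _. ?f acc) [[]] (take k (replicate (n z) (0 :: nat)))) \<le> (P z + 1) * (n z * (sz (xs z) + 1) + 2) + 1"
    using k by (simp only:) (rule sz_lists, auto)
  also have "\<dots> \<le> (sz (P z) + 1) * (sz (n z) * (sz (xs z) + 1) + 2) + 1"
    by (intro add_mono mult_mono nat_le_sz) auto
  finally show "sz (foldl (%acc _. ?f acc) [[]] (take k (replicate (n z) (0 :: nat)))) \<le> (sz (P z) + 1) * (sz (n z) * (sz (xs z) + 1) + 2) + 1" .
qed (intro fpi fp_replicate_0 n fp_comp[OF P] fp_comp[OF xs])+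

lemma fp_tsubs [fpi]:
  fixes xs :: "'a::data => 'b::data list"
  assumes P: "fp P" and xs: "fp xs"
  shows "fp (%z. tsubs (P z) (xs z))"
proof -
  have "fp (%z. foldl (%acc x. take (P z) (map ((#) x) acc @ acc)) [[]] (rev (xs z)))"
  proof (rule fp_foldl)
    show "pb (%z. (sz (P z) + 1) * (sz (xs z) * (sz (xs z) + 1) + 2) + 1)" by (intro pbd_add pbd_mult pbd_const pb_sz P xs)
    fix z k assume k: "k \<le> length (rev (xs z))"
    let ?F = "%k. foldl (%acc x. take (P z) (map ((#) x) acc @ acc)) [[]] (take k (rev (xs z)))"
    have "length (?F k) \<le> P z + 1 \<and> (\<forall>ys\<in>set (?F k). length ys \<le> k \<and> set ys \<subseteq> set (xs z))"
      using k
    proof (induction k)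
      case (Suc k)
      have e: "?F (Suc k) = take (P z) (map ((#) (rev (xs z) ! k)) (?F k) @ ?F k)" using Suc.prems by (simp add: take_Suc_conv_app_nth)
      have "rev (xs z) ! k \<in> set (xs z)" using Suc.prems by (metis Suc_le_lessD length_rev nth_mem set_rev)
      moreover have "\<forall>ys\<in>set (?F k). length ys \<le> k \<and> set ys \<subseteq> set (xs z)" using Suc by simp
      ultimately have "length ys \<le> Suc k \<and> set ys \<subseteq> set (xs z)" if ys: "ys \<in> set (?F (Suc k))" for ys
      proof -
        obtain v where "v \<in> set (?F k)" "ys = rev (xs z) ! k # v \<or> ys = v" using in_set_takeD[OF ys[unfolded e]] by auto
        moreover from this have "length v \<le> k \<and> set v \<subseteq> set (xs z)" using \<open>\<forall>ys\<in>set (?F k). length ys \<le> k \<and> set ys \<subseteq> set (xs z)\<close> by blast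
        ultimately show ?thesis using \<open>rev (xs z) ! k \<in> set (xs z)\<close> by auto
      qed
      moreover have "length (?F (Suc k)) \<le> P z + 1" unfolding e length_take by simp
      ultimately show ?case by blast
    qed simp
    then have "sz (?F k) \<le> (P z + 1) * (k * (sz (xs z) + 1) + 2) + 1"
      by (intro sz_lists) auto
    also have "\<dots> \<le> (sz (P z) + 1) * (sz (xs z) * (sz (xs z) + 1) + 2) + 1"
      using k length_le_sz[of "xs z"] by (intro add_mono mult_mono nat_le_sz) auto
    finally show "sz (?F k) \<le> (sz (P z) + 1) * (sz (xs z) * (sz (xs z) + 1) + 2) + 1" .
  qed (intro fpi xs fp_comp[OF P])+
  then show ?thesis by (simp add: tsubs_def foldr_conv_foldl)
qed

lemma sz_filter: "sz (filter p l) \<le> sz l" by (induction l) auto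

lemma fp_winset:
  assumes t: "fp (%z. step (fst z) (fst (snd z)) (fst (snd (snd z))) (snd (snd (snd z))))" and Xs: "fp Xs" and Ys: "fp Ys" and S: "fp S"
  shows "fp (%z. winset (step z) (Xs z) (Ys z) (S z))"
  unfolding winset_def
proof (rule fp_foldl_bdd[where P = "%z a. sz a \<le> sz (S z)" and g = "%z. sz (S z)"])
  have s: "fp (%z. step (a z) (b z) (c z) (d z))" if "fp a" "fp b" "fp c" "fp d" for a b c d
    using fp_comp[OF t fp_pair[OF that(1) fp_pair[OF that(2) fp_pair[OF that(3,4)]]]] by simp
  show "fp (%z. filter (%s. \<exists>x\<in>set (Xs (fst z)). \<forall>y\<in>set (Ys (fst z)). step (fst z) s x y \<in> set (fst (snd z))) (fst (snd z)))"
    by (intro fpi fp_comp[OF Xs] fp_comp[OF Ys] s)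
qed (use sz_filter le_trans in \<open>blast intro: S pb_sz\<close>)+

definition dedup :: "'a list => 'a list" where "dedup xs = foldl (%a x. if x \<in> set a then a else a @ [x]) [] xs"

lemma dedup: "set (dedup xs) = set xs" "distinct (dedup xs)" "length (dedup xs) \<le> length xs"
proof -
  have "set (foldl (%a x. if x \<in> set a then a else a @ [x]) b xs) = set b \<union> set xs \<and>
      length (foldl (%a x. if x \<in> set a then a else a @ [x]) b xs) \<le> length b + length xs \<and>
      distinct (foldl (%a x. if x \<in> set a then a else a @ [x]) b xs)" if "distinct b" for b :: "'a list"
    using that
  proof (induction xs arbitrary: b)
    case (Cons x xs)
    show ?case using Cons.IH[of "if x \<in> set b then b else b @ [x]"] Cons.prems by auto
  qed simp
  from this[of "[]"] show "set (dedup xs) = set xs" "distinct (dedup xs)" "length (dedup xs) \<le> length xs" by (simp_all add: dedup_def)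
qed

lemma fp_dedup [fpi]: "fp xs ==> fp (%z. dedup (xs z))"
proof -
  assume xs: "fp xs"
  show ?thesis unfolding dedup_def
  proof (rule fp_foldl_add[OF _ _ xs, where g = "%z. sz (xs z) + 5"])
    show "sz (if y \<in> set a then a else a @ [y]) \<le> sz a + (sz (xs x) + 5)" if "y \<in> set (xs x)" for x a y
      using elem_le_sz[OF that] sz_append_le[of a "[y]"] by auto
  qed (intro fpi xs pbd_add pbd_const pb_sz)+
qed

lemma fp_expand [fpi]: "fp g ==> fp b ==> fp (%z. expand (g z) (b z))"
proof -
  assume g: "fp g" and b: "fp b"
  have "expand g b = (if fst g \<le> 1 then (if b then [(4, []), (fst g, [])] else [])
     else if fst g = 4 then (if b then [(5, [])] else [])
     else if fst g = 5 then (if b then [(4, [])] else [(6, [])])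
     else if fst g = 6 then (if b then [(5, [])] else [(9, [])])
     else if fst g = 9 then [(9, [])]
     else if length (snd g) < 2 then [(fst g, snd g @ [b])]
     else if fst g = 2 then
       (if nthd False (snd g @ [b]) 0 = False then [(3, [])]
        else if snd g @ [b] = [True, False, False] \<or> snd g @ [b] = [True, False, True] then [(2, []), (2, [])]
        else if snd g @ [b] = [True, True, False] then [(2, [])] else [(9, [])])
     else
       (if snd g @ [b] = [False, False, False] then [(4, [])]
        else if snd g @ [b] = [False, False, True] \<or> snd g @ [b] = [True, False, False] then [(3, [])]
        else if snd g @ [b] = [False, True, False] \<or> snd g @ [b] = [False, True, True] \<or> snd g @ [b] = [True, False, True]
        then [(3, []), (3, [])] else [(9, [])]))" for g b
    by (cases "snd g @ [b]") (simp_all add: expand_def nthd_Cons)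
  then show ?thesis by (simp only:) (intro fpi g b)
qed

lemma sz_expand: "sz (expand g b) \<le> sz g + 60"
proof -
  have "sz (snd g @ [b]) \<le> sz (snd g) + 5" using sz_append_le[of "snd g" "[b]"] sz_bool[of b] by auto
  then show ?thesis unfolding expand_def sz_pair[of g] by simp
qed

lemma fp_pstep: "fp st ==> fp b ==> fp (%z. pstep (st z) (b z))"
proof -
  assume st: "fp st" and b: "fp b"
  show ?thesis unfolding pstep_def by (intro fpi st b fp_comp[OF st] fp_comp[OF b])
qed

lemma sz_pstep: "sz (pstep st b) \<le> sz st + 200"
proof (cases "fst st")
  case Nil then show ?thesis by (simp add: pstep_def sz_pair[of st])
next
  case (Cons g s)
  have 1: "sz (expand g b @ s) \<le> sz g + 60 + sz s" using sz_append_le[of "expand g b" s] sz_expand[of g b] by simp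
  have 2: "sz (if fst g \<le> 3 \<and> snd g = [] then (fst g, [b]) # snd st
         else (case snd st of [] => [] | h # t => (fst h, snd h @ [b]) # t)) \<le> sz (snd st) + 40"
    using sz_bool[of b] sz_append_le[of "snd (hd (snd st))" "[b]"]
    by (cases "snd st") (auto simp: sz_pair[of "_ :: nat \<times> bool list"])
  have "pstep st b = (expand g b @ s, if fst g \<le> 3 \<and> snd g = [] then (fst g, [b]) # snd st
         else (case snd st of [] => [] | h # t => (fst h, snd h @ [b]) # t))" using Cons by (simp add: pstep_def)
  then show ?thesis using 1 2 Cons by (simp only: sz_simps sz_pair[of st])
qed

lemma fp_parse [fpi]: "fp w ==> fp (%z. parse (w z))"
proof -
  assume w: "fp w"
  show ?thesis unfolding parse_def
    by (rule fp_foldl_add[OF _ _ w pbd_const[of _ _ 200]]) (intro fp_pstep fpi sz_pstep)+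
qed

lemma fp_comp2: "fp (%z. h (fst z) (snd z)) ==> fp a ==> fp b ==> fp (%x. h (a x) (b x))"
  using fp_comp[OF _ fp_pair, of "%z. h (fst z) (snd z)" a b] by simp

lemma fp_comp3: "fp (%z. h (fst z) (fst (snd z)) (snd (snd z))) ==> fp a ==> fp b ==> fp c ==> fp (%x. h (a x) (b x) (c x))"
  using fp_comp[OF _ fp_pair[OF _ fp_pair], of "%z. h (fst z) (fst (snd z)) (snd (snd z))" a b c] by simp

lemma enc_list_simps [simp]: "enc_list e [] = [False]" "enc_list e (x # xs) = True # e x @ enc_list e xs"
  by (simp_all add: enc_list_def)

text \<open>The output is assembled from the codes of atoms found in the input. Their values may be
  exponential in the input length and are never expanded into unary; only state indices are.\<close>

definition encC :: "bool list list => bool list" where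
  "encC x = concat (map (%c. True # c) x) @ [False]"

definition encT :: "(bool list list \<times> (bool list list \<times> nat) list) list => bool list" where
  "encT T = concat (map (%e. True # encC (fst e) @ concat (map (%r. True # encC (fst r) @ enc_nat (snd r)) (snd e)) @ [False]) T) @ [False]"

lemma encC: "set x \<subseteq> range enc_nat ==> enc_list enc_nat (map code_nat x) = encC x"
  by (induction x) (auto simp: enc_list_def encC_def)

lemma encT:
  assumes "\<And>e. e \<in> set T ==> set (fst e) \<subseteq> range enc_nat \<and> (\<forall>r\<in>set (snd e). set (fst r) \<subseteq> range enc_nat)"
  shows "enc_moore (machine T) = encT T"
proof -
  have l: "enc_list e (map f T) = concat (map (%x. True # g x) T) @ [False]" if "\<And>x. x \<in> set T ==> e (f x) = g x"
    for e f T and g :: "'x => bool list"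
    using that by (induction T) auto
  show ?thesis unfolding enc_moore_def machine_def encT_def using assms
    by (intro l) (fastforce simp: enc_pair_def encC split: prod.splits intro!: l[of _ "enc_pair (enc_list enc_nat) enc_nat" for e, unfolded enc_pair_def])
qed

definition codes_of :: "nat => token list => bool list list" where
  "codes_of l segs = concat (map (%s. if fst s = l then (case snd s of [] => [] | b # c => if b then [c] else []) else []) segs)"

definition valid_codes :: "bool list list => bool list list => token list => bool" where
  "valid_codes X Y ts \<longleftrightarrow> (\<forall>x\<in>set X. x \<notin> set Y) \<and> (X \<noteq> [] \<or> Y \<noteq> []) \<and>
     (\<forall>s\<in>set ts. fst s = 3 \<and> take 3 (snd s) = [False, False, False] \<longrightarrow> drop 3 (snd s) \<in> set X \<or> drop 3 (snd s) \<in> set Y)"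

lemma codes_of_segs: "codes_of 0 (segs_of X Y \<Psi>) = map enc_nat X" "codes_of 1 (segs_of X Y \<Psi>) = map enc_nat Y"
  "filter (%s. 2 \<le> fst s) (segs_of X Y \<Psi>) = prep \<Psi>"
proof -
  have p: "\<forall>s\<in>set (pre \<phi>). fst s = 3" for \<phi> by (induction \<phi>) auto
  then have p: "\<forall>s\<in>set (prep \<Psi>). fst s = 2 \<or> fst s = 3" by (induction \<Psi>) auto
  have c: "codes_of l (xs @ ys) = codes_of l xs @ codes_of l ys" for l xs ys by (simp add: codes_of_def)
  have 1: "codes_of l (map (%x. (k, True # enc_nat x)) X) = (if k = l then map enc_nat X else [])" for k l X
    by (induction X) (auto simp: codes_of_def)
  have 2: "codes_of l (prep \<Psi>) = []" if "l \<le> 1" for l using p that by (auto simp: codes_of_def)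
  have 3: "codes_of l [(k, [False])] = []" for k l by (simp add: codes_of_def)
  show "codes_of 0 (segs_of X Y \<Psi>) = map enc_nat X" "codes_of 1 (segs_of X Y \<Psi>) = map enc_nat Y"
    by (simp_all only: segs_of_def c 1 2[of 0] 2[of 1] 3 zero_neq_one one_neq_zero le_refl zero_le if_True if_False append_Nil append_Nil2 simp_thms)
  show "filter (%s. 2 \<le> fst s) (segs_of X Y \<Psi>) = prep \<Psi>"
    using p by (auto simp: segs_of_def filter_id_conv filter_empty_conv)
qed

lemma valid_codes: "valid_codes (map enc_nat X) (map enc_nat Y) (prep \<Psi>) \<longleftrightarrow> valid_inst atoms_ltlf (X, Y, \<Psi>)"
proof -
  have 1: "(\<forall>s\<in>set (pre \<phi>). fst s = 3 \<and> take 3 (snd s) = [False, False, False] \<longrightarrow> Z (drop 3 (snd s))) \<longleftrightarrow> (\<forall>p\<in>atoms_ltlf \<phi>. Z (enc_nat p))" for \<phi> Z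
    by (induction \<phi>) (auto simp: ball_Un)
  have 2: "(\<forall>s\<in>set (prep \<Psi>). fst s = 3 \<and> take 3 (snd s) = [False, False, False] \<longrightarrow> Z (drop 3 (snd s))) \<longleftrightarrow> (\<forall>\<phi>\<in>base \<Psi>. \<forall>p\<in>atoms_ltlf \<phi>. Z (enc_nat p))" for Z
    by (induction \<Psi>) (auto simp: ball_Un 1)
  have 3: "enc_nat p \<in> set (map enc_nat X) \<longleftrightarrow> p \<in> set X" for p X by (auto simp: inj_image_mem_iff[OF enc_nat_inj])
  show ?thesis unfolding valid_codes_def valid_inst_def 2[of "%c. c \<in> set (map enc_nat X) \<or> c \<in> set (map enc_nat Y)"] 3
    by (auto simp: inj_image_mem_iff[OF enc_nat_inj])
qed

section \<open>The synthesis procedure\<close>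

locale fp_vmachine = vmachine +
  assumes fp_d0: "fp d0" and fp_updd: "fp (%z. updd (fst z) (fst (snd z)) (snd (snd z)))"
    and fp_vecof: "fp (%z. vecof (fst z) (snd z))" and fp_Ds: "fp (%z. Ds (fst z) (snd z))"
begin

definition solve :: "nat => nat => env => bool list list list => bool list list list => bool list" where
  "solve P B env Xs Ys = (if init env \<in> set (W P B env Xs Ys) then True # encT (table env Xs Ys (WS P B env Xs Ys)) else [False])"

text \<open>The bounds are arguments, so the procedure is polynomial for both logics. Duplicate
  atoms are removed because a transition table must contain exactly one entry for each subset of the
  environment's atoms.\<close>

definition synth :: "nat => nat => bool list => bool list" where
  "synth P B w = (let segs = rev (snd (parse w)); ts = filter (%s. 2 \<le> fst s) segs; X = codes_of 0 segs; Y = codes_of 1 segs in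
     if fst (parse w) = [] \<and> valid_codes X Y ts
     then solve P B (ts, tnl P (length ts) [False, True]) (tsubs P (dedup X)) (tsubs P (dedup Y)) else [False])"

lemma fp_qtrans: "fp e ==> fp a ==> fp q ==> fp (%x. qtrans (e x) (a x) (q x))"
  unfolding qtrans_def Let_def
  by (intro fpi fp_comp3[OF fp_updd] fp_comp2[OF fp_vecof])

lemma fp_trans: "fp e ==> fp a ==> fp q ==> fp (%x. trans (e x) (a x) (q x))"
  unfolding trans_def by (intro fpi fp_qtrans)

lemma fp_init: "fp e ==> fp (%x. init (e x))"
  unfolding init_def zero_vec_def by (intro fpi fp_comp[OF fp_d0])

lemma fp_allS: "fp P ==> fp B ==> fp e ==> fp (%x. allS (P x) (B x) (e x))"
proof -
  assume P: "fp P" and B: "fp B" and e: "fp e"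
  show ?thesis unfolding allS_def
    by (intro fpi fp_comp2[OF fp_Ds] fp_comp[OF P] fp_comp[OF B] fp_comp[OF e] P e)
qed

lemma fp_W: "fp P ==> fp B ==> fp e ==> fp Xs ==> fp Ys ==> fp (%x. W (P x) (B x) (e x) (Xs x) (Ys x))"
proof -
  assume P: "fp P" and B: "fp B" and e: "fp e" and Xs: "fp Xs" and Ys: "fp Ys"
  show ?thesis unfolding W_def
    by (rule fp_winset[where step = "%x s u y. trans (e x) (u @ y) s"]) (intro fpi fp_trans fp_comp[OF e] fp_allS P B e Xs Ys)+
qed

lemma fp_choice: "fp e ==> fp Xs ==> fp Ys ==> fp ws ==> fp s ==> fp (%x. choice (e x) (Xs x) (Ys x) (ws x) (s x))"
proof -
  assume e: "fp e" and Xs: "fp Xs" and Ys: "fp Ys" and ws: "fp ws" and s: "fp s"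
  show ?thesis unfolding choice_def
    by (intro fpi fp_trans Xs fp_comp[OF e] fp_comp[OF Ys] fp_comp[OF ws] fp_comp[OF s])
qed

lemma fp_index: "fp e ==> fp ws ==> fp s ==> fp (%x. index (e x) (ws x) (s x))"
proof -
  assume e: "fp e" and ws: "fp ws" and s: "fp s"
  show ?thesis unfolding index_def
    by (intro fpi fp_init ws fp_comp[OF e] fp_comp[OF ws] fp_comp[OF s])
qed

lemma fp_table: "fp e ==> fp Xs ==> fp Ys ==> fp ws ==> fp (%x. table (e x) (Xs x) (Ys x) (ws x))"
proof -
  assume e: "fp e" and Xs: "fp Xs" and Ys: "fp Ys" and ws: "fp ws"
  show ?thesis unfolding table_def
    by (intro fpi fp_trans fp_index fp_choice ws fp_comp[OF e] fp_comp[OF Xs] fp_comp[OF Ys] fp_comp[OF ws])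
qed

lemma fp_encC: "fp x ==> fp (%z. encC (x z))" unfolding encC_def by (intro fpi)

lemma fp_encT: "fp x ==> fp (%z. encT (x z))" unfolding encT_def by (intro fpi fp_encC)

lemma fp_codes_of: "fp s ==> fp (%z. codes_of l (s z))" unfolding codes_of_def by (intro fpi)

lemma fp_valid_codes: "fp X ==> fp Y ==> fp ts ==> fp (%z. valid_codes (X z) (Y z) (ts z))"
proof -
  assume X: "fp X" and Y: "fp Y" and ts: "fp ts"
  show ?thesis unfolding valid_codes_def by (intro fpi X Y ts fp_comp[OF X] fp_comp[OF Y])
qed

lemma fp_WS: "fp P ==> fp B ==> fp e ==> fp Xs ==> fp Ys ==> fp (%x. WS (P x) (B x) (e x) (Xs x) (Ys x))"
proof -
  assume P: "fp P" and B: "fp B" and e: "fp e" and Xs: "fp Xs" and Ys: "fp Ys"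
  show ?thesis unfolding WS_def by (intro fpi fp_init fp_W P B e Xs Ys fp_comp[OF e])
qed

lemma fp_synth: "fp P ==> fp B ==> fp w ==> fp (%z. synth (P z) (B z) (w z))"
  unfolding synth_def solve_def Let_def
  by (intro fpi fp_valid_codes fp_codes_of fp_encT fp_table fp_WS fp_W fp_init)

end

lemma length_pre_le: "length (pre \<phi>) \<le> length (enc_ltlf \<phi>)"
  by (induction \<phi>) auto

lemma length_prep_le: "length (prep \<Psi>) \<le> length (enc_plus enc_ltlf \<Psi>)"
  by (induction \<Psi>) (auto intro: le_trans[OF length_pre_le])

lemma length_enc_list: "length xs \<le> length (enc_list e xs)"
  by (induction xs) auto

lemma set_subseqs_codes:
  assumes "set xs = enc_nat ` A" "distinct xs"
  shows "x \<in> set (subseqs xs) ==> set x \<subseteq> enc_nat ` A" "s \<subseteq> A ==> \<exists>x\<in>set (subseqs xs). set x = enc_nat ` s"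
    "y \<in> set (subseqs xs) ==> y' \<in> set (subseqs xs) ==> set y = set y' ==> y = y'"
proof -
  have p: "set ` set (subseqs xs) = Pow (set xs)" by (rule subseqs_powset)
  show "x \<in> set (subseqs xs) ==> set x \<subseteq> enc_nat ` A" using p assms(1) by blast
  show "s \<subseteq> A ==> \<exists>x\<in>set (subseqs xs). set x = enc_nat ` s"
  proof -
    assume "s \<subseteq> A"
    then have "enc_nat ` s \<in> set ` set (subseqs xs)" unfolding p assms(1) by blast
    then show ?thesis by force
  qed
  have "inj_on set (set (subseqs xs))" using distinct_set_subseqs[OF assms(2)] by (simp add: distinct_map)
  then show "y \<in> set (subseqs xs) ==> y' \<in> set (subseqs xs) ==> set y = set y' ==> y = y'" by (auto dest: inj_onD)
qed

context fp_vmachine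
begin

text \<open>The bounds are assumed for every \<open>m\<close> up to the input length because they
  are applied to the number of tokens as well as to the numbers of atoms.\<close>

lemma synth_correct:
  assumes b: "\<And>m. m \<le> length w ==> nd m \<le> P \<and> m ^ m \<le> P \<and> B ^ (2 * m + 3) \<le> P \<and> nq m < B \<and> 2 ^ m \<le> P"
  shows "synthesis_answer atoms_ltlf L enc_ltlf w (synth P B w)"
proof (cases "\<exists>X Y \<Psi>. w = enc_inst enc_ltlf (X, Y, \<Psi>) \<and> valid_inst atoms_ltlf (X, Y, \<Psi>)")
  case False
  then have "w \<notin> realizable_words atoms_ltlf L enc_ltlf" unfolding realizable_words_def by fastforce
  moreover have "synth P B w = [False]"
  proof (cases "fst (parse w) = []")
    case True
    then obtain X Y \<Psi> where w: "w = enc_inst enc_ltlf (X, Y, \<Psi>)" using parse_complete by blast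
    then have "\<not> valid_inst atoms_ltlf (X, Y, \<Psi>)" using False by blast
    then show ?thesis unfolding w synth_def parse_inst by (simp add: codes_of_segs valid_codes[symmetric] codes_of_segs(2)[simplified])
  qed (simp add: synth_def)
  ultimately show ?thesis by (simp add: synthesis_answer_def)
next
  case True
  then obtain X Y \<Psi> where w: "w = enc_inst enc_ltlf (X, Y, \<Psi>)" and v: "valid_inst atoms_ltlf (X, Y, \<Psi>)" by blast
  define m where "m = length (prep \<Psi>)"
  have lw: "length w = length (enc_list enc_nat X) + length (enc_list enc_nat Y) + length (enc_plus enc_ltlf \<Psi>)"
    by (simp add: w enc_inst_def enc_pair_def)
  have mw: "m \<le> length w" using length_prep_le[of \<Psi>] by (simp add: m_def lw)
  have bX: "2 ^ length (dedup (map enc_nat X)) \<le> P" "2 ^ length (dedup (map enc_nat Y)) \<le> P"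
    using b[of "length (dedup (map enc_nat X))"] b[of "length (dedup (map enc_nat Y))"] dedup(3)[of "map enc_nat X"] dedup(3)[of "map enc_nat Y"]
      length_enc_list[of X enc_nat] length_enc_list[of Y enc_nat] by (simp_all add: lw)
  define Xs where "Xs = subseqs (dedup (map enc_nat X))"
  define Ys where "Ys = subseqs (dedup (map enc_nat Y))"
  define env where "env = envof \<Psi>"
  have "tnl P m [False, True] = List.n_lists m [False, True]"
  proof (rule tnl)
    have "2 ^ m \<le> P" using b[OF mw] by blast
    then show "length [False, True] ^ m \<le> P" by (simp add: numeral_2_eq_2)
  qed
  then have s: "synth P B w = solve P B env Xs Ys"
    using v unfolding w synth_def parse_inst
    by (simp add: codes_of_segs codes_of_segs(2)[simplified] valid_codes Let_def tsubs[OF bX(1)] tsubs[OF bX(2)] Xs_def Ys_def env_def envof_def m_def)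
  note bb = b[OF mw]
  have dX: "set (dedup (map enc_nat X)) = enc_nat ` set X" "distinct (dedup (map enc_nat X))" by (simp_all add: dedup)
  have dY: "set (dedup (map enc_nat Y)) = enc_nat ` set Y" "distinct (dedup (map enc_nat Y))" by (simp_all add: dedup)
  have dis: "set X \<inter> set Y = {}" using v by (simp add: valid_inst_def)
  note F = m_def env_def dis set_subseqs_codes(1)[OF dX, folded Xs_def] set_subseqs_codes(2)[OF dX, folded Xs_def]
    set_subseqs_codes(1)[OF dY, folded Ys_def] set_subseqs_codes(2)[OF dY, folded Ys_def] set_subseqs_codes(3)[OF dY, folded Ys_def]
    bb[THEN conjunct1] bb[THEN conjunct2, THEN conjunct1] bb[THEN conjunct2, THEN conjunct2, THEN conjunct1]
    bb[THEN conjunct2, THEN conjunct2, THEN conjunct2, THEN conjunct1]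
  have 1: "init env \<in> set (W P B env Xs Ys)" if "wins (set X) (set Y) \<sigma> (plus_lang L (set X \<union> set Y) \<Psi>)" for \<sigma>
    by (rule wins_imp_init[OF F that])
  let ?T = "machine (table env Xs Ys (WS P B env Xs Ys))"
  have 2: "moore_wf (set X) (set Y) ?T \<and> wins (set X) (set Y) (moore_strategy ?T) (plus_lang L (set X \<union> set Y) \<Psi>)"
    if "init env \<in> set (W P B env Xs Ys)"
    by (rule machine_correct[OF F that])
  have enc: "enc_moore ?T = encT (table env Xs Ys (WS P B env Xs Ys))" if i: "init env \<in> set (W P B env Xs Ys)"
  proof (rule encT)
    fix e assume "e \<in> set (table env Xs Ys (WS P B env Xs Ys))"
    then obtain s where s: "s \<in> set (WS P B env Xs Ys)" "e = (choice env Xs Ys (WS P B env Xs Ys) s,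
     map (%y. (y, index env (WS P B env Xs Ys) (trans env (choice env Xs Ys (WS P B env Xs Ys) s @ y) s))) Ys)"
      unfolding table_def by auto
    have "choice env Xs Ys ws s' \<in> insert [] (set Xs)" for ws s'
      unfolding choice_def first_of_def by (auto split: list.split dest!: filter_eq_ConsD)
    then have "set (choice env Xs Ys ws s') \<subseteq> range enc_nat" for ws s'
      using set_subseqs_codes(1)[OF dX, folded Xs_def] by (metis (no_types) empty_subsetI image_mono insertE list.set(1) order_trans subset_UNIV)
    moreover have "\<forall>y\<in>set Ys. set y \<subseteq> range enc_nat" using set_subseqs_codes(1)[OF dY, folded Ys_def] by blast
    ultimately show "set (fst e) \<subseteq> range enc_nat \<and> (\<forall>r\<in>set (snd e). set (fst r) \<subseteq> range enc_nat)" unfolding s(2) by auto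
  qed
  have inj: "w = enc_inst enc_ltlf I \<longleftrightarrow> I = (X, Y, \<Psi>)" for I
    using inj_enc_inst[OF prefix_code_enc_ltlf] unfolding w by (auto dest: injD)
  have real: "w \<in> realizable_words atoms_ltlf L enc_ltlf \<longleftrightarrow> (\<exists>\<sigma>. wins (set X) (set Y) \<sigma> (plus_lang L (set X \<union> set Y) \<Psi>))"
    using v by (auto simp: realizable_words_def inj inst_wins_def)
  show ?thesis
  proof (cases "init env \<in> set (W P B env Xs Ys)")
    case True
    then have "w \<in> realizable_words atoms_ltlf L enc_ltlf" using 2 real by blast
    then have "synthesis_answer atoms_ltlf L enc_ltlf w v \<longleftrightarrow> (\<exists>X Y \<Psi> T. valid_inst atoms_ltlf (X, Y, \<Psi>) \<and> w = enc_inst enc_ltlf (X, Y, \<Psi>) \<and>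
             moore_wf (set X) (set Y) T \<and> inst_wins L (X, Y, \<Psi>) (moore_strategy T) \<and> v = True # enc_moore T)" for v
      unfolding synthesis_answer_def by simp
    moreover have "synth P B w = True # enc_moore ?T" unfolding s solve_def using True by (simp add: enc[OF True])
    moreover have "inst_wins L (X, Y, \<Psi>) (moore_strategy ?T)" "moore_wf (set X) (set Y) ?T" using 2[OF True] by (simp_all add: inst_wins_def)
    ultimately show ?thesis using v w by blast
  next
    case False
    then have "w \<notin> realizable_words atoms_ltlf L enc_ltlf" using 1 real by blast
    then show ?thesis unfolding synthesis_answer_def s solve_def using False by simp
  qed
qed

text \<open>Decision and search share one program: the first letter of the synthesis output tells
  whether the instance is realizable.\<close>

lemma upper_bound:
  assumes B: "fpon UNIV r B" and P: "fpon UNIV r P" and r: "\<And>w :: bool list. sz w \<le> r w"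
    and b: "\<And>w m. m \<le> length w ==> nd m \<le> P w \<and> m ^ m \<le> P w \<and> B w ^ (2 * m + 3) \<le> P w \<and> nq m < B w \<and> 2 ^ m \<le> P w"
  shows "\<exists>k. \<forall>F. (\<forall>w. (r w + 2) ^ k \<le> F (length w)) \<longrightarrow>
     decidable_in_time F (realizable_words atoms_ltlf L enc_ltlf) \<and> solvable_in_time F (synthesis_answer atoms_ltlf L enc_ltlf)"
proof -
  have s: "pbd UNIV r sz" by (rule pbd_mono[OF pbd_self]) (rule r)
  have id: "fpon UNIV r (%w. w)" by (rule fpon_id[OF s])
  have "fpon UNIV r (%w. (P w, (B w, w)))" by (intro fpon_pair P B id s)
  moreover have "fp (%z :: nat \<times> nat \<times> bool list. synth (fst z) (fst (snd z)) (snd (snd z)))" by (intro fp_synth fpi)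
  ultimately have f1: "fpon UNIV r (%w. synth (P w) (B w) w)" by (drule_tac fpon_fp) auto
  then have f2: "fpon UNIV r (%w. take 1 (synth (P w) (B w) w))" by (rule fpon_fp) (intro fpi)
  have c: "synthesis_answer atoms_ltlf L enc_ltlf w (synth (P w) (B w) w)" for w
    by (rule synth_correct) (rule b)
  have d: "take 1 (synth (P w) (B w) w) = [w \<in> realizable_words atoms_ltlf L enc_ltlf]" for w
    using c[of w] by (auto simp: synthesis_answer_def split: if_splits)
  obtain k1 where k1: "\<And>F R. (\<forall>w. (r w + 2) ^ k1 \<le> F (length w)) ==> (\<forall>w. R w (synth (P w) (B w) w)) ==> solvable_in_time F R"
    using fpon_solvable[OF f1 r] by blast
  obtain k2 where k2: "\<And>F R. (\<forall>w. (r w + 2) ^ k2 \<le> F (length w)) ==> (\<forall>w. R w (take 1 (synth (P w) (B w) w))) ==> solvable_in_time F R"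
    using fpon_solvable[OF f2 r] by blast
  show ?thesis
  proof (intro exI[of _ "k1 + k2"] allI impI)
    fix F assume F: "\<forall>w. (r w + 2) ^ (k1 + k2) \<le> F (length w)"
    have 1: "\<forall>w. (r w + 2) ^ k1 \<le> F (length w)" using F power_mono2[of k1 "k1 + k2"] by (meson le_add1 le_trans)
    have 2: "\<forall>w. (r w + 2) ^ k2 \<le> F (length w)" using F power_mono2[of k2 "k1 + k2"] by (meson le_add2 le_trans)
    have "solvable_in_time F (synthesis_answer atoms_ltlf L enc_ltlf)" by (rule k1[OF 1]) (simp add: c)
    moreover have "decidable_in_time F (realizable_words atoms_ltlf L enc_ltlf)"
      unfolding decidable_in_time_def by (rule k2[OF 2]) (simp add: d[simplified])
    ultimately show "decidable_in_time F (realizable_words atoms_ltlf L enc_ltlf) \<and> solvable_in_time F (synthesis_answer atoms_ltlf L enc_ltlf)" by blast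
  qed
qed

end

subsection \<open>The two logics\<close>

definition mir_lang :: "nat set => nat ltlf => nat set list set" where
  "mir_lang AP \<phi> = ppltl_lang AP (mir \<phi>)"

definition d0_l :: "env => bool list list" where "d0_l e = snd e"
text \<open>A state tabulates a map on vectors, from the values behind the prefix to those at its
  beginning. A further letter is precomposed, so that the first letter is applied last, as in
  \<open>ltlf_vec\<close>. The truth values of the prefix are the image of the zero vector, which is
  the first entry of the table.\<close>

definition updd_l :: "env => bool list list => bool list list => bool list list" where
  "updd_l e a d = map (%b. snd (first_of ([], []) (%p. fst p = step_vec (fst e) a b) (zip (snd e) d))) (snd e)"

lemma n_lists_Cons: "\<exists>l. List.n_lists n [False, True] = replicate n False # l"
  by (induction n) auto

interpretation ltlf: fp_vmachine "%t \<phi>. ltlf_sat t 0 \<phi>" d0_l updd_l "%e d. nthd [] d 0"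
  "%P e. tnl P (length (snd e)) (snd e)" "%m. (2 ^ m) ^ (2 ^ m)"
proof
  fix t as \<Psi> assume c: "codes t as" "as \<noteq> []"
  let ?e = "envof \<Psi>" and ?m = "length (prep \<Psi>)"
  have sete: "set (snd ?e) = {u. length u = ?m}" by (auto simp: envof_def set_n_lists)
  have look: "snd (first_of ([], []) (%p. fst p = v) (zip l (map f l))) = f v" if "v \<in> set l" for v :: "bool list" and l and f :: "bool list => bool list"
    using first_of[of "zip l (map f l)" "%p. fst p = v" "([], [])"] that by (auto simp: zip_map2 zip_same_conv_map)
  have d: "foldl (%d a. updd_l ?e a d) (map f (snd ?e)) as = map (%b. f (foldr (step_vec (prep \<Psi>)) as b)) (snd ?e)" for f as
  proof (induction as arbitrary: f)
    case (Cons a as)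
    have "updd_l ?e a (map f (snd ?e)) = map (%b. f (step_vec (prep \<Psi>) a b)) (snd ?e)"
      unfolding updd_l_def using sete by (intro map_cong refl) (auto simp: look length_step_vec envof_def)
    then show ?case using Cons by simp
  qed simp
  have "0 < length t" using c by (cases as; cases t) (auto simp: codes_def)
  moreover have "nthd [] (map g (snd ?e)) 0 = g (zero_vec (prep \<Psi>))" for g :: "bool list => bool list"
  proof -
    have "\<exists>l. snd ?e = replicate ?m False # l" unfolding envof_def snd_conv by (rule n_lists_Cons)
    then show ?thesis by (auto simp: nthd_Cons zero_vec_def)
  qed
  ultimately show "nthd [] (foldl (%d a. updd_l ?e a d) (d0_l ?e) as) 0 = map (opt (%\<phi>. ltlf_sat t 0 \<phi>)) (subsp \<Psi>)"
    using d[of "%b. b" as] ltlf_vec[OF c(1), of \<Psi>] by (simp add: d0_l_def)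
next
  fix P :: nat and \<Psi> assume P: "(2 ^ length (prep \<Psi>)) ^ (2 ^ length (prep \<Psi>)) \<le> P"
  let ?e = "envof \<Psi>" and ?m = "length (prep \<Psi>)"
  have le: "length (snd ?e) = 2 ^ ?m" by (simp add: envof_def length_n_lists numeral_2_eq_2)
  have t: "tnl P (length (snd ?e)) (snd ?e) = List.n_lists (length (snd ?e)) (snd ?e)"
    by (rule tnl) (use P in \<open>simp add: le\<close>)
  show "d0_l ?e \<in> set (tnl P (length (snd ?e)) (snd ?e))" unfolding t by (simp add: set_n_lists d0_l_def)
  show "length (tnl P (length (snd ?e)) (snd ?e)) \<le> (2 ^ ?m) ^ (2 ^ ?m)" unfolding t by (simp add: length_n_lists le numeral_2_eq_2)
  fix d a assume "d \<in> set (tnl P (length (snd ?e)) (snd ?e))"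
  then have d: "length d = length (snd ?e)" "set d \<subseteq> set (snd ?e)" unfolding t by (auto simp: set_n_lists)
  have sete: "set (snd ?e) = {u. length u = ?m}" by (auto simp: envof_def set_n_lists)
  have h: "snd (first_of ([], []) (%p. fst p = v) (zip (snd ?e) d)) \<in> set (snd ?e)" if v: "v \<in> set (snd ?e)" for v
  proof -
    obtain i where i: "i < length (snd ?e)" "snd ?e ! i = v" using v unfolding in_set_conv_nth by blast
    then have "(v, d ! i) \<in> set (zip (snd ?e) d)" unfolding in_set_zip using d(1) i by (intro exI[of _ i]) simp
    then have "first_of ([], []) (%p. fst p = v) (zip (snd ?e) d) \<in> set (zip (snd ?e) d)"
      by (intro first_of[THEN conjunct1] bexI[of _ "(v, d ! i)"]) simp_all
    then show ?thesis using d(2) by (metis in_mono prod.collapse set_zip_rightD)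
  qed
  have "step_vec (fst ?e) a b \<in> set (snd ?e)" if "b \<in> set (snd ?e)" for b
    using that unfolding sete by (simp add: length_step_vec envof_def)
  then show "updd_l ?e a d \<in> set (tnl P (length (snd ?e)) (snd ?e))"
    unfolding t set_n_lists updd_l_def mem_Collect_eq length_map set_map by (intro conjI refl image_subsetI h) blast
next
  show "fp d0_l" unfolding d0_l_def by (intro fpi)
  show "fp (%z. updd_l (fst z) (fst (snd z)) (snd (snd z)))" unfolding updd_l_def by (intro fpi)
qed (intro fpi)+

interpretation ppltl: fp_vmachine "%t \<phi>. ppltl_sat t (length t - 1) (mir \<phi>)" "%e. zero_vec (fst e)"
  "%e a d. step_vec (fst e) a d" "%e d. d" "%P e. snd e" "%m. 2 ^ m"
proof
  fix t as \<Psi> assume c: "codes t as" "as \<noteq> []"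
  show "foldl (%d a. step_vec (fst (envof \<Psi>)) a d) (zero_vec (fst (envof \<Psi>))) as = map (opt (%\<phi>. ppltl_sat t (length t - 1) (mir \<phi>))) (subsp \<Psi>)"
    using ppltl_vec[OF c] by (simp add: envof_def)
next
  show "fp (%e :: env. zero_vec (fst e))" unfolding zero_vec_def by (intro fpi)
qed (auto simp: envof_def set_n_lists length_n_lists length_step_vec zero_vec_def numeral_2_eq_2 intro!: fpi)

lemma L_ltlf: "ltlf.L = ltlf_lang"
  by (auto simp: fun_eq_iff ltlf.L_def ltlf_lang_def)

lemma L_ppltl: "ppltl.L = mir_lang"
  unfolding fun_eq_iff ppltl.L_def mir_lang_def ppltl_lang_def by blast

text \<open>Both problems speak about words only, so a surjective translation that preserves codes,
  atoms and languages makes them equal.\<close>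

lemma transfer_problem:
  assumes e: "\<And>\<phi>. e' (f \<phi>) = e \<phi>" and a: "\<And>\<phi>. ats' (f \<phi>) = ats \<phi>" and L: "\<And>AP \<phi>. L' AP (f \<phi>) = L AP \<phi>" and s: "surj f"
  shows "realizable_words ats' L' e' = realizable_words ats L e" "synthesis_answer ats' L' e' = synthesis_answer ats L e"
proof -
  have 1: "enc_plus e' (map_plus f \<Psi>) = enc_plus e \<Psi>" for \<Psi> by (induction \<Psi>) (auto simp: e)
  have 2: "plus_lang L' AP (map_plus f \<Psi>) = plus_lang L AP \<Psi>" for AP \<Psi> by (induction \<Psi>) (auto simp: L)
  have 3: "\<exists>\<Psi>. \<Psi>' = map_plus f \<Psi>" for \<Psi>'
    by (rule exI[of _ "map_plus (inv f) \<Psi>'"]) (simp add: plus.map_comp surj_iff[THEN iffD1, OF s] plus.map_id[unfolded id_def] id_def)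
  have v: "valid_inst ats' (X, Y, map_plus f \<Psi>) = valid_inst ats (X, Y, \<Psi>)" for X Y \<Psi>
    by (simp add: valid_inst_def plus.set_map a)
  have i: "enc_inst e' (X, Y, map_plus f \<Psi>) = enc_inst e (X, Y, \<Psi>)" for X Y \<Psi> by (simp add: enc_inst_def enc_pair_def 1)
  have w: "inst_wins L' (X, Y, map_plus f \<Psi>) = inst_wins L (X, Y, \<Psi>)" for X Y \<Psi> by (simp add: fun_eq_iff inst_wins_def 2)
  have all: "(\<exists>\<Psi>'. P \<Psi>') \<longleftrightarrow> (\<exists>\<Psi>. P (map_plus f \<Psi>))" for P using 3 by metis
  show r: "realizable_words ats' L' e' = realizable_words ats L e"
    unfolding realizable_words_def by (simp add: all v i w)
  show "synthesis_answer ats' L' e' = synthesis_answer ats L e"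
    unfolding fun_eq_iff synthesis_answer_def r by (simp add: all v i w)
qed

lemma surj_mir: "surj mir"
proof -
  have "\<exists>\<phi>. mir \<phi> = \<psi>" for \<psi> :: "'a ppltl"
  proof (induction \<psi>)
    case (PAtom x) show ?case by (rule exI[of _ "LAtom x"]) simp
  next
    case (PNot \<psi>) then obtain \<phi> where "mir \<phi> = \<psi>" by blast
    then show ?case by (intro exI[of _ "LNot \<phi>"]) simp
  next
    case (POr \<psi> \<psi>') then obtain \<phi> \<phi>' where "mir \<phi> = \<psi>" "mir \<phi>' = \<psi>'" by blast
    then show ?case by (intro exI[of _ "LOr \<phi> \<phi>'"]) simp
  next
    case (PAnd \<psi> \<psi>') then obtain \<phi> \<phi>' where "mir \<phi> = \<psi>" "mir \<phi>' = \<psi>'" by blast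
    then show ?case by (intro exI[of _ "LAnd \<phi> \<phi>'"]) simp
  next
    case (PYesterday \<psi>) then obtain \<phi> where "mir \<phi> = \<psi>" by blast
    then show ?case by (intro exI[of _ "LNext \<phi>"]) simp
  next
    case (PSince \<psi> \<psi>') then obtain \<phi> \<phi>' where "mir \<phi> = \<psi>" "mir \<phi>' = \<psi>'" by blast
    then show ?case by (intro exI[of _ "LUntil \<phi> \<phi>'"]) simp
  qed
  then show ?thesis unfolding surj_def by metis
qed

lemma enc_mir: "enc_ppltl (mir \<phi>) = enc_ltlf \<phi>" and atoms_mir: "atoms_ppltl (mir \<phi>) = atoms_ltlf \<phi>"
  by (induction \<phi>) auto

lemma PPLTL_plus_mir: "PPLTL_plus_realizability = realizable_words atoms_ltlf mir_lang enc_ltlf"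
  "PPLTL_plus_synthesis = synthesis_answer atoms_ltlf mir_lang enc_ltlf"
  unfolding PPLTL_plus_realizability_def PPLTL_plus_synthesis_def
  by (rule transfer_problem[where f = mir]; simp add: enc_mir atoms_mir mir_lang_def surj_mir)+

section \<open>Exponents of the time bounds\<close>

lemma nq_arith:
  fixes m n :: nat assumes "m \<le> n"
  shows "m ^ m * (2 * m + 3) \<le> 2 ^ (m * m + (m + 2))" "2 * m + 3 \<le> (2 :: nat) ^ (m + 2)"
proof -
  have le: "k < 2 ^ k" for k :: nat by (rule less_exp)
  have "m ^ m \<le> (2 ^ m) ^ m" using le[of m] by (intro power_mono) auto
  then have 1: "m ^ m \<le> 2 ^ (m * m)" by (simp add: power_mult)
  show 2: "2 * m + 3 \<le> (2 :: nat) ^ (m + 2)" using Suc_leI[OF le[of m]] by simp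
  show "m ^ m * (2 * m + 3) \<le> 2 ^ (m * m + (m + 2))" unfolding power_add[of _ "m * m"] by (rule mult_mono[OF 1 2]) auto
qed

lemma fp_len: "fp (%w :: bool list. (length w + 4) ^ k)" by (intro fpi)

lemma sz_le_exp: "sz (w :: bool list) \<le> 2 ^ ((length w + 4) ^ 4)"
proof -
  have "sz w \<le> 4 * length w + 1" by (rule sz_bools)
  also have "\<dots> \<le> 2 ^ (length w + 4)" using Suc_leI[OF less_exp[of "length w"]] by (simp add: power_add)
  also have "\<dots> \<le> 2 ^ ((length w + 4) ^ 4)" by (intro power_increasing self_le_power) auto
  finally show ?thesis .
qed

text \<open>For PPLTL the bounds are \<open>B = 2 ^ (n + 4) ^ 2\<close> and
  \<open>P = 2 ^ (n + 4) ^ 4\<close>, and for LTLf one exponential more. \<open>B\<close> has to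
  exceed the number of positions without counters, and \<open>P\<close> has to be at least the
  number \<open>B ^ (2 * m + 3)\<close> of counter vectors; this dictates the exponents 2 and
  4.\<close>

lemma e_arith:
  fixes m n :: nat assumes "m \<le> n"
  shows "m + m + m * m + m + 2 < (n + 4) ^ 2" "(n + 4) ^ 2 * (2 * m + 3) \<le> (n + 4) ^ 4" "m \<le> (n + 4) ^ 4" "m * m \<le> (n + 4) ^ 4"
    "(n + 4) ^ 2 + (m + 2) \<le> (n + 4) ^ 4" "2 * m + 3 < (n + 4) ^ 2" "2 * m \<le> (n + 4) ^ 4" "(n + 4) ^ 2 \<le> (n + 4) ^ 4"
proof -
  have mm: "m * m \<le> n * n" using assms by (intro mult_mono) auto
  show a: "m + m + m * m + m + 2 < (n + 4) ^ 2" using assms mm by (simp add: power2_eq_square algebra_simps)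
  have 4: "(n + 4) ^ 4 = (n + 4) ^ 2 * (n + 4) ^ 2" by (simp add: power_add[symmetric])
  show b: "2 * m + 3 < (n + 4) ^ 2" using assms by (simp add: power2_eq_square algebra_simps)
  then show "(n + 4) ^ 2 * (2 * m + 3) \<le> (n + 4) ^ 4" unfolding 4 by (intro mult_le_mono) auto
  have c: "(n + 4) ^ 2 * 2 \<le> (n + 4) ^ 4" unfolding 4 using b by (intro mult_le_mono) auto
  then show "m \<le> (n + 4) ^ 4" "m * m \<le> (n + 4) ^ 4" "(n + 4) ^ 2 + (m + 2) \<le> (n + 4) ^ 4" "2 * m \<le> (n + 4) ^ 4" "(n + 4) ^ 2 \<le> (n + 4) ^ 4"
    using a b by linarith+
qed

theorem PPLTL_plus_upper: "PPLTL_plus_realizability \<in> EXPTIME" "PPLTL_plus_synthesis \<in> search_EXPTIME"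
proof -
  define r where "r w = (2 :: nat) ^ ((length w + 4) ^ 4)" for w :: "bool list"
  have sr: "sz w \<le> r w" for w unfolding r_def by (rule sz_le_exp)
  have len: "fpon UNIV r (%w. (length w + 4) ^ k)" for k
    using fp_len[of k] unfolding fp_def by (rule fpon_mono_r) (rule sr)
  have P: "fpon UNIV r (%w. (2::nat) ^ ((length w + 4) ^ 4))" by (rule fpon_exp_comp[OF len]) (simp add: r_def)
  have B: "fpon UNIV r (%w. (2::nat) ^ ((length w + 4) ^ 2))"
    by (rule fpon_exp_comp[OF len]) (use e_arith(8)[OF order_refl] in \<open>simp add: r_def\<close>)
  have b: "2 ^ m \<le> (2::nat) ^ ((length w + 4) ^ 4) \<and> m ^ m \<le> (2::nat) ^ ((length w + 4) ^ 4) \<and>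
      ((2::nat) ^ ((length w + 4) ^ 2)) ^ (2 * m + 3) \<le> 2 ^ ((length w + 4) ^ 4) \<and>
      ppltl.nq m < 2 ^ ((length w + 4) ^ 2) \<and> 2 ^ m \<le> (2::nat) ^ ((length w + 4) ^ 4)"
    if "m \<le> length w" for m and w :: "bool list"
  proof (intro conjI)
    note a = e_arith[OF that]
    show "2 ^ m \<le> (2::nat) ^ ((length w + 4) ^ 4)" "2 ^ m \<le> (2::nat) ^ ((length w + 4) ^ 4)" using a by simp_all
    have "m ^ m \<le> (2 ^ m) ^ m" using less_exp[of m] by (intro power_mono) auto
    also have "\<dots> \<le> 2 ^ ((length w + 4) ^ 4)" using a by (simp add: power_mult[symmetric])
    finally show "m ^ m \<le> 2 ^ ((length w + 4) ^ 4)" .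
    show "((2::nat) ^ ((length w + 4) ^ 2)) ^ (2 * m + 3) \<le> 2 ^ ((length w + 4) ^ 4)"
      unfolding power_mult[symmetric] using a(2) by (intro power_increasing) auto
    have "ppltl.nq m \<le> 2 ^ m * (2 ^ m * 2 ^ (m * m + (m + 2)))"
      unfolding ppltl.nq_def using nq_arith(1)[OF order_refl] by (intro mult_le_mono le_refl)
    also have "\<dots> = 2 ^ (m + m + m * m + m + 2)" by (simp add: power_add)
    also have "\<dots> < 2 ^ ((length w + 4) ^ 2)" by (intro power_strict_increasing a(1)) simp
    finally show "ppltl.nq m < 2 ^ ((length w + 4) ^ 2)" .
  qed
  obtain k where k: "\<And>F. \<forall>w. (r w + 2) ^ k \<le> F (length w) ==>
     decidable_in_time F PPLTL_plus_realizability \<and> solvable_in_time F PPLTL_plus_synthesis"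
    using ppltl.upper_bound[OF B P sr b] unfolding L_ppltl PPLTL_plus_mir by blast
  \<comment> \<open>From \<open>r w + 2 \<le> 2 ^ ((length w + 4) ^ 4 + 1)\<close>; the power
    \<open>k\<close> becomes a factor of the exponent.\<close>
  define p where "p = [:k:] * ([:4, 1:] ^ 4 + 1)"
  have "(r w + 2) ^ k \<le> 2 ^ poly p (length w)" for w
  proof -
    have "r w + 2 \<le> 2 ^ ((length w + 4) ^ 4 + 1)"
      using self_le_power[of 2 "(length w + 4) ^ 4"] by (simp add: r_def)
    then have "(r w + 2) ^ k \<le> (2 ^ ((length w + 4) ^ 4 + 1)) ^ k" by (intro power_mono) auto
    then show ?thesis unfolding power_mult[symmetric] by (simp add: p_def poly_power algebra_simps)
  qed
  then have "decidable_in_time (%n. 2 ^ poly p n) PPLTL_plus_realizability \<and> solvable_in_time (%n. 2 ^ poly p n) PPLTL_plus_synthesis"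
    by (intro k) blast
  then show "PPLTL_plus_realizability \<in> EXPTIME" "PPLTL_plus_synthesis \<in> search_EXPTIME"
    unfolding EXPTIME_def search_EXPTIME_def by blast+
qed

theorem LTLf_plus_upper: "LTLf_plus_realizability \<in> TWO_EXPTIME" "LTLf_plus_synthesis \<in> search_TWO_EXPTIME"
proof -
  define r where "r w = (2 :: nat) ^ 2 ^ ((length w + 4) ^ 4)" for w :: "bool list"
  have le: "n \<le> 2 ^ n" for n :: nat using less_exp[of n] by simp
  have sr: "sz w \<le> r w" for w unfolding r_def by (rule le_trans[OF sz_le_exp le])
  have len: "fpon UNIV r (%w. (length w + 4) ^ k)" for k
    using fp_len[of k] unfolding fp_def by (rule fpon_mono_r) (rule sr)
  have 1: "fpon UNIV r (%w. (2::nat) ^ ((length w + 4) ^ 4))" by (rule fpon_exp_comp[OF len]) (simp add: r_def le)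
  have e2: "(2::nat) ^ ((length w + 4) ^ 2) \<le> 2 ^ ((length w + 4) ^ 4)" for w :: "bool list"
    using e_arith(8)[OF order_refl] by (intro power_increasing) auto
  have 2: "fpon UNIV r (%w. (2::nat) ^ ((length w + 4) ^ 2))"
    by (rule fpon_exp_comp[OF len]) (use e2 le le_trans in \<open>unfold r_def, blast\<close>)
  have P: "fpon UNIV r (%w. (2::nat) ^ 2 ^ ((length w + 4) ^ 4))" by (rule fpon_exp_comp[OF 1]) (simp add: r_def)
  have B: "fpon UNIV r (%w. (2::nat) ^ 2 ^ ((length w + 4) ^ 2))"
    by (rule fpon_exp_comp[OF 2]) (unfold r_def, intro power_increasing e2, simp)
  have b: "(2 ^ m) ^ (2 ^ m) \<le> (2::nat) ^ 2 ^ ((length w + 4) ^ 4) \<and> m ^ m \<le> (2::nat) ^ 2 ^ ((length w + 4) ^ 4) \<and>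
      ((2::nat) ^ 2 ^ ((length w + 4) ^ 2)) ^ (2 * m + 3) \<le> 2 ^ 2 ^ ((length w + 4) ^ 4) \<and>
      ltlf.nq m < 2 ^ 2 ^ ((length w + 4) ^ 2) \<and> 2 ^ m \<le> (2::nat) ^ 2 ^ ((length w + 4) ^ 4)"
    if "m \<le> length w" for m and w :: "bool list"
  proof (intro conjI)
    note a = e_arith[OF that]
    have m4: "m * 2 ^ m \<le> (2::nat) ^ (2 * m)" using le[of m] by (simp add: mult_2 power_add)
    have "m * 2 ^ m \<le> (2::nat) ^ ((length w + 4) ^ 4)"
      by (rule le_trans[OF m4]) (intro power_increasing a(7), simp)
    then show "(2 ^ m) ^ (2 ^ m) \<le> (2::nat) ^ 2 ^ ((length w + 4) ^ 4)"
      unfolding power_mult[symmetric] by (intro power_increasing) auto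
    have l: "(length w + 4) ^ 4 \<le> 2 ^ ((length w + 4) ^ 4)" by (rule le)
    then show "2 ^ m \<le> (2::nat) ^ 2 ^ ((length w + 4) ^ 4)"
      using a(3) by (intro power_increasing) linarith+
    have "m ^ m \<le> (2 ^ m) ^ m" using less_exp[of m] by (intro power_mono) auto
    also have "\<dots> \<le> 2 ^ 2 ^ ((length w + 4) ^ 4)" unfolding power_mult[symmetric]
      using a(4) l by (intro power_increasing) linarith+
    finally show "m ^ m \<le> 2 ^ 2 ^ ((length w + 4) ^ 4)" .
    have "2 ^ ((length w + 4) ^ 2) * (2 * m + 3) \<le> 2 ^ ((length w + 4) ^ 2) * (2::nat) ^ (m + 2)"
      by (rule mult_le_mono2) (rule nq_arith(2)[OF order_refl])
    also have "\<dots> \<le> 2 ^ ((length w + 4) ^ 4)" unfolding power_add[symmetric] by (intro power_increasing a(5)) simp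
    finally show "((2::nat) ^ 2 ^ ((length w + 4) ^ 2)) ^ (2 * m + 3) \<le> 2 ^ 2 ^ ((length w + 4) ^ 4)"
      unfolding power_mult[symmetric] by (intro power_increasing) auto
    have "ltlf.nq m \<le> (2 ^ m) ^ (2 ^ m) * (2 ^ m * 2 ^ (m * m + (m + 2)))"
      unfolding ltlf.nq_def using nq_arith(1)[OF order_refl] by (intro mult_le_mono le_refl)
    also have "\<dots> = 2 ^ (m * 2 ^ m + (m + (m * m + (m + 2))))" by (simp add: power_add power_mult)
    also have "\<dots> < 2 ^ 2 ^ ((length w + 4) ^ 2)"
    proof (intro power_strict_increasing)
      have "m + 2 \<le> 2 ^ (m + 1)" using less_exp[of "m + 1"] by linarith
      then have "(m + 2) * (m + 2) \<le> 2 ^ (m + 1) * 2 ^ (m + 1)" by (intro mult_le_mono)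
      then have "m + (m * m + (m + 2)) \<le> 2 ^ (2 * m + 2)" by (simp add: power_add[symmetric] algebra_simps mult_2_right)
      then have "m * 2 ^ m + (m + (m * m + (m + 2))) \<le> 2 ^ (2 * m + 3)" using m4 by (simp add: power_add)
      also have "\<dots> < 2 ^ ((length w + 4) ^ 2)" by (intro power_strict_increasing a(6)) simp
      finally show "m * 2 ^ m + (m + (m * m + (m + 2))) < 2 ^ ((length w + 4) ^ 2)" .
    qed simp
    finally show "ltlf.nq m < 2 ^ 2 ^ ((length w + 4) ^ 2)" .
  qed
  obtain k where k: "\<And>F. \<forall>w. (r w + 2) ^ k \<le> F (length w) ==>
     decidable_in_time F LTLf_plus_realizability \<and> solvable_in_time F LTLf_plus_synthesis"
    using ltlf.upper_bound[OF B P sr b] unfolding L_ltlf LTLf_plus_realizability_def LTLf_plus_synthesis_def by blast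
  \<comment> \<open>Here \<open>k\<close> is absorbed one level higher, by
    \<open>(?E + 1) * k \<le> (?E * 2) * 2 ^ k\<close> for the inner exponential
    \<open>?E\<close>.\<close>
  define p where "p = [:4, 1:] ^ 4 + [:k + 1:]"
  have "(r w + 2) ^ k \<le> 2 ^ 2 ^ poly p (length w)" for w
  proof -
    let ?E = "2 ^ ((length w + 4) ^ 4) :: nat"
    have "r w + 2 \<le> 2 ^ (?E + 1)" using self_le_power[of 2 ?E] by (simp add: r_def)
    then have "(r w + 2) ^ k \<le> (2 ^ (?E + 1)) ^ k" by (intro power_mono) auto
    also have "\<dots> \<le> 2 ^ 2 ^ poly p (length w)" unfolding power_mult[symmetric]
    proof (intro power_increasing)
      have "(?E + 1) * k \<le> (?E * 2) * 2 ^ k" using le[of k] by (intro mult_le_mono) auto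
      also have "\<dots> = 2 ^ poly p (length w)" by (simp add: p_def poly_power power_add add.commute)
      finally show "(?E + 1) * k \<le> 2 ^ poly p (length w)" .
    qed simp
    finally show ?thesis .
  qed
  then have "decidable_in_time (%n. 2 ^ 2 ^ poly p n) LTLf_plus_realizability \<and> solvable_in_time (%n. 2 ^ 2 ^ poly p n) LTLf_plus_synthesis"
    by (intro k) blast
  then show "LTLf_plus_realizability \<in> TWO_EXPTIME" "LTLf_plus_synthesis \<in> search_TWO_EXPTIME"
    unfolding TWO_EXPTIME_def search_TWO_EXPTIME_def by blast+
qed

subsection \<open>Counting with local rules\<close>

text \<open>Bits in two's complement, so that negative distances have bits too; \<open>W\<close>
  bits determine an integer modulo \<open>2 ^ W\<close>.\<close>

definition bt :: "int => nat => bool" where "bt x i \<longleftrightarrow> odd (x div 2 ^ i)"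

lemma bt_0 [simp]: "\<not> bt 0 i" by (simp add: bt_def)

text \<open>A carry enters bit \<open>i\<close> iff bit \<open>i - 1\<close> has just dropped from 1
  to 0. The rule thus consults only the old and new value of the next lower bit, and no carry has to
  be recorded.\<close>

lemma bt_succ: "(bt (x + 1) i \<noteq> bt x i) \<longleftrightarrow> i = 0 \<or> (bt x (i - 1) \<and> \<not> bt (x + 1) (i - 1))"
proof (cases i)
  case (Suc k)
  define a b where "a = x div 2 ^ k" and "b = (x + 1) div 2 ^ k"
  have d: "y div 2 ^ Suc k = y div 2 ^ k div 2" for y :: int
    unfolding power_Suc2 by (rule zdiv_zmult2_eq) simp
  have "x + 1 \<le> (a + 1) * 2 ^ k"
  proof -
    have "x = a * 2 ^ k + x mod 2 ^ k" unfolding a_def by (rule div_mult_mod_eq[symmetric])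
    moreover have "x mod 2 ^ k < 2 ^ k" by simp
    ultimately show ?thesis unfolding distrib_right by linarith
  qed
  then have "b \<le> ((a + 1) * 2 ^ k) div 2 ^ k" unfolding b_def by (rule zdiv_mono1) simp
  then have "b \<le> a + 1" by simp
  moreover have "a \<le> b" unfolding a_def b_def by (rule zdiv_mono1) auto
  ultimately have "b = a \<or> b = a + 1" by linarith
  then show ?thesis unfolding bt_def Suc diff_Suc_1 d a_def[symmetric] b_def[symmetric] by presburger
qed (simp add: bt_def)

lemma bits_zero: "(\<forall>i<W. \<not> bt x i) \<longleftrightarrow> 2 ^ W dvd x"
proof (induction W)
  case (Suc W)
  have "2 ^ Suc W dvd x \<longleftrightarrow> 2 ^ W dvd x \<and> even (x div 2 ^ W)"
  proof
    assume h: "2 ^ Suc W dvd x"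
    then obtain k where k: "x = 2 ^ Suc W * k" by (rule dvdE)
    then have "x = 2 ^ W * (2 * k)" by simp
    then show "2 ^ W dvd x \<and> even (x div 2 ^ W)" by (metis dvd_triv_left nonzero_mult_div_cancel_left power_not_zero zero_neq_numeral)
  next
    assume "2 ^ W dvd x \<and> even (x div 2 ^ W)"
    then show "2 ^ Suc W dvd x" by (metis dvd_div_iff_mult mult.commute power_Suc power_not_zero zero_neq_numeral)
  qed
  then show ?case using Suc by (auto simp: less_Suc_eq bt_def)
qed simp

text \<open>Starting from the lowest bit, the rule determines either row from the other. The carry
  out of the last bit is lost, so the rows count modulo \<open>2 ^ W\<close>.\<close>

lemma bits_inc:
  assumes "\<And>i. i < W ==> (n i \<noteq> b i) \<longleftrightarrow> i = 0 \<or> (b (i - 1) \<and> \<not> n (i - 1))"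
  shows "(\<forall>i<W. b i = bt x i) \<longleftrightarrow> (\<forall>i<W. n i = bt (x + 1) i)"
proof
  assume b: "\<forall>i<W. b i = bt x i"
  have "i < W \<longrightarrow> n i = bt (x + 1) i" for i
    by (induction i) (use assms b bt_succ[of x] in \<open>metis, metis diff_Suc_1 Suc_lessD\<close>)
  then show "\<forall>i<W. n i = bt (x + 1) i" by blast
next
  assume n: "\<forall>i<W. n i = bt (x + 1) i"
  have "i < W \<longrightarrow> b i = bt x i" for i
    by (induction i) (use assms n bt_succ[of x] in \<open>metis, metis diff_Suc_1 Suc_lessD\<close>)
  then show "\<forall>i<W. b i = bt x i" by blast
qed

lemma bits_dec:
  assumes "\<And>i. i < W ==> (n i \<noteq> b i) \<longleftrightarrow> i = 0 \<or> (\<not> b (i - 1) \<and> n (i - 1))"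
  shows "(\<forall>i<W. b i = bt x i) \<longleftrightarrow> (\<forall>i<W. n i = bt (x - 1) i)"
proof -
  have "(\<forall>i<W. n i = bt (x - 1) i) \<longleftrightarrow> (\<forall>i<W. b i = bt (x - 1 + 1) i)"
    by (rule bits_inc) (use assms in blast)
  then show ?thesis by simp
qed

subsection \<open>Tiles\<close>

text \<open>A row of \<open>W\<close> tiles claims facts about the run of a machine at the time written in binary in the bits \<open>tb\<close>:
  its state \<open>qq\<close>, the symbols \<open>sv\<close> under the heads, and the symbol \<open>ts\<close> of the cell of tape \<open>tj\<close> whose
  distance from the head is written in the bits \<open>db\<close>, modulo \<open>2\<^sup>W\<close>. Time decreases from row to row. The
  opponent decides which cell to follow, and at time 0 its symbol is looked up in the input, which is copied down
  and finally shifted (rows of kind 2 and 4). Rows of kind 3 are unconstrained; kind 0 is the virtual row above row 0.\<close>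

datatype rho = Rho (kd: nat) (qq: nat) (sv: "nat list") (tj: nat) (ts: nat) (rt: bool) (zz: bool) (mv: int) (rs: bool)
datatype tile = Tile (rh: rho) (tb: bool) (ot: bool) (tz: bool) (db: bool) (od: bool) (dz: bool) (cc: nat)

text \<open>At the start of a row there is no left neighbour. The default \<open>True\<close> then
  serves as the initial carry and as the empty conjunction in the tests for zero.\<close>

definition fr :: "'a option => ('a => bool) => bool" where "fr l P = (case l of None => True | Some x => P x)"

lemma fr_simps [simp]: "fr None P" "fr (Some x) P = P x" by (auto simp: fr_def)

lemma fr_if: "fr (if z then None else Some l) P \<longleftrightarrow> z \<or> P l" by simp

text \<open>The tiles repeat the bits above them in \<open>ot\<close> and \<open>od\<close>, so that
  the counting rule finds the old and new bit of the left neighbour without a diagonal comparison. A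
  reset replaces the old distance by 0. In a row of kind 4 the input moves one place to the left,
  which is why the cell above is compared with the left neighbour.\<close>

definition loc :: "tile option => tile => tile => bool" where
  "loc lf ab c \<longleftrightarrow> (kd (rh c) \<noteq> 4 \<longrightarrow> cc c = cc ab) \<and> (kd (rh c) = 4 \<longrightarrow> fr lf (%l. cc l = cc ab)) \<and>
     (tz c \<longleftrightarrow> fr lf tz \<and> \<not> tb c) \<and> (dz c \<longleftrightarrow> fr lf dz \<and> \<not> db c) \<and>
     (kd (rh ab) \<noteq> 0 \<longrightarrow>
       (kd (rh c) = 1 \<longrightarrow> ot c = tb ab \<and> (tb c \<noteq> ot c \<longleftrightarrow> fr lf (%l. \<not> ot l \<and> tb l))) \<and>
       (od c \<longleftrightarrow> \<not> rs (rh c) \<and> db ab) \<and>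
       (mv (rh c) = 0 \<longrightarrow> db c = od c) \<and>
       (mv (rh c) = 1 \<longrightarrow> (db c \<noteq> od c \<longleftrightarrow> fr lf (%l. od l \<and> \<not> db l))) \<and>
       (mv (rh c) = -1 \<longrightarrow> (db c \<noteq> od c \<longleftrightarrow> fr lf (%l. \<not> od l \<and> db l))))"

lemma locD:
  assumes "loc (if z then None else Some l) ab c" "kd (rh ab) \<noteq> 0"
  shows "(kd (rh c) = 1 \<longrightarrow> ot c = tb ab \<and> (tb c \<noteq> ot c \<longleftrightarrow> z \<or> (\<not> ot l \<and> tb l))) \<and>
    (od c \<longleftrightarrow> \<not> rs (rh c) \<and> db ab) \<and> (mv (rh c) = 0 \<longrightarrow> db c = od c) \<and>
       (mv (rh c) = 1 \<longrightarrow> (db c \<noteq> od c \<longleftrightarrow> z \<or> (od l \<and> \<not> db l))) \<and>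
       (mv (rh c) = -1 \<longrightarrow> (db c \<noteq> od c \<longleftrightarrow> z \<or> (\<not> od l \<and> db l)))"
  by (rule assms(1)[unfolded loc_def fr_if, THEN conjunct2, THEN conjunct2, THEN conjunct2, THEN conjunct2, THEN mp, OF assms(2)])

definition bj :: "nat option => rho => nat" where "bj e p = (case e of None => tj p | Some l => l)"
definition bs0 :: "nat option => rho => nat" where "bs0 e p = (case e of None => ts p | Some l => sv p ! l)"

locale mach =
  fixes L :: nat and dl :: "nat => nat list => nat \<times> (nat \<times> int) list" and hlt :: "nat => nat list => bool" and Tl :: "tile set"
begin

text \<open>The new row \<open>c\<close> describes the time before that of \<open>p\<close>. The
  last tile of a row has time bit 0, so times stay below \<open>2 ^ (W - 1)\<close> and cannot wrap
  around. If the followed cell was under the head at the earlier time (\<open>zz c\<close>), the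
  symbol claimed so far must be the one written in that step; otherwise it is passed on.\<close>

definition rstep :: "tile => nat option => rho => bool" where
  "rstep p e c \<longleftrightarrow>
    (if kd (rh p) = 1 then \<not> tb p \<and> tj c = bj e (rh p) \<and> (rt c \<longleftrightarrow> e = None \<and> rt (rh p)) \<and> (rs c \<longleftrightarrow> e \<noteq> None) \<and>
       (if tz p then qq (rh p) = 0 \<and> (rt (rh p) \<longrightarrow> zz (rh p)) \<and> kd c = 2 \<and> ts c = bs0 e (rh p) \<and> mv c = 0
        else kd c = 1 \<and> qq (rh p) = fst (dl (qq c) (sv c)) \<and> mv c = snd (snd (dl (qq c) (sv c)) ! tj c) \<and>
          (zz c \<longrightarrow> fst (snd (dl (qq c) (sv c)) ! tj c) = bs0 e (rh p) \<and> ts c = sv c ! tj c) \<and>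
          (\<not> zz c \<longrightarrow> ts c = bs0 e (rh p)))
     else if zz (rh p) \<or> tj (rh p) \<noteq> 0 then kd c = 3
     else kd c = 4 \<and> tj c = 0 \<and> ts c = ts (rh p) \<and> mv c = -1 \<and> \<not> rs c)"

text \<open>A blank in the first cell of the shifted row means that the input is exhausted. The
  followed cell then lies outside of the input and is blank.\<close>

definition lookup :: "tile => bool" where
  "lookup c \<longleftrightarrow> (kd (rh c) \<in> {2, 4} \<longrightarrow> (tj (rh c) \<noteq> 0 \<longrightarrow> ts (rh c) = 0) \<and>
     (tj (rh c) = 0 \<longrightarrow> (zz (rh c) \<longrightarrow> ts (rh c) = cc c) \<and> (cc c = 0 \<longrightarrow> ts (rh c) = 0)))"

text \<open>The flag \<open>zz\<close> is announced at the start of a row, where the rules need it,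
  and verified at its end, where all distance bits are known. \<open>cc p = 0\<close> determines the
  last cell, which the shift leaves open.\<close>

definition rownext :: "tile => nat option => tile => bool" where
  "rownext p e c \<longleftrightarrow> cc p = 0 \<and> (dz p \<longleftrightarrow> zz (rh p)) \<and> rstep p e (rh c) \<and> lookup c"

text \<open>Row 0 claims acceptance: a halted state and the letter \<open>True\<close> on the last
  tape. The distance of that cell is free at first; the flag \<open>rt\<close> has it checked at
  time 0, when every head is in cell 0.\<close>

definition start0 :: "tile => bool" where
  "start0 c \<longleftrightarrow> kd (rh c) = 1 \<and> tj (rh c) = L - 1 \<and> ts (rh c) = 2 \<and> rt (rh c) \<and> hlt (qq (rh c)) (sv (rh c))"

definition R :: "bool => (tile \<times> nat option) option => tile => tile => bool" where
  "R st prev ab c \<longleftrightarrow> c \<in> Tl \<and> (case prev of None => start0 c \<and> loc None ab c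
     | Some (p, e) => if kd (rh p) = 3 then kd (rh c) = 3
         else if st then rownext p e c \<and> (kd (rh c) \<noteq> 3 \<longrightarrow> loc None ab c)
         else rh c = rh p \<and> loc (Some p) ab c)"

end

definition ini :: "nat => tile" where
  "ini c = Tile (Rho 0 0 [] 0 0 False False 0 False) False False False False False False c"

definition Tls :: "nat => nat => nat => tile set" where
  "Tls L NQ NS = {c. kd (rh c) \<in> {1,2,3,4} \<and> qq (rh c) < NQ \<and> length (sv (rh c)) = L \<and> set (sv (rh c)) \<subseteq> {..<NS} \<and>
     tj (rh c) < L \<and> ts (rh c) < NS \<and> mv (rh c) \<in> {-1,0,1} \<and> cc c < 3}"

lemma finite_Tls: "finite (Tls L NQ NS)"
proof -
  let ?r = "(%(a, b, c, d, e, f, g, h, i). Rho a b c d e f g h i) ` ({1,2,3,4} \<times> {..<NQ} \<times> {l. set l \<subseteq> {..<NS} \<and> length l = L} \<times> {..<L} \<times> {..<NS} \<times> UNIV \<times> UNIV \<times> {-1,0,1} \<times> UNIV)"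
  let ?t = "(%(a, b, c, d, e, f, g, h). Tile a b c d e f g h) ` (?r \<times> UNIV \<times> UNIV \<times> UNIV \<times> UNIV \<times> UNIV \<times> UNIV \<times> {..<3})"
  have 1: "r \<in> ?r" if "kd r \<in> {1,2,3,4}" "qq r < NQ" "length (sv r) = L" "set (sv r) \<subseteq> {..<NS}" "tj r < L" "ts r < NS" "mv r \<in> {-1,0,1}" for r
    using that by (cases r) (simp add: image_iff)
  have "Tls L NQ NS \<subseteq> ?t"
  proof
    fix c assume c: "c \<in> Tls L NQ NS"
    then have r: "rh c \<in> ?r" by (intro 1) (auto simp: Tls_def)
    have "c = (%(a, b, c, d, e, f, g, h). Tile a b c d e f g h) (rh c, tb c, ot c, tz c, db c, od c, dz c, cc c)" by simp
    moreover have "(rh c, tb c, ot c, tz c, db c, od c, dz c, cc c) \<in> ?r \<times> UNIV \<times> UNIV \<times> UNIV \<times> UNIV \<times> UNIV \<times> UNIV \<times> {..<3}"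
      using r c by (simp only: mem_Times_iff fst_conv snd_conv UNIV_I lessThan_iff) (simp add: Tls_def)
    ultimately show "c \<in> ?t" by (rule image_eqI)
  qed
  moreover have "finite ?t" by (intro finite_imageI finite_cartesian_product finite_lists_length_eq) auto
  ultimately show ?thesis by (rule finite_subset)
qed

text \<open>A machine run as states, head positions and cell contents over time.
  \<open>n < W\<close> ensures that a row holds the input and at least one blank.\<close>

locale msys =
  fixes L NQ NS :: nat and dl :: "nat => nat list => nat \<times> (nat \<times> int) list" and hlt :: "nat => nat list => bool"
    and qt :: "nat => nat" and pos :: "nat => nat => int" and cont :: "nat => int => nat => nat"
    and lt :: "nat => nat" and W n :: nat
  assumes L: "1 \<le> L" and NS: "3 \<le> NS"
    and qt: "qt t < NQ" "qt 0 = 0" "qt (Suc t) = fst (dl (qt t) (map (%j. cont j (pos j t) t) [0..<L]))"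
    and pos: "j < L ==> pos j 0 = 0" "j < L ==> pos j (Suc t) = pos j t + snd (snd (dl (qt t) (map (%j. cont j (pos j t) t) [0..<L])) ! j)"
    and cont: "j < L ==> cont j P t < NS" "cont 0 P 0 = (if 0 \<le> P then lt (nat P) else 0)" "0 < j ==> j < L ==> cont j P 0 = 0"
      "j < L ==> cont j P (Suc t) = (if P = pos j t then fst (snd (dl (qt t) (map (%j. cont j (pos j t) t) [0..<L])) ! j) else cont j P t)"
    and dlmv: "j < L ==> snd (snd (dl (qt t) (map (%j. cont j (pos j t) t) [0..<L])) ! j) \<in> {-1, 0, 1}"
    and lt: "lt i < 3" "n \<le> i ==> lt i = 0" "i < n ==> lt i \<noteq> 0" and W: "n < W"
begin

sublocale mach L dl hlt "Tls L NQ NS" .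

definition svt :: "nat => nat list" where "svt t = map (%j. cont j (pos j t) t) [0..<L]"

lemmas qt' = qt(3)[folded svt_def] and pos' = pos(2)[folded svt_def] and cont' = cont(4)[folded svt_def] and dlmv' = dlmv[folded svt_def]

lemma svt_nth: "j < L ==> svt t ! j = cont j (pos j t) t" by (simp add: svt_def)

lemma pos_le: "j < L ==> \<bar>pos j t\<bar> \<le> int t"
proof (induction t)
  case (Suc t)
  then show ?case using pos'[of j t] dlmv'[of j t] by auto
qed (simp add: pos)

lemma W_le: "W \<le> 2 ^ (W - 1)"
proof (cases W)
  case (Suc k) then show ?thesis using Suc_leI[OF less_exp[of k]] by simp
qed simp

lemma two_W: "(2::int) ^ W = 2 * 2 ^ (W - 1)" "int W \<le> 2 ^ (W - 1)"
proof -
  show "(2::int) ^ W = 2 * 2 ^ (W - 1)" using W by (cases W) auto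
  show "int W \<le> 2 ^ (W - 1)" using W_le of_nat_mono[of W "2 ^ (W - 1)", where ?'a = int] by simp
qed

section \<open>Soundness of the rules\<close>

definition okplay :: "(nat => tile) => (nat => nat option) => bool" where
  "okplay \<theta> e \<longleftrightarrow> (\<forall>i. R (W dvd i) (if i = 0 then None else Some (\<theta> (i - 1), e (i - 1))) (if i < W then ini (lt i) else \<theta> (i - W)) (\<theta> i))"

lemma okplay_Tl: "okplay \<theta> e ==> \<theta> i \<in> Tls L NQ NS" unfolding okplay_def R_def by blast

lemma row_step:
  assumes ok: "okplay \<theta> e" and k: "kd (rh (\<theta> (r * W))) \<noteq> 3"
  shows "i < W ==> rh (\<theta> (r * W + i)) = rh (\<theta> (r * W)) \<and>
    loc (if i = 0 then None else Some (\<theta> (r * W + (i - 1)))) (if r = 0 then ini (lt i) else \<theta> ((r - 1) * W + i)) (\<theta> (r * W + i))"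
proof (induction i)
  case 0
  have R: "R True (if r * W = 0 then None else Some (\<theta> (r * W - 1), e (r * W - 1))) (if r * W < W then ini (lt (r * W)) else \<theta> (r * W - W)) (\<theta> (r * W))"
    using ok[unfolded okplay_def, rule_format, of "r * W"] unfolding dvd_triv_right by simp
  show ?case
  proof (cases r)
    case 0 then show ?thesis using R W by (simp add: R_def)
  next
    case (Suc r')
    then show ?thesis using R W k by (auto simp: R_def split: if_splits)
  qed
next
  case (Suc i)
  have "\<not> W dvd Suc i" using Suc.prems by (simp add: nat_dvd_not_less)
  then have nd: "\<not> W dvd r * W + Suc i" by (simp only: dvd_add_right_iff[OF dvd_triv_right[of W r]] not_False_eq_True)
  have R: "R False (Some (\<theta> (r * W + i), e (r * W + i))) (if r * W + Suc i < W then ini (lt (r * W + Suc i)) else \<theta> (r * W + Suc i - W)) (\<theta> (r * W + Suc i))"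
    using ok[unfolded okplay_def, rule_format, of "r * W + Suc i"] nd by simp
  have IH: "rh (\<theta> (r * W + i)) = rh (\<theta> (r * W))" using Suc by simp
  have ab: "(if r * W + Suc i < W then ini (lt (r * W + Suc i)) else \<theta> (r * W + Suc i - W)) = (if r = 0 then ini (lt (Suc i)) else \<theta> ((r - 1) * W + Suc i))"
    using Suc.prems by (cases r) auto
  show ?case using R k unfolding ab by (simp add: R_def IH)
qed

lemma row_next:
  assumes ok: "okplay \<theta> e" and k: "kd (rh (\<theta> (r * W))) \<noteq> 3"
  shows "rownext (\<theta> (r * W + (W - 1))) (e (r * W + (W - 1))) (\<theta> (Suc r * W))"
proof -
  have e: "Suc r * W - 1 = r * W + (W - 1)" "(Suc r * W = 0) = False" "W dvd Suc r * W" using W by auto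
  have "R True (Some (\<theta> (r * W + (W - 1)), e (r * W + (W - 1)))) (if Suc r * W < W then ini (lt (Suc r * W)) else \<theta> (Suc r * W - W)) (\<theta> (Suc r * W))"
    using ok[unfolded okplay_def, rule_format, of "Suc r * W"] unfolding e if_False using e(3) by (simp only:)
  then show ?thesis using row_step[OF ok k, of "W - 1"] k W by (simp add: R_def)
qed

lemma kd3: "okplay \<theta> e ==> kd (rh (\<theta> i)) = 3 ==> kd (rh (\<theta> (i + k))) = 3"
proof (induction k)
  case (Suc k)
  then show ?case using Suc.prems(1)[unfolded okplay_def, rule_format, of "i + Suc k"] by (simp add: R_def)
qed simp

lemma row_pred: "okplay \<theta> e ==> kd (rh (\<theta> (Suc r * W))) \<noteq> 3 ==> kd (rh (\<theta> (r * W))) \<noteq> 3"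
  using kd3[of \<theta> e "r * W" W] by (auto simp: add.commute)

definition rep :: "(nat => tile) => nat => (tile => bool) => int => bool" where
  "rep \<theta> r f x \<longleftrightarrow> (\<forall>i<W. f (\<theta> (r * W + i)) = bt x i)"

lemma row_zero:
  assumes ok: "okplay \<theta> e" and k: "kd (rh (\<theta> (r * W))) \<noteq> 3"
  shows "rep \<theta> r tb x ==> tz (\<theta> (r * W + (W - 1))) \<longleftrightarrow> 2 ^ W dvd x" "rep \<theta> r db x ==> zz (rh (\<theta> (r * W))) \<longleftrightarrow> 2 ^ W dvd x"
    "zz (rh (\<theta> (r * W))) ==> rep \<theta> r db 0"
proof -
  have 1: "i < W \<longrightarrow> (tz (\<theta> (r * W + i)) \<longleftrightarrow> (\<forall>k\<le>i. \<not> tb (\<theta> (r * W + k)))) \<and> (dz (\<theta> (r * W + i)) \<longleftrightarrow> (\<forall>k\<le>i. \<not> db (\<theta> (r * W + k))))" for i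
  proof (induction i)
    case 0 show ?case using row_step[OF ok k, of 0] by (auto simp: loc_def)
  next
    case (Suc i)
    have "(tz (\<theta> (r * W + Suc i)) \<longleftrightarrow> tz (\<theta> (r * W + i)) \<and> \<not> tb (\<theta> (r * W + Suc i))) \<and>
        (dz (\<theta> (r * W + Suc i)) \<longleftrightarrow> dz (\<theta> (r * W + i)) \<and> \<not> db (\<theta> (r * W + Suc i)))" if "Suc i < W"
      using row_step[OF ok k that] unfolding loc_def by simp
    moreover have a: "(\<forall>k\<le>Suc i. Q k) \<longleftrightarrow> (\<forall>k\<le>i. Q k) \<and> Q (Suc i)" for Q by (auto simp: le_Suc_eq)
    ultimately show ?case using Suc unfolding a by auto
  qed
  have z: "zz (rh (\<theta> (r * W))) = dz (\<theta> (r * W + (W - 1)))"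
    using row_next[OF ok k] row_step[OF ok k, of "W - 1"] W by (simp add: rownext_def)
  have le: "k \<le> W - 1 \<longleftrightarrow> k < W" for k using W by auto
  show "rep \<theta> r tb x ==> tz (\<theta> (r * W + (W - 1))) \<longleftrightarrow> 2 ^ W dvd x" "rep \<theta> r db x ==> zz (rh (\<theta> (r * W))) \<longleftrightarrow> 2 ^ W dvd x"
    "zz (rh (\<theta> (r * W))) ==> rep \<theta> r db 0"
    using 1[of "W - 1"] W unfolding z bits_zero[symmetric] rep_def le by auto
qed

lemma row_t:
  assumes ok: "okplay \<theta> e" and k: "kd (rh (\<theta> (Suc r * W))) = 1"
  shows "rep \<theta> r tb x ==> rep \<theta> (Suc r) tb (x - 1)"
proof -
  have k3: "kd (rh (\<theta> (Suc r * W))) \<noteq> 3" using k by simp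
  have nz: "kd (rh (\<theta> (r * W + i))) \<noteq> 0" for i using okplay_Tl[OF ok, of "r * W + i"] by (auto simp: Tls_def)
  have l: "ot (\<theta> (Suc r * W + i)) = tb (\<theta> (r * W + i)) \<and>
    ((tb (\<theta> (Suc r * W + i)) \<noteq> ot (\<theta> (Suc r * W + i))) \<longleftrightarrow> i = 0 \<or> (\<not> ot (\<theta> (Suc r * W + (i - 1))) \<and> tb (\<theta> (Suc r * W + (i - 1)))))" if "i < W" for i
  proof -
    have "loc (if i = 0 then None else Some (\<theta> (Suc r * W + (i - 1)))) (\<theta> (r * W + i)) (\<theta> (Suc r * W + i))" "kd (rh (\<theta> (Suc r * W + i))) = 1"
      using row_step[OF ok k3 that] k by simp_all
    then show ?thesis using locD[THEN conjunct1, THEN mp] nz[of i] by blast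
  qed
  note l = l[THEN conjunct1] l[THEN conjunct2]
  have "(\<forall>i<W. ot (\<theta> (Suc r * W + i)) = bt x i) \<longleftrightarrow> (\<forall>i<W. tb (\<theta> (Suc r * W + i)) = bt (x - 1) i)"
    by (rule bits_dec) (rule l(2))
  then show "rep \<theta> r tb x ==> rep \<theta> (Suc r) tb (x - 1)" using l(1) by (simp add: rep_def)
qed

lemma row_d:
  assumes ok: "okplay \<theta> e" and k: "kd (rh (\<theta> (Suc r * W))) \<noteq> 3"
  shows "\<not> rs (rh (\<theta> (Suc r * W))) ==> rep \<theta> r db x \<longleftrightarrow> rep \<theta> (Suc r) db (x + mv (rh (\<theta> (Suc r * W))))"
    "rs (rh (\<theta> (Suc r * W))) ==> rep \<theta> (Suc r) db (mv (rh (\<theta> (Suc r * W))))"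
proof -
  let ?m = "mv (rh (\<theta> (Suc r * W)))"
  have nz: "kd (rh (\<theta> (r * W + i))) \<noteq> 0" for i using okplay_Tl[OF ok, of "r * W + i"] by (auto simp: Tls_def)
  have lo: "(od (\<theta> (Suc r * W + i)) \<longleftrightarrow> \<not> rs (rh (\<theta> (Suc r * W))) \<and> db (\<theta> (r * W + i))) \<and>
    (?m = 0 \<longrightarrow> db (\<theta> (Suc r * W + i)) = od (\<theta> (Suc r * W + i))) \<and>
    (?m = 1 \<longrightarrow> ((db (\<theta> (Suc r * W + i)) \<noteq> od (\<theta> (Suc r * W + i))) \<longleftrightarrow> i = 0 \<or> (od (\<theta> (Suc r * W + (i - 1))) \<and> \<not> db (\<theta> (Suc r * W + (i - 1)))))) \<and>
    (?m = -1 \<longrightarrow> ((db (\<theta> (Suc r * W + i)) \<noteq> od (\<theta> (Suc r * W + i))) \<longleftrightarrow> i = 0 \<or> (\<not> od (\<theta> (Suc r * W + (i - 1))) \<and> db (\<theta> (Suc r * W + (i - 1))))))" if "i < W" for i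
  proof -
    have l: "loc (if i = 0 then None else Some (\<theta> (Suc r * W + (i - 1)))) (\<theta> (r * W + i)) (\<theta> (Suc r * W + i))" "rh (\<theta> (Suc r * W + i)) = rh (\<theta> (Suc r * W))"
      using row_step[OF ok k that] by simp_all
    show ?thesis by (rule locD[OF l(1) nz, unfolded l(2), THEN conjunct2])
  qed
  note od = lo[THEN conjunct1] and m0 = lo[THEN conjunct2, THEN conjunct1, THEN mp] and
    m1 = lo[THEN conjunct2, THEN conjunct2, THEN conjunct1, THEN mp] and m2 = lo[THEN conjunct2, THEN conjunct2, THEN conjunct2, THEN mp]
  have m: "?m \<in> {-1, 0, 1}" using okplay_Tl[OF ok, of "Suc r * W"] by (auto simp: Tls_def)
  have *: "(\<forall>i<W. od (\<theta> (Suc r * W + i)) = bt x i) \<longleftrightarrow> rep \<theta> (Suc r) db (x + ?m)" for x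
  proof -
    consider "?m = -1" | "?m = 0" | "?m = 1" using m by auto
    then show ?thesis
    proof cases
      case 1
      have "(\<forall>i<W. od (\<theta> (Suc r * W + i)) = bt x i) \<longleftrightarrow> (\<forall>i<W. db (\<theta> (Suc r * W + i)) = bt (x - 1) i)"
        by (rule bits_dec) (rule m2[OF _ 1])
      then show ?thesis unfolding rep_def 1 by simp
    next
      case 2 then show ?thesis unfolding rep_def using m0 by simp
    next
      case 3
      have "(\<forall>i<W. od (\<theta> (Suc r * W + i)) = bt x i) \<longleftrightarrow> (\<forall>i<W. db (\<theta> (Suc r * W + i)) = bt (x + 1) i)"
        by (rule bits_inc) (rule m1[OF _ 3])
      then show ?thesis unfolding rep_def 3 by simp
    qed
  qed
  show "\<not> rs (rh (\<theta> (Suc r * W))) ==> rep \<theta> r db x \<longleftrightarrow> rep \<theta> (Suc r) db (x + ?m)" unfolding *[symmetric] unfolding rep_def using od by simp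
  show "rs (rh (\<theta> (Suc r * W))) ==> rep \<theta> (Suc r) db ?m" using *[of 0] od by simp
qed

lemma row_c:
  assumes ok: "okplay \<theta> e" and k: "kd (rh (\<theta> (Suc r * W))) \<noteq> 3"
  shows "kd (rh (\<theta> (Suc r * W))) \<noteq> 4 ==> i < W ==> cc (\<theta> (Suc r * W + i)) = cc (\<theta> (r * W + i))"
    "kd (rh (\<theta> (Suc r * W))) = 4 ==> Suc i < W ==> cc (\<theta> (Suc r * W + i)) = cc (\<theta> (r * W + Suc i))"
    "cc (\<theta> (Suc r * W + (W - 1))) = 0"
proof -
  show "kd (rh (\<theta> (Suc r * W))) \<noteq> 4 ==> i < W ==> cc (\<theta> (Suc r * W + i)) = cc (\<theta> (r * W + i))"
    using row_step[OF ok k, of i] by (simp add: loc_def)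
  show "kd (rh (\<theta> (Suc r * W))) = 4 ==> Suc i < W ==> cc (\<theta> (Suc r * W + i)) = cc (\<theta> (r * W + Suc i))"
    using row_step[OF ok k, of "Suc i"] by (simp add: loc_def)
  show "cc (\<theta> (Suc r * W + (W - 1))) = 0" using row_next[OF ok k] by (simp add: rownext_def)
qed

text \<open>Induction on the number of shifts still possible. The last hypothesis says that the
  shifts have not moved past the followed cell unnoticed.\<close>

lemma lookup_sound:
  assumes ok: "okplay \<theta> e" and P: "\<bar>P\<bar> < 2 ^ (W - 1)"
  shows "m \<le> n ==> kd (rh (\<theta> (r * W))) \<in> {2, 4} ==> tj (rh (\<theta> (r * W))) = 0 ==> 0 < r ==>
    (\<forall>i<W. cc (\<theta> (r * W + i)) = lt (m + i)) ==> rep \<theta> r db (P - int m) ==> P < 0 \<or> int m \<le> P ==>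
    ts (rh (\<theta> (r * W))) = (if 0 \<le> P then lt (nat P) else 0)"
proof (induction "n - m" arbitrary: m r rule: less_induct)
  case (less m r)
  obtain r' where r': "r = Suc r'" using less.prems(4) by (cases r) auto
  have k: "kd (rh (\<theta> (r * W))) \<noteq> 3" using less.prems(2) by auto
  have c0: "cc (\<theta> (r * W)) = lt m" using less.prems(5) W by (auto dest: spec[of _ 0])
  have lk: "(zz (rh (\<theta> (r * W))) \<longrightarrow> ts (rh (\<theta> (r * W))) = lt m) \<and> (lt m = 0 \<longrightarrow> ts (rh (\<theta> (r * W))) = 0)"
    using row_next[OF ok row_pred[OF ok k[unfolded r']], folded r'] less.prems(2,3) c0 by (auto simp: rownext_def lookup_def)
  have Wp: "int m < 2 ^ (W - 1)" using less.prems(1) W two_W(2) by linarith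
  have z: "zz (rh (\<theta> (r * W))) \<longleftrightarrow> P = int m"
  proof -
    \<comment> \<open>Both numbers are below \<open>2 ^ (W - 1)\<close> in absolute value, so
      equality modulo \<open>2 ^ W\<close> is equality.\<close>
    have "\<bar>P - int m\<bar> < 2 ^ W" unfolding two_W(1) using P Wp by linarith
    then have "2 ^ W dvd P - int m \<longleftrightarrow> P - int m = 0" using zdvd_imp_le[of "2 ^ W" "\<bar>P - int m\<bar>"] by auto
    then show ?thesis unfolding row_zero(2)[OF ok k less.prems(6)] by simp
  qed
  show ?case
  proof (cases "P = int m \<or> m = n")
    case True
    then show ?thesis using lk z lt(2) less.prems(7) W by (cases "P = int m") (auto simp: nat_le_iff)
  next
    case False
    then have mn: "m < n" using less.prems(1) by simp
    have ls: "rh (\<theta> (r * W + (W - 1))) = rh (\<theta> (r * W))" using row_step[OF ok k, of "W - 1"] W by simp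
    have s: "kd (rh (\<theta> (Suc r * W))) = 4" "tj (rh (\<theta> (Suc r * W))) = 0" "ts (rh (\<theta> (Suc r * W))) = ts (rh (\<theta> (r * W)))"
      "mv (rh (\<theta> (Suc r * W))) = -1" "\<not> rs (rh (\<theta> (Suc r * W)))"
      using row_next[OF ok k, unfolded rownext_def rstep_def ls] less.prems(2,3) False z by auto
    have k': "kd (rh (\<theta> (Suc r * W))) \<noteq> 3" using s by simp
    have "P - int (Suc m) = P - int m + mv (rh (\<theta> (Suc r * W)))" using s(4) by simp
    then have "rep \<theta> (Suc r) db (P - int (Suc m))" using row_d(1)[OF ok k' s(5), of "P - int m"] less.prems(6) by (simp only:)
    moreover have "\<forall>i<W. cc (\<theta> (Suc r * W + i)) = lt (Suc m + i)"
    proof (intro allI impI)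
      fix i assume i: "i < W"
      show "cc (\<theta> (Suc r * W + i)) = lt (Suc m + i)"
      proof (cases "Suc i < W")
        case True
        then show ?thesis using row_c(2)[OF ok k' s(1) True] less.prems(5)[rule_format, OF True] by simp
      next
        case False
        then have "i = W - 1" using i by simp
        then show ?thesis using row_c(3)[OF ok k'] lt(2)[of "Suc m + i"] W by simp
      qed
    qed
    ultimately have "ts (rh (\<theta> (Suc r * W))) = (if 0 \<le> P then lt (nat P) else 0)"
      using mn s False less.prems(7) by (intro less.hyps[of "Suc m" "Suc r"]) auto
    then show ?thesis using s(3) by simp
  qed
qed

definition gwin :: "'y set => ('y => nat option) => ('y list => tile) => bool" where
  "gwin Ys ch str \<longleftrightarrow> (\<forall>\<eta>. (\<forall>i. \<eta> i \<in> Ys) \<longrightarrow> okplay (%i. str (map \<eta> [0..<i])) (%i. ch (\<eta> i)))"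

lemma rt_bound: "int t < 2 ^ (W - 1) ==> j < L ==> s \<le> t ==> \<bar>pos j s\<bar> < 2 ^ (W - 1)"
  using pos_le[of j s] by linarith

lemma dvd_W: "\<bar>P\<bar> < 2 ^ (W - 1) ==> \<bar>Q\<bar> < 2 ^ (W - 1) ==> 2 ^ W dvd P - Q \<longleftrightarrow> P = Q" for P Q :: int
proof -
  assume "\<bar>P\<bar> < 2 ^ (W - 1)" "\<bar>Q\<bar> < 2 ^ (W - 1)"
  then have "\<bar>P - Q\<bar> < 2 ^ W" unfolding two_W(1) by linarith
  then have "2 ^ W dvd P - Q \<longleftrightarrow> P - Q = 0" using zdvd_imp_le[of "2 ^ W" "\<bar>P - Q\<bar>"] by auto
  then show ?thesis by simp
qed

text \<open>The strategy is fixed, so the claims of row \<open>r\<close> are made before the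
  environment's choice at the end of that row. Redirecting this choice yields, for every choice, a
  play with the same row \<open>r\<close>, and the induction hypothesis for the earlier time applies
  to its next row. The followed cell is whichever \<open>P\<close> the distance bits encode; the
  root flag pins it to cell 0.\<close>

lemma claim_sound:
  assumes g: "gwin Ys ch str" and ch: "ch ` Ys = insert None (Some ` {..<L})"
  shows "(\<forall>i. \<eta> i \<in> Ys) ==> \<theta> = (%i. str (map \<eta> [0..<i])) ==> kd (rh (\<theta> (r * W))) = 1 ==> rep \<theta> r tb (int t) ==>
    int t < 2 ^ (W - 1) ==> (\<forall>i<W. cc (\<theta> (r * W + i)) = lt i) ==>
    qq (rh (\<theta> (r * W))) = qt t \<and> sv (rh (\<theta> (r * W))) = svt t \<and>
    (\<forall>P. \<bar>P\<bar> < 2 ^ (W - 1) \<longrightarrow> rep \<theta> r db (P - pos (tj (rh (\<theta> (r * W)))) t) \<longrightarrow> cont (tj (rh (\<theta> (r * W)))) P t = ts (rh (\<theta> (r * W)))) \<and>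
    (rt (rh (\<theta> (r * W))) \<longrightarrow> rep \<theta> r db (- pos (tj (rh (\<theta> (r * W)))) t))"
proof (induction t arbitrary: \<eta> \<theta> r)
  case (0 \<eta> \<theta> r)
  let ?p = "rh (\<theta> (r * W))"
  have ok0: "okplay \<theta> (%i. ch (\<eta> i))" using g 0(1,2) unfolding gwin_def by blast
  have k: "kd ?p \<noteq> 3" using 0(3) by simp
  have Tl: "tj ?p < L" "length (sv ?p) = L" using okplay_Tl[OF ok0, of "r * W"] by (auto simp: Tls_def)
  have tz: "tz (\<theta> (r * W + (W - 1)))" using row_zero(1)[OF ok0 k 0(4)] by simp
  have sw: "qq ?p = 0 \<and> (rt ?p \<longrightarrow> zz ?p) \<and>
     (\<forall>P. \<bar>P\<bar> < 2 ^ (W - 1) \<longrightarrow> (if c = None then rep \<theta> r db P else P = 0) \<longrightarrow> cont (bj c ?p) P 0 = bs0 c ?p)"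
     if c: "c \<in> insert None (Some ` {..<L})" for c
  proof -
    have "c \<in> ch ` Ys" using c unfolding ch .
    then obtain y where y: "y \<in> Ys" "ch y = c" by blast
    \<comment> \<open>The same play up to the last tile of row \<open>r\<close>, and then the choice
      \<open>c\<close>.\<close>
    define \<eta>' where "\<eta>' = \<eta>(r * W + (W - 1) := y)"
    define \<theta>' where "\<theta>' i = str (map \<eta>' [0..<i])" for i
    have eq: "\<theta>' i = \<theta> i" if "i \<le> r * W + (W - 1)" for i
    proof -
      have "map \<eta>' [0..<i] = map \<eta> [0..<i]" using that by (auto simp: \<eta>'_def)
      then show ?thesis unfolding \<theta>'_def 0(2) by (rule arg_cong)
    qed
    have row: "\<theta>' (r * W + i) = \<theta> (r * W + i)" if "i < W" for i using that by (intro eq) simp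
    have row0: "\<theta>' (r * W) = \<theta> (r * W)" using row[of 0] W by simp
    have Y': "\<forall>i. \<eta>' i \<in> Ys" using 0(1) y by (simp add: \<eta>'_def)
    have ok: "okplay \<theta>' (%i. ch (\<eta>' i))" using g Y' unfolding gwin_def \<theta>'_def by blast
    have k': "kd (rh (\<theta>' (r * W))) \<noteq> 3" using k row0 by simp
    have ls: "rh (\<theta>' (r * W + (W - 1))) = ?p" using row_step[OF ok k', of "W - 1"] row0 W by simp
    have chy: "ch (\<eta>' (r * W + (W - 1))) = c" by (simp add: \<eta>'_def y)
    have lst: "\<theta>' (r * W + (W - 1)) = \<theta> (r * W + (W - 1))" using row[of "W - 1"] W by simp
    let ?n = "rh (\<theta>' (Suc r * W))"
    have n: "tj ?n = bj c ?p" "rs ?n \<longleftrightarrow> c \<noteq> None" "kd ?n = 2" "qq ?p = 0" "mv ?n = 0" "rt ?p \<longrightarrow> zz ?p" "ts ?n = bs0 c ?p"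
      "lookup (\<theta>' (Suc r * W))"
      using row_next[OF ok k', unfolded rownext_def rstep_def ls chy] tz 0(3) unfolding lst by simp_all
    have kn: "kd ?n \<noteq> 3" using n(3) by simp
    have rp: "rep \<theta>' r f x = rep \<theta> r f x" for f x unfolding rep_def using row by simp
    have cn: "\<forall>i<W. cc (\<theta>' (Suc r * W + i)) = lt i" using row_c(1)[OF ok kn] n(3) row 0(6) by simp
    have jL: "bj c ?p < L" using okplay_Tl[OF ok, of "Suc r * W"] n(1) by (auto simp: Tls_def)
    have 2: "cont (bj c ?p) P 0 = bs0 c ?p" if P: "\<bar>P\<bar> < 2 ^ (W - 1)" and b: "if c = None then rep \<theta> r db P else P = 0" for P
    proof (cases "bj c ?p = 0")
      case True
      have rd: "rep \<theta>' (Suc r) db (P - int 0)"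
        using row_d[OF ok kn] n(2,5) b by (cases "c = None") (simp_all add: rp)
      have "ts ?n = (if 0 \<le> P then lt (nat P) else 0)"
        by (rule lookup_sound[OF ok P _ _ _ _ _ rd]) (use n(1,3) True cn in auto)
      then show ?thesis unfolding True cont(2) using n(7) by simp
    next
      case False
      then show ?thesis using n(1,3,7,8) cont(3)[OF _ jL] by (simp add: lookup_def)
    qed
    show ?thesis using 2 n(4,6) by blast
  qed
  \<comment> \<open>The choice \<open>Some l\<close> follows the cell under head \<open>l\<close>,
    whose symbol is thereby verified.\<close>
  have s: "sv ?p = svt 0"
  proof (rule nth_equalityI)
    show "length (sv ?p) = length (svt 0)" using Tl by (simp add: svt_def)
    fix l assume "l < length (sv ?p)"
    then have l: "l < L" using Tl by simp
    have "cont l 0 0 = sv ?p ! l" using sw[of "Some l"] l by (simp add: bj_def bs0_def)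
    then show "sv ?p ! l = svt 0 ! l" using svt_nth[OF l] pos(1)[OF l] by simp
  qed
  show ?case using sw[of None] s row_zero(3)[OF ok0 k] pos(1)[OF Tl(1)] qt(2) by (simp add: bj_def bs0_def)
next
  case (Suc t \<eta> \<theta> r)
  let ?p = "rh (\<theta> (r * W))"
  have ok0: "okplay \<theta> (%i. ch (\<eta> i))" using g Suc.prems(1,2) unfolding gwin_def by blast
  have k: "kd ?p \<noteq> 3" using Suc.prems(3) by simp
  have Tl: "tj ?p < L" "length (sv ?p) = L" using okplay_Tl[OF ok0, of "r * W"] by (auto simp: Tls_def)
  have tz: "\<not> tz (\<theta> (r * W + (W - 1)))"
    using row_zero(1)[OF ok0 k Suc.prems(4)] zdvd_imp_le[of "2 ^ W" "int (Suc t)"] Suc.prems(5) unfolding two_W(1) by auto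
  have sw: "qq ?p = qt (Suc t) \<and> bj c ?p < L \<and>
     (\<forall>P. \<bar>P\<bar> < 2 ^ (W - 1) \<longrightarrow> (if c = None then rep \<theta> r db (P - pos (tj ?p) (Suc t)) else P = pos (bj c ?p) (Suc t)) \<longrightarrow> cont (bj c ?p) P (Suc t) = bs0 c ?p) \<and>
     (c = None \<longrightarrow> rt ?p \<longrightarrow> rep \<theta> r db (- pos (tj ?p) (Suc t)))" if c: "c \<in> insert None (Some ` {..<L})" for c
  proof -
    have "c \<in> ch ` Ys" using c unfolding ch .
    then obtain y where y: "y \<in> Ys" "ch y = c" by blast
    define \<eta>' where "\<eta>' = \<eta>(r * W + (W - 1) := y)"
    define \<theta>' where "\<theta>' i = str (map \<eta>' [0..<i])" for i
    have eq: "\<theta>' i = \<theta> i" if "i \<le> r * W + (W - 1)" for i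
    proof -
      have "map \<eta>' [0..<i] = map \<eta> [0..<i]" using that by (auto simp: \<eta>'_def)
      then show ?thesis unfolding \<theta>'_def Suc.prems(2) by (rule arg_cong)
    qed
    have row: "\<theta>' (r * W + i) = \<theta> (r * W + i)" if "i < W" for i using that by (intro eq) simp
    have row0: "\<theta>' (r * W) = \<theta> (r * W)" using row[of 0] W by simp
    have Y': "\<forall>i. \<eta>' i \<in> Ys" using Suc.prems(1) y by (simp add: \<eta>'_def)
    have ok: "okplay \<theta>' (%i. ch (\<eta>' i))" using g Y' unfolding gwin_def \<theta>'_def by blast
    have k': "kd (rh (\<theta>' (r * W))) \<noteq> 3" using k row0 by simp
    have ls: "rh (\<theta>' (r * W + (W - 1))) = ?p" using row_step[OF ok k', of "W - 1"] row0 W by simp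
    have chy: "ch (\<eta>' (r * W + (W - 1))) = c" by (simp add: \<eta>'_def y)
    have lst: "\<theta>' (r * W + (W - 1)) = \<theta> (r * W + (W - 1))" using row[of "W - 1"] W by simp
    let ?n = "rh (\<theta>' (Suc r * W))"
    have n: "tj ?n = bj c ?p" "rt ?n \<longleftrightarrow> c = None \<and> rt ?p" "rs ?n \<longleftrightarrow> c \<noteq> None" "kd ?n = 1"
      "qq ?p = fst (dl (qq ?n) (sv ?n))" "mv ?n = snd (snd (dl (qq ?n) (sv ?n)) ! tj ?n)"
      "zz ?n \<longrightarrow> fst (snd (dl (qq ?n) (sv ?n)) ! tj ?n) = bs0 c ?p \<and> ts ?n = sv ?n ! tj ?n" "\<not> zz ?n \<longrightarrow> ts ?n = bs0 c ?p"
      using row_next[OF ok k', unfolded rownext_def rstep_def lst ls[unfolded lst] chy if_P[OF Suc.prems(3)] if_not_P[OF tz]] by blast+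
    have kn: "kd ?n \<noteq> 3" using n(4) by simp
    have rp: "rep \<theta>' r f x = rep \<theta> r f x" for f x unfolding rep_def using row by simp
    have "rep \<theta>' (Suc r) tb (int (Suc t) - 1)" by (rule row_t[OF ok n(4)]) (simp only: rp Suc.prems(4))
    then have tn: "rep \<theta>' (Suc r) tb (int t)" by simp
    have cn: "\<forall>i<W. cc (\<theta>' (Suc r * W + i)) = lt i" using row_c(1)[OF ok kn] n(4) row Suc.prems(6) by simp
    have tl: "int t < 2 ^ (W - 1)" using Suc.prems(5) unfolding of_nat_Suc by linarith
    have IH: "qq ?n = qt t" "sv ?n = svt t"
      "\<And>P. \<bar>P\<bar> < 2 ^ (W - 1) ==> rep \<theta>' (Suc r) db (P - pos (tj ?n) t) ==> cont (tj ?n) P t = ts ?n"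
      "rt ?n ==> rep \<theta>' (Suc r) db (- pos (tj ?n) t)"
      using Suc.IH[OF Y' _ n(4) tn tl cn] \<theta>'_def by blast+
    have jL: "bj c ?p < L" using okplay_Tl[OF ok, of "Suc r * W"] n(1) by (auto simp: Tls_def)
    have mv: "mv ?n = pos (bj c ?p) (Suc t) - pos (bj c ?p) t" using n(6) pos'[OF jL] unfolding IH(1,2) n(1) by simp
    have 1: "qq ?p = qt (Suc t)" using n(5) unfolding IH(1,2) qt' .
    have 2: "cont (bj c ?p) P (Suc t) = bs0 c ?p" if P: "\<bar>P\<bar> < 2 ^ (W - 1)"
      and b: "if c = None then rep \<theta> r db (P - pos (tj ?p) (Suc t)) else P = pos (bj c ?p) (Suc t)" for P
    proof -
      have rd: "rep \<theta>' (Suc r) db (P - pos (bj c ?p) t)"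
      proof (cases "c = None")
        case True
        then have "rep \<theta>' (Suc r) db (P - pos (tj ?p) (Suc t) + mv ?n)" using row_d(1)[OF ok kn] n(3) b by (simp add: rp)
        then show ?thesis using True unfolding mv by (simp add: bj_def)
      next
        case False
        then have "rep \<theta>' (Suc r) db (mv ?n)" using row_d(2)[OF ok kn] n(3) by simp
        then show ?thesis using False b unfolding mv by simp
      qed
      \<comment> \<open>The content at the earlier time \<open>t\<close> is known from the next row;
        \<open>zz\<close> tells whether the step from \<open>t\<close> to \<open>Suc t\<close>
        overwrote it.\<close>
      have c1: "cont (bj c ?p) P t = ts ?n" using IH(3)[OF P] rd unfolding n(1) by blast
      have z: "zz ?n \<longleftrightarrow> P = pos (bj c ?p) t"
        unfolding row_zero(2)[OF ok kn rd] by (rule dvd_W[OF P rt_bound[OF tl jL order_refl]])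
      show ?thesis unfolding cont'[OF jL] using c1 z n(7,8) unfolding n(1) IH(1,2) by auto
    qed
    have 3: "rep \<theta> r db (- pos (tj ?p) (Suc t))" if "c = None" "rt ?p"
    proof -
      have "rep \<theta>' (Suc r) db (- pos (tj ?p) (Suc t) + mv ?n)" using IH(4) n(1,2) that unfolding mv by (simp add: bj_def)
      then show ?thesis using row_d(1)[OF ok kn] n(3) that by (simp add: rp)
    qed
    show ?thesis using 1 2 3 jL by blast
  qed
  have s: "sv ?p = svt (Suc t)"
  proof (rule nth_equalityI)
    show "length (sv ?p) = length (svt (Suc t))" using Tl by (simp add: svt_def)
    fix l assume "l < length (sv ?p)"
    then have l: "l < L" using Tl by simp
    have "\<bar>pos l (Suc t)\<bar> < 2 ^ (W - 1)" by (rule rt_bound[OF Suc.prems(5) l order_refl])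
    then have "cont l (pos l (Suc t)) (Suc t) = sv ?p ! l" using sw[of "Some l"] l by (simp add: bj_def bs0_def)
    then show "sv ?p ! l = svt (Suc t) ! l" using svt_nth[OF l] by simp
  qed
  show ?case using sw[of None] s by (simp add: bj_def bs0_def)
qed

lemma game_sound:
  assumes g: "gwin Ys ch str" and ch: "ch ` Ys = insert None (Some ` {..<L})"
  shows "\<exists>t. int t < 2 ^ (W - 1) \<and> hlt (qt t) (svt t) \<and> cont (L - 1) 0 t = 2"
proof -
  have "None \<in> ch ` Ys" unfolding ch by simp
  then obtain y where y: "y \<in> Ys" by blast
  define \<theta> where "\<theta> = (%i. str (map (%_::nat. y) [0..<i]))"
  have Y: "\<forall>i::nat. (%_. y) i \<in> Ys" using y by simp
  have ok: "okplay \<theta> (%i. ch y)" using g[unfolded gwin_def, rule_format, of "%_. y"] y unfolding \<theta>_def by simp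
  have s0: "start0 (\<theta> (0 * W))" using ok[unfolded okplay_def, rule_format, of 0] by (simp add: R_def)
  then have k1: "kd (rh (\<theta> (0 * W))) = 1" by (simp add: start0_def)
  have k: "kd (rh (\<theta> (0 * W))) \<noteq> 3" using k1 by simp
  \<comment> \<open>The time claimed in row 0 is not prescribed; it is whatever number its bits
    represent.\<close>
  have "\<exists>t < 2 ^ k. \<forall>i<k. f i = bt (int t) i" for f k
  proof (induction k)
    case (Suc k)
    then obtain t where t: "t < 2 ^ k" "\<forall>i<k. f i = bt (int t) i" by blast
    define t' where "t' = t + of_bool (f k) * 2 ^ k"
    have "f i = bt (int t') i" if "i < Suc k" for i
    proof (cases "i = k")
      case True
      have "int t < 2 ^ k" using t(1) by (metis of_nat_less_iff of_nat_numeral of_nat_power)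
      then have "int t div 2 ^ k = 0" by (intro div_pos_pos_trivial) auto
      moreover have "int t' = int t + of_bool (f k) * 2 ^ k" by (simp add: t'_def)
      ultimately have "int t' div 2 ^ k = of_bool (f k)" by simp
      then show ?thesis unfolding bt_def True by simp
    next
      case False
      then have i: "i < k" using that by simp
      then have "k = i + Suc (k - Suc i)" by simp
      then have "(2::int) ^ k = 2 ^ i * 2 ^ Suc (k - Suc i)" unfolding power_add[symmetric] by simp
      then have "int t' = int t + 2 ^ i * (2 * (of_bool (f k) * 2 ^ (k - Suc i)))" unfolding t'_def by simp
      then have "int t' div 2 ^ i = int t div 2 ^ i + 2 * (of_bool (f k) * 2 ^ (k - Suc i))" by simp
      then show ?thesis using t(2) i unfolding bt_def by simp
    qed
    moreover have "t' < 2 ^ Suc k" using t(1) by (simp add: t'_def)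
    ultimately show ?case by blast
  qed simp
  from this[of W "%i. tb (\<theta> (0 * W + i))"] obtain t where t: "t < 2 ^ W" "\<forall>i<W. tb (\<theta> (0 * W + i)) = bt (int t) i" by blast
  have rp: "rep \<theta> 0 tb (int t)" using t(2) by (simp add: rep_def)
  have ls: "rh (\<theta> (0 * W + (W - 1))) = rh (\<theta> (0 * W))" using row_step[OF ok k, of "W - 1"] W by simp
  have "\<not> tb (\<theta> (0 * W + (W - 1)))" using row_next[OF ok k, unfolded rownext_def rstep_def ls] k1 by simp
  then have "even (int t div 2 ^ (W - 1))" using t(2) W unfolding bt_def by simp
  moreover have tl: "int t < 2 ^ (W - 1)" if "even (int t div 2 ^ (W - 1))"
  proof (rule ccontr)
    assume "\<not> int t < 2 ^ (W - 1)"
    moreover have "int t < 2 * 2 ^ (W - 1)" unfolding two_W(1)[symmetric] using t(1) by (metis of_nat_less_iff of_nat_numeral of_nat_power)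
    ultimately have "int t div 2 ^ (W - 1) = 1" by (intro int_div_pos_eq[where r = "int t - 2 ^ (W - 1)"]) auto
    with that show False by simp
  qed
  ultimately have tl: "int t < 2 ^ (W - 1)" by blast
  have c: "\<forall>i<W. cc (\<theta> (0 * W + i)) = lt i"
  proof (intro allI impI)
    fix i assume i: "i < W"
    have "kd (rh (\<theta> (0 * W + i))) \<noteq> 4" "loc (if i = 0 then None else Some (\<theta> (0 * W + (i - 1)))) (ini (lt i)) (\<theta> (0 * W + i))"
      using row_step[OF ok k i] k1 by auto
    then show "cc (\<theta> (0 * W + i)) = lt i" unfolding loc_def by (simp add: ini_def)
  qed
  note C = claim_sound[OF g ch Y \<theta>_def k1 rp tl c]
  have j: "tj (rh (\<theta> (0 * W))) = L - 1" "ts (rh (\<theta> (0 * W))) = 2" "rt (rh (\<theta> (0 * W)))" "hlt (qt t) (svt t)"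
    using s0 C by (auto simp: start0_def)
  have "cont (L - 1) 0 t = 2" using C[THEN conjunct2, THEN conjunct2, THEN conjunct1, rule_format, of 0] C j by simp
  then show ?thesis using tl j(4) by blast
qed

end

text \<open>The rows of the truthful strategy: kind, tape, absolute position of the followed cell, root flag, reset flag,
  move, offset of the shifted input, and time.\<close>

datatype xs = XS (xk: nat) (xj: nat) (xP: int) (xr: bool) (xrs: bool) (xmv: int) (xm: nat) (xt: nat)

context msys
begin

text \<open>The distance of the followed cell from the head or, once the input is being shifted,
  from the first letter that is left in the row.\<close>

definition D :: "xs => int" where "D x = xP x - pos (xj x) (xt x) - int (xm x)"
definition xz :: "xs => bool" where "xz x \<longleftrightarrow> 2 ^ W dvd D x"

definition bP :: "nat option => xs => int" where "bP e x = (case e of None => xP x | Some l => pos l (xt x))"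
definition bJ :: "nat option => xs => nat" where "bJ e x = (case e of None => xj x | Some l => l)"

definition nx :: "xs => nat option => xs" where
  "nx x e = (if xk x = 1 then
     (if xt x = 0 then XS 2 (bJ e x) (bP e x) (e = None \<and> xr x) (e \<noteq> None) 0 0 0
      else XS 1 (bJ e x) (bP e x) (e = None \<and> xr x) (e \<noteq> None) (snd (snd (dl (qt (xt x - 1)) (svt (xt x - 1))) ! bJ e x)) 0 (xt x - 1))
     else if xk x = 3 \<or> xz x \<or> xj x \<noteq> 0 then XS 3 0 0 False False 0 0 0
     else XS 4 0 (xP x) (xr x) False (-1) (Suc (xm x)) 0)"

definition rhx :: "xs => rho" where
  "rhx x = Rho (xk x) (qt (xt x)) (svt (xt x)) (xj x) (cont (xj x) (xP x) (xt x)) (xr x) (xz x) (xmv x) (xrs x)"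

definition tl' :: "xs => nat => tile" where
  "tl' x i = Tile (rhx x) (bt (int (xt x)) i) (bt (int (xt x) + 1) i) (\<forall>k\<le>i. \<not> bt (int (xt x)) k) (bt (D x) i) (bt (D x - xmv x) i)
     (\<forall>k\<le>i. \<not> bt (D x) k) (lt (xm x + i))"

text \<open>\<open>xP x = 0\<close> under the root flag lets the test at time 0 succeed. The last
  clause says that the shifts have not passed the followed cell, unless it lies behind the input,
  where all cells are blank anyway.\<close>

definition Inv :: "xs => bool" where
  "Inv x \<longleftrightarrow> xj x < L \<and> \<bar>xP x\<bar> < 2 ^ (W - 1) \<and> int (xt x) < 2 ^ (W - 1) \<and> xk x \<in> {1, 2, 3, 4} \<and> xmv x \<in> {-1, 0, 1} \<and>
     (xk x = 1 \<longrightarrow> xm x = 0 \<and> (xr x \<longrightarrow> xP x = 0)) \<and> (xk x = 2 \<longrightarrow> xm x = 0 \<and> xt x = 0) \<and> (xk x = 4 \<longrightarrow> xt x = 0 \<and> xj x = 0) \<and>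
     (xk x \<in> {2, 4} \<longrightarrow> xj x = 0 \<longrightarrow> xP x < 0 \<or> int (xm x) \<le> xP x \<or> int n \<le> xP x)"

lemma base_Inv: "Inv x ==> e \<in> insert None (Some ` {..<L}) ==> bJ e x < L \<and> \<bar>bP e x\<bar> < 2 ^ (W - 1)"
proof (cases e)
  case None
  assume "Inv x"
  then show ?thesis unfolding None Inv_def by (simp add: bJ_def bP_def)
next
  case (Some l)
  assume x: "Inv x" and "e \<in> insert None (Some ` {..<L})"
  then have l: "l < L" using Some by auto
  have "int (xt x) < 2 ^ (W - 1)" using x unfolding Inv_def by blast
  then show ?thesis using rt_bound[OF _ l order_refl] l by (simp add: Some bJ_def bP_def)
qed

lemma Inv_nx: assumes x: "Inv x" and e: "e \<in> insert None (Some ` {..<L})" shows "Inv (nx x e)"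
proof (cases "xk x = 1")
  case True
  have m: "xt x \<noteq> 0 ==> snd (snd (dl (qt (xt x - 1)) (svt (xt x - 1))) ! bJ e x) \<in> {-1, 0, 1}"
    using dlmv' base_Inv[OF x e] by blast
  have r: "e = None ==> bP e x = xP x" by (simp add: bP_def)
  have "int (xt x) < 2 ^ (W - 1)" using x unfolding Inv_def by blast
  then have t: "int (xt x - 1) < 2 ^ (W - 1)" using zless_nat_eq_int_zless by linarith
  show ?thesis
  proof (cases "xt x = 0")
    case t0: True
    show ?thesis using base_Inv[OF x e] True t0 unfolding Inv_def nx_def by auto
  next
    case False
    have nxe: "nx x e = XS 1 (bJ e x) (bP e x) (e = None \<and> xr x) (e \<noteq> None) (snd (snd (dl (qt (xt x - 1)) (svt (xt x - 1))) ! bJ e x)) 0 (xt x - 1)"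
      using True False by (simp add: nx_def)
    have "e = None \<and> xr x \<longrightarrow> bP e x = 0" using r x True unfolding Inv_def by auto
    then show ?thesis unfolding nxe Inv_def xs.sel using base_Inv[OF x e] m[OF False] t by simp
  qed
next
  case False
  show ?thesis
  proof (cases "xk x = 3 \<or> xz x \<or> xj x \<noteq> 0")
    case True
    then have "nx x e = XS 3 0 0 False False 0 0 0" using False by (simp add: nx_def)
    then show ?thesis using L by (simp add: Inv_def)
  next
    case F: False
    then have n: "nx x e = XS 4 0 (xP x) (xr x) False (-1) (Suc (xm x)) 0" using False by (simp add: nx_def)
    have k: "xk x \<in> {2, 4}" "xt x = 0" "xj x = 0" using x F False by (auto simp: Inv_def)
    have "D x = xP x - int (xm x)" using k pos(1)[of 0] L by (simp add: D_def)
    then have "xP x \<noteq> int (xm x)" using F by (auto simp: xz_def)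
    then show ?thesis using x k L unfolding n Inv_def by auto
  qed
qed

lemma D_nx:
  assumes x: "Inv x" and e: "e \<in> insert None (Some ` {..<L})" and k: "xk (nx x e) \<noteq> 3"
  shows "D (nx x e) - xmv (nx x e) = (if xrs (nx x e) then 0 else D x)"
proof (cases "xk x = 1")
  case True
  have j: "bJ e x < L" using base_Inv[OF x e] by blast
  have m0: "xm x = 0" using x True by (simp add: Inv_def)
  show ?thesis
  proof (cases "xt x")
    case 0
    then show ?thesis using True m0 by (cases e) (simp_all add: nx_def D_def bP_def bJ_def)
  next
    case (Suc t)
    then show ?thesis using True m0 pos'[OF j, of t] by (cases e) (simp_all add: nx_def D_def bP_def bJ_def)
  qed
next
  case False
  then have n: "nx x e = XS 4 0 (xP x) (xr x) False (-1) (Suc (xm x)) 0" "xj x = 0" using k by (auto simp: nx_def split: if_splits)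
  moreover have "xt x = 0" using x False k n by (auto simp: Inv_def nx_def split: if_splits)
  ultimately show ?thesis by (simp add: D_def)
qed

lemma ball_le_Suc: "0 < k ==> (\<forall>j\<le>k. Q j) \<longleftrightarrow> (\<forall>j\<le>k - 1. Q j) \<and> Q k" for k :: nat
  by (cases k) (auto simp: le_Suc_eq)

lemma fr_tl: "fr (if k = 0 then None else Some (tl' x (k - 1))) P \<longleftrightarrow> k = 0 \<or> P (tl' x (k - 1))"
  by simp

text \<open>In a truthful tile the old bits are those of the time plus 1 and of the distance before
  the move, so all counting rules are instances of \<open>bt_succ\<close>. Only the agreement with
  the tile above remains as hypothesis.\<close>

lemma loc_any:
  assumes "kd (rh ab) \<noteq> 0 ==> (xk x = 1 \<longrightarrow> (bt (int (xt x) + 1) k \<longleftrightarrow> tb ab)) \<and> (bt (D x - xmv x) k \<longleftrightarrow> \<not> xrs x \<and> db ab)"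
    and "xk x \<noteq> 4 ==> lt (xm x + k) = cc ab" and "xk x = 4 ==> 0 < k ==> lt (xm x + (k - 1)) = cc ab"
  shows "loc (if k = 0 then None else Some (tl' x (k - 1))) ab (tl' x k)"
proof -
  have z: "(\<forall>j\<le>k. \<not> Q j) \<longleftrightarrow> (k = 0 \<or> (\<forall>j\<le>k - 1. \<not> Q j)) \<and> \<not> Q k" for Q
    using ball_le_Suc[of k "%j. \<not> Q j"] by (cases "k = 0") auto
  have t: "(bt (int (xt x)) k \<noteq> bt (int (xt x) + 1) k) \<longleftrightarrow> k = 0 \<or> (\<not> bt (int (xt x) + 1) (k - 1) \<and> bt (int (xt x)) (k - 1))"
    using bt_succ[of "int (xt x)" k] by blast
  have d1: "xmv x = 1 ==> (bt (D x) k \<noteq> bt (D x - xmv x) k) \<longleftrightarrow> k = 0 \<or> (bt (D x - xmv x) (k - 1) \<and> \<not> bt (D x) (k - 1))"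
    using bt_succ[of "D x - 1" k] by simp
  have d2: "xmv x = -1 ==> (bt (D x) k \<noteq> bt (D x - xmv x) k) \<longleftrightarrow> k = 0 \<or> (\<not> bt (D x - xmv x) (k - 1) \<and> bt (D x) (k - 1))"
    using bt_succ[of "D x" k] by auto
  have d0: "xmv x = 0 ==> bt (D x) k = bt (D x - xmv x) k" by simp
  show ?thesis unfolding loc_def fr_tl
  proof (intro conjI impI)
    show "tz (tl' x k) = ((k = 0 \<or> tz (tl' x (k - 1))) \<and> \<not> tb (tl' x k))" using z[of "bt (int (xt x))"] by (simp add: tl'_def)
    show "dz (tl' x k) = ((k = 0 \<or> dz (tl' x (k - 1))) \<and> \<not> db (tl' x k))" using z[of "bt (D x)"] by (simp add: tl'_def)
    show "cc (tl' x k) = cc ab" if "kd (rh (tl' x k)) \<noteq> 4" using assms(2) that by (simp add: tl'_def rhx_def)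
    show "k = 0 \<or> cc (tl' x (k - 1)) = cc ab" if "kd (rh (tl' x k)) = 4" using assms(3) that by (cases "k = 0") (simp_all add: tl'_def rhx_def)
    show "ot (tl' x k) = tb ab" if "kd (rh ab) \<noteq> 0" "kd (rh (tl' x k)) = 1" using assms(1)[OF that(1)] that(2) by (simp add: tl'_def rhx_def)
    show "(tb (tl' x k) \<noteq> ot (tl' x k)) = (k = 0 \<or> \<not> ot (tl' x (k - 1)) \<and> tb (tl' x (k - 1)))" unfolding tl'_def tile.sel by (rule t)
    show "od (tl' x k) = (\<not> rs (rh (tl' x k)) \<and> db ab)" if "kd (rh ab) \<noteq> 0" using assms(1)[OF that] by (simp add: tl'_def rhx_def)
    show "db (tl' x k) = od (tl' x k)" if "mv (rh (tl' x k)) = 0" using that unfolding tl'_def rhx_def tile.sel rho.sel by (rule d0)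
    show "(db (tl' x k) \<noteq> od (tl' x k)) = (k = 0 \<or> od (tl' x (k - 1)) \<and> \<not> db (tl' x (k - 1)))" if "mv (rh (tl' x k)) = 1"
      using that unfolding tl'_def rhx_def tile.sel rho.sel by (rule d1)
    show "(db (tl' x k) \<noteq> od (tl' x k)) = (k = 0 \<or> \<not> od (tl' x (k - 1)) \<and> db (tl' x (k - 1)))" if "mv (rh (tl' x k)) = -1"
      using that unfolding tl'_def rhx_def tile.sel rho.sel by (rule d2)
  qed
qed

lemma loc_tl:
  assumes x: "Inv x" and e: "e \<in> insert None (Some ` {..<L})" and k3: "xk x \<noteq> 3" "xk (nx x e) \<noteq> 3"
  shows "loc (if k = 0 then None else Some (tl' (nx x e) (k - 1))) (tl' x k) (tl' (nx x e) k)"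
proof (rule loc_any)
  have "xk (nx x e) = 1 ==> int (xt (nx x e)) + 1 = int (xt x)" by (auto simp: nx_def split: if_splits)
  then show "(xk (nx x e) = 1 \<longrightarrow> (bt (int (xt (nx x e)) + 1) k \<longleftrightarrow> tb (tl' x k))) \<and>
      (bt (D (nx x e) - xmv (nx x e)) k \<longleftrightarrow> \<not> xrs (nx x e) \<and> db (tl' x k))"
    using D_nx[OF x e k3(2)] by (simp add: tl'_def)
  show "xk (nx x e) \<noteq> 4 ==> lt (xm (nx x e) + k) = cc (tl' x k)"
    using k3 x by (auto simp: nx_def tl'_def Inv_def split: if_splits)
  show "xk (nx x e) = 4 ==> 0 < k ==> lt (xm (nx x e) + (k - 1)) = cc (tl' x k)"
    by (auto simp: nx_def tl'_def split: if_splits)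
qed

lemma tl_Tls: "Inv x ==> tl' x i \<in> Tls L NQ NS"
proof -
  assume x: "Inv x"
  have "set (svt t) \<subseteq> {..<NS}" "length (svt t) = L" for t by (auto simp: svt_def cont(1))
  then show ?thesis using x qt(1) lt(1) cont(1)[of "xj x"] unfolding Tls_def tl'_def rhx_def Inv_def mem_Collect_eq tile.sel rho.sel by blast
qed

lemma lookup_tl: assumes x: "Inv x" shows "lookup (tl' x 0)"
proof (cases "xk x \<in> {2, 4}")
  case True
  then have t: "xt x = 0" using x by (auto simp: Inv_def)
  show ?thesis
  proof (cases "xj x = 0")
    case False
    then have "cont (xj x) (xP x) 0 = 0" using x by (intro cont(3)) (auto simp: Inv_def)
    then show ?thesis using False t by (simp add: lookup_def tl'_def rhx_def)
  next
    case j: True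
    have c: "cont (xj x) (xP x) (xt x) = (if 0 \<le> xP x then lt (nat (xP x)) else 0)" unfolding j t by (rule cont(2))
    have P: "xP x < 0 \<or> int (xm x) \<le> xP x \<or> int n \<le> xP x" using x True j by (auto simp: Inv_def)
    have D: "D x = xP x - int (xm x)" using pos(1)[of 0] L j t by (simp add: D_def)
    have 1: "(if 0 \<le> xP x then lt (nat (xP x)) else 0) = 0" if "n \<le> xm x" using P that lt(2)[of "nat (xP x)"] by auto
    have 2: "lt (xm x) = 0 ==> n \<le> xm x" using lt(3)[of "xm x"] by (meson not_le)
    have 3: "(if 0 \<le> xP x then lt (nat (xP x)) else 0) = lt (xm x)" if "xz x"
    proof (cases "n \<le> xm x")
      case True then show ?thesis using 1 lt(2) by simp
    next
      case False
      then have "int (xm x) < 2 ^ (W - 1)" using W two_W(2) by linarith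
      then have "xP x = int (xm x)" using that x unfolding xz_def D by (subst (asm) dvd_W) (auto simp: Inv_def)
      then show ?thesis by simp
    qed
    show ?thesis using 1 2 3 by (simp add: lookup_def tl'_def rhx_def j c[unfolded j])
  qed
qed (auto simp: lookup_def tl'_def rhx_def)

lemma rownext_tl:
  assumes x: "Inv x" and e: "e \<in> insert None (Some ` {..<L})" and k3: "xk x \<noteq> 3"
  shows "rownext (tl' x (W - 1)) e (tl' (nx x e) 0)"
proof -
  have le: "k \<le> W - 1 \<longleftrightarrow> k < W" for k using W by auto
  have 1: "cc (tl' x (W - 1)) = 0" using W lt(2) by (simp add: tl'_def)
  have 2: "dz (tl' x (W - 1)) \<longleftrightarrow> zz (rh (tl' x (W - 1)))" by (simp add: tl'_def rhx_def xz_def le[simplified] bits_zero)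
  have tb: "\<not> tb (tl' x (W - 1))" using x by (simp add: tl'_def bt_def Inv_def div_pos_pos_trivial)
  have tz: "tz (tl' x (W - 1)) \<longleftrightarrow> xt x = 0"
  proof -
    have "tz (tl' x (W - 1)) \<longleftrightarrow> 2 ^ W dvd int (xt x) - 0" by (simp add: tl'_def le[simplified] bits_zero)
    also have "\<dots> \<longleftrightarrow> int (xt x) = 0" using x by (intro dvd_W) (auto simp: Inv_def)
    finally show ?thesis by simp
  qed
  have bj: "bj e (rhx x) = bJ e x" by (cases e) (simp_all add: bj_def bJ_def rhx_def)
  have J: "bJ e x < L" "\<bar>bP e x\<bar> < 2 ^ (W - 1)" using base_Inv[OF x e] by auto
  have bs: "bs0 e (rhx x) = cont (bJ e x) (bP e x) (xt x)"
    using e by (cases e) (auto simp: bs0_def bJ_def bP_def rhx_def svt_nth)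
  have rh: "rh (tl' y i) = rhx y" for y i by (simp add: tl'_def)
  have 3: "rstep (tl' x (W - 1)) e (rhx (nx x e))"
  proof (cases "xk x = 1")
    case k: True
    have kx: "kd (rhx x) = 1" using k by (simp add: rhx_def)
    have m0: "xm x = 0" using x k by (simp add: Inv_def)
    show ?thesis
    proof (cases "xt x")
      case 0
      have n: "nx x e = XS 2 (bJ e x) (bP e x) (e = None \<and> xr x) (e \<noteq> None) 0 0 0" using k 0 by (simp add: nx_def)
      have "xr x ==> D x = 0" using x k 0 m0 pos(1) by (simp add: Inv_def D_def)
      then have "xr x ==> xz x" by (simp add: xz_def)
      then show ?thesis unfolding rstep_def rh kx n if_P[OF refl] bj bs using tb tz 0 qt(2) by (simp add: rhx_def)
    next
      case (Suc t)
      have n: "nx x e = XS 1 (bJ e x) (bP e x) (e = None \<and> xr x) (e \<noteq> None) (snd (snd (dl (qt t) (svt t)) ! bJ e x)) 0 t" using k Suc by (simp add: nx_def)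
      have tl: "int t < 2 ^ (W - 1)" using x Suc unfolding Inv_def by linarith
      have z: "xz (nx x e) \<longleftrightarrow> bP e x = pos (bJ e x) t"
        unfolding xz_def n D_def using dvd_W[OF J(2) rt_bound[OF tl J(1) order_refl]] by simp
      show ?thesis unfolding rstep_def rh kx if_P[OF refl] bj bs using tb tz Suc qt'[of t] z cont'[OF J(1), of "bP e x" t] svt_nth[OF J(1), of t]
        by (auto simp: rhx_def n)
    qed
  next
    case False
    then show ?thesis unfolding rstep_def rh using k3 x by (auto simp: rhx_def nx_def Inv_def)
  qed
  show ?thesis unfolding rownext_def using 1 2 3 lookup_tl[OF Inv_nx[OF x e]] by (simp add: rh)
qed

primrec X :: "nat => (nat => nat option) => nat => xs" where
  "X T e 0 = XS 1 (L - 1) 0 True False 0 0 T"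
| "X T e (Suc r) = nx (X T e r) (e r)"

lemma X_cong: "(\<And>k. k < r ==> e k = e' k) ==> X T e r = X T e' r"
  by (induction r) auto

lemma game_complete:
  assumes T: "int T < 2 ^ (W - 1)" "hlt (qt T) (svt T)" "cont (L - 1) 0 T = 2" and ch: "ch ` Ys \<subseteq> insert None (Some ` {..<L})"
  shows "\<exists>str. gwin Ys ch str"
proof -
  \<comment> \<open>The choices that matter are those made at the ends of rows; the length of the
    history gives the row and the place in it.\<close>
  define str where "str h = tl' (X T (%r. ch (h ! (r * W + (W - 1)))) (length h div W)) (length h mod W)" for h
  have "okplay (%i. str (map \<eta> [0..<i])) (%i. ch (\<eta> i))" if \<eta>: "\<forall>i. \<eta> i \<in> Ys" for \<eta>
  proof -
    define e where "e r = ch (\<eta> (r * W + (W - 1)))" for r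
    define Z where "Z = X T e"
    have e: "e r \<in> insert None (Some ` {..<L})" for r using ch \<eta> unfolding e_def by blast
    have Z0: "Z 0 = XS 1 (L - 1) 0 True False 0 0 T" by (simp add: Z_def)
    have ZS: "Z (Suc r) = nx (Z r) (e r)" for r by (simp add: Z_def)
    have I: "Inv (Z r)" for r
    proof (induction r)
      case 0 show ?case using T(1) L by (simp add: Z0 Inv_def)
    next
      case (Suc r) then show ?case using Inv_nx e by (simp add: ZS)
    qed
    have th: "str (map \<eta> [0..<i]) = tl' (Z (i div W)) (i mod W)" for i
    proof -
      have "X T (%r. ch (map \<eta> [0..<i] ! (r * W + (W - 1)))) (i div W) = X T e (i div W)"
      proof (rule X_cong)
        fix k assume "k < i div W"
        then have "Suc k * W \<le> i" using div_times_less_eq_dividend[of i W] mult_le_mono1[of "Suc k" "i div W" W] by linarith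
        then have "k * W + (W - 1) < i" using W by simp
        then show "ch (map \<eta> [0..<i] ! (k * W + (W - 1))) = e k" by (simp add: e_def)
      qed
      then show ?thesis by (simp add: str_def Z_def)
    qed
    show ?thesis unfolding okplay_def th
    proof
      fix i
      define r k where "r = i div W" and "k = i mod W"
      have k: "k < W" and i: "i = r * W + k" using W by (simp_all add: k_def r_def)
      have dv: "W dvd i \<longleftrightarrow> k = 0" by (simp add: k_def dvd_eq_mod_eq_0)
      have rk: "(r * W + k) div W = r" "(r * W + k) mod W = k" using i unfolding k_def r_def by simp_all
      have dm: "k < W ==> (r * W + k) div W = r \<and> (r * W + k) mod W = k" for r k by simp
      have rh: "rh (tl' y i) = rhx y" "kd (rhx y) = xk y" for y i by (simp_all add: tl'_def rhx_def)
      define ab where "ab = (if i < W then ini (lt i) else tl' (Z ((i - W) div W)) ((i - W) mod W))"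
      have ab: "ab = (if r = 0 then ini (lt k) else tl' (Z (r - 1)) k)"
      proof (cases r)
        case 0 then show ?thesis using k i by (simp add: ab_def)
      next
        case (Suc r')
        then have "i - W = r' * W + k" "\<not> i < W" using i by auto
        moreover have "(r' * W + k) div W = r'" "(r' * W + k) mod W = k" using k by simp_all
        ultimately show ?thesis using Suc by (simp add: ab_def)
      qed
      have loc: "loc (if k = 0 then None else Some (tl' (Z r) (k - 1))) ab (tl' (Z r) k)" if k3: "xk (Z r) \<noteq> 3"
      proof (cases r)
        case 0
        then show ?thesis unfolding ab by (intro loc_any) (simp_all add: ini_def Z0)
      next
        case (Suc r')
        have "xk (Z r') \<noteq> 3" using k3 Suc by (auto simp: ZS nx_def)
        then show ?thesis using loc_tl[OF I e, of r'] k3 unfolding ab Suc ZS by simp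
      qed
      have "R (W dvd i) (if i = 0 then None else Some (tl' (Z ((i - 1) div W)) ((i - 1) mod W), ch (\<eta> (i - 1)))) ab (tl' (Z r) k)"
      proof (cases k)
        case k0: 0
        show ?thesis
        proof (cases r)
          case 0
          then show ?thesis using loc tl_Tls[OF I[of 0], unfolded Z0] T k0 i unfolding R_def start0_def by (simp add: rh Z0) (simp add: rhx_def)
        next
          case (Suc r')
          have n3: "xk (Z r') = 3 ==> xk (nx (Z r') (e r')) = 3" by (simp add: nx_def)
          have "i - 1 = r' * W + (W - 1)" "i \<noteq> 0" using i k0 Suc W by auto
          moreover have "(r' * W + (W - 1)) div W = r'" "(r' * W + (W - 1)) mod W = W - 1" using dm[of "W - 1" r'] W by simp_all
          ultimately have p: "(if i = 0 then None else Some (tl' (Z ((i - 1) div W)) ((i - 1) mod W), ch (\<eta> (i - 1)))) = Some (tl' (Z r') (W - 1), e r')"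
            by (simp add: e_def)
          show ?thesis unfolding p R_def
            using tl_Tls[OF I, of "Suc r'" 0, unfolded ZS] loc rownext_tl[OF I e, of r' r'] n3 k0 Suc dv by (auto simp: rh ZS)
        qed
      next
        case (Suc k')
        have "i - 1 = r * W + k'" "i \<noteq> 0" using i Suc by auto
        moreover have "(r * W + k') div W = r" "(r * W + k') mod W = k'" using k Suc by simp_all
        ultimately have p: "(if i = 0 then None else Some (tl' (Z ((i - 1) div W)) ((i - 1) mod W), ch (\<eta> (i - 1)))) = Some (tl' (Z r) k', ch (\<eta> (i - 1)))"
          by simp
        show ?thesis unfolding p R_def using tl_Tls[OF I] loc Suc dv by (auto simp: rh)
      qed
      then show "R (W dvd i) (if i = 0 then None else Some (tl' (Z ((i - 1) div W)) ((i - 1) mod W), ch (\<eta> (i - 1))))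
          (if i < W then ini (lt i) else tl' (Z ((i - W) div W)) ((i - W) mod W)) (tl' (Z (i div W)) (i mod W))"
        unfolding ab_def r_def k_def .
    qed
  qed
  then show ?thesis unfolding gwin_def by blast
qed

theorem game_iff:
  assumes ch: "ch ` Ys = insert None (Some ` {..<L})"
  shows "(\<exists>str. gwin Ys ch str) \<longleftrightarrow> (\<exists>t. int t < 2 ^ (W - 1) \<and> hlt (qt t) (svt t) \<and> cont (L - 1) 0 t = 2)"
  using game_sound[OF _ ch] game_complete[OF _ _ _ equalityD1[OF ch]] by blast

end

subsection \<open>Formulas for local rules\<close>

definition ff_tt :: "nat ltlf" where "ff_tt = LOr (LAtom 0) (LNot (LAtom 0))"
definition cj :: "nat ltlf list => nat ltlf" where "cj l = foldr LAnd l ff_tt"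
definition dj :: "nat ltlf list => nat ltlf" where "dj l = foldr LOr l (LNot ff_tt)"
definition iff :: "nat ltlf => nat ltlf => nat ltlf" where "iff \<phi> \<psi> = LOr (LAnd \<phi> \<psi>) (LAnd (LNot \<phi>) (LNot \<psi>))"
definition lit :: "nat => (nat => nat ltlf) => nat set => nat ltlf" where
  "lit c f A = cj (map (%a. if a \<in> A then f a else LNot (f a)) [0..<c])"

lemma atoms_cj [simp]: "atoms_ltlf (cj l) = insert 0 (\<Union>\<phi>\<in>set l. atoms_ltlf \<phi>)" "atoms_ltlf (dj l) = insert 0 (\<Union>\<phi>\<in>set l. atoms_ltlf \<phi>)"
  by (induction l) (auto simp: cj_def dj_def ff_tt_def)

lemma atoms_lit: "atoms_ltlf (lit c f A) \<subseteq> insert 0 (\<Union>a<c. atoms_ltlf (f a))"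
  by (auto simp: lit_def split: if_splits)

definition sets_below :: "nat => nat set list" where "sets_below c = map set (subseqs [0..<c])"

lemma set_sets_below: "A \<in> set (sets_below c) \<longleftrightarrow> A \<subseteq> {..<c}"
  using subseqs_powset[of "[0..<c]"] by (auto simp: sets_below_def atLeast0LessThan)

text \<open>The number \<open>c\<close> of atoms depends on the machine alone, so this list, though
  exponential in \<open>c\<close>, is a constant of the reduction.\<close>

definition tuples :: "nat => (bool \<times> nat set option \<times> (nat + nat set) \<times> nat set) list" where
  "tuples c = List.product [False, True] (List.product (None # map Some (sets_below c))
     (List.product (map Inl [0, 1, 2] @ map Inr (sets_below c)) (sets_below c)))"

text \<open>The disjunction over all allowed neighbourhoods of the last position; the arguments \<open>f\<close> are formulas that describe
  the start of a row, the first position, the previous letter, the existence of a row above, the letter above,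
  the initial letter and the current letter.\<close>

definition cform :: "nat => (bool => nat set option => nat + nat set => nat set => bool) =>
    nat ltlf => nat ltlf => (nat => nat ltlf) => nat ltlf => (nat => nat ltlf) => (nat => nat ltlf) => (nat => nat ltlf) => nat ltlf" where
  "cform c Rs fst_row fst_pos fprv fex fabv fini fcur = dj (map (%(s, p, a, u). cj
     [if s then fst_row else LNot fst_row,
      case p of None => fst_pos | Some A => LAnd (LNot fst_pos) (lit c fprv A),
      case a of Inl v => LAnd (LNot fex) (fini v) | Inr A => LAnd fex (lit c fabv A),
      lit c fcur u]) (filter (%(s, p, a, u). Rs s p a u) (tuples c)))"

lemma ball_set_map: "(\<forall>y\<in>set (map g l). P y) \<longleftrightarrow> (\<forall>x\<in>set l. P (g x))" "(\<exists>y\<in>set (map g l). P y) \<longleftrightarrow> (\<exists>x\<in>set l. P (g x))"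
  by auto

text \<open>The Boolean clauses are common to LTLf at the first and mirrored PPLTL at the last
  position; all temporal information is in the parameters of \<open>cform\<close>.\<close>

locale sem =
  fixes S :: "nat set list => nat ltlf => bool"
  assumes S_bool [simp]: "S t (LNot \<phi>) \<longleftrightarrow> \<not> S t \<phi>" "S t (LOr \<phi> \<psi>) \<longleftrightarrow> S t \<phi> \<or> S t \<psi>" "S t (LAnd \<phi> \<psi>) \<longleftrightarrow> S t \<phi> \<and> S t \<psi>"
begin

lemma S_tt [simp]: "S t ff_tt" by (simp add: ff_tt_def)

lemma S_cj [simp]: "S t (cj l) \<longleftrightarrow> (\<forall>\<phi>\<in>set l. S t \<phi>)" and S_dj [simp]: "S t (dj l) \<longleftrightarrow> (\<exists>\<phi>\<in>set l. S t \<phi>)"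
  by (induction l) (auto simp: cj_def dj_def)

lemma S_iff [simp]: "S t (iff \<phi> \<psi>) \<longleftrightarrow> (S t \<phi> \<longleftrightarrow> S t \<psi>)" by (auto simp: iff_def)

lemma S_dj_quads: "S t (dj (map (%(s, p, a, u). cj [f s, g p, h a, k u]) (filter (%(s, p, a, u). Q s p a u) l))) \<longleftrightarrow>
    (\<exists>s p a u. (s, p, a, u) \<in> set l \<and> Q s p a u \<and> S t (f s) \<and> S t (g p) \<and> S t (h a) \<and> S t (k u))"
  unfolding S_dj ball_set_map by (auto simp: Bex_def)

lemma S_lit: "A \<subseteq> {..<c} ==> B \<subseteq> {..<c} ==> (\<And>a. a < c ==> S t (f a) \<longleftrightarrow> a \<in> B) ==> S t (lit c f A) \<longleftrightarrow> A = B"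
proof -
  assume A: "A \<subseteq> {..<c}" "B \<subseteq> {..<c}" and f: "\<And>a. a < c ==> S t (f a) \<longleftrightarrow> a \<in> B"
  have "S t (lit c f A) \<longleftrightarrow> (\<forall>a<c. S t (if a \<in> A then f a else LNot (f a)))" unfolding lit_def S_cj ball_set_map by auto
  also have "\<dots> \<longleftrightarrow> (\<forall>a<c. a \<in> A \<longleftrightarrow> a \<in> B)" using f by auto
  finally show ?thesis using A by auto
qed

lemma S_cform:
  assumes st: "S t fst_row \<longleftrightarrow> s0" and fp: "S t fst_pos \<longleftrightarrow> p0 = None"
    and p: "\<And>A a. p0 = Some A ==> a < c ==> S t (fprv a) \<longleftrightarrow> a \<in> A" "\<And>A. p0 = Some A ==> A \<subseteq> {..<c}"
    and e: "S t fex \<longleftrightarrow> (\<exists>A. a0 = Inr A)"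
    and a: "\<And>A a. a0 = Inr A ==> a < c ==> S t (fabv a) \<longleftrightarrow> a \<in> A" "\<And>A. a0 = Inr A ==> A \<subseteq> {..<c}"
    and i: "\<And>v. a0 = Inl v ==> v < 3" "\<And>v v'. a0 = Inl v ==> v' < 3 ==> S t (fini v') \<longleftrightarrow> v' = v"
    and u: "\<And>a. a < c ==> S t (fcur a) \<longleftrightarrow> a \<in> u0" "u0 \<subseteq> {..<c}"
  shows "S t (cform c Rs fst_row fst_pos fprv fex fabv fini fcur) \<longleftrightarrow> Rs s0 p0 a0 u0"
proof -
  have tu: "(s, p, a, u) \<in> set (tuples c) \<longleftrightarrow> (\<forall>A. p = Some A \<longrightarrow> A \<subseteq> {..<c}) \<and> (\<forall>A. a = Inr A \<longrightarrow> A \<subseteq> {..<c}) \<and> (\<forall>v. a = Inl v \<longrightarrow> v < 3) \<and> u \<subseteq> {..<c}" for s p a u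
  proof -
    have 1: "p \<in> set (None # map Some (sets_below c)) \<longleftrightarrow> (\<forall>A. p = Some A \<longrightarrow> A \<subseteq> {..<c})"
      by (cases p) (auto simp: set_sets_below)
    have 2: "a \<in> set (map Inl [0, 1, 2] @ map Inr (sets_below c)) \<longleftrightarrow> (\<forall>A. a = Inr A \<longrightarrow> A \<subseteq> {..<c}) \<and> (\<forall>v. a = Inl v \<longrightarrow> v < 3)"
      by (cases a) (auto simp: set_sets_below)
    have 3: "s \<in> set [False, True]" by auto
    have "(s, p, a, u) \<in> set (tuples c) \<longleftrightarrow> s \<in> set [False, True] \<and> p \<in> set (None # map Some (sets_below c)) \<and>
       a \<in> set (map Inl [0, 1, 2] @ map Inr (sets_below c)) \<and> u \<in> set (sets_below c)"
      unfolding tuples_def set_product mem_Times_iff fst_conv snd_conv ..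
    then show ?thesis unfolding 1 2 set_sets_below using 3 by blast
  qed
  have P: "S t (case p of None => fst_pos | Some A => LAnd (LNot fst_pos) (lit c fprv A)) \<longleftrightarrow> p = p0" if "\<forall>A. p = Some A \<longrightarrow> A \<subseteq> {..<c}" for p
    using that fp p S_lit[of _ c "the p0" t fprv] by (cases p; cases p0) auto
  have A: "S t (case a of Inl v => LAnd (LNot fex) (fini v) | Inr A => LAnd fex (lit c fabv A)) \<longleftrightarrow> a = a0"
    if "\<forall>A. a = Inr A \<longrightarrow> A \<subseteq> {..<c}" "\<forall>v. a = Inl v \<longrightarrow> v < 3" for a
  proof (cases a0)
    case (Inl v) then show ?thesis using that e i by (cases a) auto
  next
    case (Inr B) then show ?thesis using that e a S_lit[of _ c B t fabv] by (cases a) auto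
  qed
  have U: "S t (lit c fcur u) \<longleftrightarrow> u = u0" if "u \<subseteq> {..<c}" for u by (rule S_lit[OF that u(2,1)])
  have I: "S t (if s then fst_row else LNot fst_row) \<longleftrightarrow> (s \<longleftrightarrow> s0)" for s using st by simp
  have "S t (cform c Rs fst_row fst_pos fprv fex fabv fini fcur) \<longleftrightarrow> (\<exists>s p a u. (s, p, a, u) \<in> set (tuples c) \<and> Rs s p a u \<and>
     (s \<longleftrightarrow> s0) \<and> S t (case p of None => fst_pos | Some A => LAnd (LNot fst_pos) (lit c fprv A)) \<and>
     S t (case a of Inl v => LAnd (LNot fex) (fini v) | Inr A => LAnd fex (lit c fabv A)) \<and> S t (lit c fcur u))"
    unfolding cform_def S_dj_quads using I by simp
  also have "\<dots> \<longleftrightarrow> (\<exists>s p a u. (s, p, a, u) \<in> set (tuples c) \<and> Rs s p a u \<and> s = s0 \<and> p = p0 \<and> a = a0 \<and> u = u0)"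
    using P A U unfolding tu by (intro ex_cong1 conj_cong refl) auto
  also have "\<dots> \<longleftrightarrow> Rs s0 p0 a0 u0" using tu[of s0 p0 a0 u0] p(2) a(2) i(1) u(2) by blast
  finally show ?thesis .
qed

end

subsection \<open>Realizability as a game with local rules\<close>

text \<open>A power of two is exponentially large in unary, but its binary code can be written down
  directly.\<close>

definition dyn :: "nat => nat => nat" where "dyn c b = 2 ^ (c + b)"

lemma dyn_ge: "c < dyn c b" "\<not> dyn c b < c"
proof -
  have "c < 2 ^ (c + b)" using less_exp[of "c + b"] by linarith
  then show "c < dyn c b" "\<not> dyn c b < c" by (simp_all add: dyn_def)
qed

definition letter :: "(nat set list => nat set) => (nat => nat set) => nat => nat set" where
  "letter str \<eta> i = str (map \<eta> [0..<i]) \<union> \<eta> i"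

text \<open>The atoms \<open>dyn c b\<close> leave the agent no choice: the formula forces values
  \<open>dv b n\<close> that depend on the position only. The agent can always play them, so they
  drop out of the game.\<close>

lemma realizable_game:
  fixes L :: "nat set => nat ltlf => nat set list set" and K c q :: nat and dv :: "nat => nat => bool"
  defines "X \<equiv> {..<K} \<union> dyn c ` {..<q}" and "Y \<equiv> {K..<c}"
  assumes K: "K \<le> c"
    and char: "\<And>\<tau>. \<tau> \<in> inf_traces (X \<union> Y) ==> (\<forall>n. trace_prefix \<tau> n \<in> L (X \<union> Y) \<Phi>) \<longleftrightarrow>
      (\<forall>n. \<forall>b<q. dyn c b \<in> \<tau> n \<longleftrightarrow> dv b n) \<and> (\<forall>n. G n (%i. \<tau> i \<inter> {..<c}))"
  shows "(\<exists>\<sigma>. wins X Y \<sigma> (plus_lang L (X \<union> Y) (QAll \<Phi>))) \<longleftrightarrow>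
    (\<exists>str. (\<forall>h. str h \<subseteq> {..<K}) \<and> (\<forall>\<eta>. (\<forall>i. \<eta> i \<subseteq> Y) \<longrightarrow> (\<forall>n. G n (letter str \<eta>))))"
proof
  assume "\<exists>\<sigma>. wins X Y \<sigma> (plus_lang L (X \<union> Y) (QAll \<Phi>))"
  then obtain \<sigma> where w: "wins X Y \<sigma> (plus_lang L (X \<union> Y) (QAll \<Phi>))" by blast
  define str where "str h = \<sigma> h \<inter> {..<K}" for h
  have "\<forall>n. G n (letter str \<eta>)" if \<eta>: "\<forall>i. \<eta> i \<subseteq> Y" for \<eta>
  proof -
    define \<tau> where "\<tau> i = \<sigma> (map \<eta> [0..<i]) \<union> \<eta> i" for i
    have XY: "X \<inter> Y = {}" using K dyn_ge(2)[of c] by (auto simp: X_def Y_def)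
    have "map \<eta> [0..<i] \<in> lists (Pow Y)" for i using \<eta> by (auto simp: in_lists_conv_set)
    then have sX: "\<sigma> (map \<eta> [0..<i]) \<subseteq> X" for i using w unfolding wins_def is_strategy_def by blast
    have tY: "\<tau> i \<inter> Y = \<eta> i" for i using sX[of i] XY \<eta> by (auto simp: \<tau>_def)
    have tX: "\<tau> i \<inter> X = \<sigma> (map \<eta> [0..<i])" for i using sX[of i] XY \<eta> by (auto simp: \<tau>_def)
    have it: "\<tau> \<in> inf_traces (X \<union> Y)" using sX \<eta> by (auto simp: inf_traces_def \<tau>_def)
    have "\<tau> \<in> outcomes X Y \<sigma>" unfolding outcomes_def using it by (simp add: tX tY)
    then have "\<tau> \<in> plus_lang L (X \<union> Y) (QAll \<Phi>)" using w by (auto simp: wins_def)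
    then have "\<forall>n. G n (%i. \<tau> i \<inter> {..<c})" using char[OF it] by simp
    moreover have "\<tau> i \<inter> {..<c} = letter str \<eta> i" for i
    proof -
      have "\<sigma> (map \<eta> [0..<i]) \<inter> {..<c} = \<sigma> (map \<eta> [0..<i]) \<inter> {..<K}" using sX[of i] K dyn_ge(2)[of c] by (auto simp: X_def)
      moreover have "\<eta> i \<inter> {..<c} = \<eta> i" using \<eta>[rule_format, of i] unfolding Y_def by auto
      ultimately show ?thesis by (simp add: \<tau>_def letter_def str_def Int_Un_distrib2)
    qed
    ultimately show ?thesis by simp
  qed
  then show "\<exists>str. (\<forall>h. str h \<subseteq> {..<K}) \<and> (\<forall>\<eta>. (\<forall>i. \<eta> i \<subseteq> Y) \<longrightarrow> (\<forall>n. G n (letter str \<eta>)))"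
    by (intro exI[of _ str]) (auto simp: str_def)
next
  assume "\<exists>str. (\<forall>h. str h \<subseteq> {..<K}) \<and> (\<forall>\<eta>. (\<forall>i. \<eta> i \<subseteq> Y) \<longrightarrow> (\<forall>n. G n (letter str \<eta>)))"
  then obtain str where str: "\<And>h. str h \<subseteq> {..<K}" "\<And>\<eta>. (\<forall>i. \<eta> i \<subseteq> Y) ==> \<forall>n. G n (letter str \<eta>)" by blast
  define \<sigma> where "\<sigma> h = str h \<union> dyn c ` {b. b < q \<and> dv b (length h)}" for h :: "nat set list"
  have "outcomes X Y \<sigma> \<subseteq> plus_lang L (X \<union> Y) (QAll \<Phi>)"
  proof
    fix \<tau> assume "\<tau> \<in> outcomes X Y \<sigma>"
    then have it: "\<tau> \<in> inf_traces (X \<union> Y)" and t: "\<And>i. \<tau> i \<inter> X = \<sigma> (map (%j. \<tau> j \<inter> Y) [0..<i])" by (auto simp: outcomes_def)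
    define \<eta> where "\<eta> i = \<tau> i \<inter> Y" for i
    have t: "\<tau> i \<inter> X = str (map \<eta> [0..<i]) \<union> dyn c ` {b. b < q \<and> dv b i}" for i using t[of i] unfolding \<sigma>_def \<eta>_def[symmetric] by simp
    have "dyn c b \<in> \<tau> n \<longleftrightarrow> dv b n" if "b < q" for n b
    proof -
      have "dyn c b \<in> \<tau> n \<longleftrightarrow> dyn c b \<in> \<tau> n \<inter> X" using that by (auto simp: X_def)
      also have "\<dots> \<longleftrightarrow> dv b n" unfolding t using str(1) K dyn_ge(1)[of c b] that by (fastforce simp: dyn_def)
      finally show ?thesis .
    qed
    moreover have "\<tau> i \<inter> {..<c} = letter str \<eta> i" for i
    proof -
      have dK: "\<not> dyn c b < K" for b using K dyn_ge(2)[of c b] by linarith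
      have "\<tau> i \<inter> {..<c} = (\<tau> i \<inter> X) \<inter> {..<K} \<union> \<tau> i \<inter> Y" using it K dyn_ge(2)[of c] unfolding inf_traces_def X_def Y_def by fastforce
      also have "(\<tau> i \<inter> X) \<inter> {..<K} = str (map \<eta> [0..<i])" unfolding t using str(1)[of "map \<eta> [0..<i]"] dK by auto
      finally show ?thesis by (simp add: letter_def \<eta>_def)
    qed
    moreover have "\<forall>n. G n (letter str \<eta>)" by (rule str(2)) (simp add: \<eta>_def)
    ultimately have "\<forall>n. trace_prefix \<tau> n \<in> L (X \<union> Y) \<Phi>" unfolding char[OF it] by simp
    then show "\<tau> \<in> plus_lang L (X \<union> Y) (QAll \<Phi>)" using it by simp
  qed
  moreover have "is_strategy X Y \<sigma>" unfolding is_strategy_def \<sigma>_def X_def using str(1) by blast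
  ultimately show "\<exists>\<sigma>. wins X Y \<sigma> (plus_lang L (X \<union> Y) (QAll \<Phi>))" unfolding wins_def by blast
qed

subsection \<open>Row formulas of the two logics\<close>

text \<open>The formula \<open>edge\<close> holds at the last position in LTLf and, mirrored, at the first position in PPLTL.\<close>

definition edge :: "nat ltlf" where "edge = LNot (LNext ff_tt)"
definition nxt :: "nat => nat ltlf => nat ltlf" where "nxt k \<phi> = (LNext ^^ k) \<phi>"
definition ev :: "nat ltlf => nat ltlf" where "ev \<phi> = LUntil ff_tt \<phi>"
text \<open>An LTLf formula is evaluated at the first position, while the rules concern the last
  one; \<open>edge\<close> leads there.\<close>

definition curf :: "nat => nat ltlf" where "curf a = ev (LAnd edge (LAtom a))"
definition prvf :: "nat => nat ltlf" where "prvf a = ev (LAnd (LAtom a) (LNext edge))"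
definition rowf :: "nat => nat => nat ltlf" where "rowf c q = cj (map (%b. LNot (LAtom (dyn c b))) [0..<q])"
definition eqf :: "nat => nat => nat ltlf" where "eqf c q = cj (map (%b. iff (LAtom (dyn c b)) (curf (dyn c b))) [0..<q])"
text \<open>Exactly one row starts strictly after the position. Together with \<open>eqf\<close>,
  which demands the same counter value as at the end of the prefix, this singles out the position
  one row length back.\<close>

definition onef :: "nat => nat => nat ltlf" where
  "onef c q = LNext (LUntil (LNot (rowf c q)) (LAnd (rowf c q) (LNot (LNext (ev (rowf c q))))))"
definition abvf :: "nat => nat => nat ltlf => nat ltlf" where "abvf c q \<phi> = ev (LAnd \<phi> (LAnd (eqf c q) (onef c q)))"

text \<open>A binary counter: bit \<open>b\<close> changes iff bit \<open>b - 1\<close> changes from 1 to 0.\<close>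

definition cntf :: "nat => nat => nat ltlf" where
  "cntf c q = cj (map (%b. LOr (LAnd edge (LNot (curf (dyn c b)))) (LAnd (LNot edge) (iff (iff (curf (dyn c b)) (prvf (dyn c b)))
     (LNot (if b = 0 then ff_tt else LAnd (prvf (dyn c (b - 1))) (LNot (curf (dyn c (b - 1))))))))) [0..<q])"

text \<open>In both logics \<open>nxt k edge\<close> characterises the prefix whose last position is
  \<open>k\<close>, so the input enters the formula letter by letter.\<close>

definition inif :: "bool list => bool => nat ltlf" where
  "inif w v = dj (map (%k. if nthd False w k = v then nxt k edge else LNot ff_tt) [0..<length w])"
definition iniv :: "bool list => nat => nat ltlf" where
  "iniv w v = (if v = 0 then LAnd (LNot (inif w False)) (LNot (inif w True)) else inif w (v = 2))"

definition lw :: "bool list => nat => nat" where "lw w i = (if i < length w then (if w ! i then 2 else 1) else 0)"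

definition form_l where "form_l c Rs q w = LAnd (cntf c q)
  (cform c Rs (ev (LAnd edge (rowf c q))) edge prvf (abvf c q ff_tt) (%a. abvf c q (LAtom a)) (iniv w) curf)"

text \<open>Here \<open>W\<close> is polynomial, so one marker of row starts and iterated yesterday
  take the place of the counter.\<close>

definition form_p where "form_p c Rs W w = LAnd (iff (LAtom (dyn c 0)) (LOr edge (nxt W (LAtom (dyn c 0)))))
  (cform c Rs (LAtom (dyn c 0)) edge (%a. LNext (LAtom a)) (nxt W ff_tt) (%a. nxt W (LAtom a)) (iniv w) LAtom)"

definition nbh :: "(bool => nat set option => nat + nat set => nat set => bool) => nat => bool list => nat => (nat => nat set) => bool" where
  "nbh Rs W w n t \<longleftrightarrow> Rs (W dvd n) (if n = 0 then None else Some (t (n - 1))) (if n < W then Inl (lw w n) else Inr (t (n - W))) (t n)"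

lemma lw_3: "lw w i < 3" by (simp add: lw_def)

context sem
begin

lemma S_iniv:
  assumes "\<And>k. S t (nxt k edge) \<longleftrightarrow> k = n" and "v < 3"
  shows "S t (iniv w v) \<longleftrightarrow> v = lw w n"
proof -
  have "S t (inif w b) \<longleftrightarrow> n < length w \<and> w ! n = b" for b
  proof -
    have "S t (inif w b) \<longleftrightarrow> (\<exists>k\<in>set [0..<length w]. S t (if nthd False w k = b then nxt k edge else LNot ff_tt))"
      unfolding inif_def S_dj ball_set_map ..
    also have "\<dots> \<longleftrightarrow> (\<exists>k\<in>set [0..<length w]. w ! k = b \<and> k = n)"
      by (intro bex_cong refl) (simp add: assms(1))
    finally show ?thesis by auto
  qed
  moreover have "v = 0 \<or> v = 1 \<or> v = 2" using assms(2) by linarith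
  ultimately show ?thesis unfolding iniv_def lw_def by (elim disjE) simp_all
qed

end

section \<open>Semantics of the row formulas\<close>

interpretation sem_l: sem "%t \<phi>. ltlf_sat t 0 \<phi>" by unfold_locales auto
interpretation sem_p: sem "%t \<phi>. ppltl_sat t (length t - 1) (mir \<phi>)" by unfold_locales auto
interpretation sem_li: sem "%t \<phi>. ltlf_sat t i \<phi>" for i by unfold_locales auto
interpretation sem_pi: sem "%t \<phi>. ppltl_sat t i (mir \<phi>)" for i by unfold_locales auto

lemma prefix_nth: "i \<le> n ==> trace_prefix \<tau> n ! i = \<tau> i" "length (trace_prefix \<tau> n) = Suc n"
  by (auto simp: trace_prefix_def nth_append less_Suc_eq)

lemma bt_bit: "bt x i = bit x i" by (simp add: bt_def bit_iff_odd)

lemma bits_eq: "(\<forall>b<q. bt x b = bt y b) \<longleftrightarrow> x mod 2 ^ q = y mod 2 ^ q"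
proof -
  have "x mod 2 ^ q = y mod 2 ^ q \<longleftrightarrow> take_bit q x = take_bit q y" by (simp add: take_bit_eq_mod)
  also have "\<dots> \<longleftrightarrow> (\<forall>b<q. bt x b = bt y b)" unfolding bt_bit bit_eq_iff bit_take_bit_iff by auto
  finally show ?thesis by simp
qed

text \<open>As \<open>i\<close> and \<open>n\<close> are congruent, the interval from
  \<open>i\<close> (excluded) to \<open>n\<close> contains one multiple of \<open>W\<close> for
  every time that \<open>W\<close> fits into \<open>n - i\<close>.\<close>

lemma unique_multiple:
  fixes i n W :: nat
  assumes "0 < W" "n mod W = i mod W" "i \<le> n"
  shows "(\<exists>j. i < j \<and> j \<le> n \<and> W dvd j \<and> (\<forall>k. i < k \<and> k < j \<longrightarrow> \<not> W dvd k) \<and> \<not> (\<exists>k. j < k \<and> k \<le> n \<and> W dvd k)) \<longleftrightarrow> n = i + W"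
proof -
  define j0 where "j0 = (i div W + 1) * W"
  have "j0 = i div W * W + W" "i div W * W + i mod W = i" "i mod W < W" using assms(1) by (simp_all add: j0_def)
  then have j0: "i < j0" "j0 \<le> i + W" "W dvd j0" by (linarith, linarith, simp add: j0_def)
  obtain k where k: "n = i + k * W"
  proof -
    have "W dvd n - i" using assms(2,3) by (simp add: mod_eq_dvd_iff_nat)
    then show ?thesis using that assms(3) by (metis dvd_def le_add_diff_inverse mult.commute)
  qed
  have m: "j0 \<le> k" if hk: "i < k" and dk: "W dvd k" for k
  proof -
    obtain l where l: "k = W * l" using dk by (rule dvdE)
    have "i div W < l" using hk l assms(1) by (metis div_less_iff_less_mult mult.commute)
    then have "(i div W + 1) * W \<le> l * W" by (intro mult_le_mono1) simp
    then show ?thesis by (simp add: j0_def l mult.commute)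
  qed
  show ?thesis
  proof
    assume "n = i + W"
    moreover have "\<not> (j0 < k \<and> k \<le> i + W \<and> W dvd k)" for k
    proof
      assume h: "j0 < k \<and> k \<le> i + W \<and> W dvd k"
      then have "W dvd k - j0" using j0(3) by (simp add: dvd_diff_nat)
      then have "W \<le> k - j0" using h by (intro dvd_imp_le) auto
      then show False using h j0(1) by linarith
    qed
    ultimately show "\<exists>j. i < j \<and> j \<le> n \<and> W dvd j \<and> (\<forall>k. i < k \<and> k < j \<longrightarrow> \<not> W dvd k) \<and> \<not> (\<exists>k. j < k \<and> k \<le> n \<and> W dvd k)"
      using j0 m by (intro exI[of _ j0]) (auto dest: leD)
  next
    assume "\<exists>j. i < j \<and> j \<le> n \<and> W dvd j \<and> (\<forall>k. i < k \<and> k < j \<longrightarrow> \<not> W dvd k) \<and> \<not> (\<exists>k. j < k \<and> k \<le> n \<and> W dvd k)"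
    then obtain j where j: "i < j" "j \<le> n" "W dvd j" "\<And>k. i < k ==> k < j ==> \<not> W dvd k" "\<And>k. j < k ==> k \<le> n ==> \<not> W dvd k" by blast
    have "\<not> j0 < j" using j(4)[of j0] j0(1,3) by blast
    then have "j = j0" using m[OF j(1,3)] by linarith
    moreover have "k \<noteq> 0" using k j by (cases k) auto
    moreover have "\<not> 2 \<le> k"
    proof
      assume "2 \<le> k"
      then have "2 * W \<le> k * W" by (rule mult_le_mono1)
      then have "j0 + W \<le> n" using k j0(2) by linarith
      then show False using j(5)[of "j0 + W"] j0(3) assms(1) \<open>j = j0\<close> by auto
    qed
    ultimately have "k = 1" by linarith
    then show "n = i + W" using k by simp
  qed
qed

context
  fixes \<tau> :: "nat => nat set" and n :: nat
begin

abbreviation "sl i \<phi> \<equiv> ltlf_sat (trace_prefix \<tau> n) i \<phi>"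

lemma sl_edge: "i \<le> n ==> sl i edge \<longleftrightarrow> i = n" by (auto simp: edge_def prefix_nth(2))

lemma sl_next: "i \<le> n ==> sl i (LNext \<phi>) \<longleftrightarrow> Suc i \<le> n \<and> sl (Suc i) \<phi>" by (auto simp: prefix_nth(2))

lemma sl_ev: "sl i (ev \<phi>) \<longleftrightarrow> (\<exists>j. i \<le> j \<and> j \<le> n \<and> sl j \<phi>)" by (auto simp: ev_def prefix_nth(2))

lemma sl_nxt: "i \<le> n ==> sl i (nxt k \<phi>) \<longleftrightarrow> i + k \<le> n \<and> sl (i + k) \<phi>"
proof (induction k arbitrary: i)
  case (Suc k)
  have e: "nxt (Suc k) \<phi> = LNext (nxt k \<phi>)" by (simp add: nxt_def)
  show ?case unfolding e sl_next[OF Suc.prems] using Suc.IH[of "Suc i"] by (cases "Suc i \<le> n") simp_all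
qed (simp add: nxt_def)

lemma sl_cur: "i \<le> n ==> sl i (curf a) \<longleftrightarrow> a \<in> \<tau> n"
  unfolding curf_def sl_ev by (auto simp: sl_edge prefix_nth(1))

lemma sl_prv: "sl 0 (prvf a) \<longleftrightarrow> 0 < n \<and> a \<in> \<tau> (n - 1)"
proof -
  have "sl j (LAnd (LAtom a) (LNext edge)) \<longleftrightarrow> n = Suc j \<and> a \<in> \<tau> j" if "j \<le> n" for j
    using that sl_edge[of "Suc j"] by (auto simp: prefix_nth)
  then have "sl 0 (prvf a) \<longleftrightarrow> (\<exists>j. j \<le> n \<and> n = Suc j \<and> a \<in> \<tau> j)" unfolding prvf_def sl_ev by auto
  also have "\<dots> \<longleftrightarrow> 0 < n \<and> a \<in> \<tau> (n - 1)" by (cases n) auto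
  finally show ?thesis .
qed

lemma sl_abv:
  assumes bk: "\<And>n b. b < q ==> dyn c b \<in> \<tau> n \<longleftrightarrow> bt (int n) b" and P: "\<And>i. i \<le> n ==> sl i \<phi> \<longleftrightarrow> P i"
  shows "sl 0 (abvf c q \<phi>) \<longleftrightarrow> 2 ^ q \<le> n \<and> P (n - 2 ^ q)" "sl 0 (ev (LAnd edge (rowf c q))) \<longleftrightarrow> 2 ^ q dvd n"
proof -
  have row: "sl i (rowf c q) \<longleftrightarrow> 2 ^ q dvd i" if "i \<le> n" for i
  proof -
    have "sl i (rowf c q) \<longleftrightarrow> (\<forall>b<q. \<not> bt (int i) b)" unfolding rowf_def sem_li.S_cj ball_set_map using that bk by (auto simp: prefix_nth)
    also have "\<dots> \<longleftrightarrow> int (2 ^ q) dvd int i" unfolding bits_zero by simp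
    finally show ?thesis unfolding of_nat_dvd_iff .
  qed
  have eq: "sl i (eqf c q) \<longleftrightarrow> n mod 2 ^ q = i mod 2 ^ q" if i: "i \<le> n" for i
  proof -
    have "sl i (eqf c q) \<longleftrightarrow> (\<forall>b<q. bt (int n) b = bt (int i) b)"
      unfolding eqf_def sem_li.S_cj ball_set_map sem_li.S_iff sl_cur[OF i] using i bk by (auto simp: prefix_nth)
    also have "\<dots> \<longleftrightarrow> int (n mod 2 ^ q) = int (i mod 2 ^ q)" unfolding bits_eq by (simp add: zmod_int)
    finally show ?thesis unfolding of_nat_eq_iff .
  qed
  have one: "sl i (onef c q) \<longleftrightarrow> (\<exists>j. i < j \<and> j \<le> n \<and> 2 ^ q dvd j \<and> (\<forall>k. i < k \<and> k < j \<longrightarrow> \<not> 2 ^ q dvd k) \<and> \<not> (\<exists>k. j < k \<and> k \<le> n \<and> 2 ^ q dvd k))"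
    if i: "i \<le> n" for i
  proof -
    have l: "sl j (LNext (ev (rowf c q))) \<longleftrightarrow> (\<exists>k. j < k \<and> k \<le> n \<and> 2 ^ q dvd k)" if "j \<le> n" for j
      unfolding sl_next[OF that] sl_ev using row by (auto simp: Suc_le_eq)
    have u: "sl i' (LUntil \<phi> \<psi>) \<longleftrightarrow> (\<exists>j. i' \<le> j \<and> j \<le> n \<and> sl j \<psi> \<and> (\<forall>k. i' \<le> k \<and> k < j \<longrightarrow> sl k \<phi>))" for i' \<phi> \<psi>
      by (auto simp: prefix_nth(2))
    have 1: "sl j (LAnd (rowf c q) (LNot (LNext (ev (rowf c q))))) \<longleftrightarrow> 2 ^ q dvd j \<and> \<not> (\<exists>k. j < k \<and> k \<le> n \<and> 2 ^ q dvd k)" if "j \<le> n" for j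
      unfolding sem_li.S_bool row[OF that] l[OF that] ..
    have 2: "(\<forall>k. Suc i \<le> k \<and> k < j \<longrightarrow> sl k (LNot (rowf c q))) \<longleftrightarrow> (\<forall>k. i < k \<and> k < j \<longrightarrow> \<not> 2 ^ q dvd k)" if j: "j \<le> n" for j
    proof -
      have "sl k (LNot (rowf c q)) \<longleftrightarrow> \<not> 2 ^ q dvd k" if "k < j" for k using row[of k] that j by simp
      then show ?thesis unfolding Suc_le_eq by blast
    qed
    have "sl i (onef c q) \<longleftrightarrow> Suc i \<le> n \<and> (\<exists>j. Suc i \<le> j \<and> j \<le> n \<and> (2 ^ q dvd j \<and> \<not> (\<exists>k. j < k \<and> k \<le> n \<and> 2 ^ q dvd k)) \<and>
        (\<forall>k. i < k \<and> k < j \<longrightarrow> \<not> 2 ^ q dvd k))"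
      unfolding onef_def sl_next[OF i] u by (intro arg_cong2[where f = "(\<and>)"] ex_cong1 conj_cong refl 1 2)
    then show ?thesis unfolding Suc_le_eq by (blast intro: less_le_trans)
  qed
  have "sl i (LAnd (eqf c q) (onef c q)) \<longleftrightarrow> n = i + 2 ^ q" if i: "i \<le> n" for i
    using eq[OF i] one[OF i] unique_multiple[of "2 ^ q" n i] i by auto
  then have "sl 0 (abvf c q \<phi>) \<longleftrightarrow> (\<exists>i. i \<le> n \<and> P i \<and> n = i + 2 ^ q)"
    unfolding abvf_def sl_ev using P by (auto simp del: ltlf_sat.simps simp: sem_li.S_bool)
  also have "\<dots> \<longleftrightarrow> 2 ^ q \<le> n \<and> P (n - 2 ^ q)" by (auto intro!: exI[of _ "n - 2 ^ q"])
  finally show "sl 0 (abvf c q \<phi>) \<longleftrightarrow> 2 ^ q \<le> n \<and> P (n - 2 ^ q)" .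
  show "sl 0 (ev (LAnd edge (rowf c q))) \<longleftrightarrow> 2 ^ q dvd n"
    unfolding sl_ev sem_li.S_bool using row sl_edge by auto
qed

lemma sl_cnt:
  "sl 0 (cntf c q) \<longleftrightarrow> (\<forall>b<q. if n = 0 then dyn c b \<notin> \<tau> n else ((dyn c b \<in> \<tau> n) \<noteq> (dyn c b \<in> \<tau> (n - 1))) \<longleftrightarrow>
     b = 0 \<or> (dyn c (b - 1) \<in> \<tau> (n - 1) \<and> dyn c (b - 1) \<notin> \<tau> n))"
proof -
  have e: "sl 0 edge \<longleftrightarrow> n = 0" using sl_edge[of 0] by auto
  have g: "sl 0 (LOr (LAnd edge (LNot (curf (dyn c b)))) (LAnd (LNot edge) (iff (iff (curf (dyn c b)) (prvf (dyn c b)))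
     (LNot (if b = 0 then ff_tt else LAnd (prvf (dyn c (b - 1))) (LNot (curf (dyn c (b - 1))))))))) \<longleftrightarrow>
     (if n = 0 then dyn c b \<notin> \<tau> n else ((dyn c b \<in> \<tau> n) \<noteq> (dyn c b \<in> \<tau> (n - 1))) \<longleftrightarrow>
     b = 0 \<or> (dyn c (b - 1) \<in> \<tau> (n - 1) \<and> dyn c (b - 1) \<notin> \<tau> n))" for b
    using sl_cur[of 0] sl_prv e by (simp del: ltlf_sat.simps add: sem_li.S_bool sem_li.S_iff sem_li.S_tt) blast
  show ?thesis unfolding cntf_def sem_li.S_cj ball_set_map g by (simp only: Ball_def set_upt atLeastLessThan_iff le0 simp_thms)
qed

lemma sp_nxt: "i \<le> n ==> ppltl_sat (trace_prefix \<tau> n) i (mir (nxt k \<phi>)) \<longleftrightarrow> k \<le> i \<and> ppltl_sat (trace_prefix \<tau> n) (i - k) (mir \<phi>)"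
proof (induction k arbitrary: i)
  case (Suc k)
  then show ?case using Suc.IH[of "i - 1"] by (cases i) (auto simp: nxt_def)
qed (simp add: nxt_def)

lemma sp_edge: "ppltl_sat (trace_prefix \<tau> n) i (mir edge) \<longleftrightarrow> i = 0"
  using sem_pi.S_tt by (auto simp: edge_def)

end

text \<open>The formula is imposed on all prefixes, so the counter is fixed by induction on the
  position; only after that does \<open>abvf\<close> have its intended meaning.\<close>

lemma form_l_sat:
  assumes t: "2 ^ q > length w"
  shows "(\<forall>n. ltlf_sat (trace_prefix \<tau> n) 0 (form_l c Rs q w)) \<longleftrightarrow>
    (\<forall>n. \<forall>b<q. dyn c b \<in> \<tau> n \<longleftrightarrow> bt (int n) b) \<and> (\<forall>n. nbh Rs (2 ^ q) w n (%i. \<tau> i \<inter> {..<c}))"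
proof -
  have 1: "(\<forall>n. ltlf_sat (trace_prefix \<tau> n) 0 (cntf c q)) \<longleftrightarrow> (\<forall>n. \<forall>b<q. dyn c b \<in> \<tau> n \<longleftrightarrow> bt (int n) b)"
  proof
    assume a: "\<forall>n. ltlf_sat (trace_prefix \<tau> n) 0 (cntf c q)"
    have "\<forall>b<q. dyn c b \<in> \<tau> n \<longleftrightarrow> bt (int n) b" for n
    proof (induction n)
      case 0 show ?case using a[rule_format, of 0] unfolding sl_cnt by simp
    next
      case (Suc n)
      have "(\<forall>b<q. (dyn c b \<in> \<tau> n) = bt (int n) b) \<longleftrightarrow> (\<forall>b<q. (dyn c b \<in> \<tau> (Suc n)) = bt (int n + 1) b)"
        by (rule bits_inc) (use a[rule_format, of "Suc n"] in \<open>simp add: sl_cnt\<close>)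
      then show ?case using Suc by (simp add: add.commute)
    qed
    then show "\<forall>n. \<forall>b<q. dyn c b \<in> \<tau> n \<longleftrightarrow> bt (int n) b" by blast
  next
    assume a: "\<forall>n. \<forall>b<q. dyn c b \<in> \<tau> n \<longleftrightarrow> bt (int n) b"
    show "\<forall>n. ltlf_sat (trace_prefix \<tau> n) 0 (cntf c q)"
    proof
      fix n
      show "ltlf_sat (trace_prefix \<tau> n) 0 (cntf c q)"
      proof (cases n)
        case 0 then show ?thesis unfolding sl_cnt using a by simp
      next
        case (Suc m)
        have "int m + 1 = int (Suc m)" by simp
        then show ?thesis unfolding sl_cnt Suc using a bt_succ[of "int m"] by (simp del: of_nat_Suc) (metis \<open>int m + 1 = int (Suc m)\<close>)
      qed
    qed
  qed
  have 2: "ltlf_sat (trace_prefix \<tau> n) 0 (cform c Rs (ev (LAnd edge (rowf c q))) edge prvf (abvf c q ff_tt) (%a. abvf c q (LAtom a)) (iniv w) curf) \<longleftrightarrow>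
      nbh Rs (2 ^ q) w n (%i. \<tau> i \<inter> {..<c})" if bk: "\<forall>n. \<forall>b<q. dyn c b \<in> \<tau> n \<longleftrightarrow> bt (int n) b" for n
    unfolding nbh_def
  proof (rule sem_l.S_cform)
    have bk': "\<And>n b. b < q ==> dyn c b \<in> \<tau> n \<longleftrightarrow> bt (int n) b" using bk by blast
    have at: "ltlf_sat (trace_prefix \<tau> n) i (LAtom a) \<longleftrightarrow> a \<in> \<tau> i" if "i \<le> n" for i a using that by (simp add: prefix_nth)
    have tt: "ltlf_sat (trace_prefix \<tau> n) i ff_tt \<longleftrightarrow> True" for i by simp
    show "ltlf_sat (trace_prefix \<tau> n) 0 (ev (LAnd edge (rowf c q))) \<longleftrightarrow> 2 ^ q dvd n" by (rule sl_abv(2)[OF bk' tt])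
    show "ltlf_sat (trace_prefix \<tau> n) 0 edge \<longleftrightarrow> (if n = 0 then None else Some (\<tau> (n - 1) \<inter> {..<c})) = None" using sl_edge[of 0 n \<tau>] by auto
    show "ltlf_sat (trace_prefix \<tau> n) 0 (abvf c q ff_tt) \<longleftrightarrow> (\<exists>A. (if n < 2 ^ q then Inl (lw w n) else Inr (\<tau> (n - 2 ^ q) \<inter> {..<c})) = Inr A)"
      using sl_abv(1)[OF bk' tt] by auto
    fix a assume a: "a < c"
    show "(if n = 0 then None else Some (\<tau> (n - 1) \<inter> {..<c})) = Some A ==> ltlf_sat (trace_prefix \<tau> n) 0 (prvf a) \<longleftrightarrow> a \<in> A" for A
      using a by (auto simp: sl_prv split: if_splits)
    show "(if n < 2 ^ q then Inl (lw w n) else Inr (\<tau> (n - 2 ^ q) \<inter> {..<c})) = Inr A ==> ltlf_sat (trace_prefix \<tau> n) 0 (abvf c q (LAtom a)) \<longleftrightarrow> a \<in> A" for A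
      using a sl_abv(1)[OF bk' at] by (auto split: if_splits)
    show "ltlf_sat (trace_prefix \<tau> n) 0 (curf a) \<longleftrightarrow> a \<in> \<tau> n \<inter> {..<c}" using a by (simp add: sl_cur)
  next
    have k: "ltlf_sat (trace_prefix \<tau> n) 0 (nxt k edge) \<longleftrightarrow> k = n" for k using sl_nxt[of 0 n \<tau> k edge] sl_edge[of k n \<tau>] by auto
    show "(if n < 2 ^ q then Inl (lw w n) else Inr (\<tau> (n - 2 ^ q) \<inter> {..<c})) = Inl v ==> v' < 3 ==> ltlf_sat (trace_prefix \<tau> n) 0 (iniv w v') \<longleftrightarrow> v' = v" for v v'
      using sem_l.S_iniv[OF k] by (auto split: if_splits)
  qed (auto split: if_splits simp: lw_3)
  show ?thesis unfolding form_l_def ltlf_sat.simps using 1 2 by blast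
qed

lemma form_p_sat:
  assumes t: "W > length w"
  shows "(\<forall>n. ppltl_sat (trace_prefix \<tau> n) (length (trace_prefix \<tau> n) - 1) (mir (form_p c Rs W w))) \<longleftrightarrow>
    (\<forall>n. \<forall>b<1. dyn c b \<in> \<tau> n \<longleftrightarrow> W dvd n) \<and> (\<forall>n. nbh Rs W w n (%i. \<tau> i \<inter> {..<c}))"
proof -
  have len: "length (trace_prefix \<tau> n) - 1 = n" for n by (simp add: prefix_nth)
  have at: "ppltl_sat (trace_prefix \<tau> n) i (mir (LAtom a)) \<longleftrightarrow> a \<in> \<tau> i" if "i \<le> n" for i a n using that by (simp add: prefix_nth)
  have nx: "ppltl_sat (trace_prefix \<tau> n) n (mir (nxt W (LAtom a))) \<longleftrightarrow> W \<le> n \<and> a \<in> \<tau> (n - W)" for n a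
    using sp_nxt[OF order_refl] at by simp
  have b: "ppltl_sat (trace_prefix \<tau> n) n (mir (iff (LAtom (dyn c 0)) (LOr edge (nxt W (LAtom (dyn c 0)))))) \<longleftrightarrow>
      (dyn c 0 \<in> \<tau> n \<longleftrightarrow> n = 0 \<or> (W \<le> n \<and> dyn c 0 \<in> \<tau> (n - W)))" for n
    unfolding sem_pi.S_iff sem_pi.S_bool at[OF order_refl] sp_edge nx ..
  have 1: "(\<forall>n. dyn c 0 \<in> \<tau> n \<longleftrightarrow> n = 0 \<or> (W \<le> n \<and> dyn c 0 \<in> \<tau> (n - W))) \<longleftrightarrow> (\<forall>n. \<forall>b<1. dyn c b \<in> \<tau> n \<longleftrightarrow> W dvd n)"
  proof -
    have d: "W dvd n \<longleftrightarrow> n = 0 \<or> (W \<le> n \<and> W dvd (n - W))" for n using dvd_imp_le[of W n] dvd_minus_self[of W n] by (auto simp: not_less)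
    have "dyn c 0 \<in> \<tau> n \<longleftrightarrow> W dvd n" if a: "\<forall>n. dyn c 0 \<in> \<tau> n \<longleftrightarrow> n = 0 \<or> (W \<le> n \<and> dyn c 0 \<in> \<tau> (n - W))" for n
    proof (induction n rule: less_induct)
      case (less n)
      have "n \<noteq> 0 ==> W \<le> n ==> dyn c 0 \<in> \<tau> (n - W) \<longleftrightarrow> W dvd (n - W)" using t by (intro less) auto
      then show ?case using a[rule_format, of n] d[of n] by (cases "n = 0"; cases "W \<le> n") simp_all
    qed
    then have i1: "\<forall>n. dyn c 0 \<in> \<tau> n \<longleftrightarrow> W dvd n" if "\<forall>n. dyn c 0 \<in> \<tau> n \<longleftrightarrow> n = 0 \<or> (W \<le> n \<and> dyn c 0 \<in> \<tau> (n - W))"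
      using that by (intro allI)
    have i2: "\<forall>n. dyn c 0 \<in> \<tau> n \<longleftrightarrow> n = 0 \<or> (W \<le> n \<and> dyn c 0 \<in> \<tau> (n - W))" if h: "\<forall>n. dyn c 0 \<in> \<tau> n \<longleftrightarrow> W dvd n"
      unfolding h[rule_format] by (intro allI) (rule d)
    have q: "(\<forall>b<1. Q b) \<longleftrightarrow> Q 0" for Q :: "nat => bool" by simp
    show ?thesis unfolding q by (rule iffI) (erule i1, erule i2)
  qed
  have 2: "ppltl_sat (trace_prefix \<tau> n) (length (trace_prefix \<tau> n) - 1) (mir (cform c Rs (LAtom (dyn c 0)) edge (%a. LNext (LAtom a)) (nxt W ff_tt) (%a. nxt W (LAtom a)) (iniv w) LAtom)) \<longleftrightarrow>
      nbh Rs W w n (%i. \<tau> i \<inter> {..<c})" if bk: "\<forall>n. \<forall>b<1. dyn c b \<in> \<tau> n \<longleftrightarrow> W dvd n" for n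
    unfolding nbh_def
  proof (rule sem_p.S_cform, unfold len)
    show "ppltl_sat (trace_prefix \<tau> n) n (mir (LAtom (dyn c 0))) \<longleftrightarrow> W dvd n" using at bk by simp
    show "ppltl_sat (trace_prefix \<tau> n) n (mir edge) \<longleftrightarrow> (if n = 0 then None else Some (\<tau> (n - 1) \<inter> {..<c})) = None" unfolding sp_edge by auto
    show "ppltl_sat (trace_prefix \<tau> n) n (mir (nxt W ff_tt)) \<longleftrightarrow> (\<exists>A. (if n < W then Inl (lw w n) else Inr (\<tau> (n - W) \<inter> {..<c})) = Inr A)"
      unfolding sp_nxt[OF order_refl] using sem_pi.S_tt by auto
    fix a assume a: "a < c"
    show "(if n = 0 then None else Some (\<tau> (n - 1) \<inter> {..<c})) = Some A ==> ppltl_sat (trace_prefix \<tau> n) n (mir (LNext (LAtom a))) \<longleftrightarrow> a \<in> A" for A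
      using a by (auto simp: prefix_nth split: if_splits)
    show "(if n < W then Inl (lw w n) else Inr (\<tau> (n - W) \<inter> {..<c})) = Inr A ==> ppltl_sat (trace_prefix \<tau> n) n (mir (nxt W (LAtom a))) \<longleftrightarrow> a \<in> A" for A
      using a nx by (auto split: if_splits)
    show "ppltl_sat (trace_prefix \<tau> n) n (mir (LAtom a)) \<longleftrightarrow> a \<in> \<tau> n \<inter> {..<c}" using a at by simp
  next
    have k: "ppltl_sat (trace_prefix \<tau> n) (length (trace_prefix \<tau> n) - 1) (mir (nxt k edge)) \<longleftrightarrow> k = n" for k unfolding len sp_nxt[OF order_refl] sp_edge by auto
    show "(if n < W then Inl (lw w n) else Inr (\<tau> (n - W) \<inter> {..<c})) = Inl v ==> v' < 3 ==> ppltl_sat (trace_prefix \<tau> n) n (mir (iniv w v')) \<longleftrightarrow> v' = v" for v v'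
      using sem_p.S_iniv[OF k, unfolded len] by (auto split: if_splits)
  qed (auto split: if_splits simp: lw_3)
  let ?B = "iff (LAtom (dyn c 0)) (LOr edge (nxt W (LAtom (dyn c 0))))"
  let ?C = "cform c Rs (LAtom (dyn c 0)) edge (%a. LNext (LAtom a)) (nxt W ff_tt) (%a. nxt W (LAtom a)) (iniv w) LAtom"
  have "(\<forall>n. ppltl_sat (trace_prefix \<tau> n) n (mir (form_p c Rs W w))) \<longleftrightarrow>
      (\<forall>n. ppltl_sat (trace_prefix \<tau> n) n (mir ?B)) \<and> (\<forall>n. ppltl_sat (trace_prefix \<tau> n) n (mir ?C))"
    unfolding form_p_def sem_pi.S_bool by (rule all_conj_distrib)
  also have "(\<forall>n. ppltl_sat (trace_prefix \<tau> n) n (mir ?B)) \<longleftrightarrow> (\<forall>n. \<forall>b<1. dyn c b \<in> \<tau> n \<longleftrightarrow> W dvd n)" unfolding b by (rule 1)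
  also have "(\<forall>n. \<forall>b<1. dyn c b \<in> \<tau> n \<longleftrightarrow> W dvd n) \<and> (\<forall>n. ppltl_sat (trace_prefix \<tau> n) n (mir ?C)) \<longleftrightarrow>
      (\<forall>n. \<forall>b<1. dyn c b \<in> \<tau> n \<longleftrightarrow> W dvd n) \<and> (\<forall>n. nbh Rs W w n (%i. \<tau> i \<inter> {..<c}))"
    by (intro conj_cong refl) (simp only: 2[unfolded len])
  finally show ?thesis unfolding len .
qed

subsection \<open>Computing the formulas\<close>

text \<open>Formulas are not made an instance of \<open>data\<close>: the reduction only has to
  produce their codes.\<close>

definition E :: "('a::data => nat ltlf) => bool" where "E \<phi> \<longleftrightarrow> fp (%x. enc_ltlf (\<phi> x))"

named_theorems Ei

lemma E_const [Ei]: "E (%x. \<phi>)" unfolding E_def by (intro fpi)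

lemma E_bool [Ei]:
  assumes "E \<phi>"
  shows "E (%x. LNot (\<phi> x))" "E (%x. LNext (\<phi> x))"
    "E \<psi> ==> E (%x. LOr (\<phi> x) (\<psi> x))" "E \<psi> ==> E (%x. LAnd (\<phi> x) (\<psi> x))" "E \<psi> ==> E (%x. LUntil (\<phi> x) (\<psi> x))"
proof -
  have a: "fp (%x. enc_ltlf (\<phi> x))" using assms unfolding E_def .
  show "E (%x. LNot (\<phi> x))" "E (%x. LNext (\<phi> x))" unfolding E_def enc_ltlf.simps by (intro fp_append fp_const a)+
  show "E \<psi> ==> E (%x. LOr (\<phi> x) (\<psi> x))" unfolding E_def enc_ltlf.simps by (intro fp_append fp_const a)
  show "E \<psi> ==> E (%x. LAnd (\<phi> x) (\<psi> x))" unfolding E_def enc_ltlf.simps by (intro fp_append fp_const a)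
  show "E \<psi> ==> E (%x. LUntil (\<phi> x) (\<psi> x))" unfolding E_def enc_ltlf.simps by (intro fp_append fp_const a)
qed

lemma E_if [Ei]: "fp p ==> E \<phi> ==> E \<psi> ==> E (%x. if p x then \<phi> x else \<psi> x)"
  unfolding E_def if_distrib[of enc_ltlf] by (rule fp_if)

lemma E_iff [Ei]: "E \<phi> ==> E \<psi> ==> E (%x. iff (\<phi> x) (\<psi> x))" unfolding iff_def by (intro Ei)

lemma enc_cj: "enc_ltlf (cj (map g l)) = concat (map (%b. [False, True, True] @ enc_ltlf (g b)) l) @ enc_ltlf ff_tt"
  "enc_ltlf (dj (map g l)) = concat (map (%b. [False, True, False] @ enc_ltlf (g b)) l) @ enc_ltlf (LNot ff_tt)"
  by (induction l) (simp_all add: cj_def dj_def)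

lemma E_cj [Ei]: "fp xs ==> E (%z. G (fst z) (snd z)) ==> E (%x. cj (map (%b. G x b) (xs x)))"
  "fp xs ==> E (%z. G (fst z) (snd z)) ==> E (%x. dj (map (%b. G x b) (xs x)))"
  for G :: "'a::data => 'b::data => nat ltlf"
  unfolding E_def enc_cj by (intro fp_append fp_concat fp_map fp_const; assumption)+

text \<open>The index list is a constant here, so every member may have its own program and the
  indices need no tree code.\<close>

lemma E_cj_const: "(\<And>a. a \<in> set l ==> E (%x. G x a)) ==> E (%x. cj (map (%a. G x a) l))"
  and E_dj_const: "(\<And>a. a \<in> set l ==> E (%x. G x a)) ==> E (%x. dj (map (%a. G x a) l))"
  by (induction l) (auto simp: cj_def dj_def intro!: Ei)

lemma E_nxt [Ei]: "fp k ==> E \<phi> ==> E (%x. nxt (k x) (\<phi> x))"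
proof -
  have "enc_ltlf (nxt k \<phi>) = concat (replicate k [True, False, False]) @ enc_ltlf \<phi>" for k \<phi> by (induction k) (auto simp: nxt_def)
  then show "fp k ==> E \<phi> ==> E (%x. nxt (k x) (\<phi> x))"
    unfolding E_def by (simp only:) (intro fp_append fp_concat fp_replicate fp_const; assumption)
qed

lemma fp_dyn: "fp b ==> fp (%x. enc_nat (dyn c (b x)))"
proof -
  have "enc_nat (2 ^ m) = concat (replicate m [True, False]) @ enc_nat 1" for m
    by (induction m) (simp_all add: enc_nat.simps[of "2 * _"])
  then have "enc_nat (dyn c b) = concat (replicate (c + b) [True, False]) @ enc_nat 1" for b unfolding dyn_def .
  then show "fp b ==> fp (%x. enc_nat (dyn c (b x)))"
    by (simp only:) (intro fp_append fp_concat fp_replicate fp_plus fp_const; assumption)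
qed

lemma E_dyn [Ei]: "fp b ==> E (%x. LAtom (dyn c (b x)))"
  unfolding E_def enc_ltlf.simps by (intro fp_append fp_const fp_dyn)

lemma E_ev [Ei]: "E \<phi> ==> E (%x. ev (\<phi> x))" unfolding ev_def by (intro Ei)

lemma E_cur [Ei]: "fp b ==> E (%x. curf (dyn c (b x)))" "fp b ==> E (%x. prvf (dyn c (b x)))"
  unfolding curf_def prvf_def by (intro Ei; assumption)+

lemma E_row [Ei]: "fp q ==> E (%x. rowf c (q x))" unfolding rowf_def by (intro Ei fpi)

lemma E_abv [Ei]: "fp q ==> E \<phi> ==> E (%x. abvf c (q x) (\<phi> x))"
  unfolding abvf_def eqf_def onef_def by (intro Ei fpi)

lemma E_cnt [Ei]: "fp q ==> E (%x. cntf c (q x))" unfolding cntf_def by (intro Ei fpi)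

lemma E_inif: "E (%w. inif w v)" unfolding inif_def by (intro Ei fpi)

lemma E_iniv: "E (%w. iniv w v)"
  by (cases "v = 0") (simp_all add: iniv_def, intro Ei E_inif, rule E_inif)

lemma E_lit: "(\<And>a. E (%x. f x a)) ==> E (%x. lit c (f x) A)"
  unfolding lit_def
proof (rule E_cj_const)
  show "E (%x. if a \<in> A then f x a else LNot (f x a))" if "\<And>a. E (%x. f x a)" for a
    using that by (cases "a \<in> A") (auto intro: Ei)
qed

lemma E_cform:
  assumes "E fst_row" "E fst_pos" "\<And>a. E (%x. fprv x a)" "E fex" "\<And>a. E (%x. fabv x a)" "\<And>v. E (%x. fini x v)" "\<And>a. E (%x. fcur x a)"
  shows "E (%x. cform c Rs (fst_row x) (fst_pos x) (fprv x) (fex x) (fabv x) (fini x) (fcur x))"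
  unfolding cform_def
proof (rule E_dj_const)
  fix y assume "y \<in> set (filter (%(s, p, a, u). Rs s p a u) (tuples c))"
  obtain s p a u where y: "y = (s, p, a, u)" by (cases y)
  have 1: "E (%x. if s then fst_row x else LNot (fst_row x))" using assms(1) by (cases s) (auto intro: Ei)
  have 2: "E (%x. case p of None => fst_pos x | Some A => LAnd (LNot (fst_pos x)) (lit c (fprv x) A))"
    using assms(2,3) by (cases p) (auto intro!: Ei E_lit)
  have 3: "E (%x. case a of Inl v => LAnd (LNot (fex x)) (fini x v) | Inr A => LAnd (fex x) (lit c (fabv x) A))"
    using assms(4,5,6) by (cases a) (auto intro!: Ei E_lit)
  have 4: "E (%x. lit c (fcur x) u)" by (rule E_lit) (rule assms(7))
  show "E (%x. case y of (s, p, a, u) => cj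
     [if s then fst_row x else LNot (fst_row x),
      case p of None => fst_pos x | Some A => LAnd (LNot (fst_pos x)) (lit c (fprv x) A),
      case a of Inl v => LAnd (LNot (fex x)) (fini x v) | Inr A => LAnd (fex x) (lit c (fabv x) A),
      lit c (fcur x) u])"
    unfolding y prod.case cj_def foldr.simps o_apply id_apply by (intro E_bool(4) E_const 1 2 3 4)
qed

lemma E_form_l: "fp q ==> E (%w. form_l c Rs (q w) w)"
  unfolding form_l_def by (intro Ei E_cform E_iniv)

lemma E_form_p: "fp W ==> E (%w. form_p c Rs (W w) w)"
  unfolding form_p_def by (intro Ei E_cform E_iniv)

lemma atoms_nxt: "atoms_ltlf (nxt k \<phi>) = atoms_ltlf \<phi>" by (induction k) (auto simp: nxt_def)

lemma atoms_iniv: "atoms_ltlf (iniv w v) \<subseteq> {0}"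
  by (auto simp: iniv_def inif_def atoms_nxt edge_def ff_tt_def split: if_splits)

lemma atoms_cform:
  assumes "atoms_ltlf fst_row \<subseteq> B" "atoms_ltlf fst_pos \<subseteq> B" "\<And>a. a < c ==> atoms_ltlf (fprv a) \<subseteq> B" "atoms_ltlf fex \<subseteq> B"
    "\<And>a. a < c ==> atoms_ltlf (fabv a) \<subseteq> B" "\<And>v. atoms_ltlf (fini v) \<subseteq> B" "\<And>a. a < c ==> atoms_ltlf (fcur a) \<subseteq> B" "0 \<in> B"
  shows "atoms_ltlf (cform c Rs fst_row fst_pos fprv fex fabv fini fcur) \<subseteq> B"
proof -
  have l: "atoms_ltlf (lit c f A) \<subseteq> B" if "\<And>a. a < c ==> atoms_ltlf (f a) \<subseteq> B" for f A
    using atoms_lit[of c f A] that assms(8) by blast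
  note l3 = l[of fprv, OF assms(3)] l[of fabv, OF assms(5)] l[of fcur, OF assms(7)]
  have 1: "atoms_ltlf (if s then fst_row else LNot fst_row) \<subseteq> B" for s using assms(1) by simp
  have 2: "atoms_ltlf (case p of None => fst_pos | Some A => LAnd (LNot fst_pos) (lit c fprv A)) \<subseteq> B" for p
    using assms(2) l3(1) by (cases p) auto
  have 3: "atoms_ltlf (case a of Inl v => LAnd (LNot fex) (fini v) | Inr A => LAnd fex (lit c fabv A)) \<subseteq> B" for a :: "nat + nat set"
    using assms(4,6) l3(2) by (cases a) auto
  have el: "atoms_ltlf (cj [x1, x2, x3, x4]) \<subseteq> B" if "atoms_ltlf x1 \<subseteq> B" "atoms_ltlf x2 \<subseteq> B" "atoms_ltlf x3 \<subseteq> B" "atoms_ltlf x4 \<subseteq> B" for x1 x2 x3 x4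
    using that assms(8) by simp
  show ?thesis unfolding cform_def atoms_cj(2)
  proof (intro insert_subsetI assms(8) UN_least, unfold set_map)
    fix \<phi> assume "\<phi> \<in> (%(s, p, a, u). cj [if s then fst_row else LNot fst_row,
      case p of None => fst_pos | Some A => LAnd (LNot fst_pos) (lit c fprv A),
      case a of Inl v => LAnd (LNot fex) (fini v) | Inr A => LAnd fex (lit c fabv A),
      lit c fcur u]) ` set (filter (%(s, p, a, u). Rs s p a u) (tuples c))"
    then obtain y where y: "\<phi> = (case y of (s, p, a, u) => cj [if s then fst_row else LNot fst_row,
      case p of None => fst_pos | Some A => LAnd (LNot fst_pos) (lit c fprv A),
      case a of Inl v => LAnd (LNot fex) (fini v) | Inr A => LAnd fex (lit c fabv A),
      lit c fcur u])" by (rule imageE)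
    obtain s p a u where "y = (s, p, a, u)" by (cases y)
    with y have "\<phi> = cj [if s then fst_row else LNot fst_row,
      case p of None => fst_pos | Some A => LAnd (LNot fst_pos) (lit c fprv A),
      case a of Inl v => LAnd (LNot fex) (fini v) | Inr A => LAnd fex (lit c fabv A),
      lit c fcur u]" by (simp only: prod.case)
    then show "atoms_ltlf \<phi> \<subseteq> B" by (simp only:) (intro el 1 2 3 l3(3))
  qed
qed

lemma atoms_form_l: "0 < c ==> atoms_ltlf (form_l c Rs q w) \<subseteq> {..<c} \<union> dyn c ` {..<q}"
proof -
  assume c: "0 < c"
  let ?B = "{..<c} \<union> dyn c ` {..<q}"
  have d: "b < q ==> dyn c b \<in> ?B" for b by auto
  have e: "atoms_ltlf edge \<subseteq> ?B" using c by (auto simp: edge_def ff_tt_def)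
  have cu: "a \<in> ?B ==> atoms_ltlf (curf a) \<subseteq> ?B" "a \<in> ?B ==> atoms_ltlf (prvf a) \<subseteq> ?B" for a
    using e c by (auto simp: curf_def prvf_def ev_def ff_tt_def)
  have r: "atoms_ltlf (rowf c q) \<subseteq> ?B" using c by (auto simp: rowf_def)
  have "atoms_ltlf (eqf c q) \<subseteq> ?B" unfolding eqf_def using cu(1)[OF d] c by (fastforce simp: iff_def)
  moreover have "atoms_ltlf (onef c q) \<subseteq> ?B" unfolding onef_def ev_def using r c by (auto simp: ff_tt_def)
  ultimately have ab: "atoms_ltlf \<phi> \<subseteq> ?B ==> atoms_ltlf (abvf c q \<phi>) \<subseteq> ?B" for \<phi>
    using c by (auto simp: abvf_def ev_def ff_tt_def)
  have cn: "atoms_ltlf (cntf c q) \<subseteq> ?B"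
  proof -
    have "atoms_ltlf (LOr (LAnd edge (LNot (curf (dyn c b)))) (LAnd (LNot edge) (iff (iff (curf (dyn c b)) (prvf (dyn c b)))
       (LNot (if b = 0 then ff_tt else LAnd (prvf (dyn c (b - 1))) (LNot (curf (dyn c (b - 1))))))))) \<subseteq> ?B" if "b < q" for b
    proof -
      have b': "b - 1 < q" using that by simp
      have "atoms_ltlf ff_tt \<subseteq> ?B" using c by (simp add: ff_tt_def)
      then show ?thesis using e cu[OF d[OF that]] cu[OF d[OF b']] by (simp add: iff_def)
    qed
    then show ?thesis unfolding cntf_def atoms_cj using c
      by (intro insert_subsetI UN_least, simp, unfold set_map set_upt, elim imageE) (simp only: atLeastLessThan_iff)
  qed
  have "atoms_ltlf (cform c Rs (ev (LAnd edge (rowf c q))) edge prvf (abvf c q ff_tt) (%a. abvf c q (LAtom a)) (iniv w) curf) \<subseteq> ?B"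
  proof (rule atoms_cform)
    show "atoms_ltlf (ev (LAnd edge (rowf c q))) \<subseteq> ?B" using e r c by (simp add: ev_def ff_tt_def)
    show "atoms_ltlf (iniv w v) \<subseteq> ?B" for v using atoms_iniv[of w v] c by auto
    show "atoms_ltlf (abvf c q ff_tt) \<subseteq> ?B" using c by (intro ab) (simp add: ff_tt_def)
    show "a < c ==> atoms_ltlf (abvf c q (LAtom a)) \<subseteq> ?B" for a by (intro ab) auto
  qed (use e c in \<open>auto intro!: cu\<close>)
  then show ?thesis using cn by (simp add: form_l_def)
qed

lemma atoms_form_p: "0 < c ==> atoms_ltlf (form_p c Rs W w) \<subseteq> {..<c} \<union> dyn c ` {..<1}"
proof -
  assume c: "0 < c"
  let ?B = "{..<c} \<union> dyn c ` {..<1}"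
  have e: "atoms_ltlf edge \<subseteq> ?B" using c by (auto simp: edge_def ff_tt_def)
  have "atoms_ltlf (cform c Rs (LAtom (dyn c 0)) edge (%a. LNext (LAtom a)) (nxt W ff_tt) (%a. nxt W (LAtom a)) (iniv w) LAtom) \<subseteq> ?B"
  proof (rule atoms_cform)
    show "atoms_ltlf (iniv w v) \<subseteq> ?B" for v using atoms_iniv[of w v] c by auto
  qed (use e c in \<open>auto simp: atoms_nxt ff_tt_def\<close>)
  then show ?thesis using e by (simp add: form_p_def iff_def atoms_nxt)
qed

lemma fp_poly: "fp n ==> fp (%x. poly p (n x) :: nat)"
  by (induction p) (auto intro: fpi)

lemma fp_poly_time: "fp g ==> poly_time_computable g"
proof -
  assume "fp g"
  then have g: "fpon UNIV sz g" unfolding fp_def .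
  obtain k where k: "\<forall>F R. (\<forall>w :: bool list. (sz w + 2) ^ k \<le> F (length w)) \<longrightarrow> (\<forall>w. R w (g w)) \<longrightarrow> solvable_in_time F R"
    using fpon_solvable[OF g order_refl] by blast
  have "(sz w + 2) ^ k \<le> poly ([:3, 4:] ^ k) (length w)" for w :: "bool list"
    unfolding poly_power using sz_bools[of w] by (intro power_mono) auto
  then show ?thesis unfolding poly_time_computable_def using k[rule_format, of "poly ([:3, 4:] ^ k)" "%w v. v = g w"] by blast
qed

subsection \<open>Runs of Turing machines\<close>

definition mvi :: "move => int" where "mvi m = (case m of MLeft => -1 | MStay => 0 | MRight => 1)"
text \<open>A total transition function: a halted machine rewrites the scanned symbols and stays, so
  its run continues for ever with the same configuration.\<close>

definition tdl :: "tm => nat => nat list => nat \<times> (nat \<times> int) list" where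
  "tdl M q ss = (case delta M q ss of None => (q, map (%s. (s, 0)) ss) | Some (q', as) => (q', map (%(s, m). (s, mvi m)) as))"
definition conf :: "tm => bool list => nat => config" where "conf M w t = (tm_step M ^^ t) (tm_init M w)"

lemma conf_wf:
  assumes "tm_wf M"
  shows "fst (conf M w t) < num_states M \<and> length (snd (conf M w t)) = num_tapes M \<and>
    (\<forall>j<num_tapes M. \<forall>P. fst (snd (conf M w t) ! j) P < num_symbols M)"
proof (induction t)
  case 0
  have "num_tapes M \<ge> 1" "num_states M \<ge> 1" "num_symbols M \<ge> 3" using assms by (auto simp: tm_wf_def)
  then show ?case by (auto simp: conf_def tm_init_def word_cells_def nth_Cons split: nat.splits)
next
  case (Suc t)
  obtain q tp where C: "conf M w t = (q, tp)" by (cases "conf M w t")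
  have S: "conf M w (Suc t) = tm_step M (q, tp)" using C by (simp add: conf_def)
  have h: "q < num_states M" "length tp = num_tapes M" "\<forall>j<num_tapes M. \<forall>P. fst (tp ! j) P < num_symbols M" using Suc C by auto
  have sy: "\<forall>s\<in>set (map head_symbol tp). s < num_symbols M"
  proof
    fix s assume "s \<in> set (map head_symbol tp)"
    then obtain j where "j < length tp" "s = head_symbol (tp ! j)" by (auto simp: in_set_conv_nth)
    then show "s < num_symbols M" using h(2,3) by (simp add: head_symbol_def case_prod_beta)
  qed
  show ?case
  proof (cases "delta M q (map head_symbol tp)")
    case None then show ?thesis using h by (simp add: S tm_step_def)
  next
    case (Some r)
    obtain q' as where r: "r = (q', as)" by (cases r)
    then have w: "q' < num_states M" "length as = num_tapes M" "\<forall>(s, m)\<in>set as. s < num_symbols M"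
    proof -
      have "length (map head_symbol tp) = num_tapes M" using h(2) by simp
      then have "q' < num_states M \<and> length as = num_tapes M \<and> (\<forall>(s, m)\<in>set as. s < num_symbols M)"
        using assms h(1) sy Some[unfolded r] unfolding tm_wf_def by blast
      then show "q' < num_states M" "length as = num_tapes M" "\<forall>(s, m)\<in>set as. s < num_symbols M" by blast+
    qed
    have "fst (tape_act (as ! j) (tp ! j)) P < num_symbols M" if "j < num_tapes M" for j P
    proof -
      have "fst (as ! j) < num_symbols M" using w(2,3) that nth_mem[of j as] by (auto simp: case_prod_beta)
      then show ?thesis using h(3) that by (simp add: tape_act_def case_prod_beta)
    qed
    then show ?thesis using w(1,2) h(2) Some by (simp add: S tm_step_def r)
  qed
qed

lemma conf_symbols:
  assumes M: "tm_wf M" and C: "conf M w t = (q, tp)"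
  shows "q < num_states M" "length (map head_symbol tp) = num_tapes M" "\<forall>s\<in>set (map head_symbol tp). s < num_symbols M"
proof -
  have h: "q < num_states M" "length tp = num_tapes M" "\<forall>j<num_tapes M. \<forall>P. fst (tp ! j) P < num_symbols M" using conf_wf[OF M, of w t] C by auto
  show "q < num_states M" "length (map head_symbol tp) = num_tapes M" using h by simp_all
  have "s < num_symbols M" if s: "s \<in> set (map head_symbol tp)" for s
  proof -
    obtain j where "j < length tp" "s = head_symbol (tp ! j)" using s by (auto simp: in_set_conv_nth)
    then show ?thesis using h(2,3) by (simp add: head_symbol_def case_prod_beta)
  qed
  then show "\<forall>s\<in>set (map head_symbol tp). s < num_symbols M" by blast
qed

lemma conf_halted: "halted M (conf M w t) ==> conf M w (t + k) = conf M w t"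
proof (induction k)
  case (Suc k)
  then show ?case by (auto simp: conf_def halted_def tm_step_def split: prod.splits)
qed simp

lemma sv_conf:
  assumes M: "tm_wf M"
  shows "map (%j. fst (snd (conf M w t) ! j) (snd (snd (conf M w t) ! j))) [0..<num_tapes M] = map head_symbol (snd (conf M w t))"
  by (rule nth_equalityI) (use conf_wf[OF M, of w t] in \<open>auto simp: head_symbol_def case_prod_beta\<close>)

lemma msys_tm:
  assumes M: "tm_wf M" and W: "length w < W"
  shows "msys (num_tapes M) (num_states M) (num_symbols M) (tdl M) (%t. fst (conf M w t)) (%j t. snd (snd (conf M w t) ! j))
    (%j P t. fst (snd (conf M w t) ! j) P) (lw w) W (length w)"
proof -
  let ?L = "num_tapes M"
  note svc = sv_conf[OF M]
  have st: "fst (conf M w (Suc t)) = fst (tdl M (fst (conf M w t)) (map head_symbol (snd (conf M w t)))) \<and>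
     (\<forall>j<?L. snd (snd (conf M w (Suc t)) ! j) = snd (snd (conf M w t) ! j) + snd (snd (tdl M (fst (conf M w t)) (map head_symbol (snd (conf M w t)))) ! j) \<and>
       (\<forall>P. fst (snd (conf M w (Suc t)) ! j) P = (if P = snd (snd (conf M w t) ! j) then fst (snd (tdl M (fst (conf M w t)) (map head_symbol (snd (conf M w t)))) ! j)
          else fst (snd (conf M w t) ! j) P)) \<and>
       snd (snd (tdl M (fst (conf M w t)) (map head_symbol (snd (conf M w t)))) ! j) \<in> {-1, 0, 1})" for t
  proof -
    obtain q tp where C: "conf M w t = (q, tp)" by (cases "conf M w t")
    have S: "conf M w (Suc t) = tm_step M (q, tp)" using C by (simp add: conf_def)
    have l: "length tp = ?L" "length (snd (conf M w (Suc t))) = ?L" using conf_wf[OF M, of w t] conf_wf[OF M, of w "Suc t"] C by auto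
    show ?thesis
    proof (cases "delta M q (map head_symbol tp)")
      case None then show ?thesis using l by (auto simp: S C tm_step_def tdl_def head_symbol_def split: prod.splits)
    next
      case (Some r)
      obtain q' as where r: "r = (q', as)" by (cases r)
      have la: "length as = ?L" using M conf_symbols[OF M C] Some[unfolded r] unfolding tm_wf_def by blast
      show ?thesis using l(1) la Some by (auto simp: S C tm_step_def tdl_def r tape_act_def head_pos_def mvi_def split: prod.splits move.splits)
    qed
  qed
  have L: "1 \<le> ?L" "3 \<le> num_symbols M" using M by (auto simp: tm_wf_def)
  have i: "snd (conf M w 0) = (word_cells w, 0) # replicate (?L - 1) (word_cells [], 0)" "fst (conf M w 0) = 0" by (simp_all add: conf_def tm_init_def)
  show ?thesis
  proof (unfold_locales, unfold svc)
    show "j < ?L ==> snd (snd (conf M w 0) ! j) = 0" for j by (auto simp: i nth_Cons split: nat.splits)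
    show "fst (snd (conf M w 0) ! 0) P = (if 0 \<le> P then lw w (nat P) else 0)" for P by (auto simp: i word_cells_def lw_def nat_less_iff)
    show "0 < j ==> j < ?L ==> fst (snd (conf M w 0) ! j) P = 0" for j P by (auto simp: i nth_Cons word_cells_def split: nat.splits)
  qed (use st L i W conf_wf[OF M, of w] in \<open>auto simp: lw_def\<close>)
qed

subsection \<open>The reduction\<close>

text \<open>Every letter of the environment must denote a choice: no atom keeps the followed cell,
  otherwise the least atom names a head.\<close>

definition chs :: "nat => nat set => nat option" where
  "chs K A = (if A - {..<K} = {} then None else Some (Min (A - {..<K}) - K))"

lemma chs_image: "chs K ` Pow {K..<K + l} = insert None (Some ` {..<l})"
proof
  show "chs K ` Pow {K..<K + l} \<subseteq> insert None (Some ` {..<l})"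
  proof (intro image_subsetI)
    fix A assume "A \<in> Pow {K..<K + l}"
    then have A: "A \<subseteq> {K..<K + l}" "A - {..<K} = A" by auto
    then have "finite A" by (meson finite_atLeastLessThan finite_subset)
    then have "A \<noteq> {} ==> Min A \<in> {K..<K + l}" using A(1) Min_in by blast
    then have "A \<noteq> {} ==> Min A - K < l" by auto
    then show "chs K A \<in> insert None (Some ` {..<l})" unfolding chs_def A(2) by auto
  qed
  show "insert None (Some ` {..<l}) \<subseteq> chs K ` Pow {K..<K + l}"
  proof (intro insert_subsetI image_subsetI)
    show "None \<in> chs K ` Pow {K..<K + l}" by (rule image_eqI[of _ _ "{}"]) (auto simp: chs_def)
    fix i assume "i \<in> {..<l}"
    moreover have "{K + i} - {..<K} = {K + i}" by auto
    ultimately show "Some i \<in> chs K ` Pow {K..<K + l}" by (intro image_eqI[of _ _ "{K + i}"]) (auto simp: chs_def)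
  qed
qed

text \<open>\<open>Min\<close> reads a tile off an arbitrary letter of the agent, so no separate
  condition has to demand one atom per letter; the rules check whatever tile results.\<close>

definition rset :: "(bool => (tile \<times> nat option) option => tile => tile => bool) => (nat => tile) => nat =>
    bool => nat set option => nat + nat set => nat set => bool" where
  "rset R f K s p a u \<longleftrightarrow> R s (map_option (%A. (f (Min (A \<inter> {..<K})), chs K A)) p)
     (case a of Inl v => ini v | Inr A => f (Min (A \<inter> {..<K}))) (f (Min (u \<inter> {..<K})))"

lemma (in msys) set_game:
  assumes f: "Tls L NQ NS = f ` {..<K}" and lw: "lt = lw w"
  shows "(\<exists>str. (\<forall>h. str h \<subseteq> {..<K}) \<and> (\<forall>\<eta>. (\<forall>i. \<eta> i \<subseteq> {K..<c}) \<longrightarrow> (\<forall>n. nbh (rset R f K) W w n (letter str \<eta>)))) \<longleftrightarrow>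
    (\<exists>str. gwin (Pow {K..<c}) (chs K) str)"
proof -
  have eq: "(\<forall>n. nbh (rset R f K) W w n (letter str \<eta>)) \<longleftrightarrow> okplay (%i. f (Min (str (map \<eta> [0..<i])))) (%i. chs K (\<eta> i))"
    if s: "\<And>h. str h \<subseteq> {..<K}" and e: "\<forall>i. \<eta> i \<subseteq> {K..<c}" for str and \<eta> :: "nat => nat set"
  proof -
    have 1: "letter str \<eta> i \<inter> {..<K} = str (map \<eta> [0..<i])" for i
    proof -
      have "\<eta> i \<inter> {..<K} = {}" using e[rule_format, of i] by auto
      then show ?thesis using s[of "map \<eta> [0..<i]"] by (auto simp: letter_def)
    qed
    have "letter str \<eta> i - {..<K} = \<eta> i - {..<K}" for i using s[of "map \<eta> [0..<i]"] by (auto simp: letter_def)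
    then have 2: "chs K (letter str \<eta> i) = chs K (\<eta> i)" for i by (simp add: chs_def)
    show ?thesis unfolding okplay_def nbh_def rset_def lw[symmetric]
    proof (intro all_cong1)
      fix n
      have a: "map_option (%A. (f (Min (A \<inter> {..<K})), chs K A)) (if n = 0 then None else Some (letter str \<eta> (n - 1))) =
        (if n = 0 then None else Some (f (Min (str (map \<eta> [0..<n - 1]))), chs K (\<eta> (n - 1))))" by (simp add: 1 2)
      have b: "(case if n < W then Inl (lt n) else Inr (letter str \<eta> (n - W)) of Inl v => ini v | Inr A => f (Min (A \<inter> {..<K}))) =
        (if n < W then ini (lt n) else f (Min (str (map \<eta> [0..<n - W]))))" by (simp add: 1)
      show "R (W dvd n) (map_option (%A. (f (Min (A \<inter> {..<K})), chs K A)) (if n = 0 then None else Some (letter str \<eta> (n - 1))))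
          (case if n < W then Inl (lt n) else Inr (letter str \<eta> (n - W)) of Inl v => ini v | Inr A => f (Min (A \<inter> {..<K})))
          (f (Min (letter str \<eta> n \<inter> {..<K}))) \<longleftrightarrow>
        R (W dvd n) (if n = 0 then None else Some (f (Min (str (map \<eta> [0..<n - 1]))), chs K (\<eta> (n - 1))))
          (if n < W then ini (lt n) else f (Min (str (map \<eta> [0..<n - W])))) (f (Min (str (map \<eta> [0..<n]))))"
        unfolding a b 1 ..
    qed
  qed
  show ?thesis
  proof
    assume "\<exists>str. (\<forall>h. str h \<subseteq> {..<K}) \<and> (\<forall>\<eta>. (\<forall>i. \<eta> i \<subseteq> {K..<c}) \<longrightarrow> (\<forall>n. nbh (rset R f K) W w n (letter str \<eta>)))"
    then obtain str where s: "\<And>h. str h \<subseteq> {..<K}" "\<And>\<eta>. (\<forall>i. \<eta> i \<subseteq> {K..<c}) ==> (\<forall>n. nbh (rset R f K) W w n (letter str \<eta>))" by blast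
    have "gwin (Pow {K..<c}) (chs K) (%h. f (Min (str h)))"
      unfolding gwin_def Pow_iff
    proof (intro allI impI)
      fix \<eta> :: "nat => nat set" assume e: "\<forall>i. \<eta> i \<subseteq> {K..<c}"
      show "okplay (%i. f (Min (str (map \<eta> [0..<i])))) (%i. chs K (\<eta> i))"
        by (rule iffD1[OF eq[OF s(1) e] s(2)[OF e]])
    qed
    then show "\<exists>str. gwin (Pow {K..<c}) (chs K) str" by blast
  next
    assume "\<exists>str. gwin (Pow {K..<c}) (chs K) str"
    then obtain str where g: "gwin (Pow {K..<c}) (chs K) str" by blast
    define code where "code \<theta> = (if \<theta> \<in> Tls L NQ NS then {SOME k. k < K \<and> f k = \<theta>} else {})" for \<theta>
    have sm: "(SOME k. k < K \<and> f k = \<theta>) < K \<and> f (SOME k. k < K \<and> f k = \<theta>) = \<theta>" if "\<theta> \<in> Tls L NQ NS" for \<theta>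
    proof (rule someI_ex)
      show "\<exists>k. k < K \<and> f k = \<theta>" using that unfolding f by auto
    qed
    have c1: "code \<theta> \<subseteq> {..<K}" for \<theta> using sm by (auto simp: code_def)
    have c2: "f (Min (code \<theta>)) = \<theta>" if "\<theta> \<in> Tls L NQ NS" for \<theta> using sm[OF that] that by (simp add: code_def)
    have "\<forall>n. nbh (rset R f K) W w n (letter (%h. code (str h)) \<eta>)" if e: "\<forall>i. \<eta> i \<subseteq> {K..<c}" for \<eta>
    proof -
      have ok: "okplay (%i. str (map \<eta> [0..<i])) (%i. chs K (\<eta> i))" using g e unfolding gwin_def Pow_iff by blast
      have "f (Min (code (str (map \<eta> [0..<i])))) = str (map \<eta> [0..<i])" for i by (rule c2) (rule okplay_Tl[OF ok])
      then show ?thesis using iffD2[OF eq[of "%h. code (str h)", OF c1 e]] ok by simp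
    qed
    then show "\<exists>str. (\<forall>h. str h \<subseteq> {..<K}) \<and> (\<forall>\<eta>. (\<forall>i. \<eta> i \<subseteq> {K..<c}) \<longrightarrow> (\<forall>n. nbh (rset R f K) W w n (letter str \<eta>)))"
      using c1 by (intro exI[of _ "%h. code (str h)"]) blast
  qed
qed

lemma poly_reducible_realizability:
  fixes lang :: "nat set => nat ltlf => nat set list set"
  assumes A: "decidable_in_time F A"
    and Wb: "\<And>w :: bool list. length w < Wf w" "\<And>w. F (length w) < 2 ^ (Wf w - 1)"
    and char: "\<And>c Rs w \<tau> AP. \<tau> \<in> inf_traces AP ==> (\<forall>n. trace_prefix \<tau> n \<in> lang AP (Fm c Rs w)) \<longleftrightarrow>
      (\<forall>n. \<forall>b<qf w. dyn c b \<in> \<tau> n \<longleftrightarrow> dv w b n) \<and> (\<forall>n. nbh Rs (Wf w) w n (%i. \<tau> i \<inter> {..<c}))"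
    and atoms: "\<And>c Rs w. 0 < c ==> atoms_ltlf (Fm c Rs w) \<subseteq> {..<c} \<union> dyn c ` {..<qf w}"
    and E: "\<And>c Rs. E (Fm c Rs)" and q: "fp qf"
  shows "poly_reducible A (realizable_words atoms_ltlf lang enc_ltlf)"
proof -
  obtain M where M: "tm_wf M" and comp: "\<And>w. tm_computes M (F (length w)) w [w \<in> A]"
    using A unfolding decidable_in_time_def solvable_in_time_def by blast
  let ?L = "num_tapes M" and ?T = "Tls (num_tapes M) (num_states M) (num_symbols M)"
  have L: "1 \<le> ?L" using M by (simp add: tm_wf_def)
  \<comment> \<open>One atom per tile. \<open>K\<close> and \<open>c\<close> depend on the machine
    only and are constants of the reduction.\<close>
  obtain K f where f: "?T = f ` {..<K :: nat}"
    using finite_imp_nat_seg_image_inj_on[OF finite_Tls] unfolding lessThan_def by blast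
  define hlt where "hlt q ss \<longleftrightarrow> delta M q ss = None" for q ss
  define Rs where "Rs = rset (mach.R ?L (tdl M) hlt ?T) f K"
  define c where "c = K + ?L"
  have c: "0 < c" "K \<le> c" using L by (simp_all add: c_def)
  define g where "g w = enc_inst enc_ltlf ([0..<K] @ map (dyn c) [0..<qf w], [K..<c], QAll (Fm c Rs w))" for w
  have "fp g"
  proof -
    have "enc_list enc_nat ([0..<K] @ map (dyn c) [0..<qf w]) = concat (map (%x. True # enc_nat x) [0..<K]) @
        concat (map (%b. True # enc_nat (dyn c b)) [0..<qf w]) @ [False]" for w
      by (simp add: enc_list_def comp_def)
    moreover have "fp (%w. (concat (map (%x. True # enc_nat x) [0..<K]) @ concat (map (%b. True # enc_nat (dyn c b)) [0..<qf w]) @ [False]) @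
        (enc_list enc_nat [K..<c] @ ([False, False, False] @ enc_ltlf (Fm c Rs w))))"
      by (intro fp_append fp_concat fp_map fp_upt q fp_Cons fp_dyn fp_snd fp_id fp_const E[unfolded E_def])
    ultimately show ?thesis unfolding g_def enc_inst_def enc_pair_def prod.case enc_plus.simps by simp
  qed
  moreover have "w \<in> A \<longleftrightarrow> g w \<in> realizable_words atoms_ltlf lang enc_ltlf" for w
  proof -
    let ?X = "{..<K} \<union> dyn c ` {..<qf w}" and ?Y = "{K..<c}"
    interpret msys ?L "num_states M" "num_symbols M" "tdl M" hlt "%t. fst (conf M w t)" "%j t. snd (snd (conf M w t) ! j)"
      "%j P t. fst (snd (conf M w t) ! j) P" "lw w" "Wf w" "length w"
      by (rule msys_tm[OF M Wb(1)])
    have sX: "set ([0..<K] @ map (dyn c) [0..<qf w]) = ?X" "set [K..<c] = ?Y" by auto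
    have XY: "?X \<inter> ?Y = {}" using c(2) dyn_ge(2)[of c] by auto
    have AP: "{..<c} \<union> dyn c ` {..<qf w} \<subseteq> ?X \<union> ?Y" by auto
    have "valid_inst atoms_ltlf ([0..<K] @ map (dyn c) [0..<qf w], [K..<c], QAll (Fm c Rs w))"
    proof -
      have "?X \<union> ?Y \<noteq> {}" using L by (auto simp: c_def)
      then show ?thesis unfolding valid_inst_def prod.case sX using XY atoms[OF c(1), of Rs w] AP by auto
    qed
    then have "g w \<in> realizable_words atoms_ltlf lang enc_ltlf \<longleftrightarrow> (\<exists>\<sigma>. wins ?X ?Y \<sigma> (plus_lang lang (?X \<union> ?Y) (QAll (Fm c Rs w))))"
      unfolding realizable_words_def g_def mem_Collect_eq
      using inj_enc_inst[OF prefix_code_enc_ltlf] by (fastforce simp only: inst_wins_def prod.case sX dest: injD)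
    also have "\<dots> \<longleftrightarrow> (\<exists>str. (\<forall>h. str h \<subseteq> {..<K}) \<and> (\<forall>\<eta>. (\<forall>i. \<eta> i \<subseteq> ?Y) \<longrightarrow> (\<forall>n. nbh Rs (Wf w) w n (letter str \<eta>))))"
      by (rule realizable_game[OF c(2)]) (rule char)
    also have "\<dots> \<longleftrightarrow> (\<exists>str. gwin (Pow ?Y) (chs K) str)" unfolding Rs_def by (rule set_game[OF f refl])
    also have "\<dots> \<longleftrightarrow> (\<exists>t. int t < 2 ^ (Wf w - 1) \<and> hlt (fst (conf M w t)) (svt t) \<and> fst (snd (conf M w t) ! (?L - 1)) 0 = 2)"
      by (rule game_iff) (simp add: c_def chs_image)
    also have "\<dots> \<longleftrightarrow> (\<exists>t. int t < 2 ^ (Wf w - 1) \<and> halted M (conf M w t) \<and> fst (last (snd (conf M w t))) 0 = 2)"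
    proof -
      have "svt t = map head_symbol (snd (conf M w t))" for t unfolding svt_def by (rule sv_conf[OF M])
      then have 1: "hlt (fst (conf M w t)) (svt t) \<longleftrightarrow> halted M (conf M w t)" for t
        by (simp add: hlt_def halted_def case_prod_beta)
      have "snd (conf M w t) ! (?L - 1) = last (snd (conf M w t))" for t
        using conf_wf[OF M, of w t] L last_conv_nth[of "snd (conf M w t)"] by force
      then show ?thesis unfolding 1 by simp
    qed
    also have "\<dots> \<longleftrightarrow> w \<in> A"
    proof -
      let ?F = "F (length w)"
      have h: "halted M (conf M w ?F)" "has_output (conf M w ?F) [w \<in> A]" using comp[of w] by (simp_all add: tm_computes_def conf_def Let_def)
      have o: "fst (last (snd (conf M w ?F))) 0 = (if w \<in> A then 2 else 1)"
        using h(2) unfolding has_output_def by (auto simp: word_cells_def dest: bspec[of _ _ 0])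
      have "int ?F < 2 ^ (Wf w - 1)" using Wb(2)[of w] by (metis of_nat_less_iff of_nat_numeral of_nat_power)
      \<comment> \<open>Halting configurations repeat, so any halting time shows the configuration
        reached at time \<open>?F\<close>, whose output letter decides membership.\<close>
      moreover have "conf M w t = conf M w ?F" if "halted M (conf M w t)" for t
        using conf_halted[OF that, of ?F] conf_halted[OF h(1), of t] by (simp add: add.commute)
      ultimately show ?thesis using h(1) o by (metis numeral_One numeral_eq_iff semiring_norm(85))
    qed
    finally show ?thesis by simp
  qed
  ultimately show ?thesis unfolding poly_reducible_def using fp_poly_time by blast
qed

lemma PPLTL_plus_hard: "A \<in> EXPTIME ==> poly_reducible A PPLTL_plus_realizability"
proof -
  assume "A \<in> EXPTIME"
  then obtain p :: "nat poly" where A: "decidable_in_time (%n. 2 ^ poly p n) A" by (auto simp: EXPTIME_def)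
  \<comment> \<open>Times below \<open>2 ^ (Wf w - 1)\<close> must cover the running time, and a row
    must have room for the input and a blank.\<close>
  define Wf where "Wf w = poly p (length w) + 2 + length w" for w :: "bool list"
  have W: "fp Wf" unfolding Wf_def by (intro fp_plus fp_poly fp_length fp_id fp_const)
  show ?thesis unfolding PPLTL_plus_mir
  proof (rule poly_reducible_realizability[OF A, where Wf = Wf and Fm = "%c Rs w. form_p c Rs (Wf w) w" and qf = "%_. 1" and dv = "%w b n. Wf w dvd n"])
    show lw: "length w < Wf w" for w by (simp add: Wf_def)
    show "(2::nat) ^ poly p (length w) < 2 ^ (Wf w - 1)" for w by (intro power_strict_increasing) (simp_all add: Wf_def)
    show "0 < c ==> atoms_ltlf (form_p c Rs (Wf w) w) \<subseteq> {..<c} \<union> dyn c ` {..<1}" for c Rs w by (rule atoms_form_p)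
    show "E (%w. form_p c Rs (Wf w) w)" for c Rs by (rule E_form_p[OF W])
    show "fp (%w :: bool list. 1 :: nat)" by (rule fp_const)
    fix c Rs w \<tau> and AP :: "nat set" assume t: "\<tau> \<in> inf_traces AP"
    have "trace_prefix \<tau> n \<in> mir_lang AP \<phi> \<longleftrightarrow> ppltl_sat (trace_prefix \<tau> n) (length (trace_prefix \<tau> n) - 1) (mir \<phi>)" for n \<phi>
      using t by (auto simp: mir_lang_def ppltl_lang_def inf_traces_def trace_prefix_def in_lists_conv_set)
    then show "(\<forall>n. trace_prefix \<tau> n \<in> mir_lang AP (form_p c Rs (Wf w) w)) \<longleftrightarrow>
        (\<forall>n. \<forall>b<1. dyn c b \<in> \<tau> n \<longleftrightarrow> Wf w dvd n) \<and> (\<forall>n. nbh Rs (Wf w) w n (%i. \<tau> i \<inter> {..<c}))"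
      using form_p_sat[OF lw, of \<tau> c Rs] by simp
  qed
qed

lemma LTLf_plus_hard: "A \<in> TWO_EXPTIME ==> poly_reducible A LTLf_plus_realizability"
proof -
  assume "A \<in> TWO_EXPTIME"
  then obtain p :: "nat poly" where A: "decidable_in_time (%n. 2 ^ 2 ^ poly p n) A" by (auto simp: TWO_EXPTIME_def)
  \<comment> \<open>The row length is \<open>2 ^ q w\<close>, so times up to a doubly exponential
    bound fit into a row. The summand 2 makes up for the 1 subtracted in
    \<open>2 ^ q w - 1\<close>.\<close>
  define q where "q w = poly p (length w) + 2 + length w" for w :: "bool list"
  have q: "fp q" unfolding q_def by (intro fp_plus fp_poly fp_length fp_id fp_const)
  show ?thesis unfolding LTLf_plus_realizability_def
  proof (rule poly_reducible_realizability[OF A, where Wf = "%w. 2 ^ q w" and Fm = "%c Rs w. form_l c Rs (q w) w" and qf = q and dv = "%w b n. bt (int n) b"])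
    show lw: "length w < 2 ^ q w" for w using less_exp[of "q w"] by (simp add: q_def)
    have "(2::nat) ^ poly p (length w) < 2 ^ q w - 1" for w
    proof -
      have "(2::nat) ^ poly p (length w) * 4 \<le> 2 ^ q w"
        using power_increasing[of "poly p (length w) + 2" "q w" "2::nat"] by (simp add: q_def)
      moreover have "(1::nat) \<le> 2 ^ poly p (length w)" by simp
      ultimately show ?thesis by linarith
    qed
    then show "(2::nat) ^ 2 ^ poly p (length w) < 2 ^ (2 ^ q w - 1)" for w by (intro power_strict_increasing) simp_all
    show "0 < c ==> atoms_ltlf (form_l c Rs (q w) w) \<subseteq> {..<c} \<union> dyn c ` {..<q w}" for c Rs w by (rule atoms_form_l)
    show "E (%w. form_l c Rs (q w) w)" for c Rs by (rule E_form_l[OF q])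
    show "fp q" by (rule q)
    fix c Rs w \<tau> and AP :: "nat set" assume t: "\<tau> \<in> inf_traces AP"
    have "trace_prefix \<tau> n \<in> ltlf_lang AP \<phi> \<longleftrightarrow> ltlf_sat (trace_prefix \<tau> n) 0 \<phi>" for n \<phi>
      using t by (auto simp: ltlf_lang_def inf_traces_def trace_prefix_def in_lists_conv_set)
    then show "(\<forall>n. trace_prefix \<tau> n \<in> ltlf_lang AP (form_l c Rs (q w) w)) \<longleftrightarrow>
        (\<forall>n. \<forall>b<q w. dyn c b \<in> \<tau> n \<longleftrightarrow> bt (int n) b) \<and> (\<forall>n. nbh Rs (2 ^ q w) w n (%i. \<tau> i \<inter> {..<c}))"
      using form_l_sat[OF lw, of \<tau> c Rs] by simp
  qed
qed

theorem theorem5: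
  shows "(complete_for TWO_EXPTIME LTLf_plus_realizability \<and>
          LTLf_plus_synthesis \<in> search_TWO_EXPTIME) \<and>
         (complete_for EXPTIME PPLTL_plus_realizability \<and>
          PPLTL_plus_synthesis \<in> search_EXPTIME)"
  unfolding complete_for_def
  using LTLf_plus_upper PPLTL_plus_upper LTLf_plus_hard PPLTL_plus_hard by blast

end
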